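(* Let $G$ be a 2-connected simple graph that contains no square as an induced subgraph and is unichord-free. Then $G$ is a complete graph, or $G$ is sparse, or $G$ is a 2-extension of the Petersen graph or of the Heawood graph, or $G$ has a proper 2-cutset.
   Context: A unichord is an edge that is the unique chord of some cycle; a graph is unichord-free if it has no unichord. A square is an induced cycle on four vertices. A branch vertex is a vertex of degree at least $3$; a graph is sparse if its branch vertices form a stable set. The Petersen graph is the graph on $\{a_1,\dots,a_5,b_1,\dots,b_5\}$ in which $a_1a_2a_3a_4a_5a_1$ and $b_1b_2b_3b_4b_5b_1$ are chordless cycles and the only other edges are $a_1b_1,a_2b_4,a_3b_2,a_4b_5,a_5b_3$. The Heawood graph is the graph on $\{a_1,\dots,a_{14}\}$ in which $a_1a_2\dots a_{14}a_1$ is a cycle and the only other edges are $a_1a_{10},a_2a_7,a_3a_{12},a_4a_9,a_5a_{14},a_6a_{11},a_8a_{13}$. A 2-extension of a graph $H$ is any graph obtained by first deleting vertices from $H$ and then subdividing (possibly several times) edges incident to at least one vertex of degree $2$. A proper 2-cutset of $G=(V,E)$ is a pair of non-adjacent vertices $a,b$ such that $V$ can be partitioned into $X$, $Y$, $\{a,b\}$ with $|X|\ge 2$, $|Y|\ge 2$, no edge between $X$ and $Y$, and such that both $G[X\cup\{a,b\}]$ and $G[Y\cup\{a,b\}]$ contain an $ab$-path but neither of them is (induces) an $ab$-path. *)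

theory Defs
  imports Main
begin

definition graph :: "'a set \<Rightarrow> 'a set set \<Rightarrow> bool" where
  "graph V E \<longleftrightarrow> finite V \<and> (\<forall>e\<in>E. \<exists>u v. e = {u, v} \<and> u \<noteq> v \<and> u \<in> V \<and> v \<in> V)"

definition induced_edges :: "'a set set \<Rightarrow> 'a set \<Rightarrow> 'a set set" where
  "induced_edges E S = {e \<in> E. e \<subseteq> S}"

definition degree :: "'a set \<Rightarrow> 'a set set \<Rightarrow> 'a \<Rightarrow> nat" where
  "degree V E v = card {u \<in> V. {u, v} \<in> E}"

definition walk :: "'a set set \<Rightarrow> 'a list \<Rightarrow> bool" where
  "walk E xs \<longleftrightarrow> (\<forall>i. Suc i < length xs \<longrightarrow> {xs ! i, xs ! Suc i} \<in> E)"

definition has_path :: "'a set \<Rightarrow> 'a set set \<Rightarrow> 'a \<Rightarrow> 'a \<Rightarrow> bool" where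
  "has_path S E a b \<longleftrightarrow> (\<exists>xs. xs \<noteq> [] \<and> distinct xs \<and> hd xs = a \<and> last xs = b
      \<and> set xs \<subseteq> S \<and> walk E xs)"

definition connected :: "'a set \<Rightarrow> 'a set set \<Rightarrow> bool" where
  "connected V E \<longleftrightarrow> V \<noteq> {} \<and> (\<forall>u\<in>V. \<forall>v\<in>V. has_path V (induced_edges E V) u v)"

definition two_connected :: "'a set \<Rightarrow> 'a set set \<Rightarrow> bool" where
  "two_connected V E \<longleftrightarrow> card V \<ge> 3 \<and> connected V E
      \<and> (\<forall>v\<in>V. connected (V - {v}) (induced_edges E (V - {v})))"

definition is_cycle :: "'a set \<Rightarrow> 'a set set \<Rightarrow> 'a list \<Rightarrow> bool" where
  "is_cycle V E xs \<longleftrightarrow> length xs \<ge> 3 \<and> distinct xs \<and> set xs \<subseteq> V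
      \<and> (\<forall>i < length xs. {xs ! i, xs ! ((i + 1) mod length xs)} \<in> E)"

definition cyc_consecutive :: "nat \<Rightarrow> nat \<Rightarrow> nat \<Rightarrow> bool" where
  "cyc_consecutive n i j \<longleftrightarrow> j = (i + 1) mod n \<or> i = (j + 1) mod n"

definition chords :: "'a set set \<Rightarrow> 'a list \<Rightarrow> 'a set set" where
  "chords E xs = {{xs ! i, xs ! j} | i j. i < length xs \<and> j < length xs \<and> i \<noteq> j
      \<and> \<not> cyc_consecutive (length xs) i j \<and> {xs ! i, xs ! j} \<in> E}"

definition unichord :: "'a set \<Rightarrow> 'a set set \<Rightarrow> 'a set \<Rightarrow> bool" where
  "unichord V E e \<longleftrightarrow> (\<exists>xs. is_cycle V E xs \<and> chords E xs = {e})"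

definition unichord_free :: "'a set \<Rightarrow> 'a set set \<Rightarrow> bool" where
  "unichord_free V E \<longleftrightarrow> \<not> (\<exists>e. unichord V E e)"

definition has_induced_square :: "'a set \<Rightarrow> 'a set set \<Rightarrow> bool" where
  "has_induced_square V E \<longleftrightarrow> (\<exists>a b c d. a \<in> V \<and> b \<in> V \<and> c \<in> V \<and> d \<in> V
      \<and> distinct [a, b, c, d]
      \<and> {a, b} \<in> E \<and> {b, c} \<in> E \<and> {c, d} \<in> E \<and> {d, a} \<in> E
      \<and> {a, c} \<notin> E \<and> {b, d} \<notin> E)"

definition complete :: "'a set \<Rightarrow> 'a set set \<Rightarrow> bool" where
  "complete V E \<longleftrightarrow> (\<forall>u\<in>V. \<forall>v\<in>V. u \<noteq> v \<longrightarrow> {u, v} \<in> E)"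

definition sparse :: "'a set \<Rightarrow> 'a set set \<Rightarrow> bool" where
  "sparse V E \<longleftrightarrow> (\<forall>u\<in>V. \<forall>v\<in>V. degree V E u \<ge> 3 \<and> degree V E v \<ge> 3 \<longrightarrow> {u, v} \<notin> E)"

definition is_ab_path :: "'a set \<Rightarrow> 'a set set \<Rightarrow> 'a \<Rightarrow> 'a \<Rightarrow> bool" where
  "is_ab_path V E a b \<longleftrightarrow> (\<exists>xs. xs \<noteq> [] \<and> distinct xs \<and> set xs = V \<and> hd xs = a \<and> last xs = b
      \<and> E = {{xs ! i, xs ! Suc i} | i. Suc i < length xs})"

definition proper_2cutset :: "'a set \<Rightarrow> 'a set set \<Rightarrow> 'a \<Rightarrow> 'a \<Rightarrow> bool" where
  "proper_2cutset V E a b \<longleftrightarrow> a \<in> V \<and> b \<in> V \<and> a \<noteq> b \<and> {a, b} \<notin> E \<and>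
     (\<exists>X Y. V = X \<union> Y \<union> {a, b} \<and> X \<inter> Y = {} \<and> a \<notin> X \<and> b \<notin> X \<and> a \<notin> Y \<and> b \<notin> Y
        \<and> card X \<ge> 2 \<and> card Y \<ge> 2
        \<and> (\<forall>x\<in>X. \<forall>y\<in>Y. {x, y} \<notin> E)
        \<and> has_path (X \<union> {a, b}) (induced_edges E (X \<union> {a, b})) a b
        \<and> has_path (Y \<union> {a, b}) (induced_edges E (Y \<union> {a, b})) a b
        \<and> \<not> is_ab_path (X \<union> {a, b}) (induced_edges E (X \<union> {a, b})) a b
        \<and> \<not> is_ab_path (Y \<union> {a, b}) (induced_edges E (Y \<union> {a, b})) a b)"

definition has_proper_2cutset :: "'a set \<Rightarrow> 'a set set \<Rightarrow> bool" where
  "has_proper_2cutset V E \<longleftrightarrow> (\<exists>a b. proper_2cutset V E a b)"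

definition isomorphic :: "'a set \<Rightarrow> 'a set set \<Rightarrow> 'b set \<Rightarrow> 'b set set \<Rightarrow> bool" where
  "isomorphic V1 E1 V2 E2 \<longleftrightarrow> (\<exists>f. bij_betw f V1 V2
      \<and> (\<forall>u\<in>V1. \<forall>v\<in>V1. {u, v} \<in> E1 \<longleftrightarrow> {f u, f v} \<in> E2))"

text \<open>Petersen graph: a_i = i - 1 (vertices 0..4), b_i = i + 4 (vertices 5..9).\<close>
definition petersen_V :: "nat set" where "petersen_V = {0..9}"
definition petersen_E :: "nat set set" where
  "petersen_E = {{0,1},{1,2},{2,3},{3,4},{4,0},
                 {5,6},{6,7},{7,8},{8,9},{9,5},
                 {0,5},{1,8},{2,6},{3,9},{4,7}}"

text \<open>Heawood graph: a_i = i - 1 (vertices 0..13).\<close>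
definition heawood_V :: "nat set" where "heawood_V = {0..13}"
definition heawood_E :: "nat set set" where
  "heawood_E = {{0,1},{1,2},{2,3},{3,4},{4,5},{5,6},{6,7},{7,8},{8,9},{9,10},{10,11},
                {11,12},{12,13},{13,0},
                {0,9},{1,6},{2,11},{3,8},{4,13},{5,10},{7,12}}"

inductive two_ext_nat :: "nat set \<Rightarrow> nat set set \<Rightarrow> nat set \<Rightarrow> nat set set \<Rightarrow> bool"
  for HV :: "nat set" and HE :: "nat set set" where
  delete: "S \<subseteq> HV \<Longrightarrow> two_ext_nat HV HE S (induced_edges HE S)"
| subdivide: "two_ext_nat HV HE V E \<Longrightarrow> {u, v} \<in> E \<Longrightarrow>
     degree V E u = 2 \<or> degree V E v = 2 \<Longrightarrow> w \<notin> V \<Longrightarrow>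
     two_ext_nat HV HE (insert w V) ((E - {{u, v}}) \<union> {{u, w}, {w, v}})"

definition two_extension_of :: "'a set \<Rightarrow> 'a set set \<Rightarrow> nat set \<Rightarrow> nat set set \<Rightarrow> bool" where
  "two_extension_of V E HV HE \<longleftrightarrow> (\<exists>V' E'. two_ext_nat HV HE V' E' \<and> isomorphic V E V' E')"

end

theory Submission
  imports Defs
begin

text \<open>If some edge joins two branch vertices and there is no proper 2-cutset, Menger's theorem gives two
  disjoint paths between its ends that avoid it. In a shortest such pair the paths are joined by exactly one
  edge, so \<open>G\<close> contains an induced subdivision of \<open>K\<^sub>4\<close> in which exactly two opposite edges are
  not subdivided. This is the first of seven patterns, which are obtained from induced subgraphs of the Petersen and
  the Heawood graph by subdividing edges. Take an induced copy of a pattern with as many unsubdivided vertices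
  as possible and then with as few vertices as possible. A vertex or a path outside the copy that attaches to two places
  which do not lie on one subdivided edge creates a unichord, a square, or a larger pattern; this is a finite check.
  Hence each component of the rest attaches inside one subdivided edge, which yields a proper
  2-cutset unless the copy is all of \<open>G\<close>. Unichords are found as an edge \<open>uv\<close> and two connected sets
  without edges between them such that \<open>u\<close> and \<open>v\<close> both have neighbours in each of them.\<close>

section \<open>Connected sets and induced paths\<close>

text \<open>Triangles are treated apart: one that exists extends to a maximal clique, and a
  component outside this clique would attach to it so as to create a unichord; hence
  \<open>G\<close> is complete. Otherwise \<open>G\<close> has neither triangles nor 4-cycles, and
  this excludes the short configurations throughout.

  Subdivided edges may be arbitrarily long, yet the check is finite: a unichord certificate asks
  only which connected pieces touch. A path enters as one connected piece, and a vertex attached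
  inside it matters only through which of the two remaining parts are nonempty, which makes four
  cases.

  The first pattern is the Petersen graph without the two ends of an edge, its four vertices of
  degree 2 read as paths. The other patterns are what growth from it produces; they have 6, 6, 8,
  10, 10 and 14 unsubdivided vertices, so growth stops. In each, a subdivided edge stands for one
  degree-2 vertex of its host graph. So a pattern that fills \<open>G\<close> is a 2-extension:
  deleting vertices from the host gives the pattern with one-vertex paths, and these are then
  subdivided.\<close>

definition edge_rel :: "'a set set \<Rightarrow> 'a set \<Rightarrow> ('a \<times> 'a) set" where
  "edge_rel E S = {(x, y). x \<in> S \<and> y \<in> S \<and> {x, y} \<in> E}"

definition conn :: "'a set set \<Rightarrow> 'a set \<Rightarrow> bool" where
  "conn E S \<longleftrightarrow> S \<noteq> {} \<and> (\<forall>x\<in>S. \<forall>y\<in>S. (x, y) \<in> (edge_rel E S)\<^sup>*)"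

definition sees :: "'a set set \<Rightarrow> 'a \<Rightarrow> 'a set \<Rightarrow> bool" where
  "sees E v S \<longleftrightarrow> (\<exists>x\<in>S. {v, x} \<in> E)"

definition anticomplete :: "'a set set \<Rightarrow> 'a set \<Rightarrow> 'a set \<Rightarrow> bool" where
  "anticomplete E A B \<longleftrightarrow> A \<inter> B = {} \<and> (\<forall>x\<in>A. \<forall>y\<in>B. {x, y} \<notin> E)"

text \<open>Recursion instead of indices turns splitting at a vertex, concatenation
  (\<open>ipath_append\<close>) and reversal (\<open>ipath_rev\<close>) into rewriting. Chords are
  excluded because each vertex sees only the next one among its successors.\<close>

fun ipath :: "'a set set \<Rightarrow> 'a list \<Rightarrow> bool" where
  "ipath E [] \<longleftrightarrow> True"
| "ipath E (x # xs) \<longleftrightarrow> x \<notin> set xs \<and> (\<forall>z\<in>set xs. {x, z} \<in> E \<longleftrightarrow> z = hd xs) \<and> ipath E xs"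

lemma edge_rel_mono: "S \<subseteq> T \<Longrightarrow> edge_rel E S \<subseteq> edge_rel E T"
  unfolding edge_rel_def by auto

lemma edge_rel_sym: "(x, y) \<in> (edge_rel E S)\<^sup>* \<Longrightarrow> (y, x) \<in> (edge_rel E S)\<^sup>*"
proof -
  have "sym (edge_rel E S)" unfolding edge_rel_def sym_def by (auto simp: insert_commute)
  then show "(x, y) \<in> (edge_rel E S)\<^sup>* \<Longrightarrow> (y, x) \<in> (edge_rel E S)\<^sup>*"
    by (meson sym_rtrancl symD)
qed

lemma edge_rel_rtrancl_mono:
  "(x, y) \<in> (edge_rel E S)\<^sup>* \<Longrightarrow> S \<subseteq> T \<Longrightarrow> (x, y) \<in> (edge_rel E T)\<^sup>*"
  using rtrancl_mono[OF edge_rel_mono] by blast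

lemma conn_singleton [simp]: "conn E {x}"
  unfolding conn_def by simp

lemma conn_nonempty: "conn E S \<Longrightarrow> S \<noteq> {}"
  unfolding conn_def by simp

lemma conn_from:
  assumes "x \<in> S" "\<And>y. y \<in> S \<Longrightarrow> (x, y) \<in> (edge_rel E S)\<^sup>*"
  shows "conn E S"
  unfolding conn_def using assms edge_rel_sym by (meson emptyE rtrancl_trans)

lemma conn_union:
  assumes A: "conn E A" and B: "conn E B" and "a \<in> A" "b \<in> B" "a = b \<or> {a, b} \<in> E"
  shows "conn E (A \<union> B)"
proof (rule conn_from[of a])
  show "a \<in> A \<union> B" using assms by simp
  have ab: "(a, b) \<in> (edge_rel E (A \<union> B))\<^sup>*"
    using assms(3-5) by (auto simp: edge_rel_def)
  fix y assume "y \<in> A \<union> B"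
  then show "(a, y) \<in> (edge_rel E (A \<union> B))\<^sup>*"
  proof
    assume "y \<in> A"
    then have "(a, y) \<in> (edge_rel E A)\<^sup>*" using A assms(3) unfolding conn_def by blast
    then show ?thesis by (rule edge_rel_rtrancl_mono) simp
  next
    assume "y \<in> B"
    then have "(b, y) \<in> (edge_rel E B)\<^sup>*" using B assms(4) unfolding conn_def by blast
    then have "(b, y) \<in> (edge_rel E (A \<union> B))\<^sup>*" by (rule edge_rel_rtrancl_mono) simp
    with ab show ?thesis by simp
  qed
qed

lemma conn_insert: "conn E A \<Longrightarrow> sees E x A \<Longrightarrow> conn E (insert x A)"
  using conn_union[of E "{x}" A x] unfolding sees_def by auto

lemma ipath_distinct: "ipath E xs \<Longrightarrow> distinct xs"
  by (induction xs) auto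

lemma ipath_conn: "ipath E xs \<Longrightarrow> xs \<noteq> [] \<Longrightarrow> conn E (set xs)"
proof (induction xs)
  case (Cons x xs)
  show ?case
  proof (cases "xs = []")
    case False
    then have "conn E (set xs)" using Cons by simp
    moreover have "sees E x (set xs)" using Cons.prems False unfolding sees_def by auto
    ultimately show ?thesis using conn_insert by fastforce
  qed simp
qed simp

lemma ipath_append:
  "ipath E (xs @ ys) \<longleftrightarrow> ipath E xs \<and> ipath E ys \<and> set xs \<inter> set ys = {} \<and>
     (\<forall>x\<in>set xs. \<forall>y\<in>set ys. {x, y} \<in> E \<longleftrightarrow> x = last xs \<and> y = hd ys)"
proof (induction xs)
  case (Cons x xs)
  show ?case
  proof (cases "xs = []")
    case True
    then show ?thesis by (auto)
  next
    case False
    then have *: "x \<notin> set xs \<Longrightarrow> x \<noteq> last xs" "hd xs \<in> set xs" "last xs \<in> set xs" by auto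
    show ?thesis
      unfolding append_Cons ipath.simps Cons.IH using False * by (auto; blast)
  qed
qed simp

lemma ipath_prefix: "ipath E (as @ p # bs) \<Longrightarrow> ipath E (as @ [p])"
  and ipath_suffix: "ipath E (as @ p # bs) \<Longrightarrow> ipath E (p # bs)"
  by (auto simp: ipath_append)

lemma ipath_rev: "ipath E (rev xs) = ipath E xs"
proof (induction xs)
  case (Cons x xs)
  show ?case
    by (cases "xs = []") (auto simp: ipath_append Cons.IH insert_commute last_rev)
qed simp

lemma ipath_snoc_conn:
  assumes "ipath E (c @ [y])" "c \<noteq> []"
  shows "conn E (set c)" "sees E y (set c)" "y \<notin> set c"
proof -
  have "last c \<in> set c" using assms(2) by simp
  moreover have "{last c, y} \<in> E" "y \<notin> set c" "ipath E c" using assms unfolding ipath_append by auto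
  ultimately show "conn E (set c)" "sees E y (set c)" "y \<notin> set c"
    using ipath_conn[of E c] assms(2) unfolding sees_def by (auto simp: insert_commute)
qed

lemma rtrancl_walk:
  assumes "(x, y) \<in> (edge_rel E S)\<^sup>*" "x \<in> S"
  shows "\<exists>xs. xs \<noteq> [] \<and> hd xs = x \<and> last xs = y \<and> set xs \<subseteq> S \<and> successively (\<lambda>a b. {a, b} \<in> E) xs"
  using assms
proof (induction rule: rtrancl_induct)
  case base
  then show ?case by (intro exI[of _ "[x]"]) simp
next
  case (step y z)
  then obtain xs where "xs \<noteq> []" "hd xs = x" "last xs = y" "set xs \<subseteq> S"
    "successively (\<lambda>a b. {a, b} \<in> E) xs" by blast
  then show ?case using step(2)
    by (intro exI[of _ "xs @ [z]"]) (auto simp: successively_append_iff edge_rel_def)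
qed

lemma walk_rtrancl:
  "successively (\<lambda>a b. {a, b} \<in> E) xs \<Longrightarrow> set xs \<subseteq> S \<Longrightarrow> xs \<noteq> [] \<Longrightarrow>
     (hd xs, last xs) \<in> (edge_rel E S)\<^sup>*"
proof (induction xs)
  case (Cons x xs)
  show ?case
  proof (cases xs)
    case (Cons y ys)
    with Cons.prems have "(x, y) \<in> edge_rel E S" by (auto simp: edge_rel_def)
    with Cons.IH Cons.prems Cons show ?thesis by (auto intro: converse_rtrancl_into_rtrancl)
  qed simp
qed simp

lemma ipath_successively: "ipath E xs \<Longrightarrow> successively (\<lambda>a b. {a, b} \<in> E) xs"
  by (induction xs) (auto simp: successively_Cons dest: hd_in_set)

text \<open>Take a walk of least length from a \<open>P\<close>-vertex to a \<open>Q\<close>-vertex.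
  A repeated vertex, a chord, a later \<open>P\<close>-vertex or an earlier \<open>Q\<close>-vertex
  would each allow a nonempty segment to be cut out.\<close>

lemma shortest_path:
  assumes "conn E S" "x \<in> S" "P x" "y \<in> S" "Q y"
  obtains xs where "xs \<noteq> []" "set xs \<subseteq> S" "ipath E xs" "P (hd xs)" "Q (last xs)"
    "\<forall>z\<in>set (tl xs). \<not> P z" "\<forall>z\<in>set (butlast xs). \<not> Q z"
proof -
  define W where "W xs \<longleftrightarrow> xs \<noteq> [] \<and> set xs \<subseteq> S \<and> successively (\<lambda>a b. {a, b} \<in> E) xs \<and> P (hd xs) \<and> Q (last xs)"
    for xs
  have "\<exists>xs. W xs"
    using rtrancl_walk[of x y E S] assms unfolding conn_def W_def by blast
  then obtain xs where xs: "W xs" and min: "\<And>ys. W ys \<Longrightarrow> length xs \<le> length ys"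
    using ex_has_least_nat[of W _ length] by blast
  \<comment> \<open>All contradictions below are instances of this: removing the nonempty middle
    segment \<open>bs\<close> cannot leave a competitor.\<close>
  have short: False if "xs = as @ bs @ cs" "W (as @ cs)" "bs \<noteq> []" for as bs cs
    using min[OF that(2)] that by simp
  have "\<not> P z" if "z \<in> set (tl xs)" for z
  proof
    assume "P z"
    from that obtain as cs where "tl xs = as @ z # cs" by (meson split_list)
    then have e: "xs = (hd xs # as) @ z # cs" using xs unfolding W_def by (cases xs) auto
    then have "W ([] @ (z # cs))" using xs \<open>P z\<close> unfolding W_def
      by (smt (verit) append_Nil last_appendR list.sel(1) list.simps(3) set_append successively_append_iff sup.bounded_iff)
    then show False using short[of "[]" "hd xs # as" "z # cs"] e by simp
  qed
  moreover have "\<not> Q z" if "z \<in> set (butlast xs)" for z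
  proof
    assume "Q z"
    from that obtain as cs where "butlast xs = as @ z # cs" by (meson split_list)
    then have e: "xs = (as @ [z]) @ (cs @ [last xs])" using xs unfolding W_def
      by (metis append.assoc append_Cons append_Nil append_butlast_last_id)
    have "W ((as @ [z]) @ [])" using xs \<open>Q z\<close> unfolding W_def append_Nil2
      by (metis Nil_is_append_conv e hd_append2 last_snoc le_sup_iff list.simps(3) set_append successively_append_iff)
    then show False using short[of "as @ [z]" "cs @ [last xs]" "[]"] e by simp
  qed
  moreover have "ipath E ys" if "xs = zs @ ys" for zs ys
    using that
  proof (induction ys arbitrary: zs)
    case (Cons a ys)
    have W': "successively (\<lambda>a b. {a, b} \<in> E) xs" "set xs \<subseteq> S" "P (hd xs)" "Q (last xs)" using xs unfolding W_def by auto
    have "a \<notin> set ys"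
    proof
      assume "a \<in> set ys"
      then obtain bs cs where ys: "ys = bs @ a # cs" by (meson split_list)
      have "W (zs @ a # cs)"
        using W' Cons.prems unfolding ys W_def
          by (cases zs) (auto simp: successively_append_iff successively_Cons hd_append split: if_splits)
      then show False using short[of zs "a # bs" "a # cs"] Cons.prems ys by simp
    qed
    moreover have "{a, z} \<in> E \<longleftrightarrow> z = hd ys" if z: "z \<in> set ys" for z
    proof
      show "z = hd ys \<Longrightarrow> {a, z} \<in> E"
        using W'(1) Cons.prems z by (cases ys) (auto simp: successively_append_iff)
      assume e: "{a, z} \<in> E"
      show "z = hd ys"
      proof (rule ccontr)
        assume "z \<noteq> hd ys"
        with z obtain b bs cs where ys: "ys = b # bs @ z # cs"
          by (metis append_Cons append_Nil list.exhaust list.sel(1) split_list)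
        have "W ((zs @ [a]) @ z # cs)"
          using W' Cons.prems e unfolding ys W_def
          by (cases zs) (auto simp: successively_append_iff successively_Cons hd_append split: if_splits)
        then show False using short[of "zs @ [a]" "b # bs" "z # cs"] Cons.prems ys by simp
      qed
    qed
    moreover have "ipath E ys" using Cons.IH[of "zs @ [a]"] Cons.prems by simp
    ultimately show ?case by simp
  qed simp
  from this[of "[]"] have "ipath E xs" by simp
  ultimately show thesis using that[of xs] xs unfolding W_def by blast
qed

lemma sees_path:
  assumes "conn E S" "sees E u S" "sees E v S"
  obtains xs where "xs \<noteq> []" "set xs \<subseteq> S" "ipath E xs" "{u, hd xs} \<in> E" "{v, last xs} \<in> E"
    "\<forall>z\<in>set (tl xs). {u, z} \<notin> E" "\<forall>z\<in>set (butlast xs). {v, z} \<notin> E"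
proof -
  obtain x y where "x \<in> S" "{u, x} \<in> E" "y \<in> S" "{v, y} \<in> E" using assms unfolding sees_def by blast
  then show thesis
    using shortest_path[OF assms(1), of x "\<lambda>z. {u, z} \<in> E" y "\<lambda>z. {v, z} \<in> E"] that by blast
qed

lemma sees_path_ends:
  assumes "conn E S" "sees E u S" "sees E v S"
  obtains xs where "xs \<noteq> []" "set xs \<subseteq> S" "ipath E xs" "{u, hd xs} \<in> E" "{v, last xs} \<in> E"
  by (rule sees_path[OF assms])

lemma sees_path_to:
  assumes "conn E S" "sees E u S" "y \<in> S"
  obtains xs where "xs \<noteq> []" "set xs \<subseteq> S" "ipath E xs" "{u, hd xs} \<in> E" "last xs = y"
proof -
  obtain x where "x \<in> S" "{u, x} \<in> E" using assms unfolding sees_def by blast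
  then show thesis
    using shortest_path[OF assms(1), of x "\<lambda>z. {u, z} \<in> E" y "\<lambda>z. z = y"] assms(3) that by blast
qed

lemma path_between:
  assumes "conn E S" "x \<in> S" "y \<in> S"
  obtains xs where "xs \<noteq> []" "set xs \<subseteq> S" "ipath E xs" "hd xs = x" "last xs = y"
  using shortest_path[OF assms(1), of x "\<lambda>z. z = x" y "\<lambda>z. z = y"] assms that by blast

section \<open>Components and edges across a cut\<close>

definition component :: "'a set set \<Rightarrow> 'a set \<Rightarrow> 'a \<Rightarrow> 'a set" where
  "component E S x = {y. (x, y) \<in> (edge_rel E S)\<^sup>*}"

lemma component_subset: "x \<in> S \<Longrightarrow> component E S x \<subseteq> S"
proof
  fix y assume "x \<in> S" "y \<in> component E S x"
  then have "(x, y) \<in> (edge_rel E S)\<^sup>*" unfolding component_def by simp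
  then show "y \<in> S" using \<open>x \<in> S\<close> by (induction rule: rtrancl_induct) (auto simp: edge_rel_def)
qed

lemma component_self [simp]: "x \<in> component E S x"
  unfolding component_def by simp

lemma component_conn: "conn E (component E S x)"
proof (rule conn_from[of x])
  fix y assume "y \<in> component E S x"
  then have "(x, y) \<in> (edge_rel E S)\<^sup>*" unfolding component_def by simp
  then show "(x, y) \<in> (edge_rel E (component E S x))\<^sup>*"
  proof (induction rule: rtrancl_induct)
    case (step y z)
    then have "(y, z) \<in> edge_rel E (component E S x)"
      unfolding edge_rel_def component_def
      by (auto intro: rtrancl_into_rtrancl simp: edge_rel_def)
    with step(3) show ?case by simp
  qed simp
qed simp

lemma component_closed: "y \<in> component E S x \<Longrightarrow> x \<in> S \<Longrightarrow> z \<in> S \<Longrightarrow> {y, z} \<in> E \<Longrightarrow> z \<in> component E S x"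
  using component_subset[of x S E] unfolding component_def
  by (auto intro: rtrancl_into_rtrancl simp: edge_rel_def)

lemma conn_cross:
  assumes "conn E T" "D \<subseteq> T" "D \<noteq> {}" "T - D \<noteq> {}"
  obtains x y where "x \<in> D" "y \<in> T - D" "{x, y} \<in> E"
proof (rule ccontr)
  assume "\<not> thesis"
  then have no: "\<And>x y. x \<in> D \<Longrightarrow> y \<in> T - D \<Longrightarrow> {x, y} \<notin> E" using that by blast
  obtain a b where "a \<in> D" "b \<in> T - D" using assms by blast
  then have "(a, b) \<in> (edge_rel E T)\<^sup>*" using assms unfolding conn_def by blast
  then have "b \<in> D" using \<open>a \<in> D\<close>
    by (induction rule: rtrancl_induct) (use no in \<open>auto simp: edge_rel_def\<close>)
  with \<open>b \<in> T - D\<close> show False by simp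
qed

section \<open>Unichords from two anticomplete connected sets\<close>

lemma ipath_nth:
  "ipath E ys \<Longrightarrow> i < j \<Longrightarrow> j < length ys \<Longrightarrow> {ys ! i, ys ! j} \<in> E \<longleftrightarrow> j = Suc i"
proof (induction ys arbitrary: i j)
  case (Cons y ys)
  show ?case
  proof (cases i)
    case 0
    with Cons.prems obtain k where k: "j = Suc k" "k < length ys" by (cases j) auto
    then have "{y, ys ! k} \<in> E \<longleftrightarrow> ys ! k = hd ys" using Cons.prems by simp
    also have "\<dots> \<longleftrightarrow> k = 0"
      using k ipath_distinct[of E ys] Cons.prems(1)
      by (metis hd_conv_nth ipath.simps(2) length_greater_0_conv less_nat_zero_code nth_eq_iff_index_eq list.size(3))
    finally show ?thesis using 0 k by simp
  next
    case (Suc i')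
    with Cons show ?thesis by (cases j) auto
  qed
qed simp

text \<open>Shortest paths through \<open>A\<close> and \<open>B\<close> between neighbours of
  \<open>u\<close> and \<open>v\<close> close up with \<open>u\<close> and \<open>v\<close> to a
  cycle. Each path meets the neighbourhoods of \<open>u\<close> and \<open>v\<close> only at its
  ends, and there are no edges between the two paths, so \<open>uv\<close> is the sole
  chord.\<close>

lemma unichordI:
  assumes "u \<in> V" "v \<in> V" "u \<noteq> v" "{u, v} \<in> E" and "conn E A" "conn E B" "anticomplete E A B"
    and "A \<subseteq> V - {u, v}" "B \<subseteq> V - {u, v}" and "sees E u A" "sees E v A" "sees E u B" "sees E v B"
  shows "unichord V E {u, v}"
proof -
  obtain as where as: "as \<noteq> []" "set as \<subseteq> A" "ipath E as" "{u, hd as} \<in> E" "{v, last as} \<in> E"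
    "\<forall>z\<in>set (tl as). {u, z} \<notin> E" "\<forall>z\<in>set (butlast as). {v, z} \<notin> E"
    using sees_path[OF assms(5,10,11)] .
  obtain bs where bs: "bs \<noteq> []" "set bs \<subseteq> B" "ipath E bs" "{v, hd bs} \<in> E" "{u, last bs} \<in> E"
    "\<forall>z\<in>set (tl bs). {v, z} \<notin> E" "\<forall>z\<in>set (butlast bs). {u, z} \<notin> E"
    using sees_path[OF assms(6,13,12)] .
  \<comment> \<open>The cycle without \<open>u\<close>. It is an induced path, so every chord must
    be at \<open>u\<close>, and \<open>u\<close> sees only its two ends and
    \<open>v\<close>.\<close>
  define ys where "ys = as @ v # bs"
  define xs where "xs = u # ys"
  have tl: "z = hd xs \<or> z \<in> set (tl xs)" "z = last xs \<or> z \<in> set (butlast xs)" if "z \<in> set xs" for z and xs :: "'a list"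
  proof -
    show "z = hd xs \<or> z \<in> set (tl xs)" using that by (cases xs) auto
    show "z = last xs \<or> z \<in> set (butlast xs)" using that by (cases xs rule: rev_cases) auto
  qed
  have vb: "ipath E (v # bs)"
    using bs(1-4,6) assms(9) tl(1)[of _ bs] by (auto simp: subset_iff)
  have va: "{x, v} \<in> E \<longleftrightarrow> x = last as" if "x \<in> set as" for x
    using as(5,7) tl(2)[OF that] by (auto simp: insert_commute)
  have ab: "x \<noteq> y" "{x, y} \<notin> E" if "x \<in> set as" "y \<in> set bs" for x y
    using that assms(7) as(2) bs(2) unfolding anticomplete_def by blast+
  have ip: "ipath E ys"
    unfolding ys_def ipath_append[of E as] using vb as(2,3) va ab assms(8) by auto
  have uys: "{u, z} \<in> E \<longleftrightarrow> z = hd ys \<or> z = last ys \<or> z = v" if z: "z \<in> set ys" for z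
  proof -
    consider "z \<in> set as" | "z = v" | "z \<in> set bs" using z unfolding ys_def by auto
    then show ?thesis
    proof cases
      case 1
      then show ?thesis using tl(1)[OF 1] as ab(1)[OF 1, of "last bs"] bs(1) assms(8) unfolding ys_def by auto
    next
      case 3
      then show ?thesis using tl(2)[OF 3] bs ab(1)[OF _ 3, of "hd as"] as(1) assms(9) unfolding ys_def by auto
    qed (use assms in simp)
  qed
  have len: "length as \<ge> 1" "length bs \<ge> 1" using as bs by (cases as; cases bs; simp)+
  let ?n = "length xs"
  have n: "?n = length as + length bs + 2" unfolding xs_def ys_def by simp
  have uni: "u \<notin> set ys" using as(2) bs(2) assms(3,8,9) unfolding ys_def by auto
  have dist: "distinct xs" using ipath_distinct[OF ip] uni unfolding xs_def by simp
  have xk: "xs ! (Suc (length as)) = v" unfolding xs_def ys_def by simp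
  have hd: "hd ys = xs ! 1" "last ys = xs ! (?n - 1)"
    unfolding xs_def using ys_def by (auto simp: hd_conv_nth last_conv_nth)
  \<comment> \<open>With \<open>u\<close> at index 0 the vertex \<open>v\<close> has index
    \<open>Suc (length as)\<close>; the pair of indices 0 and \<open>?n - 1\<close> is the edge that
    closes the cycle.\<close>
  have adj: "{xs ! i, xs ! j} \<in> E \<longleftrightarrow> j = Suc i \<or> (i = 0 \<and> (j = ?n - 1 \<or> j = Suc (length as)))"
    if "i < j" "j < ?n" for i j
  proof (cases i)
    case 0
    from that obtain k where k: "j = Suc k" "k < length ys" unfolding xs_def by (cases j) auto
    have "{xs ! i, xs ! j} \<in> E \<longleftrightarrow> xs ! j = xs ! 1 \<or> xs ! j = xs ! (?n - 1) \<or> xs ! j = xs ! (Suc (length as))"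
      using uys[of "xs ! j"] k 0 unfolding hd xk by (simp add: xs_def)
    then show ?thesis using 0 that n dist by (auto simp: nth_eq_iff_index_eq)
  next
    case (Suc i')
    then show ?thesis using that ipath_nth[OF ip, of i' "j - 1"] unfolding xs_def by (auto simp: nth_Cons')
  qed
  have cyc: "is_cycle V E xs"
    unfolding is_cycle_def
  proof (intro conjI allI impI)
    show "set xs \<subseteq> V" using as(2) bs(2) assms unfolding xs_def ys_def by auto
    fix i assume i: "i < ?n"
    show "{xs ! i, xs ! ((i + 1) mod ?n)} \<in> E"
    proof (cases "i + 1 = ?n")
      case True
      then show ?thesis using adj[of 0 i] i n by (auto simp: insert_commute)
    next
      case False
      then show ?thesis using adj[of i "i + 1"] i by simp
    qed
  qed (use n len dist in auto)
  have cc: "cyc_consecutive ?n i j \<longleftrightarrow> j = Suc i \<or> (i = 0 \<and> j = ?n - 1)" if "i < j" "j < ?n" for i j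
    using that n len unfolding cyc_consecutive_def
    by (cases "j + 1 = ?n") auto
  have ccs: "cyc_consecutive ?n i j = cyc_consecutive ?n j i" for i j
    unfolding cyc_consecutive_def by auto
  have "chords E xs = {{u, v}}"
  proof
    show "chords E xs \<subseteq> {{u, v}}"
    proof
      fix e assume "e \<in> chords E xs"
      then obtain i j where ij: "e = {xs ! i, xs ! j}" "i < ?n" "j < ?n" "i \<noteq> j" "\<not> cyc_consecutive ?n i j" "e \<in> E"
        unfolding chords_def by blast
      obtain i j where "e = {xs ! i, xs ! j}" "i < j" "j < ?n" "\<not> cyc_consecutive ?n i j" "e \<in> E"
      proof (cases "i < j")
        case True then show ?thesis using that ij by blast
      next
        case False then show ?thesis using that[of j i] ij ccs[of i j] by (simp add: insert_commute)
      qed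
      then have "i = 0" "j = Suc (length as)" "e = {xs ! i, xs ! j}" using adj[of i j] cc[of i j] by auto
      then show "e \<in> {{u, v}}" using xk xs_def by simp
    qed
    have "\<not> cyc_consecutive ?n 0 (Suc (length as))" using cc[of 0 "Suc (length as)"] n len by auto
    moreover have "xs ! 0 = u" "Suc (length as) < ?n" unfolding xs_def ys_def using len by auto
    ultimately have "\<exists>i j. {u, v} = {xs ! i, xs ! j} \<and> i < ?n \<and> j < ?n \<and> i \<noteq> j \<and>
        \<not> cyc_consecutive ?n i j \<and> {xs ! i, xs ! j} \<in> E"
      using xk assms(4) by (intro exI[of _ 0] exI[of _ "Suc (length as)"]) auto
    then show "{{u, v}} \<subseteq> chords E xs" unfolding chords_def by blast
  qed
  with cyc show ?thesis unfolding unichord_def by blast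
qed

section \<open>2-connected unichord-free graphs, and why a triangle forces completeness\<close>

locale ugraph =
  fixes V :: "'a set" and E :: "'a set set"
  assumes graph: "graph V E"
begin

lemma adj_irrefl [simp]: "{x} \<notin> E"
  using graph unfolding graph_def by (metis doubleton_eq_iff insert_absorb2)

lemma adj_in: "{x, y} \<in> E \<Longrightarrow> x \<in> V \<and> y \<in> V"
  using graph unfolding graph_def by (metis insert_iff singletonD subsetD subset_insertI insertI1 doubleton_eq_iff)

lemma adj_neq: "{x, y} \<in> E \<Longrightarrow> x \<noteq> y"
  by auto

lemma fin [simp]: "finite V"
  using graph unfolding graph_def by simp

end

locale ufree = ugraph +
  assumes ufree: "unichord_free V E" and twoc: "two_connected V E"
begin

lemma unichord_edge:
  assumes "{u, v} \<in> E" "conn E A" "conn E B" "anticomplete E A B" "A \<subseteq> V - {u, v}" "B \<subseteq> V - {u, v}"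
    "sees E u A" "sees E v A" "sees E u B" "sees E v B"
  shows False
  using unichordI[of u V v E A B] assms adj_in[of u v] adj_neq[of u v] ufree unfolding unichord_free_def by blast

lemma connected_conn:
  assumes "connected S (induced_edges E S)" shows "conn E S"
  unfolding conn_def
proof (intro conjI ballI)
  show "S \<noteq> {}" using assms unfolding connected_def by simp
  fix x y assume "x \<in> S" "y \<in> S"
  then obtain xs where xs: "xs \<noteq> []" "hd xs = x" "last xs = y" "set xs \<subseteq> S"
    and w: "walk (induced_edges (induced_edges E S) S) xs"
    using assms unfolding connected_def has_path_def by blast
  have "successively (\<lambda>a b. {a, b} \<in> E) xs"
    using w unfolding walk_def successively_conv_nth induced_edges_def by simp
  then show "(x, y) \<in> (edge_rel E S)\<^sup>*" using walk_rtrancl[of E xs S] xs by simp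
qed

lemma conn_V: "conn E V"
proof -
  have "induced_edges E V = E" using graph unfolding graph_def induced_edges_def by auto
  then show ?thesis using twoc connected_conn[of V] unfolding two_connected_def by metis
qed

lemma conn_minus: "v \<in> V \<Longrightarrow> conn E (V - {v})"
  using twoc connected_conn unfolding two_connected_def by blast

text \<open>Connectedness gives \<open>x\<close>. The second attachment comes from connectedness of
  the graph without \<open>x\<close>; there must be something else outside \<open>D\<close>, which
  is why the complement of \<open>D\<close> may not be a singleton.\<close>

lemma two_attachments:
  assumes "conn E D" "D \<subseteq> V" "V - D \<noteq> {}" "\<And>x. V - D \<noteq> {x}"
  obtains x y where "x \<in> V - D" "y \<in> V - D" "x \<noteq> y" "sees E x D" "sees E y D"
proof -
  obtain a x where x: "a \<in> D" "x \<in> V - D" "{a, x} \<in> E"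
    using conn_cross[OF conn_V assms(2) conn_nonempty[OF assms(1)] assms(3)] .
  obtain b y where y: "b \<in> D" "y \<in> V - {x} - D" "{b, y} \<in> E"
  proof -
    have "V - {x} - D \<noteq> {}" using assms(3) assms(4)[of x] by auto
    moreover have "x \<in> V" "D \<subseteq> V - {x}" using x assms(2) by auto
    ultimately show thesis using conn_cross[OF conn_minus _ conn_nonempty[OF assms(1)], of x] that by metis
  qed
  show thesis using that[of x y] x y unfolding sees_def by (auto simp: insert_commute)
qed

text \<open>Let \<open>K\<close> be a maximal clique that contains the triangle. If \<open>K\<close>
  is not everything, take a smallest connected set outside \<open>K\<close> that attaches to two
  vertices \<open>a\<close>, \<open>b\<close> of \<open>K\<close>, and a shortest path through it. A
  third vertex of \<open>K\<close> that misses the path makes \<open>ab\<close> a unichord, and one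
  that meets it allows a smaller connected set.\<close>

lemma triangle_complete:
  assumes "{x, y} \<in> E" "{y, z} \<in> E" "{x, z} \<in> E"
  shows "complete V E"
proof -
  define clq where "clq K \<longleftrightarrow> K \<subseteq> V \<and> {x, y, z} \<subseteq> K \<and> (\<forall>a\<in>K. \<forall>b\<in>K. a \<noteq> b \<longrightarrow> {a, b} \<in> E)" for K
  have "clq {x, y, z}" unfolding clq_def using assms adj_in by (auto simp: insert_commute)
  moreover have "card K \<le> card V" if "clq K" for K using that unfolding clq_def by (auto intro: card_mono)
  ultimately obtain K where K: "clq K" and max: "\<And>K'. clq K' \<Longrightarrow> card K' \<le> card K"
    using ex_has_greatest_nat[of clq "{x,y,z}" card "Suc (card V)"]
    by (metis less_Suc_eq_le)
  have finK: "finite K" using K finite_subset[OF _ fin] unfolding clq_def by blast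
  have K3: "\<exists>c\<in>K. c \<noteq> a \<and> c \<noteq> b" for a b
    using K assms adj_neq unfolding clq_def by (metis insert_subset)
  have "K = V"
  proof (rule ccontr)
    assume "K \<noteq> V"
    then obtain w where w: "w \<in> V - K" using K unfolding clq_def by blast
    define good where "good S \<longleftrightarrow> conn E S \<and> S \<subseteq> V - K \<and> (\<exists>a\<in>K. \<exists>b\<in>K. a \<noteq> b \<and> sees E a S \<and> sees E b S)" for S
    define D where "D = component E (V - K) w"
    have D: "conn E D" "D \<subseteq> V - K" unfolding D_def using component_conn component_subset[OF w] by auto
    have "V - D \<noteq> {a}" for a using K3[of a a] D K unfolding clq_def by auto
    moreover have "V - D \<noteq> {}" using K3[of x x] D K unfolding clq_def by auto
    ultimately obtain a b where ab: "a \<in> V - D" "b \<in> V - D" "a \<noteq> b" "sees E a D" "sees E b D"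
      using two_attachments[of D] D by blast
    have "c \<in> K" if "c \<in> V - D" "sees E c D" for c
      using that component_closed[of _ E "V - K" w c] w unfolding sees_def D_def by (auto simp: insert_commute)
    then have "good D" unfolding good_def using ab D by blast
    then obtain S where S: "good S" and min: "\<And>S'. good S' \<Longrightarrow> card S \<le> card S'"
      using ex_has_least_nat[of good D card] by blast
    obtain a b where ab: "a \<in> K" "b \<in> K" "a \<noteq> b" "sees E a S" "sees E b S" using S unfolding good_def by blast
    obtain xs where xs: "xs \<noteq> []" "set xs \<subseteq> S" "ipath E xs" "{a, hd xs} \<in> E" "{b, last xs} \<in> E"
    proof -
      have "conn E S" using S unfolding good_def by blast
      from sees_path_ends[OF this ab(4,5)] that show thesis .
    qed
    have see: "sees E a (set xs)" "sees E b (set xs)" using xs unfolding sees_def by auto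
    have finS: "finite S" using S finite_subset[of S V] unfolding good_def by auto
    have SK: "set xs \<subseteq> V - K" using xs S unfolding good_def by auto
    have "good (set xs)" unfolding good_def using ipath_conn[OF xs(3,1)] SK see ab by blast
    have sub: "\<not> good T" if "T \<subset> set xs" for T
      using min[of T] that xs(2) psubset_card_mono[OF finS, of T] by (meson leD psubset_subset_trans)
    \<comment> \<open>The two sides for the edge \<open>ab\<close> are the outside path and the
      single vertex \<open>c\<close>.\<close>
    have ends: False if c: "c \<in> K" "c \<noteq> a" "c \<noteq> b" "\<not> sees E c (set xs)" for c
    proof (rule unichord_edge[of a b "set xs" "{c}"])
      show "{a, b} \<in> E" "sees E a {c}" "sees E b {c}" using K ab c unfolding clq_def sees_def by auto
      show "anticomplete E (set xs) {c}" using c SK unfolding anticomplete_def sees_def by (auto simp: insert_commute)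
      show "conn E (set xs)" using ipath_conn xs by blast
      show "set xs \<subseteq> V - {a, b}" using SK ab by blast
      show "{c} \<subseteq> V - {a, b}" using c K unfolding clq_def by blast
    qed (use see in auto)
    show False
    proof (cases "\<exists>p. xs = [p]")
      case True
      then obtain p where p: "xs = [p]" by blast
      \<comment> \<open>By maximality of \<open>K\<close> a lone outside vertex misses some clique
        vertex, to which \<open>ends\<close> applies.\<close>
      have "\<not> clq (insert p K)" using max[of "insert p K"] finK SK p by auto
      then obtain c where c: "c \<in> K" "{p, c} \<notin> E"
        using K SK p unfolding clq_def by (auto simp: insert_commute)
      then have "\<not> sees E c (set xs)" using p unfolding sees_def by (simp add: insert_commute)
      moreover have "c \<noteq> a" "c \<noteq> b" using c xs p by (auto simp: insert_commute)
      ultimately show False using ends c by blast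
    next
      case False
      \<comment> \<open>Now \<open>c\<close> has a neighbour \<open>p\<close> on the path. If
        \<open>p\<close> is the last vertex, it alone attaches to \<open>b\<close> and
        \<open>c\<close>; otherwise the initial segment up to \<open>p\<close> attaches to
        \<open>a\<close> and \<open>c\<close>. Either contradicts minimality.\<close>
      obtain c where c: "c \<in> K" "c \<noteq> a" "c \<noteq> b" using K3 by blast
      with ends have "sees E c (set xs)" by blast
      then obtain p where p: "p \<in> set xs" "{c, p} \<in> E" unfolding sees_def by blast
      then obtain as bs where s: "xs = as @ p # bs" by (meson split_list)
      show False
      proof (cases "bs = []")
        case True
        then have "as \<noteq> []" using False s by auto
        then have "{p} \<subset> set xs" using s xs(3) by (cases as) auto
        moreover have "good {p}"
          unfolding good_def using ab c p SK xs(5) s True by (auto simp: sees_def)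
        ultimately show False using sub by blast
      next
        case False
        have ip: "ipath E (as @ [p])" by (rule ipath_prefix[of E as p bs]) (use xs(3) s in simp)
        have "last bs \<notin> set (as @ [p])" using ipath_distinct[OF xs(3)] False s by auto
        moreover have "last bs \<in> set xs" "set (as @ [p]) \<subseteq> set xs" using s False by auto
        ultimately have "set (as @ [p]) \<subset> set xs" by blast
        moreover have "good (set (as @ [p]))"
        proof -
          have "conn E (set (as @ [p]))" using ipath_conn[OF ip] by simp
          moreover have "set (as @ [p]) \<subseteq> V - K" using SK s by auto
          moreover have "sees E a (set (as @ [p]))" using xs(4) s unfolding sees_def by (cases as) auto
          moreover have "sees E c (set (as @ [p]))" using p unfolding sees_def by auto
          ultimately show ?thesis unfolding good_def using c ab by blast
        qed
        ultimately show False using sub by blast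
      qed
    qed
  qed
  then show ?thesis using K unfolding clq_def complete_def by blast
qed

end

text \<open>The case of two paths of Menger's theorem, proved by moving the target along a fixed
  induced path from \<open>u\<close> to \<open>v\<close>. Disjoint connected sets stand for the
  paths, so no path surgery is required. It will be applied to the graph without the edge
  \<open>uv\<close>.\<close>

lemma two_disjoint_paths:
  fixes E :: "'a set set"
  assumes noloop: "\<And>x. {x} \<notin> E" and "u \<noteq> v" "{u, v} \<notin> E" "u \<in> V" "v \<in> V"
    and c0: "(u, v) \<in> (edge_rel E V)\<^sup>*"
    and c1: "\<And>w. w \<in> V \<Longrightarrow> w \<noteq> u \<Longrightarrow> w \<noteq> v \<Longrightarrow> (u, v) \<in> (edge_rel E (V - {w}))\<^sup>*"
  obtains A B where "conn E A" "conn E B" "A \<inter> B = {}" "A \<subseteq> V - {u, v}" "B \<subseteq> V - {u, v}"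
    "sees E u A" "sees E v A" "sees E u B" "sees E v B"
proof -
  let ?C = "component E V u"
  have "v \<in> ?C" using c0 unfolding component_def by simp
  then obtain xs where xs: "xs \<noteq> []" "set xs \<subseteq> ?C" "ipath E xs" "hd xs = u" "last xs = v"
    using path_between[OF component_conn[of E V u] component_self] by metis
  have xsV: "set xs \<subseteq> V" using xs(2) component_subset[OF assms(4)] by blast
  \<comment> \<open>A vertex \<open>w\<close> lies before or after \<open>x\<close> on the path. If
    it is not after, the rest of the path leads from \<open>x\<close> to \<open>v\<close> without
    \<open>w\<close>, and the hypothesis on \<open>v\<close> takes over; if it is after, the initial
    part avoids it.\<close>
  have insep: "(u, x) \<in> (edge_rel E (V - {w}))\<^sup>*"
    if s: "xs = as @ x # bs" and w: "w \<noteq> u" "w \<noteq> x" for as x bs w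
  proof (cases "w \<in> set bs")
    case True
    have ip: "ipath E (as @ [x])" by (rule ipath_prefix[of E as x bs]) (use xs(3) s in simp)
    have "w \<notin> set (as @ [x])" using True xs(3) ipath_distinct[of E xs] s by auto
    then have "set (as @ [x]) \<subseteq> V - {w}" using xsV s by auto
    from walk_rtrancl[OF ipath_successively[OF ip] this] show ?thesis
      using xs(4) s by (cases as) auto
  next
    case False
    have ip: "ipath E (x # bs)" by (rule ipath_suffix[of E as x bs]) (use xs(3) s in simp)
    have "set (x # bs) \<subseteq> V - {w}" using xsV s w False by auto
    from walk_rtrancl[OF ipath_successively[OF ip] this]
    have xv: "(x, v) \<in> (edge_rel E (V - {w}))\<^sup>*" using xs(5) s by auto
    have "w \<noteq> v" using False w xs(5) s by (auto split: if_splits)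
    then have "(u, v) \<in> (edge_rel E (V - {w}))\<^sup>*" using c1[of w] w c0 by (cases "w \<in> V") auto
    with edge_rel_sym[OF xv] show ?thesis by simp
  qed
  let ?G = "\<lambda>x A B. conn E A \<and> conn E B \<and> A \<inter> B = {} \<and> A \<subseteq> V - {u, x} \<and> B \<subseteq> V - {u, x} \<and>
    sees E u A \<and> sees E x A \<and> sees E u B \<and> sees E x B"
  \<comment> \<open>A connected set that contains the new target \<open>y\<close> is cut down to a
    path that stops just before \<open>y\<close>; it stays nonempty because \<open>u\<close> does
    not see \<open>y\<close>.\<close>
  have sublist: "\<exists>A. conn E A \<and> A \<subseteq> S - {y} \<and> sees E u A \<and> sees E y A"
    if S: "conn E S" "y \<in> S" "sees E u S" "{u, y} \<notin> E" for S y
  proof -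
    obtain cs where cs: "cs \<noteq> []" "set cs \<subseteq> S" "ipath E cs" "{u, hd cs} \<in> E" "last cs = y"
      using sees_path_to[OF S(1,3,2)] .
    define c where "c = butlast cs"
    have e: "cs = c @ [y]" unfolding c_def using append_butlast_last_id[OF cs(1)] cs(5) by simp
    have "c \<noteq> []" using cs(4) S(4) unfolding e by auto
    then have "conn E (set c)" "sees E y (set c)" "y \<notin> set c" and hc: "hd c \<in> set c" "hd c = hd cs"
      using ipath_snoc_conn[of E c y] cs(3) unfolding e by auto
    moreover have "sees E u (set c)" using hc cs(4) unfolding sees_def by metis
    ultimately show ?thesis using cs(2) e by (intro exI[of _ "set c"]) auto
  qed
  \<comment> \<open>At least two vertices precede \<open>x\<close>, so \<open>x\<close> is neither
    \<open>u\<close> nor a neighbour of \<open>u\<close>. In the induction step \<open>p\<close> is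
    the predecessor of \<open>x\<close>.\<close>
  have main: "\<exists>A B. ?G x A B" if "xs = as @ x # bs" "length as \<ge> 2" for as x bs
    using that
  proof (induction as arbitrary: x bs rule: rev_induct)
    case (snoc p as)
    have "as \<noteq> []" using snoc.prems by auto
    then obtain as' where as': "as = u # as'" using snoc.prems xs(4) by (cases as) auto
    have ip: "ipath E (u # as' @ p # x # bs)" using xs(3) snoc.prems as' by simp
    then have ip': "ipath E (as' @ p # x # bs)" "\<forall>z\<in>set (as' @ p # x # bs). {u, z} \<in> E \<longleftrightarrow> z = hd (as' @ p # x # bs)"
      "u \<notin> set (as' @ p # x # bs)" by auto
    have ux: "u \<noteq> x" and pu: "p \<noteq> u" using ip'(3) by auto
    have px: "{p, x} \<in> E" "p \<noteq> x" using ipath_suffix[OF ip'(1)] by auto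
    have "hd (as' @ p # x # bs) \<noteq> x" using ipath_distinct[OF ip'(1)] by (cases as') auto
    then have uy: "{u, x} \<notin> E" using ip'(2) by auto
    have xV: "x \<in> V" "p \<in> V" using xsV snoc.prems by auto
    have conx: "(u, x) \<in> (edge_rel E (V - {p}))\<^sup>*" using insep[of "as @ [p]" x bs p] snoc.prems px pu by simp
    show ?case
    proof (cases "length as \<ge> 2")
      case False
      \<comment> \<open>Base case: \<open>p\<close> is adjacent to both \<open>u\<close> and
        \<open>x\<close> and serves as one of the sets; the other one comes from a path that avoids
        \<open>p\<close>.\<close>
      then have as: "as = [u]" using snoc.prems xs(4) by (cases as) (auto simp: Suc_le_eq)
      then have pu': "{u, p} \<in> E" using snoc.prems xs(3) by auto
      let ?D = "component E (V - {p}) u"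
      obtain d where d: "d \<in> ?D" "{u, d} \<in> E"
      proof -
        have "x \<in> ?D" using conx unfolding component_def by simp
        then have "?D - {u} \<noteq> {}" using ux by blast
        then show ?thesis using conn_cross[OF component_conn[of E "V - {p}" u], of "{u}"] that by auto
      qed
      have D: "?D \<subseteq> V - {p}" using component_subset[of u "V - {p}"] assms(4) pu by simp
      have "x \<in> ?D" using conx unfolding component_def by simp
      then obtain cs where cs: "cs \<noteq> []" "set cs \<subseteq> ?D" "ipath E cs" "hd cs = u" "last cs = x"
        using path_between[OF component_conn[of E "V - {p}" u] component_self] by metis
      obtain c where c: "cs = u # c @ [x]"
        using cs ux by (cases cs; cases "tl cs" rule: rev_cases) auto
      have "c \<noteq> []" using cs(3) uy unfolding c by auto
      have i: "ipath E (c @ [x])" and un: "u \<notin> set (c @ [x])" and uh: "{u, hd (c @ [x])} \<in> E"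
        using cs(3) hd_in_set[of "c @ [x]"] unfolding c ipath.simps by blast+
      have "conn E (set c)" "sees E x (set c)" "x \<notin> set c" using ipath_snoc_conn[OF i \<open>c \<noteq> []\<close>] by auto
      moreover have "hd c \<in> set c" "hd (c @ [x]) = hd c" using \<open>c \<noteq> []\<close> by auto
      then have "sees E u (set c)" using uh unfolding sees_def by metis
      moreover have "set c \<subseteq> V - {u, x}" "p \<notin> set c" using cs(2) c D un \<open>x \<notin> set c\<close> by auto
      ultimately have "conn E (set c)" "sees E u (set c)" "sees E x (set c)" "set c \<subseteq> V - {u, x}" "p \<notin> set c"
        by blast+
      then have "?G x {p} (set c)"
        using px pu pu' xV by (auto simp: sees_def insert_commute)
      then show ?thesis by blast
    next
      case True
      then obtain A B where AB: "?G p A B" using snoc.IH[of p "x # bs"] snoc.prems by auto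
      \<comment> \<open>One of the two old sets is led on to \<open>x\<close> through
        \<open>p\<close>; it remains to find the other one off \<open>p\<close>.\<close>
      have ext: "?G x A1 (insert p B1)" if "conn E A1" "conn E B1" "A1 \<inter> B1 = {}" "A1 \<subseteq> V - {u, x, p}" "B1 \<subseteq> V - {u, x}"
        "sees E u A1" "sees E x A1" "sees E u B1" "sees E p B1" for A1 B1
        using that conn_insert[of E B1 p] px xV pu unfolding sees_def by (auto simp: insert_commute)
      have case1: "\<exists>A B. ?G x A B" if AB: "?G p A B" and xA: "x \<in> A" for A B
      proof -
        obtain A1 where "conn E A1" "A1 \<subseteq> A - {x}" "sees E u A1" "sees E x A1"
          using sublist[of A x] AB xA uy by blast
        then have "?G x A1 (insert p B)" using ext[of A1 B] AB xA by blast
        then show ?thesis by blast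
      qed
      \<comment> \<open>The component of \<open>x\<close> outside the two sets touches
        \<open>A\<close>, so a path inside it prolongs \<open>A\<close> to \<open>x\<close>, while
        \<open>B\<close> continues through \<open>p\<close>.\<close>
      have case2: "\<exists>A B. ?G x A B" if AB: "?G p A B" and xA: "x \<notin> A" "x \<notin> B"
        and K: "K = component E (V - {u, p} - A - B) x" and ka: "k \<in> K" "a \<in> A" "{k, a} \<in> E" for A B K k a
      proof -
        have x0: "x \<in> V - {u, p} - A - B" using xA xV ux px by auto
        have KK: "conn E K" "K \<subseteq> V - {u, p} - A - B" "x \<in> K"
          unfolding K using component_conn component_subset[OF x0] by auto
        show ?thesis
        proof (cases "sees E x A")
          case True
          then have "?G x A (insert p B)" using ext[of A B] AB xA by blast
          then show ?thesis by blast
        next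
          case False
          obtain cs where cs: "cs \<noteq> []" "set cs \<subseteq> K" "ipath E cs" "sees E (hd cs) A" "last cs = x"
          proof -
            have "sees E k A" using ka unfolding sees_def by blast
            from shortest_path[OF KK(1) ka(1), of "\<lambda>z. sees E z A", OF this KK(3), of "\<lambda>z. z = x", OF refl]
            show thesis using that by metis
          qed
          define c where "c = butlast cs"
          have e: "cs = c @ [x]" unfolding c_def using append_butlast_last_id[OF cs(1)] cs(5) by simp
          have c0: "c \<noteq> []" using cs(4) False unfolding e by auto
          have c: "conn E (set c)" "sees E x (set c)" "x \<notin> set c"
            using ipath_snoc_conn[OF _ c0] cs(3) e by metis+
          have "hd c \<in> set c" "sees E (hd c) A" using c0 cs(4) e by auto
          then have "conn E (set c \<union> A)" using conn_union[OF c(1), of A "hd c"] AB unfolding sees_def by blast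
          moreover have cK: "set c \<subseteq> K" using cs(2) e by auto
          moreover have "(set c \<union> A) \<inter> B = {}" "set c \<union> A \<subseteq> V - {u, x, p}" "B \<subseteq> V - {u, x}"
            using cK KK(2) c(3) AB xA by blast+
          moreover have "sees E u (set c \<union> A)" "sees E x (set c \<union> A)"
            using AB c(2) unfolding sees_def by blast+
          ultimately have "?G x (set c \<union> A) (insert p B)"
            using ext[of "set c \<union> A" B] AB by blast
          then show ?thesis by blast
        qed
      qed
      show ?thesis
      proof (cases "x \<in> A \<or> x \<in> B")
        case True
        have "?G p B A" using AB by blast
        then show ?thesis using case1[of A B] case1[of B A] AB True by blast
      next
        case False
        \<comment> \<open>Since \<open>p\<close> does not separate \<open>u\<close> from
          \<open>x\<close>, this component has a neighbour other than \<open>p\<close> outside,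
          which is \<open>u\<close> or lies in \<open>A\<close> or \<open>B\<close>.\<close>
        define K where "K = component E (V - {u, p} - A - B) x"
        have x0: "x \<in> V - {u, p} - A - B" using False xV ux px by auto
        have KK: "conn E K" "K \<subseteq> V - {u, p} - A - B" "x \<in> K"
          unfolding K_def using component_conn component_subset[OF x0] by auto
        let ?D = "component E (V - {p}) u"
        have "K \<subseteq> ?D"
        proof
          fix k assume "k \<in> K"
          then have "(x, k) \<in> (edge_rel E (V - {p}))\<^sup>*"
            unfolding K_def component_def by (auto intro: edge_rel_rtrancl_mono)
          with conx show "k \<in> ?D" unfolding component_def by simp
        qed
        moreover have "u \<in> ?D - K" using KK by auto
        ultimately obtain k a where ka: "k \<in> K" "a \<in> ?D - K" "{k, a} \<in> E"
          using conn_cross[OF component_conn[of E "V - {p}" u], of K] KK by blast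
        have "a \<in> V - {p}" using ka component_subset[of u "V - {p}"] assms(4) pu by auto
        then have "a = u \<or> a \<in> A \<or> a \<in> B"
          using component_closed[of k E _ x a] x0 ka unfolding K_def by blast
        then consider "a = u" | "a \<in> A" | "a \<in> B" by blast
        then show ?thesis
        proof cases
          case 1
          then have "{u, k} \<in> E" using ka(3) by (simp add: insert_commute)
          then have "sees E u K" using ka(1) unfolding sees_def by blast
          then obtain A1 where "conn E A1" "A1 \<subseteq> K - {x}" "sees E u A1" "sees E x A1"
            using sublist[OF KK(1,3) _ uy] by blast
          then have "?G x A1 (insert p B)" using ext[of A1 B] AB KK False by blast
          then show ?thesis by blast
        next
          case 2
          then show ?thesis using case2[OF AB, of K k a] False ka K_def by blast
        next
          case 3
          have BA: "?G p B A" using AB by blast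
          have "V - {u, p} - A - B = V - {u, p} - B - A" by blast
          then show ?thesis using case2[OF BA, of K k a] 3 False ka K_def by metis
        qed
      qed
    qed
  qed simp
  obtain as where as: "xs = as @ [v]" using xs by (metis append_butlast_last_id)
  have "length as \<ge> 2"
  proof (rule ccontr)
    assume "\<not> length as \<ge> 2"
    then consider "as = []" | a where "as = [a]" by (cases as; cases "tl as") auto
    then show False using as xs assms(2,3) by cases auto
  qed
  then show thesis using main[of as v "[]"] as that by blast
qed

section \<open>Minimal pairs of disjoint paths and the induced subdivision of
  \<open>K4\<close>\<close>

lemma card_set_Un: "card (set xs \<union> set ys) \<le> length xs + length ys"
  by (metis card_length length_append set_append)

locale girth5 = ufree +
  assumes tri: "{x, y} \<in> E \<Longrightarrow> {y, z} \<in> E \<Longrightarrow> {x, z} \<notin> E"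
    and sqf: "\<not> has_induced_square V E"
begin

text \<open>Without triangles a 4-cycle has no diagonals, so a proper one would be an induced
  square.\<close>

lemma square_collapses:
  assumes "{a, b} \<in> E" "{b, c} \<in> E" "{c, d} \<in> E" "{d, a} \<in> E"
  shows "a = c \<or> b = d"
proof (rule ccontr)
  assume ne: "\<not> (a = c \<or> b = d)"
  have "{a, c} \<notin> E" using tri[OF assms(1,2)] .
  moreover have "{b, d} \<notin> E" using tri[OF assms(2,3)] .
  moreover have "a \<in> V" "b \<in> V" "c \<in> V" "d \<in> V" using assms adj_in by blast+
  moreover have "distinct [a, b, c, d]" using ne assms adj_neq by auto
  ultimately show False using sqf assms unfolding has_induced_square_def by blast
qed

text \<open>Edges between \<open>A\<close> and \<open>B\<close> are allowed on purpose:
  unichord-freeness forces at least one, and minimality will leave exactly one.\<close>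

definition double_path :: "'a \<Rightarrow> 'a \<Rightarrow> 'a set \<Rightarrow> 'a set \<Rightarrow> bool" where
  "double_path u v A B \<longleftrightarrow> {u, v} \<in> E \<and> conn E A \<and> conn E B \<and> A \<inter> B = {} \<and>
     A \<subseteq> V - {u, v} \<and> B \<subseteq> V - {u, v} \<and> sees E u A \<and> sees E v A \<and> sees E u B \<and> sees E v B"

definition thin_path :: "'a \<Rightarrow> 'a \<Rightarrow> 'a list \<Rightarrow> bool" where
  "thin_path u v xs \<longleftrightarrow> xs \<noteq> [] \<and> ipath E xs \<and> set xs \<subseteq> V - {u, v} \<and>
     (\<forall>z\<in>set xs. {u, z} \<in> E \<longleftrightarrow> z = hd xs) \<and> (\<forall>z\<in>set xs. {v, z} \<in> E \<longleftrightarrow> z = last xs)"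

text \<open>The minimum is taken over all edges of the graph, not only over \<open>uv\<close>,
  because a cross edge between the two paths will itself play the role of \<open>uv\<close>.\<close>

definition min_pair :: "'a \<Rightarrow> 'a \<Rightarrow> 'a list \<Rightarrow> 'a list \<Rightarrow> bool" where
  "min_pair u v as bs \<longleftrightarrow> {u, v} \<in> E \<and> thin_path u v as \<and> thin_path u v bs \<and> set as \<inter> set bs = {} \<and>
     (\<forall>u' v' A B. double_path u' v' A B \<longrightarrow> length as + length bs \<le> card A + card B)"

lemma thin_path_rev: "thin_path u v xs \<Longrightarrow> thin_path v u (rev xs)"
  unfolding thin_path_def by (auto simp: ipath_rev hd_rev last_rev)

lemma min_pair_rev: "min_pair u v as bs \<Longrightarrow> min_pair v u (rev as) (rev bs)"
  unfolding min_pair_def using thin_path_rev by (auto simp: insert_commute)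

lemma min_pair_swap: "min_pair u v as bs \<Longrightarrow> min_pair u v bs as"
  unfolding min_pair_def by (auto simp: add.commute)

lemma sees_thin_path:
  assumes "conn E A" "sees E u A" "sees E v A" "A \<subseteq> V - {u, v}"
  obtains xs where "thin_path u v xs" "set xs \<subseteq> A"
proof -
  obtain xs where xs: "xs \<noteq> []" "set xs \<subseteq> A" "ipath E xs" "{u, hd xs} \<in> E" "{v, last xs} \<in> E"
    "\<forall>z\<in>set (tl xs). {u, z} \<notin> E" "\<forall>z\<in>set (butlast xs). {v, z} \<notin> E"
    by (rule sees_path[OF assms(1-3)])
  have "\<forall>z\<in>set xs. {u, z} \<in> E \<longleftrightarrow> z = hd xs" using xs(1,4,6) by (cases xs) auto
  moreover have "\<forall>z\<in>set xs. {v, z} \<in> E \<longleftrightarrow> z = last xs" using xs(1,5,7) by (cases xs rule: rev_cases) auto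
  ultimately show thesis using that[of xs] xs(1-3) assms(4) unfolding thin_path_def by blast
qed

lemma ex_min_pair:
  assumes "double_path u v A B"
  obtains u v as bs where "min_pair u v as bs"
proof -
  let ?f = "\<lambda>(u, v, A, B). card A + card B"
  obtain t where t: "case t of (u, v, A, B) \<Rightarrow> double_path u v A B"
    and min: "\<And>s. (case s of (u, v, A, B) \<Rightarrow> double_path u v A B) \<Longrightarrow> ?f t \<le> ?f s"
    using ex_has_least_nat[of "\<lambda>(u, v, A, B). double_path u v A B" "(u, v, A, B)" ?f] assms by auto
  obtain u v A B where tt: "t = (u, v, A, B)" by (cases t) auto
  then have d: "double_path u v A B" and min: "\<And>u' v' A' B'. double_path u' v' A' B' \<Longrightarrow> card A + card B \<le> card A' + card B'"
    using t min by auto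
  obtain as where as: "thin_path u v as" "set as \<subseteq> A"
    using d sees_thin_path[of A u v] unfolding double_path_def by auto
  obtain bs where bs: "thin_path u v bs" "set bs \<subseteq> B"
    using d sees_thin_path[of B u v] unfolding double_path_def by auto
  have "finite A" "finite B" using d finite_subset[OF _ fin] unfolding double_path_def by blast+
  then have "card (set as) \<le> card A" "card (set bs) \<le> card B" using as bs card_mono by auto
  moreover have "card (set as) = length as" "card (set bs) = length bs"
    using as bs unfolding thin_path_def by (auto simp: distinct_card ipath_distinct)
  ultimately have "length as + length bs \<le> card A + card B" by simp
  then have "min_pair u v as bs"
    unfolding min_pair_def using as bs d min unfolding double_path_def by (auto intro: order_trans)
  then show thesis using that by blast
qed

text \<open>For a cross edge \<^term>\<open>{p, q}\<close> the two arcs of the cycle separated by it form again a double path,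
  of the same total size; every further cross edge would shortcut it.\<close>

lemma hd_arc:
  assumes "thin_path u v (a1 @ p # a2)"
  shows "conn E (insert u (set a1))" "sees E p (insert u (set a1))"
proof -
  have t: "ipath E (a1 @ p # a2)" "\<forall>z\<in>set (a1 @ p # a2). {u, z} \<in> E \<longleftrightarrow> z = hd (a1 @ p # a2)"
    using assms unfolding thin_path_def by auto
  show "conn E (insert u (set a1))"
  proof (cases "a1 = []")
    case False
    then have "conn E (set a1)" using t(1) ipath_conn unfolding ipath_append by blast
    moreover have "sees E u (set a1)" using t(2) False unfolding sees_def by (intro bexI[of _ "hd a1"]) auto
    ultimately show ?thesis by (rule conn_insert)
  qed simp
  show "sees E p (insert u (set a1))"
  proof (cases "a1 = []")
    case True
    then show ?thesis using t(2) unfolding sees_def by (auto simp: insert_commute)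
  next
    case False
    then show ?thesis using ipath_snoc_conn(2)[OF ipath_prefix[OF t(1)]] unfolding sees_def by blast
  qed
qed

lemma last_arc:
  assumes "thin_path u v (a1 @ p # a2)"
  shows "conn E (insert v (set a2))" "sees E p (insert v (set a2))"
  using hd_arc[of v u "rev a2" p "rev a1"] thin_path_rev[OF assms] by auto

lemma mid_arc:
  assumes "ipath E (as @ p # m @ q # bs)"
  shows "conn E (set (p # m))" "sees E q (set (p # m))"
proof -
  have "ipath E ((p # m) @ q # bs)" using ipath_suffix[OF assms] by simp
  from ipath_snoc_conn[OF ipath_prefix[OF this]]
  show "conn E (set (p # m))" "sees E q (set (p # m))" by auto
qed

lemma cross_facts:
  assumes "min_pair u v as bs"
  shows "thin_path u v as" "thin_path u v bs" "{u, v} \<in> E" "set as \<inter> set bs = {}" "u \<notin> set as" "v \<notin> set as" "u \<notin> set bs" "v \<notin> set bs"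
    "set as \<subseteq> V" "set bs \<subseteq> V" "u \<in> V" "v \<in> V" "u \<noteq> v" "ipath E as" "ipath E bs" "distinct as" "distinct bs"
  using assms adj_in[of u v] adj_neq[of u v] ipath_distinct unfolding min_pair_def thin_path_def by auto

lemma min_pair_le:
  assumes "min_pair u v as bs" "double_path u' v' A B" "card A \<le> k" "card B \<le> l"
  shows "length as + length bs \<le> k + l"
  using assms unfolding min_pair_def by (meson add_mono order_trans)

text \<open>Suppose \<open>p\<close> has neighbours \<open>q'\<close> before \<open>q\<close> on the
  second path. For the edge \<open>pq\<close> one set is the segment from \<open>q'\<close> to just
  before \<open>q\<close>, the other consists of the two tails joined at \<open>v\<close>. This pair
  is smaller by at least one vertex.\<close>

lemma cross_unique_end:
  assumes m: "min_pair u v (a1 @ p # a2) (c1 @ q' # c2 @ q # b2)" and "{p, q} \<in> E"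
  shows "{p, q'} \<notin> E"
proof
  assume e: "{p, q'} \<in> E"
  note f = cross_facts[OF m]
  have mid: "conn E (set (q' # c2))" "sees E q (set (q' # c2))" using mid_arc[OF f(15)] by auto
  have l: "conn E (insert v (set a2))" "sees E p (insert v (set a2))" using last_arc[OF f(1)] by auto
  have f2: "thin_path u v ((c1 @ q' # c2) @ q # b2)" using f(2) by simp
  have l2: "conn E (insert v (set b2))" "sees E q (insert v (set b2))" using last_arc[OF f2] by auto
  have cB: "conn E (insert v (set a2) \<union> insert v (set b2))" using conn_union[OF l(1) l2(1), of v v] by simp
  have "double_path p q (set (q' # c2)) (insert v (set a2) \<union> insert v (set b2))"
    unfolding double_path_def
  proof (intro conjI)
    show "sees E p (set (q' # c2))" using e unfolding sees_def by auto
    show "sees E p (insert v (set a2) \<union> insert v (set b2))" "sees E q (insert v (set a2) \<union> insert v (set b2))"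
      using l(2) l2(2) unfolding sees_def by blast+
    show "set (q' # c2) \<inter> (insert v (set a2) \<union> insert v (set b2)) = {}" using f(4,8,17) by auto
    show "set (q' # c2) \<subseteq> V - {p, q}" using f(4,10,17) by auto
    show "insert v (set a2) \<union> insert v (set b2) \<subseteq> V - {p, q}"
      using f(4,6,8,9,10,12,16,17) by auto
  qed (use mid cB assms(2) in auto)
  moreover have "card (set (q' # c2)) \<le> Suc (length c2)" by (metis card_length length_Cons)
  moreover have "card (insert v (set a2) \<union> insert v (set b2)) \<le> Suc (length a2 + length b2)"
    using card_length[of "v # a2 @ b2"] by simp
  ultimately show False using min_pair_le[OF m] by fastforce
qed

text \<open>For the edge \<open>pq\<close> one set consists of the two segments that start at
  \<open>p'\<close> and \<open>q'\<close>, joined by the edge \<open>p'q'\<close>; the other one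
  consists of the two tails joined at \<open>v\<close>. In the count \<open>v\<close> replaces
  \<open>p\<close> and \<open>q\<close>.\<close>

lemma cross_parallel:
  assumes m: "min_pair u v (a1 @ p' # m1 @ p # a2) (b1 @ q' # m2 @ q # b2)" and "{p, q} \<in> E"
  shows "{p', q'} \<notin> E"
proof
  assume e: "{p', q'} \<in> E"
  note f = cross_facts[OF m]
  have mid: "conn E (set (p' # m1))" "sees E p (set (p' # m1))" using mid_arc[OF f(14)] by auto
  have mid2: "conn E (set (q' # m2))" "sees E q (set (q' # m2))" using mid_arc[OF f(15)] by auto
  have f1: "thin_path u v ((a1 @ p' # m1) @ p # a2)" "thin_path u v ((b1 @ q' # m2) @ q # b2)" using f(1,2) by simp_all
  note l = last_arc[OF f1(1)] and l2 = last_arc[OF f1(2)]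
  have cB: "conn E (insert v (set a2) \<union> insert v (set b2))" using conn_union[OF l(1) l2(1), of v v] by simp
  have cA: "conn E (set (p' # m1) \<union> set (q' # m2))" using conn_union[OF mid(1) mid2(1), of p' q'] e by simp
  have "double_path p q (set (p' # m1) \<union> set (q' # m2)) (insert v (set a2) \<union> insert v (set b2))"
    unfolding double_path_def
  proof (intro conjI)
    show "sees E p (set (p' # m1) \<union> set (q' # m2))" "sees E q (set (p' # m1) \<union> set (q' # m2))"
      using mid(2) mid2(2) unfolding sees_def by blast+
    show "sees E p (insert v (set a2) \<union> insert v (set b2))" "sees E q (insert v (set a2) \<union> insert v (set b2))"
      using l(2) l2(2) unfolding sees_def by blast+
    show "(set (p' # m1) \<union> set (q' # m2)) \<inter> (insert v (set a2) \<union> insert v (set b2)) = {}" using f(4,6,8,16,17) by auto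
    show "set (p' # m1) \<union> set (q' # m2) \<subseteq> V - {p, q}" using f(4,9,10,16,17) by auto
    show "insert v (set a2) \<union> insert v (set b2) \<subseteq> V - {p, q}"
      using f(4,6,8,9,10,12,16,17) by auto
  qed (use cA cB assms(2) in auto)
  moreover have "card (set (p' # m1) \<union> set (q' # m2)) \<le> length m1 + length m2 + 2"
    using card_set_Un[of "p' # m1" "q' # m2"] by (simp del: list.set)
  moreover have "card (insert v (set a2) \<union> insert v (set b2)) \<le> Suc (length a2 + length b2)"
    using card_length[of "v # a2 @ b2"] by simp
  ultimately have "length (a1 @ p' # m1 @ p # a2) + length (b1 @ q' # m2 @ q # b2)
    \<le> length m1 + length m2 + 2 + Suc (length a2 + length b2)" by (rule min_pair_le[OF m])
  then show False by simp
qed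

text \<open>Two crossing edges allow the paths to exchange their tails: one runs through
  \<open>p'\<close> and \<open>q'\<close>, the other through \<open>q\<close> and
  \<open>p\<close>.\<close>

lemma cross_crossing:
  assumes m: "min_pair u v (a1 @ p' # m1 @ p # a2) (b1 @ q # m2 @ q' # b2)" and e: "{p, q} \<in> E" "{p', q'} \<in> E"
  shows False
proof -
  note f = cross_facts[OF m]
  have hd1: "{u, hd (a1 @ [p'])} \<in> E" "{u, hd (b1 @ [q])} \<in> E" and la: "{v, last (p # a2)} \<in> E" "{v, last (q' # b2)} \<in> E"
    using f(1,2) unfolding thin_path_def by (auto simp: hd_append split: if_splits)
  have i: "ipath E (a1 @ [p'])" "ipath E (b1 @ [q])" using ipath_prefix[OF f(14)] ipath_prefix[OF f(15)] by auto
  have i2: "ipath E (p # a2)" "ipath E (q' # b2)"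
    using ipath_suffix[of E "a1 @ p' # m1" p a2] ipath_suffix[of E "b1 @ q # m2" q' b2] f(14,15) by simp_all
  have cA: "conn E (set (a1 @ [p']) \<union> set (q' # b2))"
    using conn_union[OF ipath_conn[OF i(1)] ipath_conn[OF i2(2)], of p' q'] e by simp
  have cB: "conn E (set (b1 @ [q]) \<union> set (p # a2))"
    using conn_union[OF ipath_conn[OF i(2)] ipath_conn[OF i2(1)], of q p] e by (simp add: insert_commute)
  have s: "sees E u (set (a1 @ [p']))" "sees E u (set (b1 @ [q]))" "sees E v (set (p # a2))" "sees E v (set (q' # b2))"
    using hd1 la hd_in_set[of "a1 @ [p']"] hd_in_set[of "b1 @ [q]"] last_in_set[of "p # a2"] last_in_set[of "q' # b2"]
    unfolding sees_def by blast+
  have "double_path u v (set (a1 @ [p']) \<union> set (q' # b2)) (set (b1 @ [q]) \<union> set (p # a2))"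
    unfolding double_path_def
  proof (intro conjI)
    show "sees E u (set (a1 @ [p']) \<union> set (q' # b2))" "sees E v (set (a1 @ [p']) \<union> set (q' # b2))"
      "sees E u (set (b1 @ [q]) \<union> set (p # a2))" "sees E v (set (b1 @ [q]) \<union> set (p # a2))"
      using s unfolding sees_def by blast+
    show "(set (a1 @ [p']) \<union> set (q' # b2)) \<inter> (set (b1 @ [q]) \<union> set (p # a2)) = {}" using f(4,16,17) by auto
    show "set (a1 @ [p']) \<union> set (q' # b2) \<subseteq> V - {u, v}" "set (b1 @ [q]) \<union> set (p # a2) \<subseteq> V - {u, v}"
      using f(5-10) by auto
  qed (use cA cB f(3) in auto)
  moreover have "card (set (a1 @ [p']) \<union> set (q' # b2)) \<le> length a1 + length b2 + 2"
    using card_set_Un[of "a1 @ [p']" "q' # b2"] by (simp del: list.set set_append)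
  moreover have "card (set (b1 @ [q]) \<union> set (p # a2)) \<le> length b1 + length a2 + 2"
    using card_set_Un[of "b1 @ [q]" "p # a2"] by (simp del: list.set set_append)
  ultimately have "length (a1 @ p' # m1 @ p # a2) + length (b1 @ q # m2 @ q' # b2)
    \<le> length a1 + length b2 + 2 + (length b1 + length a2 + 2)" by (rule min_pair_le[OF m])
  \<comment> \<open>The exchange omits exactly \<open>m1\<close> and \<open>m2\<close>. By
    minimality they are empty, and then \<open>p'\<close>, \<open>p\<close>, \<open>q\<close>,
    \<open>q'\<close> form a 4-cycle.\<close>
  then have "m1 = []" "m2 = []" by auto
  then have "ipath E (p' # p # a2)" "ipath E (q # q' # b2)"
    using ipath_suffix[OF f(14)] ipath_suffix[OF f(15)] by simp_all
  then have "{p', p} \<in> E" "{q, q'} \<in> E" by auto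
  then have "p' = q \<or> p = q'" using square_collapses[of p' p q q'] e by (simp add: insert_commute)
  then show False using f(4) by auto
qed

lemma split_two:
  assumes "x \<in> set xs" "y \<in> set xs" "x \<noteq> y"
  obtains as ms bs where "xs = as @ x # ms @ y # bs" | as ms bs where "xs = as @ y # ms @ x # bs"
proof -
  obtain as bs where xs: "xs = as @ x # bs" using assms(1) by (meson split_list)
  then have "y \<in> set as \<or> y \<in> set bs" using assms by auto
  then show thesis
  proof
    assume "y \<in> set as"
    then obtain c d where "as = c @ y # d" by (meson split_list)
    then show thesis using that(2)[of c d bs] xs by simp
  next
    assume "y \<in> set bs"
    then obtain c d where "bs = c @ y # d" by (meson split_list)
    then show thesis using that(1)[of as c d] xs by simp
  qed
qed

lemma cross_unique:
  assumes m: "min_pair u v as bs" and "p \<in> set as" "q \<in> set bs" "{p, q} \<in> E" and "p' \<in> set as" "q' \<in> set bs" "{p', q'} \<in> E"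
  shows "p = p' \<and> q = q'"
proof (rule ccontr)
  assume ne: "\<not> (p = p' \<and> q = q')"
  have one: False if m: "min_pair u v as bs" and h: "p \<in> set as" "q \<in> set bs" "q' \<in> set bs" "q \<noteq> q'" "{p, q} \<in> E" "{p, q'} \<in> E" for as bs p q q'
  proof -
    obtain a1 a2 where as: "as = a1 @ p # a2" using h(1) by (meson split_list)
    from h(2-4) show False
    proof (cases rule: split_two)
      case (1 c1 c2 c3)
      then show False using cross_unique_end[of u v a1 p a2 c1 q c2 q' c3] m h as by blast
    next
      case (2 c1 c2 c3)
      then show False using cross_unique_end[of u v a1 p a2 c1 q' c2 q c3] m h as by blast
    qed
  qed
  show False
  proof (cases "p = p' \<or> q = q'")
    case True
    then consider "p = p'" "q \<noteq> q'" | "q = q'" "p \<noteq> p'" using ne by blast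
    then show False
    proof cases
      case 1
      then show False using one[OF m, of p q q'] assms by blast
    next
      case 2
      have "{q, p} \<in> E" "{q, p'} \<in> E" using 2 assms by (simp_all add: insert_commute)
      then show False using one[OF min_pair_swap[OF m], of q p p'] assms 2 by blast
    qed
  next
    case False
    then have n: "p \<noteq> p'" "q \<noteq> q'" by auto
    from assms(2,5) n(1) show False
    proof (cases rule: split_two)
      case A: (1 a1 a2 a3)
      from assms(3,6) n(2) show False
      proof (cases rule: split_two)
        case B: (1 b1 b2 b3)
        then show False using A cross_parallel[of u v a1 p a2 p' a3 b1 q b2 q' b3] assms by blast
      next
        case B: (2 b1 b2 b3)
        then show False using A cross_crossing[of u v a1 p a2 p' a3 b1 q' b2 q b3] assms by blast
      qed
    next
      case A: (2 a1 a2 a3)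
      from assms(3,6) n(2) show False
      proof (cases rule: split_two)
        case B: (1 b1 b2 b3)
        then show False using A cross_crossing[of u v a1 p' a2 p a3 b1 q b2 q' b3] assms by blast
      next
        case B: (2 b1 b2 b3)
        then show False using A cross_parallel[of u v a1 p' a2 p a3 b1 q' b2 q b3] assms by blast
      qed
    qed
  qed
qed

text \<open>If the cross edge were at the first vertex \<open>p\<close> of its path, then
  \<open>up\<close> would be a unichord: one side goes from \<open>p\<close> along its path to
  \<open>v\<close> and back to \<open>u\<close>, the other one from \<open>u\<close> along the
  second path to \<open>q\<close>.\<close>

lemma cross_not_hd:
  assumes m: "min_pair u v (a1 @ p # a2) (b1 @ q # b2)" and e: "{p, q} \<in> E"
  shows "a1 \<noteq> []"
proof
  assume "a1 = []"
  note f = cross_facts[OF m]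
  have up: "{u, p} \<in> E" using f(1) \<open>a1 = []\<close> unfolding thin_path_def by auto
  \<comment> \<open>Only the last vertex of the second path sees \<open>v\<close>. If that is
    \<open>q\<close>, then \<open>u\<close>, \<open>p\<close>, \<open>q\<close>, \<open>v\<close> is
    a 4-cycle.\<close>
  have vq: "{v, z} \<notin> E" if "z \<in> set (b1 @ [q])" for z
  proof
    assume "{v, z} \<in> E"
    then have z: "z = last (b1 @ q # b2)" using f(2) that unfolding thin_path_def by auto
    have "b2 = []" using z that f(17) last_in_set[of b2] by (auto split: if_splits)
    then have "{q, v} \<in> E" using z \<open>{v, z} \<in> E\<close> by (simp add: insert_commute)
    then have "u = q \<or> p = v" using square_collapses[OF up e, of v] f(3) by (simp add: insert_commute)
    then show False using f(6,7) by auto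
  qed
  show False
  proof (rule unichord_edge[OF up, of "insert v (set a2)" "set (b1 @ [q])"])
    show "conn E (insert v (set a2))" "sees E p (insert v (set a2))" using last_arc[OF f(1)] by auto
    show "sees E u (insert v (set a2))" using f(3) unfolding sees_def by auto
    show "conn E (set (b1 @ [q]))" using ipath_conn[OF ipath_prefix[OF f(15)]] by simp
    have "{u, hd (b1 @ [q])} \<in> E" using f(2) unfolding thin_path_def by (auto simp: hd_append split: if_splits)
    then show "sees E u (set (b1 @ [q]))" using hd_in_set[of "b1 @ [q]"] unfolding sees_def by blast
    show "sees E p (set (b1 @ [q]))" using e unfolding sees_def by auto
    have "{x, y} \<notin> E" if "x \<in> set a2" "y \<in> set (b1 @ [q])" for x y
      using cross_unique[OF m _ _ e, of x y] that f(16) by auto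
    then show "anticomplete E (insert v (set a2)) (set (b1 @ [q]))"
      unfolding anticomplete_def using vq f(4,8) by auto
    show "insert v (set a2) \<subseteq> V - {u, p}" using f(5,6,9,12,13,16) by auto
    show "set (b1 @ [q]) \<subseteq> V - {u, p}" using f(4,7,10) by auto
  qed
qed

text \<open>With no cross edge \<open>uv\<close> would be a unichord. The unique cross edge
  \<open>pq\<close> is interior on both paths, by \<open>cross_not_hd\<close> applied from either
  end and to either path, so \<open>u\<close>, \<open>v\<close>, \<open>p\<close>, \<open>q\<close>
  are the branch vertices of a subdivided \<open>K4\<close> in which \<open>uv\<close> and
  \<open>pq\<close> stay edges.\<close>

lemma min_pair_K4:
  assumes "min_pair u v as bs"
  obtains p q a1 a2 b1 b2 where "as = a1 @ p # a2" "bs = b1 @ q # b2" "{p, q} \<in> E"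
    "a1 \<noteq> []" "a2 \<noteq> []" "b1 \<noteq> []" "b2 \<noteq> []"
    "\<forall>x\<in>set as. \<forall>y\<in>set bs. {x, y} \<in> E \<longleftrightarrow> x = p \<and> y = q"
proof -
  note f = cross_facts[OF assms]
  have sees: "sees E u (set xs) \<and> sees E v (set xs) \<and> conn E (set xs) \<and> set xs \<subseteq> V - {u, v}" if "thin_path u v xs" for xs
    using that ipath_conn[of E xs] hd_in_set[of xs] last_in_set[of xs] unfolding thin_path_def sees_def by blast
  have "\<exists>p\<in>set as. \<exists>q\<in>set bs. {p, q} \<in> E"
  proof (rule ccontr)
    assume "\<not> ?thesis"
    then have "anticomplete E (set as) (set bs)" using f(4) unfolding anticomplete_def by blast
    then show False using unichord_edge[OF f(3), of "set as" "set bs"] sees[OF f(1)] sees[OF f(2)] by blast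
  qed
  then obtain p q where pq: "p \<in> set as" "q \<in> set bs" "{p, q} \<in> E" by blast
  then obtain a1 a2 b1 b2 where s: "as = a1 @ p # a2" "bs = b1 @ q # b2" by (meson split_list)
  have qp: "{q, p} \<in> E" using pq by (simp add: insert_commute)
  have m1: "min_pair u v (a1 @ p # a2) (b1 @ q # b2)" "min_pair u v (b1 @ q # b2) (a1 @ p # a2)"
    using assms min_pair_swap s by auto
  have m2: "min_pair v u (rev a2 @ p # rev a1) (rev b2 @ q # rev b1)" "min_pair v u (rev b2 @ q # rev b1) (rev a2 @ p # rev a1)"
    using m1[THEN min_pair_rev] by simp_all
  have "a1 \<noteq> []" "a2 \<noteq> []" "b1 \<noteq> []" "b2 \<noteq> []"
    using cross_not_hd[OF m1(1) pq(3)] cross_not_hd[OF m1(2) qp] cross_not_hd[OF m2(1) pq(3)] cross_not_hd[OF m2(2) qp] by auto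
  moreover have "\<forall>x\<in>set as. \<forall>y\<in>set bs. {x, y} \<in> E \<longleftrightarrow> x = p \<and> y = q"
    using cross_unique[OF assms pq] pq(3) by blast
  ultimately show thesis using that s pq by blast
qed

end

section \<open>Patterns of thin and flat parts\<close>

text \<open>A pattern \<open>(N, R, F)\<close> is made of numbered pieces: those in \<open>N\<close> are single vertices, with
  adjacency \<open>R\<close>, and each \<open>(d, a, b)\<close> in \<open>F\<close> is a nonempty induced path \<open>d\<close> that joins
  the single vertices \<open>a\<close> and \<open>b\<close>.\<close>
type_synonym flat = "int \<times> int \<times> int"
type_synonym model = "int list \<times> (int \<times> int) list \<times> flat list"

fun ids :: "model \<Rightarrow> int list" where "ids (N, R, F) = N @ map fst F"
fun thins :: "model \<Rightarrow> int list" where "thins (N, R, F) = N"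
fun flats :: "model \<Rightarrow> flat list" where "flats (N, R, F) = F"
fun links :: "model \<Rightarrow> (int \<times> int) list" where
  "links (N, R, F) = R @ concat (map (\<lambda>(d, a, b). [(d, a), (d, b)]) F)"

definition linked :: "(int \<times> int) list \<Rightarrow> int \<Rightarrow> int \<Rightarrow> bool" where
  "linked L i j \<longleftrightarrow> (i, j) \<in> set L \<or> (j, i) \<in> set L"

lemma linked_sym: "linked L i j = linked L j i"
  unfolding linked_def by auto

text \<open>In \<open>Split f x y\<close> the flags tell whether the path \<open>f\<close> continues before and after the
  vertex. Refining turns that vertex into a single vertex with the number of the path; the two remaining parts
  get this number plus 20 and plus 40.\<close>
datatype pt = Thin int | Whole flat | Split flat bool bool

fun pid :: "pt \<Rightarrow> int" where
  "pid (Thin i) = i" | "pid (Whole f) = fst f" | "pid (Split f x y) = fst f"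

fun is_whole :: "pt \<Rightarrow> bool" where
  "is_whole (Whole f) = True" | "is_whole _ = False"

fun refine :: "pt \<Rightarrow> model \<Rightarrow> model" where
  "refine (Split (d, a, b) x y) (N, R, F) =
     (d # N, (if x then [] else [(a, d)]) @ (if y then [] else [(d, b)]) @ R,
      (if x then [(d + 20, a, d)] else []) @ (if y then [(d + 40, d, b)] else []) @ filter (\<lambda>f. fst f \<noteq> d) F)"
| "refine (Thin i) m = m"
| "refine (Whole f) m = m"

fun is_pt :: "model \<Rightarrow> pt \<Rightarrow> bool" where
  "is_pt m (Thin i) = (i \<in> set (thins m))"
| "is_pt m (Whole f) = (f \<in> set (flats m))"
| "is_pt m (Split f x y) = (f \<in> set (flats m))"

fun located :: "(int \<Rightarrow> 'a list) \<Rightarrow> pt \<Rightarrow> 'a \<Rightarrow> bool" where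
  "located \<phi> (Thin i) h = (\<phi> i = [h])"
| "located \<phi> (Whole f) h = (h \<in> set (\<phi> (fst f)))"
| "located \<phi> (Split f x y) h = (\<exists>L1 L2. \<phi> (fst f) = L1 @ h # L2 \<and> x = (L1 \<noteq> []) \<and> y = (L2 \<noteq> []))"

definition span :: "model \<Rightarrow> (int \<Rightarrow> 'a list) \<Rightarrow> 'a set" where
  "span m \<phi> = (\<Union>i\<in>set (ids m). set (\<phi> i))"

section \<open>Embeddings of patterns as induced subgraphs\<close>

lemma anticomplete_sym: "anticomplete E A B \<Longrightarrow> anticomplete E B A"
  unfolding anticomplete_def by (metis Int_commute insert_commute)

lemma anticomplete_mono: "anticomplete E A B \<Longrightarrow> A' \<subseteq> A \<Longrightarrow> B' \<subseteq> B \<Longrightarrow> anticomplete E A' B'"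
  unfolding anticomplete_def by blast

text \<open>How a path \<open>d\<close> touches its own ends \<open>a\<close> and \<open>b\<close>,
  and that these two are not adjacent, is contained in the requirement that
  \<open>\<phi> a @ \<phi> d @ \<phi> b\<close> is an induced path. All other pairs of pieces are
  listed separately.\<close>

definition emb :: "'a set \<Rightarrow> 'a set set \<Rightarrow> model \<Rightarrow> (int \<Rightarrow> 'a list) \<Rightarrow> bool" where
  "emb V E m \<phi> \<longleftrightarrow> (case m of (N, R, F) \<Rightarrow>
     distinct (N @ map fst F) \<and> set R \<subseteq> set N \<times> set N \<and>
     (\<forall>i\<in>set N. \<exists>v\<in>V. \<phi> i = [v]) \<and>
     (\<forall>(d, a, b)\<in>set F. a \<in> set N \<and> b \<in> set N \<and> a \<noteq> b \<and> \<phi> d \<noteq> [] \<and> set (\<phi> d) \<subseteq> V \<and>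
        ipath E (\<phi> a @ \<phi> d @ \<phi> b)) \<and>
     (\<forall>i\<in>set N. \<forall>j\<in>set N. i \<noteq> j \<longrightarrow> hd (\<phi> i) \<noteq> hd (\<phi> j) \<and> ({hd (\<phi> i), hd (\<phi> j)} \<in> E \<longleftrightarrow> linked R i j)) \<and>
     (\<forall>(d, a, b)\<in>set F. \<forall>c\<in>set N. c \<noteq> a \<longrightarrow> c \<noteq> b \<longrightarrow> anticomplete E (set (\<phi> d)) (set (\<phi> c))) \<and>
     (\<forall>f\<in>set F. \<forall>g\<in>set F. fst f \<noteq> fst g \<longrightarrow> anticomplete E (set (\<phi> (fst f))) (set (\<phi> (fst g)))))"

lemma embD:
  assumes "emb V E (N, R, F) \<phi>"
  shows "distinct (N @ map fst F)" "set R \<subseteq> set N \<times> set N"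
    "\<And>i. i \<in> set N \<Longrightarrow> \<exists>v\<in>V. \<phi> i = [v]"
    "\<And>d a b. (d, a, b) \<in> set F \<Longrightarrow> a \<in> set N \<and> b \<in> set N \<and> a \<noteq> b \<and> \<phi> d \<noteq> [] \<and> set (\<phi> d) \<subseteq> V \<and> ipath E (\<phi> a @ \<phi> d @ \<phi> b)"
    "\<And>i j. i \<in> set N \<Longrightarrow> j \<in> set N \<Longrightarrow> i \<noteq> j \<Longrightarrow> hd (\<phi> i) \<noteq> hd (\<phi> j) \<and> ({hd (\<phi> i), hd (\<phi> j)} \<in> E \<longleftrightarrow> linked R i j)"
    "\<And>d a b c. (d, a, b) \<in> set F \<Longrightarrow> c \<in> set N \<Longrightarrow> c \<noteq> a \<Longrightarrow> c \<noteq> b \<Longrightarrow> anticomplete E (set (\<phi> d)) (set (\<phi> c))"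
    "\<And>f g. f \<in> set F \<Longrightarrow> g \<in> set F \<Longrightarrow> fst f \<noteq> fst g \<Longrightarrow> anticomplete E (set (\<phi> (fst f))) (set (\<phi> (fst g)))"
  using assms unfolding emb_def by auto

lemma embI:
  assumes "distinct (N @ map fst F)" "set R \<subseteq> set N \<times> set N"
    "\<And>i. i \<in> set N \<Longrightarrow> \<exists>v\<in>V. \<phi> i = [v]"
    "\<And>d a b. (d, a, b) \<in> set F \<Longrightarrow> a \<in> set N \<and> b \<in> set N \<and> a \<noteq> b \<and> \<phi> d \<noteq> [] \<and> set (\<phi> d) \<subseteq> V \<and> ipath E (\<phi> a @ \<phi> d @ \<phi> b)"
    "\<And>i j. i \<in> set N \<Longrightarrow> j \<in> set N \<Longrightarrow> i \<noteq> j \<Longrightarrow> hd (\<phi> i) \<noteq> hd (\<phi> j) \<and> ({hd (\<phi> i), hd (\<phi> j)} \<in> E \<longleftrightarrow> linked R i j)"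
    "\<And>d a b c. (d, a, b) \<in> set F \<Longrightarrow> c \<in> set N \<Longrightarrow> c \<noteq> a \<Longrightarrow> c \<noteq> b \<Longrightarrow> anticomplete E (set (\<phi> d)) (set (\<phi> c))"
    "\<And>f g. f \<in> set F \<Longrightarrow> g \<in> set F \<Longrightarrow> fst f \<noteq> fst g \<Longrightarrow> anticomplete E (set (\<phi> (fst f))) (set (\<phi> (fst g)))"
  shows "emb V E (N, R, F) \<phi>"
  unfolding emb_def prod.case
proof (intro conjI)
  show "\<forall>(d, a, b)\<in>set F. a \<in> set N \<and> b \<in> set N \<and> a \<noteq> b \<and> \<phi> d \<noteq> [] \<and> set (\<phi> d) \<subseteq> V \<and> ipath E (\<phi> a @ \<phi> d @ \<phi> b)"
    using assms(4) by (intro ballI) (clarify, blast)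
  show "\<forall>(d, a, b)\<in>set F. \<forall>c\<in>set N. c \<noteq> a \<longrightarrow> c \<noteq> b \<longrightarrow> anticomplete E (set (\<phi> d)) (set (\<phi> c))"
    using assms(6) by (intro ballI) (clarify, blast)
qed (use assms in blast)+

lemma emb_flat_unique:
  assumes "emb V E (N, R, F) \<phi>" "f \<in> set F" "g \<in> set F" "fst f = fst g"
  shows "f = g"
proof -
  have "distinct (map fst F)" using embD(1)[OF assms(1)] by simp
  then show ?thesis using assms(2-4) by (metis distinct_map inj_onD)
qed

lemma emb_id:
  assumes "emb V E m \<phi>" "i \<in> set (ids m)"
  shows "\<phi> i \<noteq> []" "set (\<phi> i) \<subseteq> V" "ipath E (\<phi> i)"
proof -
  obtain N R F where m: "m = (N, R, F)" by (cases m)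
  note e = embD[OF assms(1)[unfolded m]]
  consider "i \<in> set N" | a b where "(i, a, b) \<in> set F" using assms(2) unfolding m by auto
  then have "\<phi> i \<noteq> [] \<and> set (\<phi> i) \<subseteq> V \<and> ipath E (\<phi> i)"
  proof cases
    case 1
    then show ?thesis using e(3)[OF 1] by auto
  next
    case 2
    then show ?thesis using e(4)[OF 2] unfolding ipath_append by auto
  qed
  then show "\<phi> i \<noteq> []" "set (\<phi> i) \<subseteq> V" "ipath E (\<phi> i)" by auto
qed

lemma emb_conn: "emb V E m \<phi> \<Longrightarrow> i \<in> set (ids m) \<Longrightarrow> conn E (set (\<phi> i))"
  by (rule ipath_conn[OF emb_id(3) emb_id(1)])

lemma span_subset: "emb V E m \<phi> \<Longrightarrow> span m \<phi> \<subseteq> V"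
  unfolding span_def using emb_id(2)[of V E m \<phi>] by blast

lemma ipath_mid:
  assumes "ipath E ([a] @ xs @ [b])" "xs \<noteq> []"
  shows "a \<noteq> b" "{a, b} \<notin> E" "a \<notin> set xs" "b \<notin> set xs" "\<And>x. x \<in> set xs \<Longrightarrow> {x, a} \<in> E \<longleftrightarrow> x = hd xs"
    "\<And>x. x \<in> set xs \<Longrightarrow> {x, b} \<in> E \<longleftrightarrow> x = last xs"
proof -
  from assms have i: "ipath E (xs @ [b])" "a \<notin> set (xs @ [b])" "\<forall>z\<in>set (xs @ [b]). {a, z} \<in> E \<longleftrightarrow> z = hd (xs @ [b])" by auto
  show "a \<noteq> b" "a \<notin> set xs" using i(2) by auto
  show "b \<notin> set xs" using i(1) unfolding ipath_append by auto
  moreover have "hd (xs @ [b]) = hd xs" "hd xs \<in> set xs" using assms(2) by auto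
  ultimately show "{a, b} \<notin> E" "\<And>x. x \<in> set xs \<Longrightarrow> {x, a} \<in> E \<longleftrightarrow> x = hd xs" using i(3) by (auto simp: insert_commute)
  show "\<And>x. x \<in> set xs \<Longrightarrow> {x, b} \<in> E \<longleftrightarrow> x = last xs" using i(1) unfolding ipath_append by auto
qed

text \<open>The information that a unichord certificate uses: connected disjoint pieces and which of
  them touch. Lengths and inner structure of the paths are forgotten here, so one evaluation covers
  all subdivisions.\<close>

definition sys :: "'a set \<Rightarrow> 'a set set \<Rightarrow> int set \<Rightarrow> (int \<times> int) list \<Rightarrow> (int \<Rightarrow> 'a set) \<Rightarrow> bool" where
  "sys V E I L S \<longleftrightarrow> (\<forall>i\<in>I. conn E (S i) \<and> S i \<subseteq> V) \<and>
     (\<forall>i\<in>I. \<forall>j\<in>I. i \<noteq> j \<longrightarrow> S i \<inter> S j = {} \<and> ((\<exists>x\<in>S i. \<exists>y\<in>S j. {x, y} \<in> E) \<longleftrightarrow> linked L i j))"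

context
  fixes V :: "'a set" and E :: "'a set set" and N R F \<phi>
  assumes emb: "emb V E (N, R, F) \<phi>"
begin

lemma flat_not_thin: "(d, a, b) \<in> set F \<Longrightarrow> d \<notin> set N"
  using embD(1)[OF emb] by force

lemma linked_links_thin: "i \<in> set N \<Longrightarrow> j \<in> set N \<Longrightarrow> linked (links (N, R, F)) i j \<longleftrightarrow> linked R i j"
  using flat_not_thin unfolding linked_def by auto

lemma linked_links_flat:
  assumes "(d, a, b) \<in> set F" "c \<in> set N"
  shows "linked (links (N, R, F)) d c \<longleftrightarrow> c = a \<or> c = b"
proof
  have d: "d \<notin> set N" by (rule flat_not_thin[OF assms(1)])
  assume "linked (links (N, R, F)) d c"
  then consider "(d, c) \<in> set R \<or> (c, d) \<in> set R"
    | d' a' b' where "(d', a', b') \<in> set F" "(d, c) \<in> {(d', a'), (d', b')} \<or> (c, d) \<in> {(d', a'), (d', b')}"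
    unfolding linked_def by auto
  then show "c = a \<or> c = b"
  proof cases
    case 1
    then show ?thesis using d embD(2)[OF emb] by auto
  next
    case 2
    have "d' \<notin> set N" by (rule flat_not_thin[OF 2(1)])
    then have "d' = d" "c = a' \<or> c = b'" using 2(2) assms(2) by auto
    then show ?thesis using emb_flat_unique[OF emb 2(1) assms(1)] by auto
  qed
next
  show "c = a \<or> c = b \<Longrightarrow> linked (links (N, R, F)) d c"
    using assms unfolding linked_def by force
qed

lemma linked_links_flats:
  assumes "f \<in> set F" "g \<in> set F"
  shows "\<not> linked (links (N, R, F)) (fst f) (fst g)"
proof
  have d: "fst f \<notin> set N" "fst g \<notin> set N" using embD(1)[OF emb] assms by auto
  assume "linked (links (N, R, F)) (fst f) (fst g)"
  then consider "(fst f, fst g) \<in> set R \<or> (fst g, fst f) \<in> set R"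
    | d' a' b' where "(d', a', b') \<in> set F" "(fst f, fst g) \<in> {(d', a'), (d', b')} \<or> (fst g, fst f) \<in> {(d', a'), (d', b')}"
    unfolding linked_def by auto
  then show False
  proof cases
    case 1
    then show ?thesis using d embD(2)[OF emb] by auto
  next
    case 2
    then show ?thesis using embD(4)[OF emb 2(1)] d by auto
  qed
qed

lemma emb_flat_thin:
  assumes "(d, a, b) \<in> set F" "c \<in> set N"
  shows "set (\<phi> d) \<inter> set (\<phi> c) = {}" "(\<exists>x\<in>set (\<phi> d). \<exists>y\<in>set (\<phi> c). {x, y} \<in> E) \<longleftrightarrow> c = a \<or> c = b"
proof -
  obtain va vb where v: "\<phi> a = [va]" "\<phi> b = [vb]"
    using embD(3)[OF emb] embD(4)[OF emb assms(1)] by metis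
  have ip: "ipath E ([va] @ \<phi> d @ [vb])" and ne: "\<phi> d \<noteq> []" using embD(4)[OF emb assms(1)] v by auto
  note i = ipath_mid[OF ip ne]
  have "hd (\<phi> d) \<in> set (\<phi> d)" "last (\<phi> d) \<in> set (\<phi> d)" using ne by auto
  then have "set (\<phi> d) \<inter> set (\<phi> c) = {} \<and> ((\<exists>x\<in>set (\<phi> d). \<exists>y\<in>set (\<phi> c). {x, y} \<in> E) \<longleftrightarrow> c = a \<or> c = b)"
    using i v embD(6)[OF emb assms] unfolding anticomplete_def
    by (cases "c = a"; cases "c = b") auto
  then show "set (\<phi> d) \<inter> set (\<phi> c) = {}" "(\<exists>x\<in>set (\<phi> d). \<exists>y\<in>set (\<phi> c). {x, y} \<in> E) \<longleftrightarrow> c = a \<or> c = b" by auto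
qed

lemma emb_sys_pair:
  assumes "i \<in> set (ids (N, R, F))" "j \<in> set (ids (N, R, F))" "i \<noteq> j"
  shows "set (\<phi> i) \<inter> set (\<phi> j) = {} \<and>
    ((\<exists>x\<in>set (\<phi> i). \<exists>y\<in>set (\<phi> j). {x, y} \<in> E) \<longleftrightarrow> linked (links (N, R, F)) i j)"
proof -
  have ij: "i \<in> set N \<or> i \<in> fst ` set F" "j \<in> set N \<or> j \<in> fst ` set F" using assms by auto
  show ?thesis
  proof (cases "i \<in> set N")
    case i: True
    show ?thesis
    proof (cases "j \<in> set N")
      case j: True
      obtain v w where "\<phi> i = [v]" "\<phi> j = [w]" using embD(3)[OF emb] i j by metis
      then show ?thesis using embD(5)[OF emb i j assms(3)] linked_links_thin[OF i j] by auto
    next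
      case False
      then obtain a b where f: "(j, a, b) \<in> set F" using ij(2) by auto
      have "(\<exists>x\<in>set (\<phi> i). \<exists>y\<in>set (\<phi> j). {x, y} \<in> E) \<longleftrightarrow> (\<exists>x\<in>set (\<phi> j). \<exists>y\<in>set (\<phi> i). {x, y} \<in> E)"
        by (metis insert_commute)
      then show ?thesis using emb_flat_thin[OF f i] linked_links_flat[OF f i] linked_sym by blast
    qed
  next
    case False
    then obtain a b where f: "(i, a, b) \<in> set F" using ij(1) by auto
    show ?thesis
    proof (cases "j \<in> set N")
      case j: True
      then show ?thesis using emb_flat_thin[OF f j] linked_links_flat[OF f j] by blast
    next
      case False
      then obtain a' b' where g: "(j, a', b') \<in> set F" using ij(2) by auto
      show ?thesis using embD(7)[OF emb f g] linked_links_flats[OF f g] assms(3) unfolding anticomplete_def by auto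
    qed
  qed
qed

end

lemma emb_sys: "emb V E m \<phi> \<Longrightarrow> sys V E (set (ids m)) (links m) (\<lambda>i. set (\<phi> i))"
  unfolding sys_def using emb_conn[of V E m \<phi>] emb_id(2)[of V E m \<phi>] emb_sys_pair[of V E _ _ _ \<phi>]
  by (cases m) blast

text \<open>A connected set outside the copy, for instance an ear of any length, becomes one further
  piece.\<close>

lemma sys_attach:
  assumes m: "emb V E m \<phi>" and "conn E P" "P \<subseteq> V" "P \<inter> span m \<phi> = {}" "e \<notin> set (ids m)" "set C \<subseteq> set (ids m)"
    and C: "\<And>i. i \<in> set (ids m) \<Longrightarrow> (\<exists>x\<in>P. \<exists>y\<in>set (\<phi> i). {x, y} \<in> E) \<longleftrightarrow> i \<in> set C"
  shows "sys V E (set (e # ids m)) (links m @ map (Pair e) C) ((\<lambda>i. set (\<phi> i))(e := P))"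
proof -
  have s: "sys V E (set (ids m)) (links m) (\<lambda>i. set (\<phi> i))" by (rule emb_sys[OF m])
  have lk: "(i, j) \<in> set (links m) \<Longrightarrow> i \<in> set (ids m) \<and> j \<in> set (ids m)" for i j
  proof -
    obtain N R F where m': "m = (N, R, F)" by (cases m)
    assume "(i, j) \<in> set (links m)"
    then consider "(i, j) \<in> set R" | d a b where "(d, a, b) \<in> set F" "i = d" "j = a \<or> j = b"
      unfolding m' by auto
    then show ?thesis
    proof cases
      case 1
      then show ?thesis using embD(2)[OF m[unfolded m']] unfolding m' by auto
    next
      case 2
      then have "i \<in> fst ` set F" by force
      then show ?thesis using embD(4)[OF m[unfolded m'] 2(1)] 2(3) unfolding m' by auto
    qed
  qed
  have l1: "linked (links m @ map (Pair e) C) i j \<longleftrightarrow> linked (links m) i j" if "i \<noteq> e" "j \<noteq> e" for i j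
    using that unfolding linked_def by auto
  have l2: "linked (links m @ map (Pair e) C) e j \<longleftrightarrow> j \<in> set C" if "j \<noteq> e" for j
    using that assms(5) lk unfolding linked_def by auto
  have dis: "P \<inter> set (\<phi> i) = {}" if "i \<in> set (ids m)" for i
    using assms(4) that unfolding span_def by blast
  have sw: "(\<exists>x\<in>A. \<exists>y\<in>B. {x, y} \<in> E) \<longleftrightarrow> (\<exists>x\<in>B. \<exists>y\<in>A. {x, y} \<in> E)" for A B :: "'a set"
    by (metis insert_commute)
  show ?thesis
    unfolding sys_def
  proof (intro conjI ballI impI)
    fix i assume i: "i \<in> set (e # ids m)"
    show "conn E (((\<lambda>i. set (\<phi> i))(e := P)) i)" "((\<lambda>i. set (\<phi> i))(e := P)) i \<subseteq> V"
      using s i assms(2,3) unfolding sys_def by auto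
    fix j assume j: "j \<in> set (e # ids m)" and ne: "i \<noteq> j"
    show "((\<lambda>i. set (\<phi> i))(e := P)) i \<inter> ((\<lambda>i. set (\<phi> i))(e := P)) j = {}"
    proof -
      consider "i = e" "j \<noteq> e" "j \<in> set (ids m)" | "j = e" "i \<noteq> e" "i \<in> set (ids m)" | "i \<noteq> e" "j \<noteq> e" "i \<in> set (ids m)" "j \<in> set (ids m)"
        using i j ne by auto
      then show ?thesis
      proof cases
        case 3
        then have "set (\<phi> i) \<inter> set (\<phi> j) = {}" using s ne unfolding sys_def by blast
        then show ?thesis using 3 by simp
      qed (use dis in auto)
    qed
    consider "i = e" "j \<noteq> e" "j \<in> set (ids m)" | "j = e" "i \<noteq> e" "i \<in> set (ids m)" | "i \<noteq> e" "j \<noteq> e" "i \<in> set (ids m)" "j \<in> set (ids m)"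
      using i j ne by auto
    then show "(\<exists>x\<in>((\<lambda>i. set (\<phi> i))(e := P)) i. \<exists>y\<in>((\<lambda>i. set (\<phi> i))(e := P)) j. {x, y} \<in> E) \<longleftrightarrow>
      linked (links m @ map (Pair e) C) i j"
    proof cases
      case 1
      then show ?thesis using C l2 by simp
    next
      case 2
      then show ?thesis using C[of i] l2[of i] sw[of P "set (\<phi> i)"] linked_sym[of _ e i] by simp
    next
      case 3
      then show ?thesis using s ne l1 unfolding sys_def by simp
    qed
  qed
qed

section \<open>Executable certificates for unichords\<close>

fun memb :: "int \<Rightarrow> int list \<Rightarrow> bool" where
  "memb x [] = False"
| "memb x (y # ys) = (if x = y then True else memb x ys)"

fun meets :: "int list \<Rightarrow> int list \<Rightarrow> bool" where
  "meets [] B = False"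
| "meets (x # xs) B = (if memb x B then True else meets xs B)"

fun nbs :: "(int \<times> int) list \<Rightarrow> int \<Rightarrow> int list" where
  "nbs [] u = []"
| "nbs ((a, b) # L) u = (if a = u then b # nbs L u else if b = u then a # nbs L u else nbs L u)"

text \<open>The lists in the certificates are ordered so that every piece touches an earlier one;
  connectedness is then verified in one pass without a search.\<close>

fun grow :: "(int \<times> int) list \<Rightarrow> int list \<Rightarrow> int list \<Rightarrow> bool" where
  "grow L S [] = True"
| "grow L S (r # rs) = (if meets (nbs L r) S then grow L (r # S) rs else False)"

fun conn_ok :: "(int \<times> int) list \<Rightarrow> int list \<Rightarrow> bool" where
  "conn_ok L [] = False"
| "conn_ok L (a # r) = grow L [a] r"

fun anti_ok :: "(int \<times> int) list \<Rightarrow> int list \<Rightarrow> int list \<Rightarrow> bool" where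
  "anti_ok L [] B = True"
| "anti_ok L (a # A) B = (if memb a B then False else if meets (nbs L a) B then False else anti_ok L A B)"

fun keep :: "int list \<Rightarrow> int list \<Rightarrow> int list" where
  "keep I [] = []"
| "keep I (a # A) = (if memb a I then a # keep I A else keep I A)"

fun dist_ok :: "int list \<Rightarrow> bool" where
  "dist_ok [] = True"
| "dist_ok (a # A) = (if memb a A then False else dist_ok A)"

lemma memb_iff [simp]: "memb x xs \<longleftrightarrow> x \<in> set xs"
  by (induction xs) auto

lemma meets_iff: "meets A B \<longleftrightarrow> (\<exists>a\<in>set A. a \<in> set B)"
  by (induction A) auto

lemma nbs_iff: "v \<in> set (nbs L u) \<longleftrightarrow> linked L u v"
  by (induction L u rule: nbs.induct) (auto simp: linked_def split: if_splits)

lemma keep_eq: "keep I A = filter (\<lambda>i. i \<in> set I) A"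
  by (induction A) auto

lemma dist_ok_iff: "dist_ok A = distinct A"
  by (induction A) auto

lemma anti_okD: "anti_ok L A B \<Longrightarrow> a \<in> set A \<Longrightarrow> b \<in> set B \<Longrightarrow> a \<noteq> b \<and> \<not> linked L a b"
  by (induction A) (auto simp: meets_iff nbs_iff split: if_splits)

lemma meets_nbs: "meets (nbs L u) A \<longleftrightarrow> (\<exists>a\<in>set A. linked L u a)"
  by (auto simp: meets_iff nbs_iff)

text \<open>A certificate \<open>(u, v, A, B)\<close> claims that \<open>uv\<close> is the only chord of a cycle through the pieces
  \<open>A\<close> and \<open>B\<close>. Pieces that do not occur in the pattern are ignored, so that one certificate serves several refinements.\<close>
type_synonym cert = "int \<times> int \<times> int list \<times> int list"

fun chord_ok :: "(int \<times> int) list \<Rightarrow> int list \<Rightarrow> int \<Rightarrow> int \<Rightarrow> int list \<Rightarrow> int list \<Rightarrow> bool" where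
  "chord_ok L T u v A B \<longleftrightarrow>
     memb u T \<and> memb v T \<and> u \<noteq> v \<and> memb v (nbs L u) \<and> dist_ok (u # v # A) \<and> dist_ok (u # v # B) \<and>
     conn_ok L A \<and> conn_ok L B \<and> anti_ok L A B \<and>
     meets (nbs L u) A \<and> meets (nbs L v) A \<and> meets (nbs L u) B \<and> meets (nbs L v) B"

fun ucheck :: "(int \<times> int) list \<Rightarrow> int list \<Rightarrow> int list \<Rightarrow> cert list \<Rightarrow> bool" where
  "ucheck L I T [] = False"
| "ucheck L I T ((u, v, A, B) # cs) = (if chord_ok L T u v (keep I A) (keep I B) then True else ucheck L I T cs)"

text \<open>In the next check the chord joins an outside vertex with neighbours in the pieces \<^term>\<open>C\<close> to the piece \<^term>\<open>v\<close>;
  further neighbours of the outside vertex do no harm.\<close>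
fun out_chord_ok :: "(int \<times> int) list \<Rightarrow> int list \<Rightarrow> int list \<Rightarrow> int \<Rightarrow> int list \<Rightarrow> int list \<Rightarrow> bool" where
  "out_chord_ok L T C v A B \<longleftrightarrow>
     memb v T \<and> memb v C \<and> dist_ok (v # A) \<and> dist_ok (v # B) \<and> conn_ok L A \<and> conn_ok L B \<and> anti_ok L A B \<and>
     meets (nbs L v) A \<and> meets (nbs L v) B \<and> meets C A \<and> meets C B"

fun rcheck :: "(int \<times> int) list \<Rightarrow> int list \<Rightarrow> int list \<Rightarrow> int list \<Rightarrow> (int \<times> int list \<times> int list) list \<Rightarrow> bool" where
  "rcheck L I T C [] = False"
| "rcheck L I T C ((v, A, B) # cs) = (if out_chord_ok L T C v (keep I A) (keep I B) then True else rcheck L I T C cs)"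

lemma sys_edge:
  "sys V E I L S \<Longrightarrow> i \<in> I \<Longrightarrow> j \<in> I \<Longrightarrow> i \<noteq> j \<Longrightarrow> linked L i j \<Longrightarrow> \<exists>x\<in>S i. \<exists>y\<in>S j. {x, y} \<in> E"
  unfolding sys_def by blast

lemma grow_conn:
  assumes "grow L S rs" "sys V E I L M" "set S \<subseteq> I" "set rs \<subseteq> I" "set S \<inter> set rs = {}" "distinct rs" "conn E (\<Union>i\<in>set S. M i)"
  shows "conn E (\<Union>i\<in>set S \<union> set rs. M i)"
  using assms
proof (induction rs arbitrary: S)
  case (Cons r rs)
  have g: "meets (nbs L r) S" "grow L (r # S) rs" using Cons.prems(1) by (auto split: if_splits)
  then obtain s where s: "s \<in> set S" "linked L r s" by (auto simp: meets_nbs)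
  have "r \<noteq> s" "r \<in> I" "s \<in> I" using Cons.prems(3-5) s by auto
  then obtain x y where "x \<in> M r" "y \<in> M s" "{x, y} \<in> E" using sys_edge[OF Cons.prems(2)] s(2) by blast
  moreover have "conn E (M r)" using Cons.prems(2) \<open>r \<in> I\<close> unfolding sys_def by blast
  ultimately have "conn E (M r \<union> (\<Union>i\<in>set S. M i))" using conn_union[OF _ Cons.prems(7), of "M r" x y] s(1) by blast
  then have c: "conn E (\<Union>i\<in>set (r # S). M i)" by simp
  have "conn E (\<Union>i\<in>set (r # S) \<union> set rs. M i)"
    by (rule Cons.IH[OF g(2) Cons.prems(2) _ _ _ _ c]) (use Cons.prems(3-6) in auto)
  moreover have "set (r # S) \<union> set rs = set S \<union> set (r # rs)" by auto
  ultimately show ?case by metis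
qed simp

lemma conn_ok_conn:
  assumes "conn_ok L A" "sys V E I L M" "set A \<subseteq> I" "distinct A"
  shows "conn E (\<Union>i\<in>set A. M i)"
proof (cases A)
  case (Cons a r)
  have "conn E (M a)" using assms Cons unfolding sys_def by auto
  then have "conn E (\<Union>i\<in>set [a] \<union> set r. M i)"
    using grow_conn[of L "[a]" r V E I M] assms Cons by auto
  then show ?thesis using Cons by simp
qed (use assms in simp)

lemma sys_sees:
  assumes "sys V E I L M" "u \<in> I" "set A \<subseteq> I" "list_ex (linked L u) A" "u \<notin> set A" "M u = {x}"
  shows "sees E x (\<Union>i\<in>set A. M i)"
proof -
  obtain a where "a \<in> set A" "linked L u a" using assms(4) by (auto simp: list_ex_iff)
  moreover from this have "\<exists>x\<in>M u. \<exists>y\<in>M a. {x, y} \<in> E" using sys_edge[OF assms(1,2)] assms(3,5) by blast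
  then have "\<exists>y\<in>M a. {x, y} \<in> E" using assms(6) by simp
  ultimately show ?thesis unfolding sees_def by blast
qed

lemma sys_not_in:
  assumes "sys V E I L M" "u \<in> I" "set A \<subseteq> I" "u \<notin> set A" "M u = {x}"
  shows "(\<Union>i\<in>set A. M i) \<subseteq> V - {x}"
proof
  fix z assume "z \<in> (\<Union>i\<in>set A. M i)"
  then obtain i where i: "i \<in> set A" "z \<in> M i" by blast
  then have "i \<in> I" "i \<noteq> u" using assms(3,4) by auto
  then have "M i \<inter> M u = {}" "M i \<subseteq> V" using assms(1,2) unfolding sys_def by blast+
  then show "z \<in> V - {x}" using i assms(5) by auto
qed

lemma anti_ok_anticomplete:
  assumes "anti_ok L A B" "sys V E I L M" "set A \<subseteq> I" "set B \<subseteq> I"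
  shows "anticomplete E (\<Union>i\<in>set A. M i) (\<Union>i\<in>set B. M i)"
proof -
  have "M a \<inter> M b = {}" "\<forall>x\<in>M a. \<forall>y\<in>M b. {x, y} \<notin> E" if "a \<in> set A" "b \<in> set B" for a b
  proof -
    have "a \<noteq> b" "\<not> linked L a b" using anti_okD[OF assms(1) that] by auto
    then show "M a \<inter> M b = {}" "\<forall>x\<in>M a. \<forall>y\<in>M b. {x, y} \<notin> E"
      using assms(2-4) that unfolding sys_def by blast+
  qed
  then show ?thesis unfolding anticomplete_def by blast
qed

lemma set_filter_member: "set (filter (\<lambda>i. i \<in> set I) A) \<subseteq> set I"
  by auto

context girth5
begin

text \<open>The unions of the pieces in \<open>A\<close> and in \<open>B\<close> are the two sides
  for \<open>unichord_edge\<close>. The pieces in \<open>T\<close> are single vertices, so the link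
  between \<open>u\<close> and \<open>v\<close> is one actual edge.\<close>

lemma chord_ok_False:
  assumes s: "sys V E (set I) L M" and c: "chord_ok L T u v (keep I A0) (keep I B0)"
    and T: "\<And>t. t \<in> set T \<Longrightarrow> t \<in> set I \<and> (\<exists>x. M t = {x})"
  shows False
proof -
  note c0 = c
  define A where "A = filter (\<lambda>i. i \<in> set I) A0"
  define B where "B = filter (\<lambda>i. i \<in> set I) B0"
  have c: "u \<in> set T" "v \<in> set T" "distinct A" "distinct B" "linked L u v" "conn_ok L A" "conn_ok L B" "anti_ok L A B"
      "u \<notin> set A" "v \<notin> set A" "u \<notin> set B" "v \<notin> set B"
      "list_ex (linked L u) A" "list_ex (linked L v) A" "list_ex (linked L u) B" "list_ex (linked L v) B"
    using c unfolding chord_ok.simps keep_eq A_def[symmetric] B_def[symmetric] memb_iff nbs_iff meets_nbs dist_ok_iff list_ex_iff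
    by auto
  have AB: "set A \<subseteq> set I" "set B \<subseteq> set I" unfolding A_def B_def by (rule set_filter_member)+
  obtain x where u: "u \<in> set I" "M u = {x}" using T[OF c(1)] by auto
  obtain y where v: "v \<in> set I" "M v = {y}" using T[OF c(2)] by auto
  have uv: "u \<noteq> v" using c0 unfolding chord_ok.simps by blast
  have e: "{x, y} \<in> E" using sys_edge[OF s u(1) v(1) _ c(5)] u v uv by simp
  have sub: "S \<subseteq> V - {x} \<Longrightarrow> S \<subseteq> V - {y} \<Longrightarrow> S \<subseteq> V - {x, y}" for S by blast
  show False
    by (rule unichord_edge[OF e conn_ok_conn[OF c(6) s AB(1) c(3)] conn_ok_conn[OF c(7) s AB(2) c(4)] anti_ok_anticomplete[OF c(8) s AB]
            sub[OF sys_not_in[OF s u(1) AB(1) c(9) u(2)] sys_not_in[OF s v(1) AB(1) c(10) v(2)]]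
            sub[OF sys_not_in[OF s u(1) AB(2) c(11) u(2)] sys_not_in[OF s v(1) AB(2) c(12) v(2)]]
            sys_sees[OF s u(1) AB(1) c(13) c(9) u(2)] sys_sees[OF s v(1) AB(1) c(14) c(10) v(2)]
            sys_sees[OF s u(1) AB(2) c(15) c(11) u(2)] sys_sees[OF s v(1) AB(2) c(16) c(12) v(2)]])
qed

text \<open>The outside vertex \<open>x\<close> is an end of the chord and lies in neither side, so
  its adjacency to other pieces cannot connect the sides.\<close>

lemma out_chord_ok_False:
  assumes s: "sys V E (set I) L M" and c: "out_chord_ok L T C v (keep I A0) (keep I B0)"
    and T: "\<And>t. t \<in> set T \<Longrightarrow> t \<in> set I \<and> (\<exists>x. M t = {x})"
    and x: "x \<notin> (\<Union>i\<in>set I. M i)" "\<And>i. i \<in> set C \<Longrightarrow> i \<in> set I \<Longrightarrow> sees E x (M i)"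
  shows False
proof -
  define A where "A = filter (\<lambda>i. i \<in> set I) A0"
  define B where "B = filter (\<lambda>i. i \<in> set I) B0"
  have c: "v \<in> set T" "v \<in> set C" "distinct A" "distinct B" "conn_ok L A" "conn_ok L B" "anti_ok L A B"
      "v \<notin> set A" "v \<notin> set B"
      "list_ex (linked L v) A" "list_ex (linked L v) B" "\<exists>a\<in>set A. a \<in> set C" "\<exists>a\<in>set B. a \<in> set C"
    using c unfolding out_chord_ok.simps keep_eq A_def[symmetric] B_def[symmetric] memb_iff nbs_iff meets_nbs dist_ok_iff
      list_ex_iff unfolding meets_iff by auto
  have AB: "set A \<subseteq> set I" "set B \<subseteq> set I" unfolding A_def B_def by (rule set_filter_member)+
  obtain y where v: "v \<in> set I" "M v = {y}" using T[OF c(1)] by auto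
  have e: "{x, y} \<in> E" using x(2)[OF c(2) v(1)] v(2) unfolding sees_def by auto
  have xA: "sees E x (\<Union>i\<in>set A. M i)" "sees E x (\<Union>i\<in>set B. M i)"
  proof -
    have *: "sees E x (\<Union>i\<in>set A. M i)" if "a \<in> set A" "a \<in> set C" "set A \<subseteq> set I" for a A
    proof -
      have "sees E x (M a)" using x(2) that by blast
      then show ?thesis using that(1) unfolding sees_def by blast
    qed
    show "sees E x (\<Union>i\<in>set A. M i)" "sees E x (\<Union>i\<in>set B. M i)" using c(12,13) *[OF _ _ AB(1)] *[OF _ _ AB(2)] by blast+
  qed
  have MV: "M i \<subseteq> V" if "i \<in> set I" for i using s that unfolding sys_def by simp
  have xn: "(\<Union>i\<in>set A. M i) \<subseteq> V - {x}" "(\<Union>i\<in>set B. M i) \<subseteq> V - {x}"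
  proof -
    have "(\<Union>i\<in>set I. M i) \<subseteq> V" using MV by blast
    then show "(\<Union>i\<in>set A. M i) \<subseteq> V - {x}" "(\<Union>i\<in>set B. M i) \<subseteq> V - {x}"
      using x(1) AB by blast+
  qed
  have sub: "S \<subseteq> V - {x} \<Longrightarrow> S \<subseteq> V - {y} \<Longrightarrow> S \<subseteq> V - {x, y}" for S by blast
  show False
    by (rule unichord_edge[OF e conn_ok_conn[OF c(5) s AB(1) c(3)] conn_ok_conn[OF c(6) s AB(2) c(4)] anti_ok_anticomplete[OF c(7) s AB]
          sub[OF xn(1) sys_not_in[OF s v(1) AB(1) c(8) v(2)]] sub[OF xn(2) sys_not_in[OF s v(1) AB(2) c(9) v(2)]]
          xA(1) sys_sees[OF s v(1) AB(1) c(10) c(8) v(2)] xA(2) sys_sees[OF s v(1) AB(2) c(11) c(9) v(2)]])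
qed

lemma ucheck_False:
  assumes "sys V E (set I) L M" "ucheck L I T cs" "\<And>t. t \<in> set T \<Longrightarrow> t \<in> set I \<and> (\<exists>x. M t = {x})"
  shows False
proof -
  have "\<exists>u v A B. chord_ok L T u v (keep I A) (keep I B)"
    using assms(2)
  proof (induction L I T cs rule: ucheck.induct)
    case (2 L I T u v A B cs)
    then show ?case by (cases "chord_ok L T u v (keep I A) (keep I B)") (simp_all del: chord_ok.simps, blast)
  qed simp
  then obtain u v A B where "chord_ok L T u v (keep I A) (keep I B)" by blast
  from chord_ok_False[OF assms(1) this assms(3)] show False .
qed

lemma rcheck_False:
  assumes "sys V E (set I) L M" "rcheck L I T C cs" "\<And>t. t \<in> set T \<Longrightarrow> t \<in> set I \<and> (\<exists>x. M t = {x})"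
    and "x \<notin> (\<Union>i\<in>set I. M i)" "\<And>i. i \<in> set C \<Longrightarrow> i \<in> set I \<Longrightarrow> sees E x (M i)"
  shows False
proof -
  have "\<exists>v A B. out_chord_ok L T C v (keep I A) (keep I B)"
    using assms(2)
  proof (induction L I T C cs rule: rcheck.induct)
    case (2 L I T C v A B cs)
    then show ?case by (cases "out_chord_ok L T C v (keep I A) (keep I B)") (simp_all del: out_chord_ok.simps, blast)
  qed simp
  then obtain v A B where "out_chord_ok L T C v (keep I A) (keep I B)" by blast
  from out_chord_ok_False[OF assms(1) this assms(3-5)] show False .
qed

end

section \<open>Refining an embedding at a vertex inside a path\<close>

lemma emb_split:
  assumes e: "emb V E (N, R, F) \<phi>" and f: "(d, a, b) \<in> set F" and p: "\<phi> d = L1 @ s # L2"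
    and fresh: "d + 20 \<notin> set (ids (N, R, F))" "d + 40 \<notin> set (ids (N, R, F))"
  defines "\<phi>' \<equiv> \<phi>(d := [s], d + 20 := L1, d + 40 := L2)"
    and "m' \<equiv> refine (Split (d, a, b) (L1 \<noteq> []) (L2 \<noteq> [])) (N, R, F)"
  shows "emb V E m' \<phi>'" "span m' \<phi>' = span (N, R, F) \<phi>"
proof -
  define N' where "N' = d # N"
  define R' where "R' = (if L1 \<noteq> [] then [] else [(a, d)]) @ (if L2 \<noteq> [] then [] else [(d, b)]) @ R"
  define F' where "F' = (if L1 \<noteq> [] then [(d + 20, a, d)] else []) @ (if L2 \<noteq> [] then [(d + 40, d, b)] else [])
    @ filter (\<lambda>f. fst f \<noteq> d) F"
  have m': "m' = (N', R', F')" unfolding m'_def N'_def R'_def F'_def by simp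
  note D = embD[OF e]
  have dN: "d \<notin> set N" by (rule flat_not_thin[OF e f])
  have ab: "a \<in> set N" "b \<in> set N" "a \<noteq> b" using D(4)[OF f] by auto
  obtain va where va: "\<phi> a = [va]" using D(3)[OF ab(1)] by auto
  obtain vb where vb: "\<phi> b = [vb]" using D(3)[OF ab(2)] by auto
  have ip: "ipath E ([va] @ (L1 @ s # L2) @ [vb])" using D(4)[OF f] va vb p by auto
  have dV: "set (L1 @ s # L2) \<subseteq> V" using D(4)[OF f] p by simp
  have ip2: "ipath E (([va] @ L1) @ s # (L2 @ [vb]))"
    using ip by (simp only: append_assoc append_Cons append_Nil)
  have i1: "ipath E ([va] @ L1 @ [s])"
    using ipath_prefix[OF ip2] by (simp only: append_assoc append_Cons append_Nil)
  have i2: "ipath E ([s] @ L2 @ [vb])"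
    using ipath_suffix[OF ip2] by (simp only: append_assoc append_Cons append_Nil)
  have nn: "L1 @ s # L2 \<noteq> []" by simp
  note mid = ipath_mid[OF ip nn]
  have ipd: "ipath E (L1 @ s # L2)" using ip unfolding ipath_append by blast
  have dist: "distinct (L1 @ s # L2)" by (rule ipath_distinct[OF ipd])
  have cross: "{x, y} \<notin> E" if "x \<in> set L1" "y \<in> set L2" for x y
    using ipd that dist unfolding ipath_append[of E L1] by auto
  \<comment> \<open>An empty part before or after the split vertex \<open>s\<close> means that
    \<open>s\<close> is adjacent to that end of the path; this is where \<open>refine\<close>
    inserts a link instead of a new path.\<close>
  have sva: "{s, va} \<in> E \<longleftrightarrow> L1 = []"
    using mid(5)[of s] dist by (cases L1) auto
  have svb: "{s, vb} \<in> E \<longleftrightarrow> L2 = []"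
    using mid(6)[of s] dist by (auto simp: last_append)
  have L1b: "{x, vb} \<notin> E" if "x \<in> set L1" for x
  proof -
    have "x \<noteq> last (L1 @ s # L2)" using that dist by (auto split: if_splits)
    then show ?thesis using mid(6)[of x] that by auto
  qed
  have L2a: "{x, va} \<notin> E" if "x \<in> set L2" for x
  proof -
    have "x \<noteq> hd (L1 @ s # L2)" using that dist by (cases L1) auto
    then show ?thesis using mid(5)[of x] that by auto
  qed
  have fr: "i \<noteq> d + 20" "i \<noteq> d + 40" if "i \<in> set N \<or> i \<in> fst ` set F" for i
    using fresh that by auto
  have eqN: "\<phi>' i = \<phi> i" if "i \<in> set N" for i
    using fr[of i] that dN unfolding \<phi>'_def by auto
  have eqF: "\<phi>' (fst g) = \<phi> (fst g)" if "g \<in> set F" "fst g \<noteq> d" for g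
    using fr[of "fst g"] that unfolding \<phi>'_def by auto
  have new: "\<phi>' d = [s]" "\<phi>' (d + 20) = L1" "\<phi>' (d + 40) = L2" unfolding \<phi>'_def by auto
  have vav: "\<phi>' a = [va]" "\<phi>' b = [vb]" using eqN ab va vb by auto
  \<comment> \<open>Both parts and \<open>s\<close> lie in the old path, so separation from all
    other pieces is inherited by \<open>anticomplete_mono\<close>.\<close>
  have old_anti: "anticomplete E (set (L1 @ s # L2)) (set (\<phi> (fst g)))" if "g \<in> set F" "fst g \<noteq> d" for g
    using D(7)[OF f that(1)] that(2) p by auto
  have old_thin: "anticomplete E (set (L1 @ s # L2)) (set (\<phi> c))" if "c \<in> set N" "c \<noteq> a" "c \<noteq> b" for c
    using D(6)[OF f that] p by simp
  show emb': "emb V E m' \<phi>'"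
    unfolding m'
  proof (rule embI)
    have "distinct (map fst F)" using D(1) by simp
    then have "distinct (map fst (filter (\<lambda>f. fst f \<noteq> d) F))" by (rule distinct_map_filter)
    moreover have "d + 20 \<notin> fst ` set F" "d + 40 \<notin> fst ` set F" "d + 20 \<notin> set N" "d + 40 \<notin> set N"
      using fresh by auto
    moreover have "d + 20 \<noteq> d + 40" "d + 20 \<noteq> d" "d + 40 \<noteq> d" by auto
    ultimately show "distinct (N' @ map fst F')"
      using D(1) dN unfolding N'_def F'_def by auto
    show "set R' \<subseteq> set N' \<times> set N'" using D(2) ab unfolding R'_def N'_def by auto
    show "\<exists>v\<in>V. \<phi>' i = [v]" if "i \<in> set N'" for i
    proof (cases "i = d")
      case True
      then show ?thesis using new dV by auto
    next
      case False
      then have "i \<in> set N" using that unfolding N'_def by simp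
      then show ?thesis using eqN D(3) by auto
    qed
    show "a' \<in> set N' \<and> b' \<in> set N' \<and> a' \<noteq> b' \<and> \<phi>' d' \<noteq> [] \<and> set (\<phi>' d') \<subseteq> V \<and> ipath E (\<phi>' a' @ \<phi>' d' @ \<phi>' b')"
      if g: "(d', a', b') \<in> set F'" for d' a' b'
    proof -
      consider "(d', a', b') = (d + 20, a, d)" "L1 \<noteq> []" | "(d', a', b') = (d + 40, d, b)" "L2 \<noteq> []"
        | "(d', a', b') \<in> set F" "d' \<noteq> d"
        using g unfolding F'_def by (auto split: if_splits)
      then show ?thesis
      proof cases
        case 1
        then show ?thesis using ab dN new vav i1 dV unfolding N'_def by auto
      next
        case 2
        then show ?thesis using ab dN new vav i2 dV unfolding N'_def by auto
      next
        case 3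
        then show ?thesis using D(4)[OF 3(1)] eqN eqF[OF 3(1)] unfolding N'_def by auto
      qed
    qed
    show "hd (\<phi>' i) \<noteq> hd (\<phi>' j) \<and> ({hd (\<phi>' i), hd (\<phi>' j)} \<in> E \<longleftrightarrow> linked R' i j)"
      if ij: "i \<in> set N'" "j \<in> set N'" "i \<noteq> j" for i j
    proof -
      have one: "s \<noteq> hd (\<phi>' j) \<and> ({s, hd (\<phi>' j)} \<in> E \<longleftrightarrow> linked R' d j)" if j: "j \<in> set N" for j
      proof -
        have jd: "j \<noteq> d" using j dN by auto
        have l: "linked R' d j \<longleftrightarrow> (L1 = [] \<and> j = a) \<or> (L2 = [] \<and> j = b)"
          using D(2) dN jd ab unfolding linked_def R'_def by auto
        obtain w where w: "\<phi> j = [w]" using D(3)[OF j] by auto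
        have jw: "\<phi>' j = [w]" using eqN[OF j] w by simp
        consider "j = a" | "j = b" | "j \<noteq> a" "j \<noteq> b" by blast
        then show ?thesis
        proof cases
          case 1
          have "s \<noteq> va" using mid(3) by auto
          then show ?thesis using 1 sva l vav ab by auto
        next
          case 2
          have "s \<noteq> vb" using mid(4) by auto
          then show ?thesis using 2 svb l vav ab by auto
        next
          case 3
          then show ?thesis using old_thin[OF j 3] w jw l unfolding anticomplete_def by auto
        qed
      qed
      consider "i = d" "j \<in> set N" | "j = d" "i \<in> set N" | "i \<in> set N" "j \<in> set N"
        using ij unfolding N'_def by auto
      then show ?thesis
      proof cases
        case 1
        then show ?thesis using one[of j] new by simp
      next
        case 2
        then show ?thesis using one[of i] new linked_sym[of R' i d] by (auto simp: insert_commute)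
      next
        case 3
        have "linked R' i j \<longleftrightarrow> linked R i j" using 3 dN unfolding linked_def R'_def by auto
        then show ?thesis using D(5)[OF 3 ij(3)] eqN 3 by simp
      qed
    qed
    show "anticomplete E (set (\<phi>' d')) (set (\<phi>' c))"
      if g: "(d', a', b') \<in> set F'" and c: "c \<in> set N'" "c \<noteq> a'" "c \<noteq> b'" for d' a' b' c
    proof -
      consider "(d', a', b') = (d + 20, a, d)" | "(d', a', b') = (d + 40, d, b)" | "(d', a', b') \<in> set F" "d' \<noteq> d"
        using g unfolding F'_def by (auto split: if_splits)
      then show ?thesis
      proof cases
        case 1
        then have cN: "c \<in> set N" "c \<noteq> a" using c unfolding N'_def by auto
        show ?thesis
        proof (cases "c = b")
          case True
          then show ?thesis using 1 new vav L1b mid(4) unfolding anticomplete_def by auto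
        next
          case False
          then show ?thesis using 1 new eqN[OF cN(1)] anticomplete_mono[OF old_thin[OF cN False]] by auto
        qed
      next
        case 2
        then have cN: "c \<in> set N" "c \<noteq> b" using c unfolding N'_def by auto
        show ?thesis
        proof (cases "c = a")
          case True
          then show ?thesis using 2 new vav L2a mid(3) unfolding anticomplete_def by auto
        next
          case False
          then show ?thesis using 2 new eqN[OF cN(1)] anticomplete_mono[OF old_thin[OF cN(1) False cN(2)]] by auto
        qed
      next
        case 3
        show ?thesis
        proof (cases "c = d")
          case True
          then show ?thesis
            using anticomplete_sym[OF anticomplete_mono[OF old_anti[OF 3(1)], of "{s}"]] 3 eqF[OF 3(1)] new by auto
        next
          case False
          then have cN: "c \<in> set N" using c unfolding N'_def by auto
          then show ?thesis using D(6)[OF 3(1) cN] c eqF[OF 3(1)] eqN[OF cN] 3 by auto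
        qed
      qed
    qed
    have LL: "anticomplete E (set L1) (set L2)" using cross dist unfolding anticomplete_def by auto
    have Lold: "anticomplete E (set L) (set (\<phi>' (fst g)))" if "L = L1 \<or> L = L2" "g \<in> set F" "fst g \<noteq> d" for L g
      using anticomplete_mono[OF old_anti[OF that(2,3)], of "set L"] eqF[OF that(2,3)] that(1) by auto
    show "anticomplete E (set (\<phi>' (fst g))) (set (\<phi>' (fst h)))"
      if "g \<in> set F'" "h \<in> set F'" "fst g \<noteq> fst h" for g h
    proof -
      have c: "(fst g = d + 20 \<and> \<phi>' (fst g) = L1) \<or> (fst g = d + 40 \<and> \<phi>' (fst g) = L2) \<or> (g \<in> set F \<and> fst g \<noteq> d)"
        if "g \<in> set F'" for g
        using that new unfolding F'_def by (auto split: if_splits)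
      show ?thesis
      proof (cases "g \<in> set F \<and> fst g \<noteq> d")
        case g: True
        show ?thesis
        proof (cases "h \<in> set F \<and> fst h \<noteq> d")
          case True
          then show ?thesis using D(7)[of g h] g that(3) eqF[of g] eqF[of h] by simp
        next
          case False
          then have "\<phi>' (fst h) = L1 \<or> \<phi>' (fst h) = L2" using c[OF that(2)] by blast
          then show ?thesis using anticomplete_sym[OF Lold[of "\<phi>' (fst h)" g]] g by blast
        qed
      next
        case g: False
        then have gL: "fst g = d + 20 \<and> \<phi>' (fst g) = L1 \<or> fst g = d + 40 \<and> \<phi>' (fst g) = L2" using c[OF that(1)] by blast
        show ?thesis
        proof (cases "h \<in> set F \<and> fst h \<noteq> d")
          case True
          then show ?thesis using Lold[of "\<phi>' (fst g)" h] gL by blast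
        next
          case False
          then have hL: "fst h = d + 20 \<and> \<phi>' (fst h) = L1 \<or> fst h = d + 40 \<and> \<phi>' (fst h) = L2" using c[OF that(2)] by blast
          from gL hL that(3) have "(\<phi>' (fst g) = L1 \<and> \<phi>' (fst h) = L2) \<or> (\<phi>' (fst g) = L2 \<and> \<phi>' (fst h) = L1)"
            by auto
          then show ?thesis using LL anticomplete_sym[OF LL] by auto
        qed
      qed
    qed
  qed
  have "span m' \<phi>' = (\<Union>i\<in>set N. set (\<phi>' i)) \<union> set (L1 @ s # L2) \<union> (\<Union>g\<in>set (filter (\<lambda>f. fst f \<noteq> d) F). set (\<phi>' (fst g)))"
    unfolding span_def m' ids.simps N'_def F'_def using new by auto
  also have "\<dots> = (\<Union>i\<in>set N. set (\<phi> i)) \<union> set (\<phi> d) \<union> (\<Union>g\<in>set (filter (\<lambda>f. fst f \<noteq> d) F). set (\<phi> (fst g)))"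
    using eqN eqF p by simp
  also have "\<dots> = span (N, R, F) \<phi>"
    unfolding span_def ids.simps using f by (force simp: image_iff)
  finally show "span m' \<phi>' = span (N, R, F) \<phi>" .
qed

lemma emb_refine:
  assumes "emb V E m \<phi>" "is_pt m p" "located \<phi> p h" "pid p < 20"
    and "pid p + 20 \<notin> set (ids m)" "pid p + 40 \<notin> set (ids m)"
  obtains \<phi>' where "emb V E (refine p m) \<phi>'" "span (refine p m) \<phi>' = span m \<phi>" "h \<in> set (\<phi>' (pid p))"
    "\<not> is_whole p \<Longrightarrow> pid p \<in> set (thins (refine p m)) \<and> \<phi>' (pid p) = [h]"
    "\<forall>i. i \<noteq> pid p \<and> i \<noteq> pid p + 20 \<and> i \<noteq> pid p + 40 \<longrightarrow> \<phi>' i = \<phi> i"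
proof (cases p)
  case (Split f x y)
  obtain N R F where m: "m = (N, R, F)" by (cases m)
  obtain d a b where f: "f = (d, a, b)" by (cases f)
  obtain L1 L2 where L: "\<phi> d = L1 @ h # L2" "x = (L1 \<noteq> [])" "y = (L2 \<noteq> [])" using assms(3) Split f by auto
  have e: "emb V E (N, R, F) \<phi>" "(d, a, b) \<in> set F" using assms(1,2) m Split f by auto
  have fr: "d + 20 \<notin> set (ids (N, R, F))" "d + 40 \<notin> set (ids (N, R, F))" using assms(5,6) m Split f by auto
  note es = emb_split[OF e L(1) fr]
  let ?g = "\<phi>(d := [h], d + 20 := L1, d + 40 := L2)"
  show thesis
    by (rule that[of ?g]) (use es L Split f m in auto)
qed (use assms that in auto)

lemma is_pt_refine:
  assumes "is_pt m q" "pid q \<noteq> pid p"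
  shows "is_pt (refine p m) q"
proof (cases p)
  case (Split f x y)
  obtain N R F where m: "m = (N, R, F)" by (cases m)
  obtain d a b where f: "f = (d, a, b)" by (cases f)
  show ?thesis using assms unfolding m Split f by (cases q) auto
qed (use assms in auto)

lemma ids_refine: "set (ids (refine p m)) \<subseteq> set (ids m) \<union> {pid p, pid p + 20, pid p + 40}"
proof (cases p)
  case (Split f x y)
  obtain N R F where m: "m = (N, R, F)" by (cases m)
  obtain d a b where f: "f = (d, a, b)" by (cases f)
  show ?thesis unfolding m Split f by auto
qed auto

lemma located_cong: "\<phi>' (pid q) = \<phi> (pid q) \<Longrightarrow> located \<phi>' q h = located \<phi> q h"
  by (cases q) auto

lemma thins_refine: "set (thins m) \<subseteq> set (thins (refine p m))"
proof (cases p)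
  case (Split f x y)
  obtain N R F where m: "m = (N, R, F)" by (cases m)
  obtain d a b where f: "f = (d, a, b)" by (cases f)
  show ?thesis unfolding m Split f by auto
qed auto

text \<open>Points in different pieces can be refined one after the other: the numbers created lie
  at 20 or above, so refining one piece leaves the number and the vertices of every other point
  unchanged. The bounds on \<open>pid p\<close> guarantee this.\<close>

lemma emb_refine_list:
  assumes "emb V E m \<phi>" "\<And>p. p \<in> set ps \<Longrightarrow> is_pt m p \<and> located \<phi> p (h p) \<and> 0 \<le> pid p \<and> pid p < 20 \<and>
      pid p + 20 \<notin> set (ids m) \<and> pid p + 40 \<notin> set (ids m)" "distinct (map pid ps)"
  obtains \<phi>' where "emb V E (fold refine ps m) \<phi>'" "span (fold refine ps m) \<phi>' = span m \<phi>"
    "\<forall>p\<in>set ps. h p \<in> set (\<phi>' (pid p))"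
    "\<forall>p\<in>set ps. \<not> is_whole p \<longrightarrow> pid p \<in> set (thins (fold refine ps m)) \<and> \<phi>' (pid p) = [h p]"
    "\<forall>i<20. i \<notin> pid ` set ps \<longrightarrow> \<phi>' i = \<phi> i" "set (thins m) \<subseteq> set (thins (fold refine ps m))"
  using assms
proof (induction ps arbitrary: m \<phi> thesis)
  case (Cons p ps)
  have p: "is_pt m p" "located \<phi> p (h p)" "0 \<le> pid p" "pid p < 20" "pid p + 20 \<notin> set (ids m)" "pid p + 40 \<notin> set (ids m)"
    using Cons.prems(3) by auto
  obtain \<phi>1 where 1: "emb V E (refine p m) \<phi>1" "span (refine p m) \<phi>1 = span m \<phi>" "h p \<in> set (\<phi>1 (pid p))"
    "\<not> is_whole p \<Longrightarrow> pid p \<in> set (thins (refine p m)) \<and> \<phi>1 (pid p) = [h p]"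
    "\<forall>i. i \<noteq> pid p \<and> i \<noteq> pid p + 20 \<and> i \<noteq> pid p + 40 \<longrightarrow> \<phi>1 i = \<phi> i"
    using emb_refine[OF Cons.prems(2) p(1,2,4-6)] by metis
  have *: "is_pt (refine p m) q \<and> located \<phi>1 q (h q) \<and> 0 \<le> pid q \<and> pid q < 20 \<and>
      pid q + 20 \<notin> set (ids (refine p m)) \<and> pid q + 40 \<notin> set (ids (refine p m))" if "q \<in> set ps" for q
  proof -
    have "pid q \<noteq> pid p"
      using Cons.prems(4) imageI[OF that, of pid] by (metis distinct.simps(2) list.simps(9) set_map)
    then have q: "is_pt m q" "located \<phi> q (h q)" "0 \<le> pid q" "pid q < 20" "pid q + 20 \<notin> set (ids m)" "pid q + 40 \<notin> set (ids m)" "pid q \<noteq> pid p"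
      using Cons.prems(3)[of q] that by auto
    have "\<phi>1 (pid q) = \<phi> (pid q)" using 1(5) q(4,7) p(3) by auto
    then show ?thesis using q ids_refine[of p m] is_pt_refine[OF q(1,7)] located_cong[of \<phi>1 q \<phi>] p(3,4) by auto
  qed
  have "distinct (map pid ps)" using Cons.prems(4) by simp
  from Cons.IH[OF _ 1(1) * this] obtain \<phi>' where 2: "emb V E (fold refine ps (refine p m)) \<phi>'"
    "span (fold refine ps (refine p m)) \<phi>' = span (refine p m) \<phi>1"
    "\<forall>p\<in>set ps. h p \<in> set (\<phi>' (pid p))"
    "\<forall>q\<in>set ps. \<not> is_whole q \<longrightarrow> pid q \<in> set (thins (fold refine ps (refine p m))) \<and> \<phi>' (pid q) = [h q]"
    "\<forall>i<20. i \<notin> pid ` set ps \<longrightarrow> \<phi>' i = \<phi>1 i" "set (thins (refine p m)) \<subseteq> set (thins (fold refine ps (refine p m)))"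
    by metis
  have pp: "\<phi>' (pid p) = \<phi>1 (pid p)" using 2(5) p(4) Cons.prems(4) by auto
  show ?case
  proof (rule Cons.prems(1)[of \<phi>'])
    show "emb V E (fold refine (p # ps) m) \<phi>'" "span (fold refine (p # ps) m) \<phi>' = span m \<phi>" using 1 2 by auto
    show "\<forall>q\<in>set (p # ps). h q \<in> set (\<phi>' (pid q))" using 1(3) 2(3) pp by auto
    show "\<forall>q\<in>set (p # ps). \<not> is_whole q \<longrightarrow> pid q \<in> set (thins (fold refine (p # ps) m)) \<and> \<phi>' (pid q) = [h q]"
      using 1(4) 2(4,6) pp by auto
    show "\<forall>i<20. i \<notin> pid ` set (p # ps) \<longrightarrow> \<phi>' i = \<phi> i" using 1(5) 2(5) p(3) by auto
    show "set (thins m) \<subseteq> set (thins (fold refine (p # ps) m))" using 2(6) thins_refine[of m p] by auto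
  qed
qed simp

section \<open>Adding an ear or a vertex, and renaming the pieces\<close>

lemma in_span: "i \<in> set (ids m) \<Longrightarrow> x \<in> set (\<phi> i) \<Longrightarrow> x \<in> span m \<phi>"
  unfolding span_def by blast

text \<open>The ends have to be single vertices of the pattern. An attachment in the interior of a
  path is first made one by \<open>refine\<close>.\<close>

lemma emb_ear:
  assumes e: "emb V E (N, R, F) \<phi>" and fresh: "e \<notin> set (ids (N, R, F))" and P: "P \<noteq> []" "set P \<subseteq> V" "set P \<inter> span (N, R, F) \<phi> = {}"
    and st: "s \<in> set N" "t \<in> set N" "\<phi> s = [vs]" "\<phi> t = [vt]" and ip: "ipath E ([vs] @ P @ [vt])"
    and no: "\<And>x h. x \<in> set P \<Longrightarrow> h \<in> span (N, R, F) \<phi> \<Longrightarrow> h \<noteq> vs \<Longrightarrow> h \<noteq> vt \<Longrightarrow> {x, h} \<notin> E"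
  shows "emb V E (N, R, (e, s, t) # F) (\<phi>(e := P))"
proof -
  note D = embD[OF e]
  let ?p = "\<phi>(e := P)"
  have eN: "\<And>i. i \<in> set N \<Longrightarrow> i \<noteq> e" and eF: "\<And>f. f \<in> set F \<Longrightarrow> fst f \<noteq> e" using fresh by auto
  have st': "s \<noteq> t" using ipath_mid(1)[OF ip P(1)] st by auto
  have anti: "anticomplete E (set P) (set (\<phi> i))" if "i \<in> set (ids (N, R, F))" "vs \<notin> set (\<phi> i)" "vt \<notin> set (\<phi> i)" for i
    unfolding anticomplete_def
  proof (intro conjI ballI)
    show "set P \<inter> set (\<phi> i) = {}" using P(3) in_span[where \<phi>=\<phi>, OF that(1), of _] by blast
    fix x y assume "x \<in> set P" "y \<in> set (\<phi> i)"
    then show "{x, y} \<notin> E" using no[of x y] in_span[where \<phi>=\<phi>, OF that(1), of y] that(2,3) by auto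
  qed
  have thin: "anticomplete E (set P) (set (\<phi> c))" if c: "c \<in> set N" "c \<noteq> s" "c \<noteq> t" for c
  proof -
    obtain w where w: "\<phi> c = [w]" using D(3)[OF c(1)] by auto
    have "w \<noteq> vs" "w \<noteq> vt" using D(5)[OF that(1) st(1)] D(5)[OF that(1) st(2)] that st w by auto
    then show ?thesis using anti[of c] that w by auto
  qed
  have flat: "anticomplete E (set P) (set (\<phi> (fst f)))" if f: "f \<in> set F" for f
  proof -
    obtain d a b where fd: "f = (d, a, b)" by (cases f)
    have "set (\<phi> d) \<inter> set (\<phi> s) = {}" "set (\<phi> d) \<inter> set (\<phi> t) = {}"
      using emb_flat_thin(1)[OF e f[unfolded fd] st(1)] emb_flat_thin(1)[OF e f[unfolded fd] st(2)] by blast+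
    moreover have "d \<in> set (ids (N, R, F))" using f fd by force
    ultimately show ?thesis using anti[of d] fd st by auto
  qed
  show ?thesis
  proof (rule embI)
    show "distinct (N @ map fst ((e, s, t) # F))" using D(1) fresh by auto
    show "set R \<subseteq> set N \<times> set N" by (rule D(2))
    show "\<And>i. i \<in> set N \<Longrightarrow> \<exists>v\<in>V. ?p i = [v]" using D(3) eN by auto
    show "a \<in> set N \<and> b \<in> set N \<and> a \<noteq> b \<and> ?p d \<noteq> [] \<and> set (?p d) \<subseteq> V \<and> ipath E (?p a @ ?p d @ ?p b)"
      if "(d, a, b) \<in> set ((e, s, t) # F)" for d a b
    proof (cases "(d, a, b) = (e, s, t)")
      case True
      have "s \<noteq> e" "t \<noteq> e" using st eN by auto
      then have "?p s = [vs]" "?p t = [vt]" "?p e = P" using st by auto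
      then show ?thesis using True st(1,2) st' P(1,2) ip by (metis prod.inject)
    next
      case False
      then have f: "(d, a, b) \<in> set F" using that by auto
      have "a \<noteq> e" "b \<noteq> e" "d \<noteq> e" using D(4)[OF f] eN eF[OF f] by auto
      then show ?thesis using D(4)[OF f] by simp
    qed
    show "hd (?p i) \<noteq> hd (?p j) \<and> ({hd (?p i), hd (?p j)} \<in> E \<longleftrightarrow> linked R i j)"
      if "i \<in> set N" "j \<in> set N" "i \<noteq> j" for i j
      using D(5)[OF that] eN[OF that(1)] eN[OF that(2)] by simp
    show "anticomplete E (set (?p d)) (set (?p c))"
      if "(d, a, b) \<in> set ((e, s, t) # F)" "c \<in> set N" "c \<noteq> a" "c \<noteq> b" for d a b c
    proof (cases "(d, a, b) = (e, s, t)")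
      case True
      then show ?thesis using thin[of c] that eN by auto
    next
      case False
      then have f: "(d, a, b) \<in> set F" using that by auto
      then show ?thesis using D(6)[OF f that(2-4)] eN[OF that(2)] eF[OF f] by simp
    qed
    show "anticomplete E (set (?p (fst f))) (set (?p (fst g)))"
      if fg: "f \<in> set ((e, s, t) # F)" "g \<in> set ((e, s, t) # F)" "fst f \<noteq> fst g" for f g
    proof -
      consider "f = (e, s, t)" "g \<in> set F" | "g = (e, s, t)" "f \<in> set F" | "f \<in> set F" "g \<in> set F"
        using fg by auto
      then show ?thesis
      proof cases
        case 1
        then show ?thesis using flat[of g] eF[of g] by simp
      next
        case 2
        then show ?thesis using anticomplete_sym[OF flat[of f]] eF[of f] by simp
      next
        case 3
        then show ?thesis using D(7)[OF 3 fg(3)] eF[of f] eF[of g] by simp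
      qed
    qed
  qed
qed

lemma emb_vertex:
  assumes e: "emb V E (N, R, F) \<phi>" and fresh: "e \<notin> set (ids (N, R, F))" and x: "x \<in> V" "x \<notin> span (N, R, F) \<phi>"
    and C: "set C \<subseteq> set N" "\<And>h. h \<in> span (N, R, F) \<phi> \<Longrightarrow> {x, h} \<in> E \<longleftrightarrow> (\<exists>c\<in>set C. \<phi> c = [h])"
  shows "emb V E (e # N, map (Pair e) C @ R, F) (\<phi>(e := [x]))"
proof -
  note D = embD[OF e]
  let ?p = "\<phi>(e := [x])"
  have eN: "\<And>i. i \<in> set N \<Longrightarrow> i \<noteq> e" and eF: "\<And>f. f \<in> set F \<Longrightarrow> fst f \<noteq> e" using fresh by auto
  have flat: "anticomplete E (set (\<phi> (fst f))) {x}" if f: "f \<in> set F" for f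
    unfolding anticomplete_def
  proof (intro conjI ballI)
    obtain d a b where fd: "f = (d, a, b)" by (cases f)
    have i: "fst f \<in> set (ids (N, R, F))" using f by auto
    show "set (\<phi> (fst f)) \<inter> {x} = {}" using x(2) in_span[where \<phi>=\<phi>, OF i, of x] by blast
    fix h z assume h: "h \<in> set (\<phi> (fst f))" and "z \<in> {x}"
    have "\<phi> c \<noteq> [h]" if "c \<in> set C" for c
    proof
      assume c: "\<phi> c = [h]"
      have "c \<in> set N" using C(1) that by blast
      from emb_flat_thin(1)[OF e f[unfolded fd] this] show False using h c fd by auto
    qed
    then show "{h, z} \<notin> E" using C(2)[OF in_span[where \<phi>=\<phi>, OF i h]] \<open>z \<in> {x}\<close> by (auto simp: insert_commute)
  qed
  have thin: "hd (\<phi> j) \<noteq> x \<and> ({x, hd (\<phi> j)} \<in> E \<longleftrightarrow> linked (map (Pair e) C @ R) e j)" if j: "j \<in> set N" for j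
  proof -
    obtain w where w: "\<phi> j = [w]" using D(3)[OF j] by auto
    have ws: "w \<in> span (N, R, F) \<phi>" using in_span[of j "(N, R, F)" w \<phi>] j w by auto
    have "(\<exists>c\<in>set C. \<phi> c = [w]) \<longleftrightarrow> j \<in> set C"
      using D(5)[OF j, of] C(1) w by (metis list.sel(1) subsetD)
    moreover have "linked (map (Pair e) C @ R) e j \<longleftrightarrow> j \<in> set C"
      using D(2) eN[OF j] eN unfolding linked_def by auto
    ultimately show ?thesis using C(2)[OF ws] w ws x(2) by auto
  qed
  show ?thesis
  proof (rule embI)
    show "distinct ((e # N) @ map fst F)" using D(1) fresh by auto
    show "set (map (Pair e) C @ R) \<subseteq> set (e # N) \<times> set (e # N)" using D(2) C(1) by auto
    show "\<And>i. i \<in> set (e # N) \<Longrightarrow> \<exists>v\<in>V. ?p i = [v]" using D(3) x(1) by auto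
    show "a \<in> set (e # N) \<and> b \<in> set (e # N) \<and> a \<noteq> b \<and> ?p d \<noteq> [] \<and> set (?p d) \<subseteq> V \<and> ipath E (?p a @ ?p d @ ?p b)"
      if f: "(d, a, b) \<in> set F" for d a b
    proof -
      have "a \<noteq> e" "b \<noteq> e" "d \<noteq> e" using D(4)[OF f] eN eF[OF f] by auto
      then show ?thesis using D(4)[OF f] by simp
    qed
    show "hd (?p i) \<noteq> hd (?p j) \<and> ({hd (?p i), hd (?p j)} \<in> E \<longleftrightarrow> linked (map (Pair e) C @ R) i j)"
      if ij: "i \<in> set (e # N)" "j \<in> set (e # N)" "i \<noteq> j" for i j
    proof -
      consider "i = e" "j \<in> set N" | "j = e" "i \<in> set N" | "i \<in> set N" "j \<in> set N" using ij by auto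
      then show ?thesis
      proof cases
        case 1
        then show ?thesis using thin[of j] eN[of j] by auto
      next
        case 2
        then show ?thesis using thin[of i] eN[of i] linked_sym[of _ e i] by (auto simp: insert_commute)
      next
        case 3
        then have "linked (map (Pair e) C @ R) i j \<longleftrightarrow> linked R i j" using eN unfolding linked_def by auto
        then show ?thesis using D(5)[OF 3 ij(3)] eN 3 by auto
      qed
    qed
    show "anticomplete E (set (?p d)) (set (?p c))"
      if f: "(d, a, b) \<in> set F" and c: "c \<in> set (e # N)" "c \<noteq> a" "c \<noteq> b" for d a b c
    proof (cases "c = e")
      case True
      then show ?thesis using flat[OF f] eF[OF f] by simp
    next
      case False
      then show ?thesis using D(6)[OF f] c eF[OF f] by simp
    qed
    show "anticomplete E (set (?p (fst f))) (set (?p (fst g)))"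
      if "f \<in> set F" "g \<in> set F" "fst f \<noteq> fst g" for f g
      using D(7)[OF that] eF[OF that(1)] eF[OF that(2)] by simp
  qed
qed

text \<open>Here \<open>\<sigma>\<close> sends the numbers of a known pattern to those of a grown
  one, so an embedding is pulled back along it. A path may be traversed in either direction.\<close>

fun relabel_ok :: "model \<Rightarrow> model \<Rightarrow> (int \<Rightarrow> int) \<Rightarrow> bool" where
  "relabel_ok (N, R, F) (N', R', F') \<sigma> \<longleftrightarrow>
     distinct (N @ map fst F) \<and> distinct (map \<sigma> (N @ map fst F)) \<and>
     list_all (\<lambda>(i, j). i \<in> set N \<and> j \<in> set N) R \<and> list_all (\<lambda>i. \<sigma> i \<in> set N') N \<and>
     list_all (\<lambda>i. list_all (\<lambda>j. i = j \<or> linked R i j = linked R' (\<sigma> i) (\<sigma> j)) N) N \<and>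
     list_all (\<lambda>(d, a, b). a \<in> set N \<and> b \<in> set N \<and> ((\<sigma> d, \<sigma> a, \<sigma> b) \<in> set F' \<or> (\<sigma> d, \<sigma> b, \<sigma> a) \<in> set F')) F"

lemma emb_relabel:
  assumes e: "emb V E (N', R', F') \<phi>" and ok: "relabel_ok (N, R, F) (N', R', F') \<sigma>"
  obtains \<psi> where "emb V E (N, R, F) \<psi>"
proof -
  note D = embD[OF e]
  have ok: "distinct (N @ map fst F)" "distinct (map \<sigma> (N @ map fst F))" "set R \<subseteq> set N \<times> set N" "\<And>i. i \<in> set N \<Longrightarrow> \<sigma> i \<in> set N'"
    "\<And>i j. i \<in> set N \<Longrightarrow> j \<in> set N \<Longrightarrow> i \<noteq> j \<Longrightarrow> linked R i j = linked R' (\<sigma> i) (\<sigma> j)"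
    "\<And>d a b. (d, a, b) \<in> set F \<Longrightarrow> a \<in> set N \<and> b \<in> set N \<and> ((\<sigma> d, \<sigma> a, \<sigma> b) \<in> set F' \<or> (\<sigma> d, \<sigma> b, \<sigma> a) \<in> set F')"
    using ok unfolding relabel_ok.simps list_all_iff by auto
  have inj: "\<sigma> i \<noteq> \<sigma> j" if "i \<in> set (N @ map fst F)" "j \<in> set (N @ map fst F)" "i \<noteq> j" for i j
    using ok(2) that by (metis distinct_map inj_onD)
  \<comment> \<open>Marks the paths whose ends \<open>\<sigma>\<close> exchanges; their vertex lists
    must be read backwards.\<close>
  define flip where "flip i \<longleftrightarrow> (\<exists>a b. (i, a, b) \<in> set F \<and> (\<sigma> i, \<sigma> a, \<sigma> b) \<notin> set F')" for i
  define \<psi> where "\<psi> i = (if flip i then rev (\<phi> (\<sigma> i)) else \<phi> (\<sigma> i))" for i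
  have set\<psi>: "set (\<psi> i) = set (\<phi> (\<sigma> i))" for i unfolding \<psi>_def by auto
  have \<psi>N: "\<psi> i = \<phi> (\<sigma> i)" if "i \<in> set N" for i
    using ok(1) that unfolding \<psi>_def flip_def by force
  have FN: "fst f \<in> set (N @ map fst F)" if "f \<in> set F" for f using that by auto
  have uniq: "f = g" if "f \<in> set F" "g \<in> set F" "fst f = fst g" for f g
    using ok(1) that by (metis distinct_append distinct_map inj_onD)
  have fl: "\<exists>a' b'. (\<sigma> d, a', b') \<in> set F' \<and> {a', b'} = {\<sigma> a, \<sigma> b}" if "(d, a, b) \<in> set F" for d a b
    using ok(6)[OF that] by blast
  have "emb V E (N, R, F) \<psi>"
  proof (rule embI)
    show "\<exists>v\<in>V. \<psi> i = [v]" if "i \<in> set N" for i using D(3)[OF ok(4)[OF that]] \<psi>N[OF that] by simp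
    show "a \<in> set N \<and> b \<in> set N \<and> a \<noteq> b \<and> \<psi> d \<noteq> [] \<and> set (\<psi> d) \<subseteq> V \<and> ipath E (\<psi> a @ \<psi> d @ \<psi> b)"
      if f: "(d, a, b) \<in> set F" for d a b
    proof -
      have ab: "a \<in> set N" "b \<in> set N" using ok(6)[OF f] by auto
      show ?thesis
      proof (cases "flip d")
        case False
        then have g: "(\<sigma> d, \<sigma> a, \<sigma> b) \<in> set F'" using f unfolding flip_def by blast
        then show ?thesis using D(4)[OF g] ab \<psi>N False unfolding \<psi>_def[of d] by auto
      next
        case True
        then obtain a' b' where "(d, a', b') \<in> set F" "(\<sigma> d, \<sigma> a', \<sigma> b') \<notin> set F'" unfolding flip_def by blast
        then have "(\<sigma> d, \<sigma> a, \<sigma> b) \<notin> set F'" using uniq[OF f, of "(d, a', b')"] by simp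
        then have g: "(\<sigma> d, \<sigma> b, \<sigma> a) \<in> set F'" using ok(6)[OF f] by blast
        have "ipath E (\<phi> (\<sigma> b) @ \<phi> (\<sigma> d) @ \<phi> (\<sigma> a))" using D(4)[OF g] by blast
        then have "ipath E (rev (\<phi> (\<sigma> b) @ \<phi> (\<sigma> d) @ \<phi> (\<sigma> a)))" by (simp only: ipath_rev)
        moreover have "rev (\<phi> (\<sigma> b) @ \<phi> (\<sigma> d) @ \<phi> (\<sigma> a)) = \<psi> a @ \<psi> d @ \<psi> b"
          using D(3)[OF ok(4)[OF ab(1)]] D(3)[OF ok(4)[OF ab(2)]] \<psi>N ab True unfolding \<psi>_def[of d] by auto
        ultimately have "ipath E (\<psi> a @ \<psi> d @ \<psi> b)" by simp
        moreover have "\<psi> d \<noteq> []" "set (\<psi> d) \<subseteq> V" "a \<noteq> b" using D(4)[OF g] True unfolding \<psi>_def by auto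
        ultimately show ?thesis using ab by blast
      qed
    qed
    show "hd (\<psi> i) \<noteq> hd (\<psi> j) \<and> ({hd (\<psi> i), hd (\<psi> j)} \<in> E \<longleftrightarrow> linked R i j)"
      if ij: "i \<in> set N" "j \<in> set N" "i \<noteq> j" for i j
      using D(5)[OF ok(4)[OF ij(1)] ok(4)[OF ij(2)] inj] ok(5)[OF ij] \<psi>N ij by simp
    show "anticomplete E (set (\<psi> d)) (set (\<psi> c))"
      if f: "(d, a, b) \<in> set F" and c: "c \<in> set N" "c \<noteq> a" "c \<noteq> b" for d a b c
    proof -
      obtain a' b' where g: "(\<sigma> d, a', b') \<in> set F'" "{a', b'} = {\<sigma> a, \<sigma> b}" using fl[OF f] by blast
      have "\<sigma> c \<noteq> \<sigma> a" "\<sigma> c \<noteq> \<sigma> b" using inj[of c a] inj[of c b] c ok(6)[OF f] by auto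
      then have "\<sigma> c \<noteq> a'" "\<sigma> c \<noteq> b'" using g(2) by auto
      then show ?thesis using D(6)[OF g(1) ok(4)[OF c(1)]] set\<psi> by metis
    qed
    show "anticomplete E (set (\<psi> (fst f))) (set (\<psi> (fst g)))"
      if fg: "f \<in> set F" "g \<in> set F" "fst f \<noteq> fst g" for f g
    proof -
      obtain d a b where f: "f = (d, a, b)" by (cases f)
      obtain d' a' b' where g: "g = (d', a', b')" by (cases g)
      obtain x y where 1: "(\<sigma> d, x, y) \<in> set F'" using fl fg(1) f by blast
      obtain x' y' where 2: "(\<sigma> d', x', y') \<in> set F'" using fl fg(2) g by blast
      have "\<sigma> d \<noteq> \<sigma> d'" using inj[OF FN[OF fg(1)] FN[OF fg(2)] fg(3)] f g by simp
      then show ?thesis using D(7)[OF 1 2] set\<psi> f g by simp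
    qed
  qed (use ok in auto)
  then show thesis using that by blast
qed

section \<open>Shortening a path of the copy through an outside vertex\<close>

context girth5
begin

text \<open>If all neighbours of \<open>x\<close> in the copy lie on one closed path and there are
  at least two of them, replace everything between the first and the last one by \<open>x\<close>.
  The result is again induced, and it is smaller because at least two vertices are removed.\<close>

lemma reroute:
  assumes e: "emb V E (N, R, F) \<phi>" and f: "(d, a, b) \<in> set F" and x: "x \<in> V" "x \<notin> span (N, R, F) \<phi>"
    and nb: "\<And>h. h \<in> span (N, R, F) \<phi> \<Longrightarrow> {x, h} \<in> E \<Longrightarrow> h \<in> set (\<phi> a @ \<phi> d @ \<phi> b)"
    and h: "h1 \<in> set (\<phi> a @ \<phi> d @ \<phi> b)" "h2 \<in> set (\<phi> a @ \<phi> d @ \<phi> b)" "h1 \<noteq> h2" "{x, h1} \<in> E" "{x, h2} \<in> E"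
  obtains \<phi>' where "emb V E (N, R, F) \<phi>'" "card (span (N, R, F) \<phi>') < card (span (N, R, F) \<phi>)"
proof -
  note D = embD[OF e]
  define cl where "cl = \<phi> a @ \<phi> d @ \<phi> b"
  have ab: "a \<in> set N" "b \<in> set N" using D(4)[OF f] by auto
  obtain va where va: "\<phi> a = [va]" using D(3)[OF ab(1)] by auto
  obtain vb where vb: "\<phi> b = [vb]" using D(3)[OF ab(2)] by auto
  have ipc: "ipath E cl" using D(4)[OF f] unfolding cl_def by blast
  have dN: "d \<notin> set N" by (rule flat_not_thin[OF e f])
  have idd: "d \<in> set (ids (N, R, F))" using f by force
  obtain P1 g1 Q where s1: "cl = P1 @ g1 # Q" "{x, g1} \<in> E" "\<forall>z\<in>set P1. {x, z} \<notin> E"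
    using split_list_first_prop[of cl "\<lambda>z. {x, z} \<in> E"] h unfolding cl_def by blast
  have "\<exists>z\<in>set Q. {x, z} \<in> E"
  proof -
    have "h1 \<in> set cl" "h2 \<in> set cl" using h cl_def by auto
    then show ?thesis using s1 h(3-5) by auto
  qed
  then obtain M g2 P2 where s2: "Q = M @ g2 # P2" "{x, g2} \<in> E" "\<forall>z\<in>set P2. {x, z} \<notin> E"
    using split_list_last_prop[of Q "\<lambda>z. {x, z} \<in> E"] by blast
  have cl: "cl = (P1 @ [g1]) @ (M @ g2 # P2)" using s1 s2 by simp
  have dist: "distinct cl" by (rule ipath_distinct[OF ipc])
  have xcl: "x \<notin> set cl"
    using x(2) in_span[of a "(N, R, F)" x \<phi>] in_span[of b "(N, R, F)" x \<phi>] in_span[of d "(N, R, F)" x \<phi>] ab idd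
    unfolding cl_def by auto
  have i1: "ipath E (P1 @ [g1])" and i2: "ipath E (M @ g2 # P2)"
    and cr: "\<And>y z. y \<in> set (P1 @ [g1]) \<Longrightarrow> z \<in> set (M @ g2 # P2) \<Longrightarrow> {y, z} \<in> E \<longleftrightarrow> y = last (P1 @ [g1]) \<and> z = hd (M @ g2 # P2)"
    using ipc unfolding cl ipath_append[of E "P1 @ [g1]"] by blast+
  have i3: "ipath E (g2 # P2)" by (rule ipath_suffix[OF i2])
  \<comment> \<open>With no vertex in between there would be a triangle, with one vertex a
    4-cycle.\<close>
  have M2: "2 \<le> length M"
  proof (rule ccontr)
    assume "\<not> 2 \<le> length M"
    then consider "M = []" | z where "M = [z]" by (cases M; cases "tl M") auto
    then show False
    proof cases
      case 1
      then have "{g1, g2} \<in> E" using cr[of g1 g2] by simp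
      then show False using tri[of g1 x g2] s1(2) s2(2) by (simp add: insert_commute)
    next
      case 2
      then have "{g1, z} \<in> E" "{z, g2} \<in> E" using cr[of g1 z] i2 by auto
      then have "g1 = g2 \<or> z = x" using square_collapses[of g1 z g2 x] s1(2) s2(2) by (simp add: insert_commute)
      then show False using dist xcl unfolding cl 2 by auto
    qed
  qed
  have hdM: "hd (M @ g2 # P2) \<in> set M" using M2 by (cases M) auto
  have cr2: "{y, z} \<notin> E" if "y \<in> set (P1 @ [g1])" "z \<in> set (g2 # P2)" for y z
  proof -
    have "z \<noteq> hd (M @ g2 # P2)" using hdM that(2) dist unfolding cl by auto
    then show ?thesis using cr[of y z] that by auto
  qed
  define cl' where "cl' = (P1 @ [g1]) @ (x # g2 # P2)"
  have ix: "ipath E (x # g2 # P2)" using i3 s2(2,3) xcl unfolding cl by (auto simp del: ipath.simps(2) simp: ipath.simps(2)[of E x])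
  have "{y, x} \<in> E \<longleftrightarrow> y = g1" if "y \<in> set (P1 @ [g1])" for y
    using that s1(2,3) by (auto simp: insert_commute)
  moreover have "set (P1 @ [g1]) \<inter> set (x # g2 # P2) = {}" using dist xcl unfolding cl by auto
  ultimately have ip': "ipath E cl'"
    unfolding cl'_def ipath_append[of E "P1 @ [g1]"] using i1 ix cr2 dist unfolding cl by auto
  have hdl: "hd cl' = va" "last cl' = vb"
  proof -
    have "hd cl = va" "last cl = vb" unfolding cl_def va vb by auto
    moreover have "hd cl' = hd cl" unfolding cl cl'_def by (cases P1) auto
    moreover have "last cl' = last cl" unfolding cl cl'_def by (cases P2) auto
    ultimately show "hd cl' = va" "last cl' = vb" by auto
  qed
  \<comment> \<open>The end vertices stay the same also when \<open>g1\<close> or \<open>g2\<close>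
    is one of them; if both are, the new interior is \<open>x\<close> alone.\<close>
  define D' where "D' = butlast (tl cl')"
  have len: "length cl' \<ge> 3" unfolding cl'_def by simp
  have tlne: "tl cl' \<noteq> []" unfolding cl'_def by (cases P1) auto
  have "cl' = hd cl' # tl cl'" unfolding cl'_def by simp
  moreover have "tl cl' = butlast (tl cl') @ [last (tl cl')]" "last (tl cl') = last cl'"
    using tlne append_butlast_last_id[OF tlne] last_tl[of cl'] by simp_all
  ultimately have cl'D: "cl' = [va] @ D' @ [vb]" unfolding D'_def using hdl by (metis append_Cons append_Nil)
  have D'ne: "D' \<noteq> []" using len unfolding cl'D by (cases D') auto
  have dist': "distinct cl'" by (rule ipath_distinct[OF ip'])
  have setcl: "set cl = {va} \<union> set (\<phi> d) \<union> {vb}" unfolding cl_def va vb by auto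
  have D'sub: "set D' \<subseteq> insert x (set (\<phi> d))"
  proof
    fix z assume z: "z \<in> set D'"
    then have "z \<noteq> va" "z \<noteq> vb" using dist' unfolding cl'D by auto
    moreover have "z \<in> set cl'" using z unfolding cl'D by auto
    then have "z = x \<or> z \<in> set cl" unfolding cl'_def cl by auto
    ultimately show "z \<in> insert x (set (\<phi> d))" using setcl by auto
  qed
  let ?p = "\<phi>(d := D')"
  have dF: "fst g \<noteq> d \<Longrightarrow> ?p (fst g) = \<phi> (fst g)" for g by simp
  have xno: "{x, z} \<notin> E" if "i \<in> set (ids (N, R, F))" "z \<in> set (\<phi> i)" "i \<noteq> a" "i \<noteq> b" "i \<noteq> d" for i z
  proof
    assume "{x, z} \<in> E"
    then have "z \<in> set (\<phi> a @ \<phi> d @ \<phi> b)" using nb in_span[where \<phi>=\<phi>, OF that(1,2)] by blast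
    then have "\<exists>j\<in>{a, b, d}. set (\<phi> i) \<inter> set (\<phi> j) \<noteq> {}" using that(2) by auto
    then show False using emb_sys_pair[OF e that(1)] that(3-5) ab idd by auto
  qed
  have xdis: "x \<notin> set (\<phi> i)" if "i \<in> set (ids (N, R, F))" for i using x(2) in_span[where \<phi>=\<phi>, OF that, of x] by blast
  have anti: "anticomplete E (set D') (set (\<phi> i))"
    if "i \<in> set (ids (N, R, F))" "i \<noteq> a" "i \<noteq> b" "i \<noteq> d" "anticomplete E (set (\<phi> d)) (set (\<phi> i))" for i
  proof (rule anticomplete_mono[OF _ D'sub subset_refl])
    show "anticomplete E (insert x (set (\<phi> d))) (set (\<phi> i))"
      using that(5) xno[OF that(1)] that(2-4) xdis[OF that(1)] unfolding anticomplete_def by auto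
  qed
  have "emb V E (N, R, F) ?p"
  proof (rule embI)
    show "\<exists>v\<in>V. ?p i = [v]" if "i \<in> set N" for i using D(3)[OF that] that dN by auto
    show "a' \<in> set N \<and> b' \<in> set N \<and> a' \<noteq> b' \<and> ?p d' \<noteq> [] \<and> set (?p d') \<subseteq> V \<and> ipath E (?p a' @ ?p d' @ ?p b')"
      if g: "(d', a', b') \<in> set F" for d' a' b'
    proof (cases "d' = d")
      case True
      then have "a' = a" "b' = b" using emb_flat_unique[OF e g f] by auto
      moreover have "a \<noteq> d" "b \<noteq> d" using ab dN by auto
      moreover have "set D' \<subseteq> V" using D'sub x(1) D(4)[OF f] by auto
      moreover have "ipath E (\<phi> a @ D' @ \<phi> b)" using ip' unfolding cl'D va vb .
      ultimately show ?thesis using True D(4)[OF f] D'ne by simp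
    next
      case False
      moreover have "a' \<noteq> d" "b' \<noteq> d" using D(4)[OF g] dN by auto
      ultimately show ?thesis using D(4)[OF g] by simp
    qed
    show "hd (?p i) \<noteq> hd (?p j) \<and> ({hd (?p i), hd (?p j)} \<in> E \<longleftrightarrow> linked R i j)"
      if ij: "i \<in> set N" "j \<in> set N" "i \<noteq> j" for i j
    proof -
      have "i \<noteq> d" "j \<noteq> d" using ij dN by auto
      then show ?thesis using D(5)[OF ij] by simp
    qed
    show "anticomplete E (set (?p d')) (set (?p c))"
      if g: "(d', a', b') \<in> set F" and c: "c \<in> set N" "c \<noteq> a'" "c \<noteq> b'" for d' a' b' c
    proof -
      have cd: "c \<noteq> d" using c dN by auto
      show ?thesis
      proof (cases "d' = d")
        case True
        then have "a' = a" "b' = b" using emb_flat_unique[OF e g f] by auto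
        then show ?thesis using anti[of c] D(6)[OF f c(1)] c cd True by simp
      next
        case False
        then show ?thesis using D(6)[OF g c] cd by simp
      qed
    qed
    have one: "anticomplete E (set D') (set (\<phi> (fst g)))" if "g \<in> set F" "fst g \<noteq> d" for g
    proof -
      have "fst g \<notin> set N" using flat_not_thin[OF e, of "fst g" "fst (snd g)" "snd (snd g)"] that by simp
      then have "fst g \<noteq> a" "fst g \<noteq> b" using ab by auto
      moreover have "fst g \<in> set (ids (N, R, F))" using that by auto
      ultimately show ?thesis using anti[of "fst g"] D(7)[OF f that(1)] that(2) by simp
    qed
    show "anticomplete E (set (?p (fst g))) (set (?p (fst h)))"
      if "g \<in> set F" "h \<in> set F" "fst g \<noteq> fst h" for g h
      using D(7)[OF that] one[of g] one[of h] anticomplete_sym[OF one[of g]] that by auto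
  qed (use D(1,2) in auto)
  moreover have "card (span (N, R, F) ?p) < card (span (N, R, F) \<phi>)"
  proof -
    have MV: "set M \<subseteq> set (\<phi> d)"
    proof
      fix z assume z: "z \<in> set M"
      have "hd cl \<noteq> z" using z dist unfolding cl by (cases P1) auto
      moreover have "last cl \<noteq> z" using z dist unfolding cl by (cases P2 rule: rev_cases) auto
      moreover have "hd cl = va" "last cl = vb" unfolding cl_def va vb by auto
      moreover have "z \<in> set cl" using z unfolding cl by auto
      ultimately show "z \<in> set (\<phi> d)" using setcl by auto
    qed
    have "set M \<inter> set D' = {}"
    proof -
      have "set M \<inter> set cl' = {}" using dist xcl unfolding cl cl'_def by auto
      then show ?thesis unfolding cl'D by auto
    qed
    have sub: "span (N, R, F) ?p \<subseteq> insert x (span (N, R, F) \<phi> - set M)"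
    proof
      fix z assume "z \<in> span (N, R, F) ?p"
      then obtain i where i: "i \<in> set (ids (N, R, F))" "z \<in> set (?p i)" unfolding span_def by blast
      show "z \<in> insert x (span (N, R, F) \<phi> - set M)"
      proof (cases "i = d")
        case True
        then show ?thesis using i D'sub \<open>set M \<inter> set D' = {}\<close> in_span[where \<phi>=\<phi>, OF idd, of z] by auto
      next
        case False
        then have z: "z \<in> set (\<phi> i)" using i by simp
        have "set (\<phi> i) \<inter> set (\<phi> d) = {}" using emb_sys_pair[OF e i(1) idd False] by blast
        then have "z \<notin> set M" using z MV by blast
        then show ?thesis using in_span[where \<phi>=\<phi>, OF i(1) z] by blast
      qed
    qed
    have fs: "finite (span (N, R, F) \<phi>)" using span_subset[OF e] finite_subset[OF _ fin] by blast
    have "card (set M) = length M" using dist unfolding cl by (simp add: distinct_card)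
    moreover have Ms: "set M \<subseteq> span (N, R, F) \<phi>" using MV in_span[where \<phi>=\<phi>, OF idd] by blast
    ultimately have "card (span (N, R, F) \<phi> - set M) + length M = card (span (N, R, F) \<phi>)"
      using card_Diff_subset[OF _ Ms] card_mono[OF fs Ms] by simp
    moreover have "card (span (N, R, F) ?p) \<le> card (insert x (span (N, R, F) \<phi> - set M))"
      using card_mono[OF _ sub] fs by simp
    moreover have "card (insert x (span (N, R, F) \<phi> - set M)) \<le> Suc (card (span (N, R, F) \<phi> - set M))"
      using fs by (simp add: card_insert_if)
    ultimately show ?thesis using M2 by linarith
  qed
  ultimately show thesis using that by blast
qed

end

section \<open>The seven patterns\<close>

fun on :: "pt \<Rightarrow> flat \<Rightarrow> bool" where
  "on (Thin i) (d, a, b) \<longleftrightarrow> i = a \<or> i = b"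
| "on (Whole g) (d, a, b) \<longleftrightarrow> fst g = d"
| "on (Split g x y) (d, a, b) \<longleftrightarrow> fst g = d"

text \<open>Attaching to two points on a common closed path is the situation that ends in a proper
  2-cutset. Ear certificates are therefore demanded only for pairs that do not share.\<close>

fun share :: "flat list \<Rightarrow> pt \<Rightarrow> pt \<Rightarrow> bool" where
  "share [] p q = False"
| "share (f # F) p q \<longleftrightarrow> on p f \<and> on q f \<or> share F p q"

fun coarse :: "model \<Rightarrow> pt list" where
  "coarse (N, R, F) = map Thin N @ map Whole F"

fun fines :: "pt \<Rightarrow> pt list" where
  "fines (Whole f) = [Split f True True, Split f True False, Split f False True, Split f False False]"
| "fines p = [p]"

fun pairs :: "'b list \<Rightarrow> ('b \<times> 'b) list" where
  "pairs [] = []"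
| "pairs (x # xs) = map (Pair x) xs @ pairs xs"

fun triples :: "'b list \<Rightarrow> ('b \<times> 'b \<times> 'b) list" where
  "triples [] = []"
| "triples (x # xs) = map (Pair x) (pairs xs) @ triples xs"

text \<open>Minimality of an ear from \<open>p\<close> to \<open>q\<close> forces each further
  attachment onto a common closed path with \<open>p\<close> and onto one with \<open>q\<close>. As
  \<open>p\<close> and \<open>q\<close> do not share, only these single vertices qualify.\<close>

fun shared :: "flat list \<Rightarrow> pt \<Rightarrow> pt \<Rightarrow> int list \<Rightarrow> int list" where
  "shared F p q [] = []"
| "shared F p q (w # ws) = (if share F (Thin w) p \<and> share F (Thin w) q then w # shared F p q ws else shared F p q ws)"

text \<open>The number 99 stands for a piece outside the pattern.\<close>
fun add_ear :: "int \<Rightarrow> int \<Rightarrow> model \<Rightarrow> model" where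
  "add_ear s t (N, R, F) = (N, R, (99, s, t) # F)"

fun add_vertex :: "int list \<Rightarrow> model \<Rightarrow> model" where
  "add_vertex C (N, R, F) = (99 # N, map (Pair 99) C @ R, F)"

text \<open>The lists \<open>Ws\<close> contain the possible further attachments of an ear besides its two ends.\<close>
fun killed_all :: "model \<Rightarrow> int list \<Rightarrow> cert list \<Rightarrow> int list list \<Rightarrow> bool" where
  "killed_all m C cs [] = True"
| "killed_all m C cs (W # Ws) \<longleftrightarrow>
     ucheck (links m @ map (Pair 99) (C @ W)) (99 # ids m) (thins m) cs \<and> killed_all m C cs Ws"

fun ears_row :: "model \<Rightarrow> int list \<Rightarrow> cert list \<Rightarrow> (pt \<times> pt) list \<Rightarrow> pt \<Rightarrow> pt list \<Rightarrow> bool" where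
  "ears_row m Ws cs G p [] = True"
| "ears_row m Ws cs G p (q # qs) \<longleftrightarrow>
     (killed_all (refine q (refine p m)) [pid p, pid q] cs ([] # map (\<lambda>w. [w]) Ws) \<or> Ws = [] \<and> (p, q) \<in> set G) \<and>
     ears_row m Ws cs G p qs"

fun ears_table :: "model \<Rightarrow> int list \<Rightarrow> cert list \<Rightarrow> (pt \<times> pt) list \<Rightarrow> pt list \<Rightarrow> pt list \<Rightarrow> bool" where
  "ears_table m Ws cs G [] qs = True"
| "ears_table m Ws cs G (p # ps) qs \<longleftrightarrow> ears_row m Ws cs G p qs \<and> ears_table m Ws cs G ps qs"

text \<open>Minimality of an ear puts any two further attachments on a common closed path. If
  candidates never share one, at most one further attachment occurs, so the empty list and the
  singletons exhaust the cases in \<open>ears_row\<close>.\<close>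

fun indep :: "flat list \<Rightarrow> (int \<times> int) list \<Rightarrow> bool" where
  "indep F [] = True"
| "indep F ((v, w) # r) \<longleftrightarrow> \<not> share F (Thin v) (Thin w) \<and> indep F r"

type_synonym ear_data = "(pt \<times> pt \<times> cert list) list"

fun ears_ok :: "model \<Rightarrow> (pt \<times> pt) list \<Rightarrow> ear_data \<Rightarrow> bool" where
  "ears_ok m G [] = True"
| "ears_ok m G ((p, q, cs) # D) \<longleftrightarrow>
     indep (flats m) (pairs (shared (flats m) p q (thins m))) \<and>
     ears_table m (shared (flats m) p q (thins m)) cs G (fines p) (fines q) \<and> ears_ok m G D"

fun ears_cover :: "flat list \<Rightarrow> (pt \<times> pt) list \<Rightarrow> (pt \<times> pt) list \<Rightarrow> bool" where
  "ears_cover F K [] = True"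
| "ears_cover F K ((p, q) # r) \<longleftrightarrow> (share F p q \<or> (p, q) \<in> set K) \<and> ears_cover F K r"

fun has_mid :: "(int \<times> int) list \<Rightarrow> int \<Rightarrow> int \<Rightarrow> int list \<Rightarrow> bool" where
  "has_mid R i j [] = False"
| "has_mid R i j (k # N) \<longleftrightarrow> linked R i k \<and> linked R k j \<or> has_mid R i j N"

text \<open>An outside vertex that sees two vertices which are adjacent or have a common neighbour
  in the pattern would complete a triangle or a 4-cycle.\<close>

fun near :: "model \<Rightarrow> int \<Rightarrow> int \<Rightarrow> bool" where
  "near (N, R, F) i j \<longleftrightarrow> linked R i j \<or> has_mid R i j N"

fun near_any :: "model \<Rightarrow> (pt \<times> pt) list \<Rightarrow> bool" where
  "near_any m [] = False"
| "near_any m ((p, q) # r) \<longleftrightarrow> \<not> is_whole p \<and> \<not> is_whole q \<and> near m (pid p) (pid q) \<or> near_any m r"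

text \<open>The mask marks the points whose exact position on their path matters; the other paths
  stay unsplit, which keeps the number of cases small.\<close>

fun variants :: "bool list \<Rightarrow> pt list \<Rightarrow> pt list list" where
  "variants (b # bs) (p # ps) = concat (map (\<lambda>q. map ((#) q) (variants bs ps)) (if b then fines p else [p]))"
| "variants _ _ = [[]]"

fun claw_variants :: "model \<Rightarrow> (int \<times> int list \<times> int list) list \<Rightarrow> pt list list \<Rightarrow> bool" where
  "claw_variants m cs [] = True"
| "claw_variants m cs (ps # r) \<longleftrightarrow>
     (near_any (fold refine ps m) (pairs ps) \<or>
      rcheck (links (fold refine ps m)) (ids (fold refine ps m)) (thins (fold refine ps m)) (map pid ps) cs) \<and>
     claw_variants m cs r"

type_synonym claw_data = "(pt \<times> pt \<times> pt \<times> bool list \<times> (int \<times> int list \<times> int list) list) list"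

fun claws_ok :: "model \<Rightarrow> claw_data \<Rightarrow> bool" where
  "claws_ok m [] = True"
| "claws_ok m ((p, q, r, msk, cs) # D) \<longleftrightarrow> length msk = 3 \<and> claw_variants m cs (variants msk [p, q, r]) \<and> claws_ok m D"

text \<open>A triple is dismissed only if one of the two sharing points is a whole path. Triples
  with both ends of a path are kept, because the proof of \<open>one_per_flat\<close> relies on
  certificates for them.\<close>

fun share_any :: "flat list \<Rightarrow> (pt \<times> pt) list \<Rightarrow> bool" where
  "share_any F [] = False"
| "share_any F ((p, q) # r) \<longleftrightarrow> share F p q \<and> (is_whole p \<or> is_whole q) \<or> share_any F r"

fun claws_cover :: "model \<Rightarrow> (pt \<times> pt \<times> pt) list \<Rightarrow> (pt \<times> pt \<times> pt) list \<Rightarrow> bool" where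
  "claws_cover m K [] = True"
| "claws_cover m K ((p, q, r) # t) \<longleftrightarrow>
     (share_any (flats m) (pairs [p, q, r]) \<or> near_any m (pairs [p, q, r]) \<or> (p, q, r) \<in> set K) \<and> claws_cover m K t"

text \<open>In two models a vertex may attach to the three flat paths that remain; this either creates
  a unichord or leads to a larger model.\<close>
fun exc_variants :: "model \<Rightarrow> cert list \<Rightarrow> pt list list \<Rightarrow> pt list list \<Rightarrow> bool" where
  "exc_variants m cs G [] = True"
| "exc_variants m cs G (ps # r) \<longleftrightarrow>
     (near_any (fold refine ps m) (pairs ps) \<or>
      ucheck (links (fold refine ps m) @ map (Pair 99) (map pid ps)) (99 # ids (fold refine ps m))
        (99 # thins (fold refine ps m)) cs \<or> ps \<in> set G) \<and>
     exc_variants m cs G r"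

text \<open>Distinctness, containment and equal length make \<open>ys\<close> a rearrangement of
  \<open>xs\<close>, provided \<open>xs\<close> has no repetitions.\<close>

fun rotate_conn :: "(int \<times> int) list \<Rightarrow> int list \<Rightarrow> int list \<Rightarrow> bool" where
  "rotate_conn L xs ys \<longleftrightarrow> conn_ok L ys \<and> dist_ok ys \<and> length xs = length ys \<and> keep xs ys = ys"

text \<open>The list \<open>ys\<close> is an ordering of the pieces outside the closed flat path in which every piece is linked to an earlier one.\<close>
fun flat_shapes :: "model \<Rightarrow> flat list \<Rightarrow> int list list \<Rightarrow> bool" where
  "flat_shapes m [] yss = True"
| "flat_shapes m (f # F) [] = False"
| "flat_shapes m ((d, a, b) # F) (ys # yss) \<longleftrightarrow>
     rotate_conn (links m) (removeAll b (removeAll a (removeAll d (ids m)))) ys \<and>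
     meets (nbs (links m) a) ys \<and> meets (nbs (links m) b) ys \<and>
     length (remdups (nbs (links m) (hd ys))) \<ge> 3 \<and> memb (hd ys) (thins m) \<and>
     \<not> memb (hd ys) (nbs (links m) (hd ys)) \<and> flat_shapes m F yss"

text \<open>Attachments at three single vertices that lie pairwise, but not jointly, on closed paths
  would need such a triangle.\<close>

fun no_flat_triangle :: "flat list \<Rightarrow> (int \<times> int \<times> int) list \<Rightarrow> bool" where
  "no_flat_triangle F [] = True"
| "no_flat_triangle F ((i, j, k) # r) \<longleftrightarrow>
     \<not> (share F (Thin i) (Thin j) \<and> share F (Thin j) (Thin k) \<and> share F (Thin i) (Thin k)) \<and> no_flat_triangle F r"

text \<open>The bound 20 keeps \<open>d + 20\<close>, \<open>d + 40\<close> and 99 fresh. Four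
  single vertices leave at least two besides the ends of a path, as one side of a proper 2-cutset
  requires.\<close>

definition shape_ok :: "model \<Rightarrow> int list list \<Rightarrow> bool" where
  "shape_ok m yss \<longleftrightarrow> list_all (\<lambda>i. 0 \<le> i \<and> i < 20) (ids m) \<and> flat_shapes m (flats m) yss \<and>
     no_flat_triangle (flats m) (triples (thins m)) \<and> 4 \<le> length (thins m)"

section \<open>The patterns and their certificates\<close>

definition K4_model :: model where
  "K4_model =
   ([0, 1, 2, 3], [(0, 1), (2, 3)], [(4, 0, 2), (5, 0, 3), (6, 1, 2), (7, 1, 3)])"

definition Pet_minus_v :: model where
  "Pet_minus_v =
   ([0, 1, 2, 3, 4, 5], [(0, 1), (0, 4), (1, 5), (2, 3), (2, 4), (3, 5)], [(6, 0, 3), (7, 1, 2), (8, 4, 5)])"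

definition Hea_minus_P3 :: model where
  "Hea_minus_P3 =
   ([0, 1, 2, 3, 4, 5], [(0, 1), (0, 4), (2, 3), (3, 5)], [(6, 0, 3), (7, 1, 2), (8, 1, 5), (9, 2, 4), (10, 4, 5)])"

definition Hea_minus_e :: model where
  "Hea_minus_e =
   ([0, 1, 2, 3, 4, 5, 6, 7], [(0, 1), (0, 4), (1, 6), (2, 3), (2, 6), (3, 5), (4, 7), (5, 7)], [(8, 0, 3), (9, 1, 5),
   (10, 2, 4), (11, 6, 7)])"

definition Hea_minus_v :: model where
  "Hea_minus_v =
   ([0, 1, 2, 3, 4, 5, 6, 7, 8, 9], [(0, 1), (0, 4), (0, 8), (1, 6), (2, 3), (2, 6), (3, 5), (3, 8), (4, 7), (5, 7),
   (6, 9), (7, 9)], [(10, 1, 5), (11, 2, 4), (12, 8, 9)])"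

definition Pet :: model where
  "Pet =
   ([0, 1, 2, 3, 4, 5, 6, 7, 8, 9], [(0, 1), (1, 2), (2, 3), (3, 4), (4, 0), (5, 6), (6, 7), (7, 8), (8, 9), (9, 5),
   (0, 5), (1, 8), (2, 6), (3, 9), (4, 7)], [])"

definition Hea :: model where
  "Hea =
   ([0, 1, 2, 3, 4, 5, 6, 7, 8, 9, 10, 11, 12, 13], [(0, 1), (1, 2), (2, 3), (3, 4), (4, 5), (5, 6), (6, 7), (7, 8),
   (8, 9), (9, 10), (10, 11), (11, 12), (12, 13), (13, 0), (0, 9), (1, 6), (2, 11), (3, 8), (4, 13), (5, 10), (7,
   12)], [])"

text \<open>Replacing every path by one vertex gives a graph with vertices deleted: the Petersen
  graph without the ends of an edge (\<open>K4_model\<close>) or without a vertex, and the Heawood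
  graph without a path on three vertices, without the ends of an edge, or without a vertex. The
  paths replace the vertices that have lost one neighbour; both full graphs close the list.\<close>

definition models :: "model list" where
  "models = [K4_model, Pet_minus_v, Hea_minus_P3, Hea_minus_e, Hea_minus_v, Pet, Hea]"

text \<open>Only ears between opposite subdivided edges can survive. If both of these paths are
  single vertices, the result is \<open>Pet_minus_v\<close>; if the ear starts next to a branch
  vertex on either path and both paths continue, it is \<open>Hea_minus_P3\<close>.\<close>

definition K4_model_grow :: "(pt \<times> pt) list" where
  "K4_model_grow = [(Split (4,0,2) True False, Split (7,1,3) False True), (Split (4,0,2) False True, Split (7,1,3) True False), (Split (4,0,2) False False, Split (7,1,3) False False), (Split (5,0,3) True False, Split (6,1,2) False True), (Split (5,0,3) False True, Split (6,1,2) True False), (Split (5,0,3) False False, Split (6,1,2) False False)]"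

text \<open>In a certificate the numbers \<open>d + 20\<close> and \<open>d + 40\<close> are the
  parts of path \<open>d\<close> before and after the attachment, and 99 is the ear. Several
  certificates for one pair cover different splittings.\<close>

definition K4_model_ears :: ear_data where
  "K4_model_ears =
   [(Thin 0, Thin 1, [(0, 1, [4, 2, 6], [99]), (0, 1, [5, 3, 7], [99])]), (Thin 0, Whole (6, 1, 2), [(0, 1, [5, 3, 7],
   [99, 6, 26])]), (Thin 0, Whole (7, 1, 3), [(0, 1, [4, 2, 6], [99, 7, 27])]), (Thin 1, Whole (4, 0, 2), [(0, 1, [5,
   3, 7], [24, 4, 99])]), (Thin 1, Whole (5, 0, 3), [(0, 1, [4, 2, 6], [25, 5, 99])]), (Thin 2, Thin 3, [(2, 3, [4, 0,
   5], [99]), (2, 3, [6, 1, 7], [99])]), (Thin 2, Whole (5, 0, 3), [(2, 3, [6, 1, 7], [99, 5, 45])]), (Thin 2, Whole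
   (7, 1, 3), [(2, 3, [4, 0, 5], [99, 7, 47])]), (Thin 3, Whole (4, 0, 2), [(2, 3, [6, 1, 7], [44, 4, 99])]), (Thin 3,
   Whole (6, 1, 2), [(2, 3, [4, 0, 5], [46, 6, 99])]), (Whole (4, 0, 2), Whole (5, 0, 3), [(2, 3, [6, 1, 7], [44, 4,
   99, 5, 45])]), (Whole (4, 0, 2), Whole (6, 1, 2), [(0, 1, [5, 3, 7], [24, 4, 99, 6, 26])]), (Whole (4, 0, 2), Whole
   (7, 1, 3), [(0, 1, [5, 3, 2, 6], [24, 4, 99, 7, 27]), (2, 3, [6, 1, 0, 5], [44, 4, 99, 7]), (1, 7, [0, 24, 4, 99],
   [6, 2, 3]), (2, 3, [4, 99, 7, 47], [6, 1, 0, 5]), (3, 7, [2, 4, 99], [5, 0, 1]), (0, 4, [1, 27, 7, 99], [5, 3, 2]),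
   (2, 4, [3, 7, 99], [6, 1, 0])]), (Whole (5, 0, 3), Whole (6, 1, 2), [(0, 1, [4, 2, 3, 7], [25, 5, 99, 6, 26]), (2,
   3, [4, 0, 1, 7], [6, 99, 5, 45]), (1, 6, [0, 25, 5, 99], [7, 3, 2]), (2, 3, [4, 0, 1, 7], [46, 6, 99, 5]), (2, 6,
   [3, 5, 99], [4, 0, 1]), (0, 5, [1, 26, 6, 99], [4, 2, 3]), (3, 5, [2, 6, 99], [7, 1, 0])]), (Whole (5, 0, 3), Whole
   (7, 1, 3), [(0, 1, [4, 2, 6], [25, 5, 99, 7, 27])]), (Whole (6, 1, 2), Whole (7, 1, 3), [(2, 3, [4, 0, 5], [46, 6,
   99, 7, 47])])]"

text \<open>An entry \<open>(v, A, B)\<close> proposes the edge from the outside vertex to piece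
  \<open>v\<close> as unichord. A path is split where a side may use only one of its parts, or where
  the attachment itself is the end \<open>v\<close> of the chord.\<close>

definition K4_model_claws :: claw_data where
  "K4_model_claws =
   [(Thin 0, Thin 2, Whole (7, 1, 3), [False, False, False], [(0, [2, 4], [7, 1])]), (Thin 0, Thin 3, Whole (6, 1, 2),
   [False, False, False], [(0, [3, 5], [6, 1])]), (Thin 0, Whole (6, 1, 2), Whole (7, 1, 3), [False, False, True],
   [(0, [6, 1], [7, 47, 3, 5])]), (Thin 1, Thin 2, Whole (5, 0, 3), [False, False, False], [(1, [2, 6], [5, 0])]),
   (Thin 1, Thin 3, Whole (4, 0, 2), [False, False, False], [(1, [3, 7], [4, 0])]), (Thin 1, Whole (4, 0, 2), Whole
   (5, 0, 3), [False, False, True], [(1, [4, 0], [5, 45, 3, 7])]), (Thin 2, Whole (5, 0, 3), Whole (7, 1, 3), [False,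
   False, True], [(2, [5, 3], [7, 27, 1, 6])]), (Thin 3, Whole (4, 0, 2), Whole (6, 1, 2), [False, False, True], [(3,
   [4, 2], [6, 26, 1, 7])]), (Whole (4, 0, 2), Whole (5, 0, 3), Whole (6, 1, 2), [True, False, False], [(4, [5, 0,
   24], [6, 2, 44])]), (Whole (4, 0, 2), Whole (5, 0, 3), Whole (7, 1, 3), [False, True, False], [(5, [4, 0, 25], [7,
   3, 45])]), (Whole (4, 0, 2), Whole (6, 1, 2), Whole (7, 1, 3), [False, True, False], [(6, [4, 2, 46], [7, 1,
   26])]), (Whole (5, 0, 3), Whole (6, 1, 2), Whole (7, 1, 3), [False, False, True], [(7, [5, 3, 47], [6, 1, 27])])]"

lemma K4_model_shape: "shape_ok K4_model
   [[1, 6, 7, 3, 5], [1, 6, 2, 4, 7], [0, 4, 5, 3, 7], [0, 4, 2, 5, 6]]"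
  by code_simp

lemma K4_model_ears_ok: "ears_ok K4_model K4_model_grow K4_model_ears"
  by code_simp

lemma K4_model_ears_cover: "ears_cover (flats K4_model) (map (\<lambda>(p, q, c). (p, q)) K4_model_ears) (pairs (coarse K4_model))"
  by code_simp

lemma K4_model_claws_ok: "claws_ok K4_model K4_model_claws"
  by code_simp

lemma K4_model_claws_cover: "claws_cover K4_model ([] @ map (\<lambda>(p, q, r, c). (p, q, r)) K4_model_claws) (triples (coarse K4_model))"
  by code_simp

lemma K4_model_grow_ok0:
  "relabel_ok Hea_minus_P3 (add_ear (pid (Split (4,0,2) True False)) (pid (Split (7,1,3) False True))
     (refine (Split (7,1,3) False True) (refine (Split (4,0,2) True False) K4_model))) (\<lambda>i. [1,7,4,2,0,3,6,99,47,24,5] ! nat i)"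
  by code_simp

lemma K4_model_grow_ok1:
  "relabel_ok Hea_minus_P3 (add_ear (pid (Split (4,0,2) False True)) (pid (Split (7,1,3) True False))
     (refine (Split (7,1,3) True False) (refine (Split (4,0,2) False True) K4_model))) (\<lambda>i. [0,4,7,3,1,2,5,99,44,27,6] ! nat i)"
  by code_simp

lemma K4_model_grow_ok2:
  "relabel_ok Pet_minus_v (add_ear (pid (Split (4,0,2) False False)) (pid (Split (7,1,3) False False))
     (refine (Split (7,1,3) False False) (refine (Split (4,0,2) False False) K4_model))) (\<lambda>i. [7,1,2,4,3,0,99,6,5] ! nat i)"
  by code_simp

lemma K4_model_grow_ok3:
  "relabel_ok Hea_minus_P3 (add_ear (pid (Split (5,0,3) True False)) (pid (Split (6,1,2) False True))
     (refine (Split (6,1,2) False True) (refine (Split (5,0,3) True False) K4_model))) (\<lambda>i. [1,6,5,3,0,2,7,99,46,25,4] ! nat i)"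
  by code_simp

lemma K4_model_grow_ok4:
  "relabel_ok Hea_minus_P3 (add_ear (pid (Split (5,0,3) False True)) (pid (Split (6,1,2) True False))
     (refine (Split (6,1,2) True False) (refine (Split (5,0,3) False True) K4_model))) (\<lambda>i. [0,5,6,2,1,3,4,99,45,26,7] ! nat i)"
  by code_simp

lemma K4_model_grow_ok5:
  "relabel_ok Pet_minus_v (add_ear (pid (Split (5,0,3) False False)) (pid (Split (6,1,2) False False))
     (refine (Split (6,1,2) False False) (refine (Split (5,0,3) False False) K4_model))) (\<lambda>i. [6,1,3,5,2,0,99,7,4] ! nat i)"
  by code_simp

text \<open>No ear enlarges this pattern; it grows only by a vertex attached to all three paths, see
  \<open>Pet_minus_v_exc_grow\<close>.\<close>

definition Pet_minus_v_grow :: "(pt \<times> pt) list" where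
  "Pet_minus_v_grow = []"

definition Pet_minus_v_ears :: ear_data where
  "Pet_minus_v_ears =
   [(Thin 0, Thin 1, [(0, 1, [4, 8, 5], [99])]), (Thin 0, Thin 2, [(0, 4, [1, 5, 8], [99, 2])]), (Thin 0, Thin 4, [(0,
   4, [1, 5, 8], [99])]), (Thin 0, Thin 5, [(0, 1, [4, 2, 7], [99, 5])]), (Thin 0, Whole (7, 1, 2), [(0, 1, [4, 8, 5],
   [99, 7, 27])]), (Thin 0, Whole (8, 4, 5), [(0, 4, [1, 7, 2], [99, 8, 28])]), (Thin 1, Thin 3, [(1, 5, [0, 4, 8],
   [99, 3])]), (Thin 1, Thin 4, [(0, 1, [4, 99], [6, 3, 5])]), (Thin 1, Thin 5, [(1, 5, [0, 4, 8], [99])]), (Thin 1,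
   Whole (6, 0, 3), [(0, 1, [4, 8, 5], [26, 6, 99])]), (Thin 1, Whole (8, 4, 5), [(1, 5, [0, 6, 3], [99, 8, 48])]),
   (Thin 2, Thin 3, [(2, 3, [4, 0, 6], [99])]), (Thin 2, Thin 4, [(2, 4, [3, 5, 8], [99])]), (Thin 2, Thin 5, [(2, 3,
   [4, 0, 6], [99, 5])]), (Thin 2, Whole (6, 0, 3), [(2, 3, [4, 8, 5], [99, 6, 46])]), (Thin 2, Whole (8, 4, 5), [(2,
   4, [3, 6, 0], [99, 8, 28])]), (Thin 3, Thin 4, [(2, 3, [4, 99], [7, 1, 5])]), (Thin 3, Thin 5, [(3, 5, [2, 4, 8],
   [99])]), (Thin 3, Whole (7, 1, 2), [(2, 3, [4, 0, 6], [47, 7, 99])]), (Thin 3, Whole (8, 4, 5), [(3, 5, [2, 7, 1],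
   [99, 8, 48])]), (Thin 4, Whole (6, 0, 3), [(0, 4, [1, 5, 8], [26, 6, 99])]), (Thin 4, Whole (7, 1, 2), [(2, 4, [3,
   5, 8], [47, 7, 99])]), (Thin 5, Whole (6, 0, 3), [(3, 5, [2, 4, 8], [46, 6, 99])]), (Thin 5, Whole (7, 1, 2), [(1,
   5, [0, 4, 8], [27, 7, 99])]), (Whole (6, 0, 3), Whole (7, 1, 2), [(0, 1, [4, 8, 5], [26, 6, 99, 7, 27])]), (Whole
   (6, 0, 3), Whole (8, 4, 5), [(0, 4, [1, 7, 2], [26, 6, 99, 8, 28])]), (Whole (7, 1, 2), Whole (8, 4, 5), [(1, 5,
   [0, 6, 3], [27, 7, 99, 8, 48])])]"

definition Pet_minus_v_claws :: claw_data where
  "Pet_minus_v_claws =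
   [(Thin 0, Thin 3, Whole (7, 1, 2), [False, False, False], [(0, [3, 6], [7, 1])]), (Thin 0, Thin 3, Whole (8, 4, 5),
   [False, False, False], [(0, [3, 6], [8, 4])]), (Thin 0, Whole (7, 1, 2), Whole (8, 4, 5), [False, False, False],
   [(0, [7, 1], [8, 4])]), (Thin 1, Thin 2, Whole (6, 0, 3), [False, False, False], [(1, [2, 7], [6, 0])]), (Thin 1,
   Thin 2, Whole (8, 4, 5), [False, False, False], [(1, [2, 7], [8, 5])]), (Thin 1, Whole (6, 0, 3), Whole (8, 4, 5),
   [False, False, False], [(1, [6, 0], [8, 5])]), (Thin 2, Whole (6, 0, 3), Whole (8, 4, 5), [False, False, False],
   [(2, [6, 3], [8, 4])]), (Thin 3, Whole (7, 1, 2), Whole (8, 4, 5), [False, False, False], [(3, [7, 2], [8, 5])]),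
   (Thin 4, Thin 5, Whole (6, 0, 3), [False, False, False], [(4, [5, 8], [6, 0])]), (Thin 4, Thin 5, Whole (7, 1, 2),
   [False, False, False], [(4, [5, 8], [7, 2])]), (Thin 4, Whole (6, 0, 3), Whole (7, 1, 2), [False, False, False],
   [(4, [6, 0], [7, 2])]), (Thin 5, Whole (6, 0, 3), Whole (7, 1, 2), [False, False, False], [(5, [6, 3], [7, 1])])]"

lemma Pet_minus_v_shape: "shape_ok Pet_minus_v
   [[1, 5, 7, 2, 4, 8], [0, 4, 6, 3, 5, 8], [0, 1, 6, 3, 2, 7]]"
  by code_simp

lemma Pet_minus_v_ears_ok: "ears_ok Pet_minus_v Pet_minus_v_grow Pet_minus_v_ears"
  by code_simp

lemma Pet_minus_v_ears_cover: "ears_cover (flats Pet_minus_v) (map (\<lambda>(p, q, c). (p, q)) Pet_minus_v_ears) (pairs (coarse Pet_minus_v))"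
  by code_simp

lemma Pet_minus_v_claws_ok: "claws_ok Pet_minus_v Pet_minus_v_claws"
  by code_simp

lemma Pet_minus_v_claws_cover: "claws_cover Pet_minus_v ([(Whole (6,0,3), Whole (7,1,2), Whole (8,4,5))] @ map (\<lambda>(p, q, r, c). (p, q, r)) Pet_minus_v_claws) (triples (coarse Pet_minus_v))"
  by code_simp

definition Pet_minus_v_exc :: "cert list" where
  "Pet_minus_v_exc =
   [(0, 1, [4, 2, 3, 5], [26, 6, 99, 7, 27]), (2, 3, [4, 0, 1, 5], [7, 99, 6, 46]), (1, 7, [0, 26, 6, 99], [5, 3, 2]),
   (2, 3, [4, 0, 1, 5], [47, 7, 99, 6]), (1, 5, [0, 4, 2, 3], [7, 99, 8, 48]), (5, 8, [1, 0, 4], [3, 6, 99]), (2, 7,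
   [3, 6, 99], [4, 0, 1]), (0, 4, [1, 5, 3, 2], [6, 99, 8, 28]), (4, 8, [0, 1, 5], [2, 7, 99]), (0, 6, [1, 27, 7, 99],
   [4, 2, 3]), (3, 6, [2, 7, 99], [5, 1, 0]), (0, 6, [1, 5, 3], [4, 28, 8, 99]), (1, 7, [0, 4, 2], [5, 8, 99])]"

text \<open>If all three paths are single vertices, the new vertex completes the Petersen graph. In
  the other two cases each path has further vertices on one side of the attachment, and the result
  is the Heawood graph without a vertex.\<close>

definition Pet_minus_v_exc_grow :: "pt list list" where
  "Pet_minus_v_exc_grow = [[Split (6,0,3) True False, Split (7,1,2) False True, Split (8,4,5) False True], [Split (6,0,3) False True, Split (7,1,2) True False, Split (8,4,5) True False], [Split (6,0,3) False False, Split (7,1,2) False False, Split (8,4,5) False False]]"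

lemma Pet_minus_v_exc_ok:
  "exc_variants Pet_minus_v Pet_minus_v_exc Pet_minus_v_exc_grow (variants [True, True, True] [Whole (6,0,3), Whole (7,1,2), Whole (8,4,5)])"
  by code_simp

lemma Pet_minus_v_exc_grow_ok0:
  "relabel_ok Hea_minus_v (add_vertex (map pid [Split (6,0,3) True False, Split (7,1,2) False True, Split (8,4,5) False True])
     (fold refine [Split (6,0,3) True False, Split (7,1,2) False True, Split (8,4,5) False True] Pet_minus_v)) (\<lambda>i. [99,8,2,3,7,5,4,1,6,0,48,47,26] ! nat i)"
  by code_simp

lemma Pet_minus_v_exc_grow_ok1:
  "relabel_ok Hea_minus_v (add_vertex (map pid [Split (6,0,3) False True, Split (7,1,2) True False, Split (8,4,5) True False])
     (fold refine [Split (6,0,3) False True, Split (7,1,2) True False, Split (8,4,5) True False] Pet_minus_v)) (\<lambda>i. [99,8,1,0,7,4,5,2,6,3,28,27,46] ! nat i)"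
  by code_simp

lemma Pet_minus_v_exc_grow_ok2:
  "relabel_ok Pet (add_vertex (map pid [Split (6,0,3) False False, Split (7,1,2) False False, Split (8,4,5) False False])
     (fold refine [Split (6,0,3) False False, Split (7,1,2) False False, Split (8,4,5) False False] Pet_minus_v)) (\<lambda>i. [99,8,4,0,6,7,2,3,5,1] ! nat i)"
  by code_simp

text \<open>Both attached paths are single vertices; the ear becomes a path of
  \<open>Hea_minus_e\<close>.\<close>

definition Hea_minus_P3_grow :: "(pt \<times> pt) list" where
  "Hea_minus_P3_grow = [(Split (7,1,2) False False, Split (10,4,5) False False), (Split (8,1,5) False False, Split (9,2,4) False False)]"

definition Hea_minus_P3_ears :: ear_data where
  "Hea_minus_P3_ears =
   [(Thin 0, Thin 1, [(0, 1, [4, 9, 2, 7], [99])]), (Thin 0, Thin 2, [(0, 1, [4, 10, 5, 8], [99, 2, 7])]), (Thin 0,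
   Thin 4, [(0, 4, [1, 8, 5, 10], [99])]), (Thin 0, Thin 5, [(0, 1, [4, 9, 2, 7], [99, 5, 8])]), (Thin 0, Whole (7, 1,
   2), [(0, 1, [4, 10, 5, 8], [99, 7, 27])]), (Thin 0, Whole (8, 1, 5), [(0, 1, [4, 9, 2, 7], [99, 8, 28])]), (Thin 0,
   Whole (9, 2, 4), [(0, 4, [1, 8, 5, 10], [99, 9, 49])]), (Thin 0, Whole (10, 4, 5), [(0, 4, [1, 7, 2, 9], [99, 10,
   30])]), (Thin 1, Thin 3, [(2, 3, [7, 1, 99], [9, 4, 10, 5])]), (Thin 1, Thin 4, [(0, 1, [4, 99], [6, 3, 2, 7]), (0,
   1, [4, 99], [6, 3, 5, 8])]), (Thin 1, Whole (6, 0, 3), [(0, 1, [4, 9, 2, 7], [26, 6, 99])]), (Thin 1, Whole (9, 2,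
   4), [(0, 1, [4, 49, 9, 99], [6, 3, 5, 8])]), (Thin 1, Whole (10, 4, 5), [(0, 1, [4, 30, 10, 99], [6, 3, 2, 7])]),
   (Thin 2, Thin 3, [(2, 3, [7, 1, 0, 6], [99])]), (Thin 2, Thin 5, [(2, 3, [7, 1, 0, 6], [99, 5]), (2, 3, [9, 4, 0,
   6], [99, 5])]), (Thin 2, Whole (6, 0, 3), [(2, 3, [7, 1, 8, 5], [99, 6, 46])]), (Thin 2, Whole (8, 1, 5), [(2, 3,
   [9, 4, 0, 6], [99, 8, 48, 5])]), (Thin 2, Whole (10, 4, 5), [(2, 3, [7, 1, 0, 6], [99, 10, 50, 5])]), (Thin 3, Thin
   4, [(2, 3, [7, 1, 8, 5], [9, 4, 99])]), (Thin 3, Thin 5, [(3, 5, [2, 9, 4, 10], [99])]), (Thin 3, Whole (7, 1, 2),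
   [(2, 3, [9, 4, 0, 6], [47, 7, 99])]), (Thin 3, Whole (8, 1, 5), [(3, 5, [2, 9, 4, 10], [99, 8, 48])]), (Thin 3,
   Whole (9, 2, 4), [(2, 3, [7, 1, 0, 6], [29, 9, 99])]), (Thin 3, Whole (10, 4, 5), [(3, 5, [2, 7, 1, 8], [99, 10,
   50])]), (Thin 4, Whole (6, 0, 3), [(0, 4, [1, 8, 5, 10], [26, 6, 99])]), (Thin 4, Whole (7, 1, 2), [(0, 1, [4, 99,
   7, 27], [6, 3, 5, 8])]), (Thin 4, Whole (8, 1, 5), [(0, 1, [4, 99, 8, 28], [6, 3, 2, 7])]), (Thin 5, Whole (6, 0,
   3), [(3, 5, [2, 9, 4, 10], [46, 6, 99])]), (Thin 5, Whole (7, 1, 2), [(2, 3, [9, 4, 0, 6], [47, 7, 99, 5])]), (Thin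
   5, Whole (9, 2, 4), [(2, 3, [7, 1, 0, 6], [29, 9, 99, 5])]), (Whole (6, 0, 3), Whole (7, 1, 2), [(0, 1, [4, 10, 5,
   8], [26, 6, 99, 7, 27])]), (Whole (6, 0, 3), Whole (8, 1, 5), [(0, 1, [4, 9, 2, 7], [26, 6, 99, 8, 28])]), (Whole
   (6, 0, 3), Whole (9, 2, 4), [(0, 4, [1, 8, 5, 10], [26, 6, 99, 9, 49])]), (Whole (6, 0, 3), Whole (10, 4, 5), [(0,
   4, [1, 7, 2, 9], [26, 6, 99, 10, 30])]), (Whole (7, 1, 2), Whole (8, 1, 5), [(2, 3, [9, 4, 0, 6], [47, 7, 99, 8,
   48, 5])]), (Whole (7, 1, 2), Whole (9, 2, 4), [(0, 1, [4, 49, 9, 99, 7, 27], [6, 3, 5, 8])]), (Whole (7, 1, 2),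
   Whole (10, 4, 5), [(0, 1, [4, 30, 10, 99, 7, 27], [6, 3, 5, 8]), (2, 3, [9, 4, 0, 6], [47, 7, 99, 10, 5]), (0, 4,
   [1, 27, 7, 99, 10], [6, 3, 2, 9]), (3, 5, [2, 7, 99, 10], [6, 0, 1, 8])]), (Whole (8, 1, 5), Whole (9, 2, 4), [(0,
   1, [4, 49, 9, 99, 8, 28], [6, 3, 2, 7]), (2, 3, [7, 1, 0, 6], [9, 99, 8, 48, 5]), (0, 4, [1, 8, 99, 9, 49], [6, 3,
   5, 10]), (1, 8, [0, 4, 10, 5], [7, 2, 9, 99])]), (Whole (8, 1, 5), Whole (10, 4, 5), [(0, 1, [4, 30, 10, 99, 8,
   28], [6, 3, 2, 7])]), (Whole (9, 2, 4), Whole (10, 4, 5), [(2, 3, [7, 1, 0, 6], [29, 9, 99, 10, 50, 5])])]"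

definition Hea_minus_P3_claws :: claw_data where
  "Hea_minus_P3_claws =
   [(Thin 0, Thin 2, Whole (8, 1, 5), [False, False, False], [(0, [2, 9, 4], [8, 1])]), (Thin 0, Thin 2, Whole (10, 4,
   5), [False, False, False], [(0, [2, 3, 6], [10, 4])]), (Thin 0, Thin 3, Whole (7, 1, 2), [False, False, False],
   [(0, [3, 6], [7, 1])]), (Thin 0, Thin 3, Whole (8, 1, 5), [False, False, False], [(0, [3, 6], [8, 1])]), (Thin 0,
   Thin 3, Whole (9, 2, 4), [False, False, False], [(0, [3, 6], [9, 4])]), (Thin 0, Thin 3, Whole (10, 4, 5), [False,
   False, False], [(0, [3, 6], [10, 4])]), (Thin 0, Thin 5, Whole (7, 1, 2), [False, False, False], [(0, [5, 10, 4],
   [7, 1])]), (Thin 0, Thin 5, Whole (9, 2, 4), [False, False, False], [(0, [5, 8, 1], [9, 4])]), (Thin 0, Whole (7,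
   1, 2), Whole (8, 1, 5), [False, False, True], [(0, [7, 1], [8, 48, 5, 3, 6])]), (Thin 0, Whole (7, 1, 2), Whole (9,
   2, 4), [False, False, False], [(0, [7, 1], [9, 4])]), (Thin 0, Whole (7, 1, 2), Whole (10, 4, 5), [False, False,
   False], [(0, [7, 1], [10, 4])]), (Thin 0, Whole (8, 1, 5), Whole (9, 2, 4), [False, False, False], [(0, [8, 1], [9,
   4])]), (Thin 0, Whole (8, 1, 5), Whole (10, 4, 5), [False, False, False], [(0, [8, 1], [10, 4])]), (Thin 0, Whole
   (9, 2, 4), Whole (10, 4, 5), [False, False, True], [(0, [9, 4], [10, 50, 5, 3, 6])]), (Thin 1, Thin 2, Whole (6, 0,
   3), [False, False, False], [(1, [2, 7], [6, 0])]), (Thin 1, Thin 2, Whole (10, 4, 5), [False, False, False], [(1,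
   [2, 7], [10, 4, 0])]), (Thin 1, Thin 3, Whole (9, 2, 4), [False, False, False], [(3, [1, 0, 6], [9, 2])]), (Thin 1,
   Thin 3, Whole (10, 4, 5), [False, False, False], [(3, [1, 0, 6], [10, 5])]), (Thin 1, Thin 5, Whole (6, 0, 3),
   [False, False, False], [(1, [5, 8], [6, 0])]), (Thin 1, Thin 5, Whole (9, 2, 4), [False, False, False], [(1, [5,
   8], [9, 2, 7])]), (Thin 1, Whole (6, 0, 3), Whole (9, 2, 4), [False, False, False], [(1, [6, 0], [9, 2, 7])]),
   (Thin 1, Whole (6, 0, 3), Whole (10, 4, 5), [False, False, False], [(1, [6, 0], [10, 5, 8])]), (Thin 1, Whole (9,
   2, 4), Whole (10, 4, 5), [False, False, False], [(1, [9, 2, 7], [10, 5, 8])]), (Thin 2, Thin 4, Whole (6, 0, 3),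
   [False, False, False], [(2, [4, 9], [6, 3])]), (Thin 2, Thin 4, Whole (8, 1, 5), [False, False, False], [(2, [4,
   9], [8, 1, 7])]), (Thin 2, Whole (6, 0, 3), Whole (8, 1, 5), [False, False, False], [(2, [6, 3], [8, 1, 7])]),
   (Thin 2, Whole (6, 0, 3), Whole (10, 4, 5), [False, False, False], [(2, [6, 3], [10, 4, 9])]), (Thin 2, Whole (8,
   1, 5), Whole (10, 4, 5), [False, False, False], [(2, [8, 1, 7], [10, 4, 9])]), (Thin 3, Thin 4, Whole (7, 1, 2),
   [False, False, False], [(3, [4, 0, 6], [7, 2])]), (Thin 3, Thin 4, Whole (8, 1, 5), [False, False, False], [(3, [4,
   0, 6], [8, 5])]), (Thin 3, Whole (7, 1, 2), Whole (8, 1, 5), [False, False, False], [(3, [7, 2], [8, 5])]), (Thin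
   3, Whole (7, 1, 2), Whole (9, 2, 4), [False, False, True], [(3, [7, 2], [9, 49, 4, 0, 6])]), (Thin 3, Whole (7, 1,
   2), Whole (10, 4, 5), [False, False, False], [(3, [7, 2], [10, 5])]), (Thin 3, Whole (8, 1, 5), Whole (9, 2, 4),
   [False, False, False], [(3, [8, 5], [9, 2])]), (Thin 3, Whole (8, 1, 5), Whole (10, 4, 5), [False, False, True],
   [(3, [8, 5], [10, 30, 4, 0, 6])]), (Thin 3, Whole (9, 2, 4), Whole (10, 4, 5), [False, False, False], [(3, [9, 2],
   [10, 5])]), (Thin 4, Thin 5, Whole (6, 0, 3), [False, False, False], [(4, [5, 10], [6, 0])]), (Thin 4, Thin 5,
   Whole (7, 1, 2), [False, False, False], [(4, [5, 10], [7, 1, 0])]), (Thin 4, Whole (6, 0, 3), Whole (7, 1, 2),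
   [False, False, False], [(4, [6, 0], [7, 2, 9])]), (Thin 4, Whole (6, 0, 3), Whole (8, 1, 5), [False, False, False],
   [(4, [6, 0], [8, 5, 10])]), (Thin 4, Whole (7, 1, 2), Whole (8, 1, 5), [False, False, False], [(4, [7, 2, 9], [8,
   5, 10])]), (Thin 5, Whole (6, 0, 3), Whole (7, 1, 2), [False, False, False], [(5, [6, 3], [7, 1, 8])]), (Thin 5,
   Whole (6, 0, 3), Whole (9, 2, 4), [False, False, False], [(5, [6, 3], [9, 4, 10])]), (Thin 5, Whole (7, 1, 2),
   Whole (9, 2, 4), [False, False, False], [(5, [7, 1, 8], [9, 4, 10])]), (Whole (6, 0, 3), Whole (7, 1, 2), Whole (8,
   1, 5), [False, False, True], [(8, [6, 3, 5, 48], [7, 1, 28])]), (Whole (6, 0, 3), Whole (7, 1, 2), Whole (9, 2, 4),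
   [False, False, True], [(9, [6, 0, 4, 49], [7, 2, 29])]), (Whole (6, 0, 3), Whole (7, 1, 2), Whole (10, 4, 5),
   [True, False, False], [(6, [7, 1, 0, 26], [10, 5, 3, 46])]), (Whole (6, 0, 3), Whole (8, 1, 5), Whole (9, 2, 4),
   [True, False, False], [(6, [8, 1, 0, 26], [9, 2, 3, 46])]), (Whole (6, 0, 3), Whole (8, 1, 5), Whole (10, 4, 5),
   [False, False, True], [(10, [6, 0, 4, 30], [8, 5, 50])]), (Whole (6, 0, 3), Whole (9, 2, 4), Whole (10, 4, 5),
   [False, False, True], [(10, [6, 3, 5, 50], [9, 4, 30])]), (Whole (7, 1, 2), Whole (8, 1, 5), Whole (9, 2, 4),
   [False, False, True], [(9, [7, 2, 29], [8, 5, 10, 4, 49])]), (Whole (7, 1, 2), Whole (8, 1, 5), Whole (10, 4, 5),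
   [False, False, True], [(10, [7, 2, 9, 4, 30], [8, 5, 50])]), (Whole (7, 1, 2), Whole (9, 2, 4), Whole (10, 4, 5),
   [False, False, True], [(10, [7, 1, 8, 5, 50], [9, 4, 30])]), (Whole (8, 1, 5), Whole (9, 2, 4), Whole (10, 4, 5),
   [False, False, True], [(10, [8, 5, 50], [9, 4, 30])])]"

lemma Hea_minus_P3_shape: "shape_ok Hea_minus_P3
   [[1, 7, 2, 8, 5, 9, 4, 10], [0, 4, 6, 3, 5, 8, 9, 10], [0, 4, 6, 3, 2, 7, 9, 10], [0, 1, 6, 3, 5, 7, 8, 10], [0, 1,
   6, 3, 2, 7, 8, 9]]"
  by code_simp

lemma Hea_minus_P3_ears_ok: "ears_ok Hea_minus_P3 Hea_minus_P3_grow Hea_minus_P3_ears"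
  by code_simp

lemma Hea_minus_P3_ears_cover: "ears_cover (flats Hea_minus_P3) (map (\<lambda>(p, q, c). (p, q)) Hea_minus_P3_ears) (pairs (coarse Hea_minus_P3))"
  by code_simp

lemma Hea_minus_P3_claws_ok: "claws_ok Hea_minus_P3 Hea_minus_P3_claws"
  by code_simp

lemma Hea_minus_P3_claws_cover: "claws_cover Hea_minus_P3 ([] @ map (\<lambda>(p, q, r, c). (p, q, r)) Hea_minus_P3_claws) (triples (coarse Hea_minus_P3))"
  by code_simp

lemma Hea_minus_P3_grow_ok0:
  "relabel_ok Hea_minus_e (add_ear (pid (Split (7,1,2) False False)) (pid (Split (10,4,5) False False))
     (refine (Split (10,4,5) False False) (refine (Split (7,1,2) False False) Hea_minus_P3))) (\<lambda>i. [10,4,1,7,5,2,0,3,99,9,8,6] ! nat i)"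
  by code_simp

lemma Hea_minus_P3_grow_ok1:
  "relabel_ok Hea_minus_e (add_ear (pid (Split (8,1,5) False False)) (pid (Split (9,2,4) False False))
     (refine (Split (9,2,4) False False) (refine (Split (8,1,5) False False) Hea_minus_P3))) (\<lambda>i. [9,2,5,8,4,1,3,0,99,7,10,6] ! nat i)"
  by code_simp

text \<open>Again both attached paths are single vertices, and the ear becomes a path of
  \<open>Hea_minus_v\<close>.\<close>

definition Hea_minus_e_grow :: "(pt \<times> pt) list" where
  "Hea_minus_e_grow = [(Split (8,0,3) False False, Split (11,6,7) False False), (Split (9,1,5) False False, Split (10,2,4) False False)]"

definition Hea_minus_e_ears :: ear_data where
  "Hea_minus_e_ears =
   [(Thin 0, Thin 1, [(0, 1, [4, 10, 2, 6], [99])]), (Thin 0, Thin 2, [(0, 1, [4, 7, 5, 9], [99, 2, 6])]), (Thin 0,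
   Thin 4, [(0, 4, [1, 9, 5, 7], [99])]), (Thin 0, Thin 5, [(0, 1, [4, 10, 2, 6], [99, 5, 9])]), (Thin 0, Thin 6, [(0,
   1, [4, 7, 5, 9], [99, 6])]), (Thin 0, Thin 7, [(0, 4, [1, 6, 2, 10], [99, 7])]), (Thin 0, Whole (9, 1, 5), [(0, 1,
   [4, 10, 2, 6], [99, 9, 29])]), (Thin 0, Whole (10, 2, 4), [(0, 4, [1, 9, 5, 7], [99, 10, 50])]), (Thin 0, Whole
   (11, 6, 7), [(0, 1, [4, 7, 5, 9], [99, 11, 31, 6]), (0, 4, [1, 6, 2, 10], [99, 11, 7]), (0, 1, [8, 3, 5, 9], [99,
   11, 6])]), (Thin 1, Thin 2, [(1, 6, [0, 4, 7, 11], [99, 2])]), (Thin 1, Thin 3, [(0, 1, [4, 7, 11, 6], [8, 3,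
   99])]), (Thin 1, Thin 4, [(0, 1, [4, 99], [8, 3, 2, 6])]), (Thin 1, Thin 6, [(1, 6, [0, 8, 3, 2], [99])]), (Thin 1,
   Thin 7, [(0, 1, [4, 7, 99], [8, 3, 2, 6])]), (Thin 1, Whole (8, 0, 3), [(0, 1, [4, 10, 2, 6], [28, 8, 99])]), (Thin
   1, Whole (10, 2, 4), [(0, 1, [4, 50, 10, 99], [8, 3, 2, 6]), (1, 6, [0, 4, 7, 11], [99, 10, 2]), (0, 1, [4, 10,
   99], [8, 3, 5, 9])]), (Thin 1, Whole (11, 6, 7), [(1, 6, [0, 8, 3, 2], [99, 11, 31])]), (Thin 2, Thin 3, [(2, 3,
   [6, 1, 0, 8], [99])]), (Thin 2, Thin 5, [(2, 3, [6, 1, 0, 8], [99, 5])]), (Thin 2, Thin 6, [(2, 6, [3, 8, 0, 1],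
   [99])]), (Thin 2, Thin 7, [(2, 3, [6, 1, 0, 8], [99, 7, 5])]), (Thin 2, Whole (8, 0, 3), [(2, 3, [6, 1, 9, 5], [99,
   8, 48])]), (Thin 2, Whole (9, 1, 5), [(1, 6, [0, 4, 7, 11], [29, 9, 99, 2])]), (Thin 2, Whole (11, 6, 7), [(2, 6,
   [3, 8, 0, 1], [99, 11, 31])]), (Thin 3, Thin 4, [(0, 4, [1, 6, 11, 7], [8, 3, 99])]), (Thin 3, Thin 5, [(3, 5, [2,
   10, 4, 7], [99])]), (Thin 3, Thin 6, [(2, 3, [6, 99], [10, 4, 0, 8])]), (Thin 3, Thin 7, [(3, 5, [2, 6, 1, 9], [99,
   7])]), (Thin 3, Whole (9, 1, 5), [(3, 5, [2, 10, 4, 7], [99, 9, 49])]), (Thin 3, Whole (10, 2, 4), [(2, 3, [6, 1,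
   0, 8], [30, 10, 99])]), (Thin 3, Whole (11, 6, 7), [(2, 3, [6, 31, 11, 99], [10, 4, 0, 8])]), (Thin 4, Thin 5, [(4,
   7, [0, 1, 6, 11], [99, 5])]), (Thin 4, Thin 6, [(0, 1, [4, 99, 6], [8, 3, 5, 9])]), (Thin 4, Thin 7, [(4, 7, [0, 8,
   3, 5], [99])]), (Thin 4, Whole (8, 0, 3), [(0, 4, [1, 9, 5, 7], [28, 8, 99])]), (Thin 4, Whole (9, 1, 5), [(0, 1,
   [4, 99, 9, 29], [8, 3, 2, 6])]), (Thin 4, Whole (11, 6, 7), [(4, 7, [0, 8, 3, 5], [99, 11, 51])]), (Thin 5, Thin 6,
   [(1, 6, [0, 4, 10, 2], [9, 5, 99])]), (Thin 5, Thin 7, [(5, 7, [3, 8, 0, 4], [99])]), (Thin 5, Whole (8, 0, 3),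
   [(3, 5, [2, 10, 4, 7], [48, 8, 99])]), (Thin 5, Whole (10, 2, 4), [(2, 3, [6, 1, 0, 8], [30, 10, 99, 5])]), (Thin
   5, Whole (11, 6, 7), [(5, 7, [3, 8, 0, 4], [99, 11, 51])]), (Thin 6, Whole (8, 0, 3), [(0, 1, [4, 7, 5, 9], [28, 8,
   99, 6])]), (Thin 6, Whole (9, 1, 5), [(1, 6, [0, 8, 3, 2], [29, 9, 99])]), (Thin 6, Whole (10, 2, 4), [(2, 6, [3,
   8, 0, 1], [30, 10, 99])]), (Thin 7, Whole (8, 0, 3), [(0, 4, [1, 6, 2, 10], [28, 8, 99, 7])]), (Thin 7, Whole (9,
   1, 5), [(5, 7, [3, 8, 0, 4], [49, 9, 99])]), (Thin 7, Whole (10, 2, 4), [(4, 7, [0, 8, 3, 5], [50, 10, 99])]),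
   (Whole (8, 0, 3), Whole (9, 1, 5), [(0, 1, [4, 10, 2, 6], [28, 8, 99, 9, 29])]), (Whole (8, 0, 3), Whole (10, 2,
   4), [(0, 4, [1, 9, 5, 7], [28, 8, 99, 10, 50])]), (Whole (8, 0, 3), Whole (11, 6, 7), [(0, 1, [4, 7, 5, 9], [28, 8,
   99, 11, 31, 6]), (0, 4, [1, 6, 2, 10], [28, 8, 99, 11, 7]), (1, 6, [0, 28, 8, 99, 11], [9, 5, 3, 2]), (2, 6, [3, 8,
   99, 11], [10, 4, 0, 1])]), (Whole (9, 1, 5), Whole (10, 2, 4), [(0, 1, [4, 50, 10, 99, 9, 29], [8, 3, 2, 6]), (1,
   6, [0, 4, 7, 11], [29, 9, 99, 10, 2]), (0, 4, [1, 29, 9, 99, 10], [8, 3, 5, 7]), (2, 3, [6, 1, 0, 8], [10, 99, 9,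
   5])]), (Whole (9, 1, 5), Whole (11, 6, 7), [(1, 6, [0, 8, 3, 2], [29, 9, 99, 11, 31])]), (Whole (10, 2, 4), Whole
   (11, 6, 7), [(2, 6, [3, 8, 0, 1], [30, 10, 99, 11, 31])])]"

definition Hea_minus_e_claws :: claw_data where
  "Hea_minus_e_claws =
   [(Thin 0, Thin 2, Whole (9, 1, 5), [False, False, False], [(0, [2, 10, 4], [9, 1])]), (Thin 0, Thin 2, Whole (11,
   6, 7), [False, False, False], [(2, [0, 8, 3], [11, 6])]), (Thin 0, Thin 3, Whole (9, 1, 5), [False, False, False],
   [(0, [3, 8], [9, 1])]), (Thin 0, Thin 3, Whole (10, 2, 4), [False, False, False], [(0, [3, 8], [10, 4])]), (Thin 0,
   Thin 3, Whole (11, 6, 7), [False, False, False], [(0, [3, 8], [11, 6, 1])]), (Thin 0, Thin 5, Whole (10, 2, 4),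
   [False, False, False], [(0, [5, 9, 1], [10, 4])]), (Thin 0, Thin 5, Whole (11, 6, 7), [False, False, False], [(5,
   [0, 8, 3], [11, 7])]), (Thin 0, Whole (9, 1, 5), Whole (10, 2, 4), [False, False, False], [(0, [9, 1], [10, 4])]),
   (Thin 0, Whole (9, 1, 5), Whole (11, 6, 7), [False, False, False], [(0, [9, 1], [11, 7, 4])]), (Thin 0, Whole (10,
   2, 4), Whole (11, 6, 7), [False, False, False], [(0, [10, 4], [11, 6, 1])]), (Thin 1, Thin 3, Whole (10, 2, 4),
   [False, False, False], [(3, [1, 0, 8], [10, 2])]), (Thin 1, Thin 3, Whole (11, 6, 7), [False, False, False], [(1,
   [3, 8, 0], [11, 6])]), (Thin 1, Thin 5, Whole (8, 0, 3), [False, False, False], [(1, [5, 9], [8, 0])]), (Thin 1,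
   Thin 5, Whole (10, 2, 4), [False, False, False], [(1, [5, 9], [10, 2, 6])]), (Thin 1, Thin 5, Whole (11, 6, 7),
   [False, False, False], [(1, [5, 9], [11, 6])]), (Thin 1, Thin 7, Whole (8, 0, 3), [False, False, False], [(1, [7,
   11, 6], [8, 0])]), (Thin 1, Thin 7, Whole (10, 2, 4), [False, False, False], [(7, [1, 9, 5], [10, 4])]), (Thin 1,
   Whole (8, 0, 3), Whole (10, 2, 4), [False, False, False], [(1, [8, 0], [10, 2, 6])]), (Thin 1, Whole (8, 0, 3),
   Whole (11, 6, 7), [False, False, False], [(1, [8, 0], [11, 6])]), (Thin 1, Whole (10, 2, 4), Whole (11, 6, 7),
   [False, False, False], [(1, [10, 4, 0], [11, 6])]), (Thin 2, Thin 4, Whole (8, 0, 3), [False, False, False], [(2,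
   [4, 10], [8, 3])]), (Thin 2, Thin 4, Whole (9, 1, 5), [False, False, False], [(2, [4, 10], [9, 1, 6])]), (Thin 2,
   Thin 4, Whole (11, 6, 7), [False, False, False], [(2, [4, 10], [11, 6])]), (Thin 2, Thin 7, Whole (8, 0, 3),
   [False, False, False], [(2, [7, 11, 6], [8, 3])]), (Thin 2, Thin 7, Whole (9, 1, 5), [False, False, False], [(7,
   [2, 10, 4], [9, 5])]), (Thin 2, Whole (8, 0, 3), Whole (9, 1, 5), [False, False, False], [(2, [8, 3], [9, 1, 6])]),
   (Thin 2, Whole (8, 0, 3), Whole (11, 6, 7), [False, False, False], [(2, [8, 3], [11, 6])]), (Thin 2, Whole (9, 1,
   5), Whole (11, 6, 7), [False, False, False], [(2, [9, 5, 3], [11, 6])]), (Thin 3, Thin 4, Whole (9, 1, 5), [False,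
   False, False], [(3, [4, 0, 8], [9, 5])]), (Thin 3, Thin 4, Whole (11, 6, 7), [False, False, False], [(4, [3, 8, 0],
   [11, 7])]), (Thin 3, Whole (9, 1, 5), Whole (10, 2, 4), [False, False, False], [(3, [9, 5], [10, 2])]), (Thin 3,
   Whole (9, 1, 5), Whole (11, 6, 7), [False, False, False], [(3, [9, 5], [11, 6, 2])]), (Thin 3, Whole (10, 2, 4),
   Whole (11, 6, 7), [False, False, False], [(3, [10, 2], [11, 7, 5])]), (Thin 4, Thin 6, Whole (8, 0, 3), [False,
   False, False], [(4, [6, 2, 10], [8, 0])]), (Thin 4, Thin 6, Whole (9, 1, 5), [False, False, False], [(6, [4, 10,
   2], [9, 1])]), (Thin 4, Whole (8, 0, 3), Whole (9, 1, 5), [False, False, False], [(4, [8, 0], [9, 5, 7])]), (Thin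
   4, Whole (8, 0, 3), Whole (11, 6, 7), [False, False, False], [(4, [8, 0], [11, 7])]), (Thin 4, Whole (9, 1, 5),
   Whole (11, 6, 7), [False, False, False], [(4, [9, 1, 0], [11, 7])]), (Thin 5, Thin 6, Whole (8, 0, 3), [False,
   False, False], [(5, [6, 1, 9], [8, 3])]), (Thin 5, Thin 6, Whole (10, 2, 4), [False, False, False], [(6, [5, 9, 1],
   [10, 2])]), (Thin 5, Whole (8, 0, 3), Whole (10, 2, 4), [False, False, False], [(5, [8, 3], [10, 4, 7])]), (Thin 5,
   Whole (8, 0, 3), Whole (11, 6, 7), [False, False, False], [(5, [8, 3], [11, 7])]), (Thin 5, Whole (10, 2, 4), Whole
   (11, 6, 7), [False, False, False], [(5, [10, 2, 3], [11, 7])]), (Thin 6, Thin 7, Whole (8, 0, 3), [False, False,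
   False], [(6, [7, 11], [8, 0, 1])]), (Thin 6, Thin 7, Whole (9, 1, 5), [False, False, False], [(6, [7, 11], [9,
   1])]), (Thin 6, Thin 7, Whole (10, 2, 4), [False, False, False], [(6, [7, 11], [10, 2])]), (Thin 6, Whole (8, 0,
   3), Whole (9, 1, 5), [False, False, False], [(6, [8, 3, 2], [9, 1])]), (Thin 6, Whole (8, 0, 3), Whole (10, 2, 4),
   [False, False, False], [(6, [8, 0, 1], [10, 2])]), (Thin 6, Whole (9, 1, 5), Whole (10, 2, 4), [False, False,
   False], [(6, [9, 1], [10, 2])]), (Thin 7, Whole (8, 0, 3), Whole (9, 1, 5), [False, False, False], [(7, [8, 0, 4],
   [9, 5])]), (Thin 7, Whole (8, 0, 3), Whole (10, 2, 4), [False, False, False], [(7, [8, 3, 5], [10, 4])]), (Thin 7,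
   Whole (9, 1, 5), Whole (10, 2, 4), [False, False, False], [(7, [9, 5], [10, 4])]), (Whole (8, 0, 3), Whole (9, 1,
   5), Whole (10, 2, 4), [True, False, False], [(8, [9, 1, 0, 28], [10, 2, 3, 48])]), (Whole (8, 0, 3), Whole (9, 1,
   5), Whole (11, 6, 7), [False, True, False], [(9, [8, 0, 1, 29], [11, 7, 5, 49])]), (Whole (8, 0, 3), Whole (10, 2,
   4), Whole (11, 6, 7), [False, True, False], [(10, [8, 0, 4, 50], [11, 6, 2, 30])]), (Whole (9, 1, 5), Whole (10, 2,
   4), Whole (11, 6, 7), [False, False, True], [(11, [9, 1, 6, 31], [10, 4, 7, 51])])]"

lemma Hea_minus_e_shape: "shape_ok Hea_minus_e
   [[1, 6, 2, 9, 5, 7, 4, 10, 11], [0, 4, 7, 8, 3, 2, 6, 10, 11], [0, 1, 6, 8, 3, 5, 7, 9, 11], [0, 1, 4, 8, 3, 2, 5,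
   9, 10]]"
  by code_simp

lemma Hea_minus_e_ears_ok: "ears_ok Hea_minus_e Hea_minus_e_grow Hea_minus_e_ears"
  by code_simp

lemma Hea_minus_e_ears_cover: "ears_cover (flats Hea_minus_e) (map (\<lambda>(p, q, c). (p, q)) Hea_minus_e_ears) (pairs (coarse Hea_minus_e))"
  by code_simp

lemma Hea_minus_e_claws_ok: "claws_ok Hea_minus_e Hea_minus_e_claws"
  by code_simp

lemma Hea_minus_e_claws_cover: "claws_cover Hea_minus_e ([] @ map (\<lambda>(p, q, r, c). (p, q, r)) Hea_minus_e_claws) (triples (coarse Hea_minus_e))"
  by code_simp

lemma Hea_minus_e_grow_ok0:
  "relabel_ok Hea_minus_v (add_ear (pid (Split (8,0,3) False False)) (pid (Split (11,6,7) False False))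
     (refine (Split (11,6,7) False False) (refine (Split (8,0,3) False False) Hea_minus_e))) (\<lambda>i. [0,8,5,7,1,11,3,6,4,2,99,9,10] ! nat i)"
  by code_simp

lemma Hea_minus_e_grow_ok1:
  "relabel_ok Hea_minus_v (add_ear (pid (Split (9,1,5) False False)) (pid (Split (10,2,4) False False))
     (refine (Split (10,2,4) False False) (refine (Split (9,1,5) False False) Hea_minus_e))) (\<lambda>i. [1,9,3,2,0,10,5,4,6,7,99,8,11] ! nat i)"
  by code_simp

definition Hea_minus_v_grow :: "(pt \<times> pt) list" where
  "Hea_minus_v_grow = []"

definition Hea_minus_v_ears :: ear_data where
  "Hea_minus_v_ears =
   [(Thin 0, Thin 1, [(0, 1, [4, 11, 2, 6], [99])]), (Thin 0, Thin 2, [(0, 1, [4, 7, 5, 10], [99, 2, 6])]), (Thin 0,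
   Thin 3, [(0, 8, [1, 6, 9, 12], [99, 3])]), (Thin 0, Thin 4, [(0, 4, [1, 10, 5, 7], [99])]), (Thin 0, Thin 5, [(0,
   1, [4, 11, 2, 6], [99, 5, 10])]), (Thin 0, Thin 6, [(0, 1, [4, 7, 5, 10], [99, 6])]), (Thin 0, Thin 7, [(0, 4, [1,
   6, 2, 11], [99, 7])]), (Thin 0, Thin 8, [(0, 8, [1, 10, 5, 3], [99])]), (Thin 0, Thin 9, [(0, 1, [8, 3, 5, 10],
   [99, 9, 6])]), (Thin 0, Whole (10, 1, 5), [(0, 1, [4, 11, 2, 6], [99, 10, 30])]), (Thin 0, Whole (11, 2, 4), [(0,
   4, [1, 10, 5, 7], [99, 11, 51])]), (Thin 0, Whole (12, 8, 9), [(0, 8, [1, 10, 5, 3], [99, 12, 32])]), (Thin 1, Thin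
   2, [(1, 6, [0, 8, 12, 9], [99, 2])]), (Thin 1, Thin 3, [(0, 1, [4, 7, 9, 6], [8, 3, 99])]), (Thin 1, Thin 4, [(0,
   1, [4, 99], [8, 3, 2, 6])]), (Thin 1, Thin 6, [(1, 6, [0, 8, 3, 2], [99])]), (Thin 1, Thin 7, [(0, 1, [4, 7, 99],
   [8, 3, 2, 6])]), (Thin 1, Thin 8, [(0, 1, [4, 11, 2, 6], [8, 99])]), (Thin 1, Thin 9, [(1, 6, [0, 8, 3, 2], [99,
   9])]), (Thin 1, Whole (11, 2, 4), [(0, 1, [4, 51, 11, 99], [8, 3, 2, 6]), (1, 6, [0, 8, 12, 9], [99, 11, 2])]),
   (Thin 1, Whole (12, 8, 9), [(0, 1, [4, 11, 2, 6], [8, 32, 12, 99])]), (Thin 2, Thin 3, [(2, 3, [6, 1, 0, 8],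
   [99])]), (Thin 2, Thin 5, [(2, 3, [6, 1, 0, 8], [99, 5])]), (Thin 2, Thin 6, [(2, 6, [3, 8, 0, 1], [99])]), (Thin
   2, Thin 7, [(2, 3, [6, 1, 0, 8], [99, 7, 5])]), (Thin 2, Thin 8, [(2, 3, [6, 1, 10, 5], [99, 8])]), (Thin 2, Thin
   9, [(2, 6, [3, 8, 0, 1], [99, 9])]), (Thin 2, Whole (10, 1, 5), [(1, 6, [0, 8, 12, 9], [30, 10, 99, 2])]), (Thin 2,
   Whole (12, 8, 9), [(2, 3, [6, 1, 10, 5], [99, 12, 32, 8])]), (Thin 3, Thin 4, [(0, 4, [1, 6, 9, 7], [8, 3, 99])]),
   (Thin 3, Thin 5, [(3, 5, [2, 11, 4, 7], [99])]), (Thin 3, Thin 6, [(2, 3, [6, 99], [11, 4, 0, 8])]), (Thin 3, Thin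
   7, [(3, 5, [2, 6, 1, 10], [99, 7])]), (Thin 3, Thin 8, [(3, 8, [2, 11, 4, 0], [99])]), (Thin 3, Thin 9, [(2, 3, [6,
   9, 99], [11, 4, 0, 8])]), (Thin 3, Whole (10, 1, 5), [(3, 5, [2, 11, 4, 7], [99, 10, 50])]), (Thin 3, Whole (11, 2,
   4), [(2, 3, [6, 1, 0, 8], [31, 11, 99])]), (Thin 3, Whole (12, 8, 9), [(3, 8, [2, 11, 4, 0], [99, 12, 32])]), (Thin
   4, Thin 5, [(4, 7, [0, 8, 12, 9], [99, 5])]), (Thin 4, Thin 6, [(0, 1, [4, 99, 6], [8, 3, 5, 10])]), (Thin 4, Thin
   7, [(4, 7, [0, 8, 3, 5], [99])]), (Thin 4, Thin 8, [(0, 4, [1, 10, 5, 7], [8, 99])]), (Thin 4, Thin 9, [(4, 7, [0,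
   8, 3, 5], [99, 9])]), (Thin 4, Whole (10, 1, 5), [(0, 1, [4, 99, 10, 30], [8, 3, 2, 6])]), (Thin 4, Whole (12, 8,
   9), [(0, 4, [1, 10, 5, 7], [8, 32, 12, 99])]), (Thin 5, Thin 6, [(1, 6, [0, 8, 12, 9], [10, 5, 99])]), (Thin 5,
   Thin 7, [(5, 7, [3, 8, 0, 4], [99])]), (Thin 5, Thin 8, [(3, 5, [2, 11, 4, 7], [8, 99])]), (Thin 5, Thin 9, [(5, 7,
   [3, 8, 0, 4], [99, 9])]), (Thin 5, Whole (11, 2, 4), [(2, 3, [6, 1, 0, 8], [31, 11, 99, 5])]), (Thin 5, Whole (12,
   8, 9), [(3, 5, [2, 11, 4, 7], [8, 32, 12, 99])]), (Thin 6, Thin 7, [(6, 9, [1, 0, 8, 12], [99, 7])]), (Thin 6, Thin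
   8, [(0, 1, [4, 7, 5, 10], [8, 99, 6])]), (Thin 6, Thin 9, [(6, 9, [1, 0, 8, 12], [99])]), (Thin 6, Whole (10, 1,
   5), [(1, 6, [0, 8, 3, 2], [30, 10, 99])]), (Thin 6, Whole (11, 2, 4), [(2, 6, [3, 8, 0, 1], [31, 11, 99])]), (Thin
   6, Whole (12, 8, 9), [(6, 9, [1, 0, 4, 7], [99, 12, 52])]), (Thin 7, Thin 8, [(0, 4, [1, 6, 2, 11], [8, 99, 7])]),
   (Thin 7, Thin 9, [(7, 9, [4, 0, 8, 12], [99])]), (Thin 7, Whole (10, 1, 5), [(5, 7, [3, 8, 0, 4], [50, 10, 99])]),
   (Thin 7, Whole (11, 2, 4), [(4, 7, [0, 8, 3, 5], [51, 11, 99])]), (Thin 7, Whole (12, 8, 9), [(7, 9, [4, 0, 1, 6],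
   [99, 12, 52])]), (Thin 8, Whole (10, 1, 5), [(0, 1, [4, 11, 2, 6], [8, 99, 10, 30])]), (Thin 8, Whole (11, 2, 4),
   [(0, 4, [1, 10, 5, 7], [8, 99, 11, 51])]), (Thin 9, Whole (10, 1, 5), [(1, 6, [0, 8, 3, 2], [30, 10, 99, 9])]),
   (Thin 9, Whole (11, 2, 4), [(2, 6, [3, 8, 0, 1], [31, 11, 99, 9])]), (Whole (10, 1, 5), Whole (11, 2, 4), [(0, 1,
   [4, 51, 11, 99, 10, 30], [8, 3, 2, 6]), (1, 6, [0, 8, 12, 9], [30, 10, 99, 11, 2])]), (Whole (10, 1, 5), Whole (12,
   8, 9), [(0, 1, [4, 11, 2, 6], [8, 32, 12, 99, 10, 30])]), (Whole (11, 2, 4), Whole (12, 8, 9), [(0, 4, [1, 10, 5,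
   7], [8, 32, 12, 99, 11, 51])])]"

definition Hea_minus_v_claws :: claw_data where
  "Hea_minus_v_claws =
   [(Thin 0, Thin 2, Whole (10, 1, 5), [False, False, False], [(0, [2, 11, 4], [10, 1])]), (Thin 0, Thin 2, Whole (12,
   8, 9), [False, False, False], [(0, [2, 11, 4], [12, 8])]), (Thin 0, Thin 5, Whole (11, 2, 4), [False, False,
   False], [(0, [5, 10, 1], [11, 4])]), (Thin 0, Thin 5, Whole (12, 8, 9), [False, False, False], [(0, [5, 10, 1],
   [12, 8])]), (Thin 0, Thin 9, Whole (10, 1, 5), [False, False, False], [(0, [9, 12, 8], [10, 1])]), (Thin 0, Thin 9,
   Whole (11, 2, 4), [False, False, False], [(0, [9, 12, 8], [11, 4])]), (Thin 0, Whole (10, 1, 5), Whole (11, 2, 4),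
   [False, False, False], [(0, [10, 1], [11, 4])]), (Thin 0, Whole (10, 1, 5), Whole (12, 8, 9), [False, False,
   False], [(0, [10, 1], [12, 8])]), (Thin 0, Whole (11, 2, 4), Whole (12, 8, 9), [False, False, False], [(0, [11, 4],
   [12, 8])]), (Thin 1, Thin 3, Whole (11, 2, 4), [False, False, False], [(3, [1, 0, 8], [11, 2])]), (Thin 1, Thin 3,
   Whole (12, 8, 9), [False, False, False], [(3, [1, 10, 5], [12, 8])]), (Thin 1, Thin 5, Whole (11, 2, 4), [False,
   False, False], [(1, [5, 10], [11, 2, 6])]), (Thin 1, Thin 5, Whole (12, 8, 9), [False, False, False], [(1, [5, 10],
   [12, 8, 0])]), (Thin 1, Thin 7, Whole (11, 2, 4), [False, False, False], [(7, [1, 10, 5], [11, 4])]), (Thin 1, Thin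
   7, Whole (12, 8, 9), [False, False, False], [(7, [1, 0, 4], [12, 9])]), (Thin 1, Whole (11, 2, 4), Whole (12, 8,
   9), [False, False, False], [(1, [11, 2, 6], [12, 8, 0])]), (Thin 2, Thin 4, Whole (10, 1, 5), [False, False,
   False], [(2, [4, 11], [10, 1, 6])]), (Thin 2, Thin 4, Whole (12, 8, 9), [False, False, False], [(2, [4, 11], [12,
   8, 3])]), (Thin 2, Thin 7, Whole (10, 1, 5), [False, False, False], [(7, [2, 11, 4], [10, 5])]), (Thin 2, Thin 7,
   Whole (12, 8, 9), [False, False, False], [(7, [2, 11, 4], [12, 9])]), (Thin 2, Whole (10, 1, 5), Whole (12, 8, 9),
   [False, False, False], [(2, [10, 1, 6], [12, 8, 3])]), (Thin 3, Thin 4, Whole (10, 1, 5), [False, False, False],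
   [(3, [4, 0, 8], [10, 5])]), (Thin 3, Thin 4, Whole (12, 8, 9), [False, False, False], [(3, [4, 11, 2], [12, 8])]),
   (Thin 3, Thin 9, Whole (10, 1, 5), [False, False, False], [(3, [9, 12, 8], [10, 5])]), (Thin 3, Thin 9, Whole (11,
   2, 4), [False, False, False], [(3, [9, 12, 8], [11, 2])]), (Thin 3, Whole (10, 1, 5), Whole (11, 2, 4), [False,
   False, False], [(3, [10, 5], [11, 2])]), (Thin 3, Whole (10, 1, 5), Whole (12, 8, 9), [False, False, False], [(3,
   [10, 5], [12, 8])]), (Thin 3, Whole (11, 2, 4), Whole (12, 8, 9), [False, False, False], [(3, [11, 2], [12, 8])]),
   (Thin 4, Thin 6, Whole (10, 1, 5), [False, False, False], [(6, [4, 11, 2], [10, 1])]), (Thin 4, Thin 6, Whole (12,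
   8, 9), [False, False, False], [(6, [4, 0, 1], [12, 9])]), (Thin 4, Whole (10, 1, 5), Whole (12, 8, 9), [False,
   False, False], [(4, [10, 1, 0], [12, 9, 7])]), (Thin 5, Thin 6, Whole (11, 2, 4), [False, False, False], [(6, [5,
   10, 1], [11, 2])]), (Thin 5, Thin 6, Whole (12, 8, 9), [False, False, False], [(6, [5, 10, 1], [12, 9])]), (Thin 5,
   Whole (11, 2, 4), Whole (12, 8, 9), [False, False, False], [(5, [11, 2, 3], [12, 9, 7])]), (Thin 6, Thin 8, Whole
   (10, 1, 5), [False, False, False], [(6, [8, 3, 2], [10, 1])]), (Thin 6, Thin 8, Whole (11, 2, 4), [False, False,
   False], [(6, [8, 0, 1], [11, 2])]), (Thin 6, Whole (10, 1, 5), Whole (11, 2, 4), [False, False, False], [(6, [10,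
   1], [11, 2])]), (Thin 6, Whole (10, 1, 5), Whole (12, 8, 9), [False, False, False], [(6, [10, 1], [12, 9])]), (Thin
   6, Whole (11, 2, 4), Whole (12, 8, 9), [False, False, False], [(6, [11, 2], [12, 9])]), (Thin 7, Thin 8, Whole (10,
   1, 5), [False, False, False], [(7, [8, 0, 4], [10, 5])]), (Thin 7, Thin 8, Whole (11, 2, 4), [False, False, False],
   [(7, [8, 3, 5], [11, 4])]), (Thin 7, Whole (10, 1, 5), Whole (11, 2, 4), [False, False, False], [(7, [10, 5], [11,
   4])]), (Thin 7, Whole (10, 1, 5), Whole (12, 8, 9), [False, False, False], [(7, [10, 5], [12, 9])]), (Thin 7, Whole
   (11, 2, 4), Whole (12, 8, 9), [False, False, False], [(7, [11, 4], [12, 9])]), (Thin 8, Thin 9, Whole (10, 1, 5),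
   [False, False, False], [(8, [9, 12], [10, 1, 0])]), (Thin 8, Thin 9, Whole (11, 2, 4), [False, False, False], [(8,
   [9, 12], [11, 2, 3])]), (Thin 8, Whole (10, 1, 5), Whole (11, 2, 4), [False, False, False], [(8, [10, 1, 0], [11,
   2, 3])]), (Thin 9, Whole (10, 1, 5), Whole (11, 2, 4), [False, False, False], [(9, [10, 1, 6], [11, 4, 7])])]"

lemma Hea_minus_v_shape: "shape_ok Hea_minus_v
   [[0, 4, 7, 8, 3, 2, 6, 9, 11, 12], [0, 1, 6, 8, 3, 5, 7, 9, 10, 12], [0, 1, 4, 6, 2, 3, 5, 7, 10, 11]]"
  by code_simp

lemma Hea_minus_v_ears_ok: "ears_ok Hea_minus_v Hea_minus_v_grow Hea_minus_v_ears"
  by code_simp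

lemma Hea_minus_v_ears_cover: "ears_cover (flats Hea_minus_v) (map (\<lambda>(p, q, c). (p, q)) Hea_minus_v_ears) (pairs (coarse Hea_minus_v))"
  by code_simp

lemma Hea_minus_v_claws_ok: "claws_ok Hea_minus_v Hea_minus_v_claws"
  by code_simp

lemma Hea_minus_v_claws_cover: "claws_cover Hea_minus_v ([(Whole (10,1,5), Whole (11,2,4), Whole (12,8,9))] @ map (\<lambda>(p, q, r, c). (p, q, r)) Hea_minus_v_claws) (triples (coarse Hea_minus_v))"
  by code_simp

definition Hea_minus_v_exc :: "cert list" where
  "Hea_minus_v_exc =
   [(0, 1, [4, 51, 11, 99, 10, 30], [8, 3, 2, 6]), (1, 6, [0, 4, 7, 9], [30, 10, 99, 11, 2]), (0, 4, [1, 6, 9, 7], [8,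
   32, 12, 99, 11]), (2, 6, [3, 8, 0, 1], [11, 99, 12, 9]), (0, 4, [1, 30, 10, 99, 11], [8, 3, 5, 7]), (2, 3, [6, 1,
   0, 8], [11, 99, 10, 5])]"

text \<open>The new vertex takes the place of the deleted one, and the paths are its three
  neighbours in the Heawood graph.\<close>

definition Hea_minus_v_exc_grow :: "pt list list" where
  "Hea_minus_v_exc_grow = [[Split (10,1,5) False False, Split (11,2,4) False False, Split (12,8,9) False False]]"

lemma Hea_minus_v_exc_ok:
  "exc_variants Hea_minus_v Hea_minus_v_exc Hea_minus_v_exc_grow (variants [True, True, True] [Whole (10,1,5), Whole (11,2,4), Whole (12,8,9)])"
  by code_simp

lemma Hea_minus_v_exc_grow_ok0:
  "relabel_ok Hea (add_vertex (map pid [Split (10,1,5) False False, Split (11,2,4) False False, Split (12,8,9) False False])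
     (fold refine [Split (10,1,5) False False, Split (11,2,4) False False, Split (12,8,9) False False] Hea_minus_v)) (\<lambda>i. [99,12,8,0,1,6,9,7,4,11,2,3,5,10] ! nat i)"
  by code_simp

definition Pet_grow :: "(pt \<times> pt) list" where
  "Pet_grow = []"

definition Pet_ears :: ear_data where
  "Pet_ears =
   [(Thin 0, Thin 1, [(0, 1, [4, 3, 2], [99])]), (Thin 0, Thin 2, [(0, 1, [4, 7, 8], [99, 2])]), (Thin 0, Thin 3, [(0,
   4, [1, 8, 7], [99, 3])]), (Thin 0, Thin 4, [(0, 4, [1, 8, 7], [99])]), (Thin 0, Thin 5, [(0, 5, [1, 8, 9], [99])]),
   (Thin 0, Thin 6, [(0, 5, [1, 8, 9], [99, 6])]), (Thin 0, Thin 7, [(0, 4, [1, 2, 3], [99, 7])]), (Thin 0, Thin 8,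
   [(0, 1, [4, 3, 2], [99, 8])]), (Thin 0, Thin 9, [(0, 5, [1, 2, 6], [99, 9])]), (Thin 1, Thin 2, [(1, 2, [0, 4, 3],
   [99])]), (Thin 1, Thin 3, [(1, 2, [0, 5, 6], [99, 3])]), (Thin 1, Thin 4, [(0, 1, [4, 99], [5, 6, 2])]), (Thin 1,
   Thin 5, [(0, 1, [4, 3, 2], [5, 99])]), (Thin 1, Thin 6, [(1, 2, [0, 4, 3], [99, 6])]), (Thin 1, Thin 7, [(1, 8, [0,
   5, 9], [99, 7])]), (Thin 1, Thin 8, [(1, 8, [0, 4, 7], [99])]), (Thin 1, Thin 9, [(1, 8, [0, 4, 7], [99, 9])]),
   (Thin 2, Thin 3, [(2, 3, [1, 0, 4], [99])]), (Thin 2, Thin 4, [(2, 3, [1, 8, 9], [99, 4])]), (Thin 2, Thin 5, [(2,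
   6, [1, 8, 7], [99, 5])]), (Thin 2, Thin 6, [(2, 6, [1, 0, 5], [99])]), (Thin 2, Thin 7, [(2, 6, [1, 0, 5], [99,
   7])]), (Thin 2, Thin 8, [(1, 2, [0, 4, 3], [8, 99])]), (Thin 2, Thin 9, [(2, 3, [1, 0, 4], [99, 9])]), (Thin 3,
   Thin 4, [(3, 4, [2, 1, 0], [99])]), (Thin 3, Thin 5, [(3, 9, [2, 1, 8], [99, 5])]), (Thin 3, Thin 6, [(2, 3, [1, 0,
   4], [6, 99])]), (Thin 3, Thin 7, [(3, 4, [2, 1, 0], [99, 7])]), (Thin 3, Thin 8, [(3, 9, [2, 6, 5], [99, 8])]),
   (Thin 3, Thin 9, [(3, 9, [2, 1, 8], [99])]), (Thin 4, Thin 5, [(0, 4, [1, 8, 7], [5, 99])]), (Thin 4, Thin 6, [(4,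
   7, [0, 1, 8], [99, 6])]), (Thin 4, Thin 7, [(4, 7, [0, 1, 8], [99])]), (Thin 4, Thin 8, [(4, 7, [0, 5, 6], [99,
   8])]), (Thin 4, Thin 9, [(3, 4, [2, 1, 0], [9, 99])]), (Thin 5, Thin 6, [(5, 6, [0, 1, 2], [99])]), (Thin 5, Thin
   7, [(5, 6, [0, 1, 2], [99, 7])]), (Thin 5, Thin 8, [(5, 9, [0, 4, 3], [99, 8])]), (Thin 5, Thin 9, [(5, 9, [0, 1,
   8], [99])]), (Thin 6, Thin 7, [(6, 7, [2, 1, 8], [99])]), (Thin 6, Thin 8, [(6, 7, [2, 3, 4], [99, 8])]), (Thin 6,
   Thin 9, [(5, 6, [0, 1, 2], [9, 99])]), (Thin 7, Thin 8, [(7, 8, [4, 0, 1], [99])]), (Thin 7, Thin 9, [(7, 8, [4, 0,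
   1], [99, 9])]), (Thin 8, Thin 9, [(8, 9, [1, 0, 5], [99])])]"

text \<open>Two vertices of the Petersen graph are adjacent or have a common neighbour, so
  \<open>near_any\<close> disposes of every triple.\<close>

definition Pet_claws :: claw_data where
  "Pet_claws =
   []"

lemma Pet_shape: "shape_ok Pet
   []"
  by code_simp

lemma Pet_ears_ok: "ears_ok Pet Pet_grow Pet_ears"
  by code_simp

lemma Pet_ears_cover: "ears_cover (flats Pet) (map (\<lambda>(p, q, c). (p, q)) Pet_ears) (pairs (coarse Pet))"
  by code_simp

lemma Pet_claws_ok: "claws_ok Pet Pet_claws"
  by code_simp

lemma Pet_claws_cover: "claws_cover Pet ([] @ map (\<lambda>(p, q, r, c). (p, q, r)) Pet_claws) (triples (coarse Pet))"
  by code_simp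

definition Hea_grow :: "(pt \<times> pt) list" where
  "Hea_grow = []"

definition Hea_ears :: ear_data where
  "Hea_ears =
   [(Thin 0, Thin 1, [(0, 1, [9, 8, 3, 2], [99])]), (Thin 0, Thin 2, [(0, 1, [9, 8, 7, 6], [99, 2])]), (Thin 0, Thin
   3, [(0, 1, [9, 10, 5, 6], [99, 3, 2])]), (Thin 0, Thin 4, [(0, 13, [1, 2, 11, 12], [99, 4])]), (Thin 0, Thin 5,
   [(0, 1, [9, 8, 3, 2], [99, 5, 6])]), (Thin 0, Thin 6, [(0, 1, [9, 8, 3, 2], [99, 6])]), (Thin 0, Thin 7, [(0, 1,
   [9, 10, 11, 2], [99, 7, 6])]), (Thin 0, Thin 8, [(0, 9, [1, 2, 11, 10], [99, 8])]), (Thin 0, Thin 9, [(0, 9, [1, 2,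
   11, 10], [99])]), (Thin 0, Thin 10, [(0, 9, [1, 2, 3, 8], [99, 10])]), (Thin 0, Thin 11, [(0, 1, [9, 8, 7, 6], [99,
   11, 2])]), (Thin 0, Thin 12, [(0, 13, [1, 2, 3, 4], [99, 12])]), (Thin 0, Thin 13, [(0, 13, [1, 2, 11, 12],
   [99])]), (Thin 1, Thin 2, [(1, 2, [0, 13, 12, 11], [99])]), (Thin 1, Thin 3, [(1, 2, [0, 13, 12, 11], [99, 3])]),
   (Thin 1, Thin 4, [(0, 1, [9, 8, 7, 6], [13, 4, 99])]), (Thin 1, Thin 5, [(1, 6, [0, 13, 12, 7], [99, 5])]), (Thin
   1, Thin 6, [(1, 6, [0, 13, 12, 7], [99])]), (Thin 1, Thin 7, [(1, 6, [0, 13, 4, 5], [99, 7])]), (Thin 1, Thin 8,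
   [(0, 1, [9, 8, 99], [13, 4, 5, 6])]), (Thin 1, Thin 9, [(0, 1, [9, 99], [13, 4, 3, 2])]), (Thin 1, Thin 10, [(0, 1,
   [9, 10, 99], [13, 4, 3, 2])]), (Thin 1, Thin 11, [(1, 2, [0, 13, 4, 3], [99, 11])]), (Thin 1, Thin 12, [(0, 1, [9,
   8, 3, 2], [13, 12, 99])]), (Thin 1, Thin 13, [(0, 1, [9, 8, 3, 2], [13, 99])]), (Thin 2, Thin 3, [(2, 3, [1, 0, 13,
   4], [99])]), (Thin 2, Thin 4, [(2, 3, [1, 0, 9, 8], [99, 4])]), (Thin 2, Thin 5, [(1, 2, [0, 13, 12, 11], [6, 5,
   99])]), (Thin 2, Thin 6, [(1, 2, [0, 13, 12, 11], [6, 99])]), (Thin 2, Thin 7, [(1, 2, [0, 13, 4, 3], [6, 7,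
   99])]), (Thin 2, Thin 8, [(2, 3, [1, 0, 13, 4], [99, 8])]), (Thin 2, Thin 9, [(0, 1, [9, 99, 2], [13, 4, 5, 6])]),
   (Thin 2, Thin 10, [(2, 11, [1, 0, 13, 12], [99, 10])]), (Thin 2, Thin 11, [(2, 11, [1, 0, 13, 12], [99])]), (Thin
   2, Thin 12, [(2, 11, [1, 0, 9, 10], [99, 12])]), (Thin 2, Thin 13, [(0, 1, [9, 8, 7, 6], [13, 99, 2])]), (Thin 3,
   Thin 4, [(3, 4, [2, 11, 10, 5], [99])]), (Thin 3, Thin 5, [(3, 4, [2, 11, 12, 13], [99, 5])]), (Thin 3, Thin 6,
   [(1, 2, [0, 13, 12, 11], [6, 99, 3])]), (Thin 3, Thin 7, [(3, 8, [2, 11, 10, 9], [99, 7])]), (Thin 3, Thin 8, [(3,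
   8, [2, 11, 10, 9], [99])]), (Thin 3, Thin 9, [(3, 8, [2, 11, 12, 7], [99, 9])]), (Thin 3, Thin 10, [(2, 3, [1, 0,
   13, 4], [11, 10, 99])]), (Thin 3, Thin 11, [(2, 3, [1, 0, 13, 4], [11, 99])]), (Thin 3, Thin 12, [(2, 3, [1, 0, 9,
   8], [11, 12, 99])]), (Thin 3, Thin 13, [(3, 4, [2, 11, 10, 5], [99, 13])]), (Thin 4, Thin 5, [(4, 5, [3, 8, 9, 10],
   [99])]), (Thin 4, Thin 6, [(4, 5, [3, 8, 9, 10], [99, 6])]), (Thin 4, Thin 7, [(3, 4, [2, 11, 10, 5], [8, 7,
   99])]), (Thin 4, Thin 8, [(3, 4, [2, 11, 10, 5], [8, 99])]), (Thin 4, Thin 9, [(0, 9, [1, 2, 11, 10], [13, 4,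
   99])]), (Thin 4, Thin 10, [(4, 5, [3, 8, 7, 6], [99, 10])]), (Thin 4, Thin 11, [(2, 3, [1, 0, 9, 8], [11, 99,
   4])]), (Thin 4, Thin 12, [(4, 13, [3, 8, 9, 0], [99, 12])]), (Thin 4, Thin 13, [(4, 13, [3, 8, 9, 0], [99])]),
   (Thin 5, Thin 6, [(5, 6, [4, 13, 0, 1], [99])]), (Thin 5, Thin 7, [(5, 6, [4, 13, 0, 1], [99, 7])]), (Thin 5, Thin
   8, [(3, 4, [2, 11, 12, 13], [8, 99, 5])]), (Thin 5, Thin 9, [(5, 10, [4, 13, 12, 11], [99, 9])]), (Thin 5, Thin 10,
   [(5, 10, [4, 13, 0, 9], [99])]), (Thin 5, Thin 11, [(5, 10, [4, 13, 0, 9], [99, 11])]), (Thin 5, Thin 12, [(4, 5,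
   [3, 8, 9, 10], [13, 12, 99])]), (Thin 5, Thin 13, [(4, 5, [3, 8, 9, 10], [13, 99])]), (Thin 6, Thin 7, [(6, 7, [1,
   0, 13, 12], [99])]), (Thin 6, Thin 8, [(6, 7, [1, 0, 13, 12], [99, 8])]), (Thin 6, Thin 9, [(0, 1, [9, 99, 6], [13,
   4, 3, 2])]), (Thin 6, Thin 10, [(5, 6, [4, 13, 0, 1], [10, 99])]), (Thin 6, Thin 11, [(1, 2, [0, 13, 4, 3], [6, 99,
   11])]), (Thin 6, Thin 12, [(6, 7, [1, 0, 9, 8], [99, 12])]), (Thin 6, Thin 13, [(0, 1, [9, 8, 3, 2], [13, 99,
   6])]), (Thin 7, Thin 8, [(7, 8, [6, 1, 0, 9], [99])]), (Thin 7, Thin 9, [(7, 8, [6, 1, 2, 3], [99, 9])]), (Thin 7,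
   Thin 10, [(5, 6, [4, 13, 0, 1], [10, 99, 7])]), (Thin 7, Thin 11, [(7, 12, [6, 1, 0, 13], [99, 11])]), (Thin 7,
   Thin 12, [(7, 12, [6, 1, 0, 13], [99])]), (Thin 7, Thin 13, [(7, 12, [6, 1, 2, 11], [99, 13])]), (Thin 8, Thin 9,
   [(8, 9, [3, 2, 11, 10], [99])]), (Thin 8, Thin 10, [(8, 9, [3, 2, 1, 0], [99, 10])]), (Thin 8, Thin 11, [(2, 3, [1,
   0, 13, 4], [11, 99, 8])]), (Thin 8, Thin 12, [(7, 8, [6, 1, 0, 9], [12, 99])]), (Thin 8, Thin 13, [(0, 9, [1, 2,
   11, 10], [13, 99, 8])]), (Thin 9, Thin 10, [(9, 10, [0, 1, 2, 11], [99])]), (Thin 9, Thin 11, [(9, 10, [0, 1, 6,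
   5], [99, 11])]), (Thin 9, Thin 12, [(0, 9, [1, 2, 3, 8], [13, 12, 99])]), (Thin 9, Thin 13, [(0, 9, [1, 2, 11, 10],
   [13, 99])]), (Thin 10, Thin 11, [(10, 11, [5, 4, 13, 12], [99])]), (Thin 10, Thin 12, [(10, 11, [5, 4, 3, 2], [99,
   12])]), (Thin 10, Thin 13, [(0, 9, [1, 2, 3, 8], [13, 99, 10])]), (Thin 11, Thin 12, [(11, 12, [2, 1, 0, 13],
   [99])]), (Thin 11, Thin 13, [(11, 12, [2, 1, 6, 7], [99, 13])]), (Thin 12, Thin 13, [(12, 13, [7, 8, 9, 0],
   [99])])]"

text \<open>Of three vertices of the bipartite Heawood graph two lie on the same side, and these
  have a common neighbour; again \<open>near_any\<close> suffices.\<close>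

definition Hea_claws :: claw_data where
  "Hea_claws =
   []"

lemma Hea_shape: "shape_ok Hea
   []"
  by code_simp

lemma Hea_ears_ok: "ears_ok Hea Hea_grow Hea_ears"
  by code_simp

lemma Hea_ears_cover: "ears_cover (flats Hea) (map (\<lambda>(p, q, c). (p, q)) Hea_ears) (pairs (coarse Hea))"
  by code_simp

lemma Hea_claws_ok: "claws_ok Hea Hea_claws"
  by code_simp

lemma Hea_claws_cover: "claws_cover Hea ([] @ map (\<lambda>(p, q, r, c). (p, q, r)) Hea_claws) (triples (coarse Hea))"
  by code_simp

section \<open>What a successful check provides\<close>

lemma pairs_mem: "x \<in> set xs \<Longrightarrow> y \<in> set xs \<Longrightarrow> x \<noteq> y \<Longrightarrow> (x, y) \<in> set (pairs xs) \<or> (y, x) \<in> set (pairs xs)"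
  by (induction xs) auto

lemma pairs_sub: "(x, y) \<in> set (pairs xs) \<Longrightarrow> x \<in> set xs \<and> y \<in> set xs"
  by (induction xs) auto

lemma triples_sub: "(x, y, z) \<in> set (triples xs) \<Longrightarrow> x \<in> set xs \<and> y \<in> set xs \<and> z \<in> set xs"
  by (induction xs) (auto dest: pairs_sub)

text \<open>\<open>triples\<close> lists each choice in one order only, which the user cannot
  predict; hence the equality of sets.\<close>

lemma triples_mem:
  assumes "x \<in> set xs" "y \<in> set xs" "z \<in> set xs" "x \<noteq> y" "y \<noteq> z" "x \<noteq> z"
  shows "\<exists>a b c. (a, b, c) \<in> set (triples xs) \<and> {a, b, c} = {x, y, z}"
  using assms
proof (induction xs)
  case (Cons w ws)
  show ?case
  proof (cases "w \<in> {x, y, z}")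
    case True
    then obtain u v where uv: "{w, u, v} = {x, y, z}" "u \<noteq> v" "u \<noteq> w" "v \<noteq> w"
      using Cons.prems(4-6) by (elim insertE) auto
    then have "u \<in> set (w # ws)" "v \<in> set (w # ws)" using Cons.prems(1-3) by auto
    then have "u \<in> set ws" "v \<in> set ws" using uv by auto
    then have "(u, v) \<in> set (pairs ws) \<or> (v, u) \<in> set (pairs ws)" using pairs_mem uv by metis
    then have "(w, u, v) \<in> set (triples (w # ws)) \<or> (w, v, u) \<in> set (triples (w # ws))" by auto
    moreover have "{w, v, u} = {x, y, z}" using uv(1) by auto
    ultimately show ?thesis using uv(1) by blast
  next
    case False
    then show ?thesis using Cons by auto
  qed
qed simp

lemma share_iff: "share F p q \<longleftrightarrow> (\<exists>f\<in>set F. on p f \<and> on q f)"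
  by (induction F) auto

lemma share_sym: "share F p q = share F q p"
  unfolding share_iff by auto

lemma shared_iff: "w \<in> set (shared F p q ws) \<longleftrightarrow> w \<in> set ws \<and> share F (Thin w) p \<and> share F (Thin w) q"
  by (induction ws) auto

lemma ears_rowD: "ears_row m Ws cs G p qs \<Longrightarrow> q \<in> set qs \<Longrightarrow>
    killed_all (refine q (refine p m)) [pid p, pid q] cs ([] # map (\<lambda>w. [w]) Ws) \<or> Ws = [] \<and> (p, q) \<in> set G"
  by (induction qs) (auto simp del: killed_all.simps)

lemma ears_tableD: "ears_table m Ws cs G ps qs \<Longrightarrow> p \<in> set ps \<Longrightarrow> ears_row m Ws cs G p qs"
  by (induction ps) auto

lemma killed_allD: "killed_all m C cs Ws \<Longrightarrow> W \<in> set Ws \<Longrightarrow>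
    ucheck (links m @ map (Pair 99) (C @ W)) (99 # ids m) (thins m) cs"
  by (induction Ws) auto

lemma ears_okD: "ears_ok m G D \<Longrightarrow> (p, q, cs) \<in> set D \<Longrightarrow> indep (flats m) (pairs (shared (flats m) p q (thins m))) \<and>
     ears_table m (shared (flats m) p q (thins m)) cs G (fines p) (fines q)"
  by (induction m G D rule: ears_ok.induct) auto

lemma ears_coverD: "ears_cover F K r \<Longrightarrow> (p, q) \<in> set r \<Longrightarrow> share F p q \<or> (p, q) \<in> set K"
  by (induction F K r rule: ears_cover.induct) auto

lemma indepD: "indep F r \<Longrightarrow> (v, w) \<in> set r \<Longrightarrow> \<not> share F (Thin v) (Thin w)"
  by (induction F r rule: indep.induct) auto

lemma near_anyD: "near_any m r \<Longrightarrow> \<exists>(p, q)\<in>set r. \<not> is_whole p \<and> \<not> is_whole q \<and> near m (pid p) (pid q)"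
  by (induction m r rule: near_any.induct) auto

lemma has_midD: "has_mid R i j N \<Longrightarrow> \<exists>k\<in>set N. linked R i k \<and> linked R k j"
  by (induction N) auto

lemma claw_variantsD: "claw_variants m cs pss \<Longrightarrow> ps \<in> set pss \<Longrightarrow> near_any (fold refine ps m) (pairs ps) \<or>
      rcheck (links (fold refine ps m)) (ids (fold refine ps m)) (thins (fold refine ps m)) (map pid ps) cs"
  by (induction pss) auto

lemma claws_okD: "claws_ok m D \<Longrightarrow> (p, q, r, msk, cs) \<in> set D \<Longrightarrow>
    length msk = 3 \<and> claw_variants m cs (variants msk [p, q, r])"
  by (induction m D rule: claws_ok.induct) auto

lemma share_anyD: "share_any F r \<Longrightarrow> \<exists>(p, q)\<in>set r. share F p q \<and> (is_whole p \<or> is_whole q)"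
  by (induction F r rule: share_any.induct) auto

lemma claws_coverD: "claws_cover m K t \<Longrightarrow> (p, q, r) \<in> set t \<Longrightarrow>
    share_any (flats m) (pairs [p, q, r]) \<or> near_any m (pairs [p, q, r]) \<or> (p, q, r) \<in> set K"
  by (induction m K t rule: claws_cover.induct) (auto simp del: share_any.simps near_any.simps pairs.simps)

lemma exc_variantsD: "exc_variants m cs G pss \<Longrightarrow> ps \<in> set pss \<Longrightarrow> near_any (fold refine ps m) (pairs ps) \<or>
      ucheck (links (fold refine ps m) @ map (Pair 99) (map pid ps)) (99 # ids (fold refine ps m))
        (99 # thins (fold refine ps m)) cs \<or> ps \<in> set G"
  by (induction pss) auto

lemma flat_shapesD: "flat_shapes m F yss \<Longrightarrow> (d, a, b) \<in> set F \<Longrightarrow>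
    \<exists>ys. rotate_conn (links m) (removeAll b (removeAll a (removeAll d (ids m)))) ys \<and>
     meets (nbs (links m) a) ys \<and> meets (nbs (links m) b) ys \<and>
     length (remdups (nbs (links m) (hd ys))) \<ge> 3 \<and> memb (hd ys) (thins m) \<and> \<not> memb (hd ys) (nbs (links m) (hd ys))"
  by (induction m F yss rule: flat_shapes.induct) (auto simp del: rotate_conn.simps)

lemma no_flat_triangleD: "no_flat_triangle F r \<Longrightarrow> (i, j, k) \<in> set r \<Longrightarrow>
    \<not> (share F (Thin i) (Thin j) \<and> share F (Thin j) (Thin k) \<and> share F (Thin i) (Thin k))"
  by (induction F r rule: no_flat_triangle.induct) auto

fun is_split :: "pt \<Rightarrow> bool" where
  "is_split (Split f x y) = True"
| "is_split _ = False"

definition grows_to :: "model \<Rightarrow> model \<Rightarrow> bool" where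
  "grows_to m m' \<longleftrightarrow> (\<exists>T\<in>set models. length (thins m) < length (thins T) \<and> (\<exists>\<sigma>. relabel_ok T m' \<sigma>))"

text \<open>\<open>exc\<close> contains the triple, at most one and consisting of whole paths, at
  which an outside vertex may have three neighbours without an immediate unichord. There the pattern
  may grow by a vertex.\<close>

definition checked :: "model \<Rightarrow> bool" where
  "checked m \<longleftrightarrow> (\<exists>yss G D C exc ecs EG. shape_ok m yss \<and> ears_ok m G D \<and>
     ears_cover (flats m) (map (\<lambda>(p, q, c). (p, q)) D) (pairs (coarse m)) \<and>
     (\<forall>(p, q)\<in>set G. is_split p \<and> is_split q \<and> grows_to m (add_ear (pid p) (pid q) (refine q (refine p m)))) \<and>
     claws_ok m C \<and> claws_cover m (exc @ map (\<lambda>(p, q, r, c). (p, q, r)) C) (triples (coarse m)) \<and>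
     (exc = [] \<or> (\<exists>p q r. exc = [(p, q, r)] \<and> is_whole p \<and> is_whole q \<and> is_whole r \<and>
        exc_variants m ecs EG (variants [True, True, True] [p, q, r]) \<and>
        (\<forall>ps\<in>set EG. grows_to m (add_vertex (map pid ps) (fold refine ps m))))))"

section \<open>Recognising that a side of a cutset is not a path\<close>

lemma is_ab_path_nbs:
  assumes "is_ab_path W F a b" "c \<in> W"
  shows "\<exists>x y. {u. {u, c} \<in> F} \<subseteq> {x, y}" "\<exists>x. {u. {u, a} \<in> F} \<subseteq> {x}" "\<exists>x. {u. {u, b} \<in> F} \<subseteq> {x}"
proof -
  obtain xs where xs: "xs \<noteq> []" "distinct xs" "set xs = W" "hd xs = a" "last xs = b"
    and F: "F = {{xs ! i, xs ! Suc i} | i. Suc i < length xs}"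
    using assms(1) unfolding is_ab_path_def by blast
  have nb: "(0 < i \<and> u = xs ! (i - 1)) \<or> (Suc i < length xs \<and> u = xs ! Suc i)"
    if h: "{u, xs ! i} \<in> F" "i < length xs" for u i
  proof -
    obtain k where k: "Suc k < length xs" "{u, xs ! i} = {xs ! k, xs ! Suc k}" using h(1) unfolding F by blast
    then consider "u = xs ! k" "xs ! i = xs ! Suc k" | "u = xs ! Suc k" "xs ! i = xs ! k" by (auto simp: doubleton_eq_iff)
    then show ?thesis
    proof cases
      case 1
      then have "i = Suc k" using xs(2) k(1) h(2) nth_eq_iff_index_eq by fastforce
      then show ?thesis using 1 by simp
    next
      case 2
      then have "i = k" using xs(2) k(1) h(2) nth_eq_iff_index_eq by fastforce
      then show ?thesis using 2 k by simp
    qed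
  qed
  obtain i where i: "i < length xs" "c = xs ! i" using assms(2) xs(3) by (metis in_set_conv_nth)
  show "\<exists>x y. {u. {u, c} \<in> F} \<subseteq> {x, y}"
    by (intro exI[of _ "xs ! (i - 1)"] exI[of _ "xs ! Suc i"]) (use nb[of _ i] i in auto)
  have "a = xs ! 0" "b = xs ! (length xs - 1)" "length xs - 1 < length xs" "0 < length xs"
    using xs(1,4,5) by (auto simp: hd_conv_nth last_conv_nth)
  then have "{u. {u, a} \<in> F} \<subseteq> {xs ! 1}" "{u. {u, b} \<in> F} \<subseteq> {xs ! (length xs - 1 - 1)}"
    using nb[of _ 0] nb[of _ "length xs - 1"] by auto
  then show "\<exists>x. {u. {u, a} \<in> F} \<subseteq> {x}" "\<exists>x. {u. {u, b} \<in> F} \<subseteq> {x}" by blast+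
qed

text \<open>An inner vertex \<open>z\<close> of a path separates its ends. So a vertex that can be
  bypassed shows that the side is not a path.\<close>

lemma is_ab_path_separates:
  assumes "is_ab_path W (induced_edges E W) a b" "z \<in> W" "z \<noteq> a" "z \<noteq> b" "conn E D" "D \<subseteq> W - {z}" "a \<in> D" "b \<in> D"
  shows False
proof -
  obtain xs where xs: "xs \<noteq> []" "distinct xs" "set xs = W" "hd xs = a" "last xs = b"
    and F: "induced_edges E W = {{xs ! i, xs ! Suc i} | i. Suc i < length xs}"
    using assms(1) unfolding is_ab_path_def by blast
  obtain k where k: "k < length xs" "z = xs ! k" using assms(2) xs(3) by (metis in_set_conv_nth)
  \<comment> \<open>The vertices before \<open>z\<close>. The set \<open>D\<close> contains
    \<open>a\<close> from \<open>L\<close> and \<open>b\<close> from outside, so an edge leaves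
    \<open>L\<close> inside \<open>D\<close>; on a path such an edge ends in
    \<open>z\<close>.\<close>
  define L where "L = {xs ! i | i. i < k}"
  have ab: "a = xs ! 0" "b = xs ! (length xs - 1)" using xs by (auto simp: hd_conv_nth last_conv_nth)
  have k0: "0 < k" using k(2) ab(1) assms(3) by (cases k) auto
  have kl: "k < length xs - 1"
  proof (rule ccontr)
    assume "\<not> k < length xs - 1"
    then have "k = length xs - 1" using k(1) by simp
    then show False using k(2) ab(2) assms(4) by simp
  qed
  have "a \<in> L" unfolding L_def ab using k0 by blast
  have "b \<notin> L"
  proof
    assume "b \<in> L"
    then obtain i where "i < k" "b = xs ! i" unfolding L_def by blast
    then have "i = length xs - 1"
    proof -
      have "length xs - 1 < length xs" "i < length xs" using kl k(1) \<open>i < k\<close> by linarith+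
      then show ?thesis using ab(2) \<open>b = xs ! i\<close> nth_eq_iff_index_eq[OF xs(2)] by metis
    qed
    then show False using \<open>i < k\<close> kl by simp
  qed
  obtain x y where xy: "x \<in> D \<inter> L" "y \<in> D - (D \<inter> L)" "{x, y} \<in> E"
    using conn_cross[OF assms(5), of "D \<inter> L"] assms(7,8) \<open>a \<in> L\<close> \<open>b \<notin> L\<close> by blast
  have "{x, y} \<in> induced_edges E W" using xy assms(6) unfolding induced_edges_def by auto
  then obtain i where i: "Suc i < length xs" "{x, y} = {xs ! i, xs ! Suc i}" unfolding F by blast
  obtain j where j: "j < k" "x = xs ! j" using xy(1) unfolding L_def by blast
  have yz: "y \<noteq> z" "y \<notin> L" using xy(2) assms(6) by auto
  have inj: "\<And>i j. i < length xs \<Longrightarrow> j < length xs \<Longrightarrow> xs ! i = xs ! j \<Longrightarrow> i = j"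
    using xs(2) nth_eq_iff_index_eq by blast
  from i(2) consider "x = xs ! i" "y = xs ! Suc i" | "x = xs ! Suc i" "y = xs ! i" by (auto simp: doubleton_eq_iff)
  then show False
  proof cases
    case 1
    have "i < length xs" "j < length xs" using i(1) j(1) k(1) by linarith+
    moreover have "xs ! i = xs ! j" using 1(1) j(2) by (rule trans[OF sym])
    ultimately have "i = j" by (rule inj)
    then have "Suc i = k \<or> Suc i < k" using j by auto
    then show False
    proof
      assume "Suc i = k"
      then show False using 1(2) k(2) yz(1) by metis
    next
      assume "Suc i < k"
      then show False using 1(2) yz(2) unfolding L_def by blast
    qed
  next
    case 2
    have "j < length xs" using j(1) k(1) by linarith
    moreover have "xs ! Suc i = xs ! j" using 2(1) j(2) by (rule trans[OF sym])
    ultimately have "Suc i = j" by (rule inj[OF i(1)])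
    then have "i < k" using j(1) by simp
    then show False using 2(2) yz(2) unfolding L_def by blast
  qed
qed

lemma conn_has_path:
  assumes "conn E D" "D \<subseteq> W" "a \<in> D" "b \<in> D"
  shows "has_path W (induced_edges E W) a b"
proof -
  obtain xs where xs: "xs \<noteq> []" "set xs \<subseteq> D" "ipath E xs" "hd xs = a" "last xs = b"
    using path_between[OF assms(1,3,4)] by metis
  have "walk (induced_edges E W) xs"
    unfolding walk_def
  proof (intro allI impI)
    fix i assume i: "Suc i < length xs"
    then have "{xs ! i, xs ! Suc i} \<in> E" using ipath_nth[OF xs(3), of i "Suc i"] by simp
    moreover have "xs ! i \<in> set xs" "xs ! Suc i \<in> set xs" using i by simp_all
    then have "xs ! i \<in> W" "xs ! Suc i \<in> W" using xs(2) assms(2) by blast+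
    ultimately show "{xs ! i, xs ! Suc i} \<in> induced_edges E W" unfolding induced_edges_def by simp
  qed
  then show ?thesis unfolding has_path_def using xs assms(2) ipath_distinct[OF xs(3)] by blast
qed

section \<open>Local obstructions for an outside vertex\<close>

context girth5
begin

text \<open>The edge \<open>xg'\<close> would be a unichord. One side is the segment of
  \<open>C\<close> from \<open>g\<close> to just before \<open>g'\<close>, the other side is the
  part of \<open>C\<close> after \<open>g'\<close> together with \<open>S\<close>. They are
  separated because \<open>S\<close> touches \<open>C\<close> only at its ends and \<open>g\<close>
  is not the first vertex.\<close>

lemma inner_neighbour:
  assumes C: "C = A0 @ g # M @ g' # B0" "A0 \<noteq> []" "ipath E C" and S: "conn E S" "S \<subseteq> V - set C" "sees E (last C) S" "set C \<subseteq> V"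
    and anti: "\<And>z s. z \<in> set C \<Longrightarrow> z \<noteq> hd C \<Longrightarrow> z \<noteq> last C \<Longrightarrow> s \<in> S \<Longrightarrow> {z, s} \<notin> E"
    and x: "x \<notin> set C" "x \<notin> S" "{x, g} \<in> E" "{x, g'} \<in> E" "y \<in> S" "{x, y} \<in> E"
  shows False
proof -
  have i: "ipath E (A0 @ g # M @ g' # B0)" using C by simp
  have dist: "distinct (A0 @ g # M @ g' # B0)" using ipath_distinct[OF C(3)] C(1) by simp
  have mid: "conn E (set (g # M))" "sees E g' (set (g # M))" using mid_arc[OF i] by auto
  have i2: "ipath E ((A0 @ g # M) @ g' # B0)" using i by simp
  have cr: "{z, w} \<in> E \<longleftrightarrow> z = last (A0 @ g # M) \<and> w = g'" if "z \<in> set (A0 @ g # M)" "w \<in> set (g' # B0)" for z w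
    using i2 that unfolding ipath_append[of E "A0 @ g # M"] by auto
  have lastC: "last C = last (g' # B0)" unfolding C(1) by simp
  have hdC: "hd C = hd A0" "hd A0 \<in> set A0" unfolding C(1) using C(2) by auto
  define B where "B = S \<union> set B0"
  have B: "conn E B \<and> sees E g' B"
  proof (cases "B0 = []")
    case True
    then show ?thesis using S lastC unfolding B_def by simp
  next
    case False
    have "ipath E ((A0 @ g # M @ [g']) @ B0)" using i by simp
    then have "ipath E B0" unfolding ipath_append by blast
    then have c: "conn E (set B0)" using False ipath_conn by blast
    have "ipath E (g' # B0)" by (rule ipath_suffix[OF i2])
    then have e: "{g', hd B0} \<in> E" "hd B0 \<in> set B0" using False by auto
    have "last B0 \<in> set B0" "last C = last B0" using False lastC by auto
    then obtain s where "s \<in> S" "{last B0, s} \<in> E" using S(3) unfolding sees_def by auto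
    then have "conn E B" unfolding B_def
      using conn_union[OF S(1) c, of s "last B0"] \<open>last B0 \<in> set B0\<close> by (auto simp: insert_commute)
    then show ?thesis using e unfolding B_def sees_def by blast
  qed
  have sub: "set (g # M) \<subseteq> set C" "set B0 \<subseteq> set C" "g' \<in> set C" unfolding C(1) by auto
  have AB: "anticomplete E (set (g # M)) B"
    unfolding anticomplete_def
  proof (intro conjI ballI)
    show "set (g # M) \<inter> B = {}" using sub S(2) dist unfolding B_def by auto
    fix z w assume z: "z \<in> set (g # M)" and w: "w \<in> B"
    show "{z, w} \<notin> E"
    proof (cases "w \<in> S")
      case True
      have "z \<noteq> last C" using z dist lastC last_in_set[of "g' # B0"] by (auto simp del: last.simps)
      moreover have "z \<noteq> hd C" using z dist hdC by auto
      ultimately show ?thesis using anti[of z w] True z sub by auto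
    next
      case False
      then have "w \<in> set B0" using w unfolding B_def by blast
      moreover from this have "w \<noteq> g'" using dist by auto
      ultimately show ?thesis using cr[of z w] z by auto
    qed
  qed
  show False
  proof (rule unichord_edge[OF x(4) mid(1) conjunct1[OF B] AB _ _ _ mid(2) _ conjunct2[OF B]])
    show "set (g # M) \<subseteq> V - {x, g'}" using sub S(4) x(1) dist by auto
    show "B \<subseteq> V - {x, g'}" using sub S(2,4) x(1,2) dist unfolding B_def by auto
    show "sees E x (set (g # M))" using x(3) unfolding sees_def by auto
    show "sees E x B" using x(5,6) unfolding sees_def B_def by blast
  qed
qed

lemma near_False:
  assumes e: "emb V E m \<phi>" and ij: "i \<in> set (thins m)" "j \<in> set (thins m)" "i \<noteq> j" "\<phi> i = [a]" "\<phi> j = [b]"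
    and x: "x \<notin> span m \<phi>" "{x, a} \<in> E" "{x, b} \<in> E" and n: "near m i j"
  shows False
proof -
  obtain N R F where m: "m = (N, R, F)" by (cases m)
  note D = embD[OF e[unfolded m]]
  have ij': "i \<in> set N" "j \<in> set N" using ij m by auto
  have ab: "a \<noteq> b" using D(5)[OF ij' ij(3)] ij by auto
  have adj: "\<not> linked R i j"
  proof
    assume "linked R i j"
    then have "{a, b} \<in> E" using D(5)[OF ij' ij(3)] ij by auto
    then show False using tri[of a x b] x by (simp add: insert_commute)
  qed
  then obtain k where k: "k \<in> set N" "linked R i k" "linked R k j" using n has_midD unfolding m near.simps by blast
  then have "k \<noteq> i" "k \<noteq> j" using adj by auto
  obtain c where c: "\<phi> k = [c]" using D(3)[OF k(1)] by auto
  have "{a, c} \<in> E" using D(5)[OF ij'(1) k(1)] \<open>k \<noteq> i\<close> k c ij by auto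
  moreover have "{c, b} \<in> E" using D(5)[OF k(1) ij'(2)] \<open>k \<noteq> j\<close> k c ij by auto
  ultimately have "c = x" using square_collapses[of a c b x] x ab by (simp add: insert_commute)
  then show False using x(1) k(1) c in_span[where \<phi>=\<phi>, of k m c] m by auto
qed

end

section \<open>Attachments to a maximal pattern\<close>

lemma ids_fold_refine:
  "i \<in> set (ids (fold refine ps m)) \<Longrightarrow> i \<in> set (ids m) \<or> (\<exists>p\<in>set ps. i = pid p \<or> i = pid p + 20 \<or> i = pid p + 40)"
proof (induction ps arbitrary: m)
  case (Cons p ps)
  then show ?case using ids_refine[of p m] by fastforce
qed simp

lemma sees_singleton: "sees E x {y} \<longleftrightarrow> {x, y} \<in> E"
  unfolding sees_def by simp

text \<open>The extremal copy. \<open>bigger\<close> turns growth into a contradiction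
  (\<open>grows_to_False\<close>), \<open>smaller\<close> does the same for rerouting
  (\<open>not_all_in_flat\<close>).\<close>

locale stage = girth5 +
  fixes m :: model and \<phi> :: "int \<Rightarrow> 'a list"
  assumes emb: "emb V E m \<phi>" and chk: "checked m"
    and bigger: "\<And>T \<psi>. T \<in> set models \<Longrightarrow> length (thins m) < length (thins T) \<Longrightarrow> \<not> emb V E T \<psi>"
    and smaller: "\<And>\<psi>. emb V E m \<psi> \<Longrightarrow> card (span m \<phi>) \<le> card (span m \<psi>)"
    and no2: "\<not> has_proper_2cutset V E"
begin

definition cl :: "flat \<Rightarrow> 'a set" where
  "cl f = (case f of (d, a, b) \<Rightarrow> set (\<phi> a @ \<phi> d @ \<phi> b))"

text \<open>Relation of lying on a common closed path. The goal of this part is that the attachments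
  of one outside component are pairwise \<open>same\<close>.\<close>

definition same :: "'a \<Rightarrow> 'a \<Rightarrow> bool" where
  "same x y \<longleftrightarrow> (\<exists>f\<in>set (flats m). x \<in> cl f \<and> y \<in> cl f)"

lemma same_sym: "same x y \<Longrightarrow> same y x"
  unfolding same_def by blast

lemma ids_m: "set (ids m) = set (thins m) \<union> fst ` set (flats m)"
  by (cases m) auto

lemma emb': "emb V E (thins m, fst (snd m), flats m) \<phi>"
  using emb by (cases m) simp

lemmas D = embD[OF emb']

lemma coarse_iff: "p \<in> set (coarse m) \<longleftrightarrow> (\<exists>i\<in>set (thins m). p = Thin i) \<or> (\<exists>f\<in>set (flats m). p = Whole f)"
  by (cases m) auto

lemma ids_range: "i \<in> set (ids m) \<Longrightarrow> 0 \<le> i \<and> i < 20"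
  using chk unfolding checked_def shape_ok_def by (auto simp: list_all_iff)

lemma unique_id: "i \<in> set (ids m) \<Longrightarrow> j \<in> set (ids m) \<Longrightarrow> h \<in> set (\<phi> i) \<Longrightarrow> h \<in> set (\<phi> j) \<Longrightarrow> i = j"
  using emb_sys[OF emb] unfolding sys_def by blast

lemma thin_not_flat: "f \<in> set (flats m) \<Longrightarrow> fst f \<notin> set (thins m)"
  using D(1) by auto

lemma pid_coarse: "p \<in> set (coarse m) \<Longrightarrow> pid p \<in> set (ids m)"
  unfolding coarse_iff ids_m by (auto intro: rev_image_eqI)

lemma pid_inj:
  assumes "p \<in> set (coarse m)" "q \<in> set (coarse m)" "pid p = pid q"
  shows "p = q"
  using assms thin_not_flat emb_flat_unique[OF emb'] unfolding coarse_iff by auto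

lemma ex_coarse:
  assumes "h \<in> span m \<phi>"
  obtains p where "p \<in> set (coarse m)" "located \<phi> p h"
proof -
  obtain i where i: "i \<in> set (ids m)" "h \<in> set (\<phi> i)" using assms unfolding span_def by blast
  then consider "i \<in> set (thins m)" | f where "f \<in> set (flats m)" "i = fst f" unfolding ids_m by blast
  then show thesis
  proof cases
    case 1
    then have "\<phi> i = [h]" using D(3)[OF 1] i(2) by auto
    then show thesis using that[of "Thin i"] 1 coarse_iff by auto
  next
    case 2
    then show thesis using that[of "Whole f"] i coarse_iff by auto
  qed
qed

lemma located_mem: "p \<in> set (coarse m) \<Longrightarrow> located \<phi> p h \<Longrightarrow> h \<in> set (\<phi> (pid p))"
  unfolding coarse_iff by auto

lemma located_span: "p \<in> set (coarse m) \<Longrightarrow> located \<phi> p h \<Longrightarrow> h \<in> span m \<phi>"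
  using located_mem[of p h] pid_coarse[of p] unfolding span_def by blast

lemma on_iff:
  assumes p: "p \<in> set (coarse m)" "located \<phi> p h" and f: "f \<in> set (flats m)"
  shows "on p f \<longleftrightarrow> h \<in> cl f"
proof -
  obtain d a b where fd: "f = (d, a, b)" by (cases f)
  have ab: "a \<in> set (thins m)" "b \<in> set (thins m)" using D(4) f fd by blast+
  have i: "a \<in> set (ids m)" "b \<in> set (ids m)" "d \<in> set (ids m)" using ab f fd unfolding ids_m by force+
  have h: "h \<in> set (\<phi> (pid p))" by (rule located_mem[OF p])
  have "h \<in> set (\<phi> j) \<longleftrightarrow> pid p = j" if "j \<in> set (ids m)" for j
    using unique_id[OF pid_coarse[OF p(1)] that h] h by blast
  then have c: "h \<in> cl f \<longleftrightarrow> pid p = a \<or> pid p = d \<or> pid p = b" using i unfolding cl_def fd by auto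
  have "d \<notin> set (thins m)" using thin_not_flat[OF f] fd by simp
  then show ?thesis using p(1) c ab thin_not_flat unfolding coarse_iff fd by auto
qed

lemma share_same:
  assumes "p \<in> set (coarse m)" "located \<phi> p h" "q \<in> set (coarse m)" "located \<phi> q g"
  shows "share (flats m) p q \<longleftrightarrow> same h g"
  unfolding share_iff same_def using on_iff[OF assms(1,2)] on_iff[OF assms(3,4)] by blast

text \<open>Points carry no vertices; \<open>hh\<close> names the attachment chosen in each piece,
  indexed by the number of the piece. So a point keeps its vertex when its piece is split.\<close>

definition okpt :: "(int \<Rightarrow> 'a) \<Rightarrow> pt \<Rightarrow> bool" where
  "okpt hh p \<longleftrightarrow> is_pt m p \<and> located \<phi> p (hh (pid p)) \<and> pid p \<in> set (ids m)"

lemma okpt_coarse: "p \<in> set (coarse m) \<Longrightarrow> located \<phi> p (hh (pid p)) \<Longrightarrow> okpt hh p"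
  unfolding okpt_def using pid_coarse[of p] unfolding coarse_iff by auto

lemma okpt_fine:
  assumes "p \<in> set (coarse m)" "located \<phi> p (hh (pid p))"
  obtains p' where "p' \<in> set (fines p)" "okpt hh p'" "pid p' = pid p" "\<not> is_whole p'"
proof (cases p)
  case (Thin i)
  then show thesis using that[of p] okpt_coarse[where hh=hh, OF assms] by simp
next
  case (Whole f)
  then obtain L1 L2 where L: "\<phi> (fst f) = L1 @ hh (fst f) # L2" using assms(2) by (auto dest: split_list)
  have f: "f \<in> set (flats m)" using assms(1) Whole unfolding coarse_iff by auto
  show thesis
  proof (rule that[of "Split f (L1 \<noteq> []) (L2 \<noteq> [])"])
    show "okpt hh (Split f (L1 \<noteq> []) (L2 \<noteq> []))" using f L unfolding okpt_def ids_m by auto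
  qed (use Whole in auto)
next
  case (Split f x y)
  then show thesis using assms(1) unfolding coarse_iff by auto
qed

lemma variants_okpt:
  assumes "length msk = length ps" "\<And>p. p \<in> set ps \<Longrightarrow> p \<in> set (coarse m) \<and> located \<phi> p (hh (pid p))"
  shows "\<exists>qs\<in>set (variants msk ps). map pid qs = map pid ps \<and> (\<forall>q\<in>set qs. okpt hh q) \<and> ((\<forall>b\<in>set msk. b) \<longrightarrow> (\<forall>q\<in>set qs. \<not> is_whole q))"
  using assms
proof (induction msk ps rule: list_induct2)
  case (Cons b bs p ps)
  have "\<exists>qs\<in>set (variants bs ps). map pid qs = map pid ps \<and> (\<forall>q\<in>set qs. okpt hh q) \<and>
      ((\<forall>b\<in>set bs. b) \<longrightarrow> (\<forall>q\<in>set qs. \<not> is_whole q))"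
    by (rule Cons.IH) (use Cons.prems in auto)
  then obtain qs where qs: "qs \<in> set (variants bs ps)" "map pid qs = map pid ps" "\<forall>q\<in>set qs. okpt hh q"
    "(\<forall>b\<in>set bs. b) \<longrightarrow> (\<forall>q\<in>set qs. \<not> is_whole q)" by blast
  have p: "p \<in> set (coarse m)" "located \<phi> p (hh (pid p))" using Cons.prems by auto
  obtain p' where p': "p' \<in> set (if b then fines p else [p])" "okpt hh p'" "pid p' = pid p" "b \<longrightarrow> \<not> is_whole p'"
  proof (cases b)
    case True
    obtain p'' where "p'' \<in> set (fines p)" "okpt hh p''" "pid p'' = pid p" "\<not> is_whole p''" by (rule okpt_fine[where hh=hh, OF p])
    then show thesis using that[of p''] True by simp
  next
    case False
    then show thesis using that[of p] okpt_coarse[where hh=hh, OF p] by simp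
  qed
  have "p' # qs \<in> set (variants (b # bs) (p # ps))" using p'(1) qs(1) by auto
  then show ?case using p' qs by (intro bexI[of _ "p' # qs"]) auto
qed simp

lemma refined:
  assumes ok: "\<And>p. p \<in> set ps \<Longrightarrow> okpt hh p" and dist: "distinct (map pid ps)"
  obtains \<phi>' where "emb V E (fold refine ps m) \<phi>'" "span (fold refine ps m) \<phi>' = span m \<phi>"
    "\<forall>p\<in>set ps. hh (pid p) \<in> set (\<phi>' (pid p))"
    "\<forall>p\<in>set ps. \<not> is_whole p \<longrightarrow> pid p \<in> set (thins (fold refine ps m)) \<and> \<phi>' (pid p) = [hh (pid p)]"
    "\<forall>i<20. i \<notin> pid ` set ps \<longrightarrow> \<phi>' i = \<phi> i" "set (thins m) \<subseteq> set (thins (fold refine ps m))"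
    "99 \<notin> set (ids (fold refine ps m))"
proof -
  have ps: "is_pt m p \<and> located \<phi> p (hh (pid p)) \<and> 0 \<le> pid p \<and> pid p < 20 \<and> pid p + 20 \<notin> set (ids m) \<and> pid p + 40 \<notin> set (ids m)"
    if "p \<in> set ps" for p
  proof -
    have o: "is_pt m p" "located \<phi> p (hh (pid p))" "pid p \<in> set (ids m)" using ok[OF that] unfolding okpt_def by auto
    have r: "0 \<le> pid p \<and> pid p < 20" using ids_range[OF o(3)] .
    have "pid p + 20 \<notin> set (ids m)" "pid p + 40 \<notin> set (ids m)"
      using ids_range[of "pid p + 20"] ids_range[of "pid p + 40"] r by auto
    then show ?thesis using o r by blast
  qed
  have no99: "99 \<notin> set (ids (fold refine ps m))"
  proof
    assume "99 \<in> set (ids (fold refine ps m))"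
    then have "99 \<in> set (ids m) \<or> (\<exists>p\<in>set ps. 99 = pid p \<or> 99 = pid p + 20 \<or> 99 = pid p + 40)" by (rule ids_fold_refine)
    then show False using ids_range[of 99] ps by fastforce
  qed
  obtain \<phi>' where "emb V E (fold refine ps m) \<phi>'" "span (fold refine ps m) \<phi>' = span m \<phi>"
    "\<forall>p\<in>set ps. hh (pid p) \<in> set (\<phi>' (pid p))"
    "\<forall>p\<in>set ps. \<not> is_whole p \<longrightarrow> pid p \<in> set (thins (fold refine ps m)) \<and> \<phi>' (pid p) = [hh (pid p)]"
    "\<forall>i<20. i \<notin> pid ` set ps \<longrightarrow> \<phi>' i = \<phi> i" "set (thins m) \<subseteq> set (thins (fold refine ps m))"
    using emb_refine_list[OF emb, of ps "\<lambda>p. hh (pid p)", OF ps dist] by metis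
  then show thesis using that no99 by blast
qed

lemma grows_to_False:
  assumes "grows_to m m'" "emb V E m' \<psi>"
  shows False
proof -
  obtain T \<sigma> where T: "T \<in> set models" "length (thins m) < length (thins T)" "relabel_ok T m' \<sigma>"
    using assms(1) unfolding grows_to_def by blast
  obtain N R F where t: "T = (N, R, F)" by (cases T)
  obtain N' R' F' where m': "m' = (N', R', F')" by (cases m')
  obtain \<psi>' where "emb V E (N, R, F) \<psi>'" using emb_relabel[of V E N' R' F' \<psi> N R F \<sigma>] assms(2) T(3) t m' by metis
  then show False using bigger[OF T(1,2)] t by blast
qed

lemma ear_info:
  assumes "(p, q) \<in> set (pairs (coarse m))" "\<not> share (flats m) p q"
  obtains cs G where "indep (flats m) (pairs (shared (flats m) p q (thins m)))"
    "ears_table m (shared (flats m) p q (thins m)) cs G (fines p) (fines q)"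
    "\<forall>(p, q)\<in>set G. is_split p \<and> is_split q \<and> grows_to m (add_ear (pid p) (pid q) (refine q (refine p m)))"
proof -
  obtain G D where 1: "ears_ok m G D" "ears_cover (flats m) (map (\<lambda>(p, q, c). (p, q)) D) (pairs (coarse m))"
    "\<forall>(p, q)\<in>set G. is_split p \<and> is_split q \<and> grows_to m (add_ear (pid p) (pid q) (refine q (refine p m)))"
    using chk unfolding checked_def by blast
  have "(p, q) \<in> set (map (\<lambda>(p, q, c). (p, q)) D)" using ears_coverD[OF 1(2) assms(1)] assms(2) by blast
  then obtain cs where "(p, q, cs) \<in> set D" by auto
  from ears_okD[OF 1(1) this] 1(3) show thesis using that by blast
qed

lemma emb_thin_single: "emb V E m' \<psi> \<Longrightarrow> t \<in> set (thins m') \<Longrightarrow> \<exists>v. \<psi> t = [v]"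
  by (cases m') (use embD(3) in fastforce)

lemma thins_ids: "set (thins m') \<subseteq> set (ids m')"
  by (cases m') auto

text \<open>The outside set becomes piece 99. This piece may be an end of the chord only when the
  set is a single vertex, hence the two forms of \<open>T\<close>.\<close>

lemma attach_ucheck:
  assumes e: "emb V E m1 \<psi>" and P: "conn E P" "P \<subseteq> V - span m1 \<psi>" and n: "99 \<notin> set (ids m1)" and C: "set C \<subseteq> set (thins m1)"
    and nb: "\<And>h. h \<in> span m1 \<psi> \<Longrightarrow> sees E h P \<longleftrightarrow> (\<exists>c\<in>set C. \<psi> c = [h])"
    and T: "T = thins m1 \<or> T = 99 # thins m1 \<and> (\<exists>x. P = {x})"
    and u: "ucheck (links m1 @ map (Pair 99) C) (99 # ids m1) T cs"
  shows False
proof -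
  have Ci: "set C \<subseteq> set (ids m1)" using C thins_ids[of m1] by blast
  have sys: "sys V E (set (99 # ids m1)) (links m1 @ map (Pair 99) C) ((\<lambda>i. set (\<psi> i))(99 := P))"
  proof (rule sys_attach[OF e P(1) _ _ n Ci])
    show "P \<subseteq> V" "P \<inter> span m1 \<psi> = {}" using P(2) by auto
    fix i assume i: "i \<in> set (ids m1)"
    show "(\<exists>x\<in>P. \<exists>y\<in>set (\<psi> i). {x, y} \<in> E) \<longleftrightarrow> i \<in> set C"
    proof
      assume "\<exists>x\<in>P. \<exists>y\<in>set (\<psi> i). {x, y} \<in> E"
      then obtain x y where xy: "x \<in> P" "y \<in> set (\<psi> i)" "{y, x} \<in> E" by (auto simp: insert_commute)
      have ys: "y \<in> span m1 \<psi>" using i xy(2) unfolding span_def by blast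
      have "sees E y P" using xy unfolding sees_def by blast
      then obtain c where c: "c \<in> set C" "\<psi> c = [y]" using nb[OF ys] by blast
      have "c = i"
      proof (rule ccontr)
        assume "c \<noteq> i"
        then have "set (\<psi> c) \<inter> set (\<psi> i) = {}" using emb_sys[OF e] i Ci c(1) unfolding sys_def by blast
        then show False using c(2) xy(2) by auto
      qed
      then show "i \<in> set C" using c by simp
    next
      assume iC: "i \<in> set C"
      then obtain h where h: "\<psi> i = [h]" using emb_thin_single[OF e] C by blast
      have "h \<in> span m1 \<psi>" using h i unfolding span_def by force
      then have "sees E h P" using nb h iC by blast
      then obtain x where "x \<in> P" "{x, h} \<in> E" unfolding sees_def by (auto simp: insert_commute)
      then show "\<exists>x\<in>P. \<exists>y\<in>set (\<psi> i). {x, y} \<in> E" using h by auto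
    qed
  qed
  show False
  proof (rule ucheck_False[OF sys u])
    fix t assume t: "t \<in> set T"
    show "t \<in> set (99 # ids m1) \<and> (\<exists>x. ((\<lambda>i. set (\<psi> i))(99 := P)) t = {x})"
    proof (cases "t = 99")
      case True
      then show ?thesis using T t n thins_ids[of m1] by auto
    next
      case False
      then have tt: "t \<in> set (thins m1)" using T t by auto
      then obtain v where "\<psi> t = [v]" using emb_thin_single[OF e] by blast
      then show ?thesis using False tt thins_ids[of m1] by auto
    qed
  qed
qed

text \<open>\<open>W\<close> collects the attachments of \<open>P\<close> besides \<open>h1\<close>
  and \<open>h2\<close>. After both ends have been made single vertices, \<open>W\<close> has at
  most one element, also a single vertex, and the table entry for this splitting yields a unichord
  or a larger pattern.\<close>

lemma no_ear_ordered:
  assumes P: "P \<noteq> []" "ipath E P" "set P \<subseteq> V - span m \<phi>"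
    and pq: "(p, q) \<in> set (pairs (coarse m))" "p \<in> set (coarse m)" "q \<in> set (coarse m)" "located \<phi> p h1" "located \<phi> q h2"
    and h: "\<not> same h1 h2" "p \<noteq> q"
    and nb: "\<And>h. h \<in> span m \<phi> \<Longrightarrow> sees E h (set P) \<longleftrightarrow> h = h1 \<or> h = h2 \<or> h \<in> W"
    and W: "\<And>w. w \<in> W \<Longrightarrow> w \<in> span m \<phi> \<and> w \<noteq> h1 \<and> w \<noteq> h2 \<and> same w h1 \<and> same w h2"
      "\<And>w w'. w \<in> W \<Longrightarrow> w' \<in> W \<Longrightarrow> w \<noteq> w' \<Longrightarrow> same w w'"
    and ends: "W = {} \<Longrightarrow> {h1, h2} \<notin> E \<Longrightarrow> ipath E ([h1] @ P @ [h2])"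
  shows False
proof -
  have ns: "\<not> share (flats m) p q" using share_same[OF pq(2,4) pq(3,5)] h(1) by blast
  obtain cs G where info: "indep (flats m) (pairs (shared (flats m) p q (thins m)))"
    "ears_table m (shared (flats m) p q (thins m)) cs G (fines p) (fines q)"
    "\<forall>(p, q)\<in>set G. is_split p \<and> is_split q \<and> grows_to m (add_ear (pid p) (pid q) (refine q (refine p m)))"
    by (rule ear_info[OF pq(1) ns])
  have pne: "pid p \<noteq> pid q" using pid_inj[OF pq(2,3)] h(2) by blast
  define hh where "hh i = (if i = pid p then h1 else h2)" for i
  have hp: "located \<phi> p (hh (pid p))" "located \<phi> q (hh (pid q))" using pq(4,5) pne unfolding hh_def by auto
  obtain p' where p': "p' \<in> set (fines p)" "okpt hh p'" "pid p' = pid p" "\<not> is_whole p'" by (rule okpt_fine[where hh=hh, OF pq(2) hp(1)])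
  obtain q' where q': "q' \<in> set (fines q)" "okpt hh q'" "pid q' = pid q" "\<not> is_whole q'" by (rule okpt_fine[where hh=hh, OF pq(3) hp(2)])
  define m1 where "m1 = refine q' (refine p' m)"
  have m1f: "fold refine [p', q'] m = m1" unfolding m1_def by simp
  have okl: "okpt hh r" if "r \<in> set [p', q']" for r using that p' q' by auto
  have dl: "distinct (map pid [p', q'])" using p'(3) q'(3) pne by simp
  obtain \<psi> where \<psi>: "emb V E m1 \<psi>" "span m1 \<psi> = span m \<phi>"
    "\<forall>r\<in>set [p', q']. hh (pid r) \<in> set (\<psi> (pid r))"
    "\<forall>r\<in>set [p', q']. \<not> is_whole r \<longrightarrow> pid r \<in> set (thins m1) \<and> \<psi> (pid r) = [hh (pid r)]"
    "\<forall>i<20. i \<notin> pid ` set [p', q'] \<longrightarrow> \<psi> i = \<phi> i" "set (thins m) \<subseteq> set (thins m1)" "99 \<notin> set (ids m1)"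
    by (rule refined[OF okl dl, unfolded m1f])
  have pp: "pid p \<in> set (thins m1)" "\<psi> (pid p) = [h1]" "pid q \<in> set (thins m1)" "\<psi> (pid q) = [h2]"
    using \<psi>(4) p'(3,4) q'(3,4) pne unfolding hh_def by auto
  \<comment> \<open>A vertex in the interior of a path lies on no other closed path. If
    \<open>w\<close> were such a vertex, \<open>h1\<close> and \<open>h2\<close> would both lie on
    this path, contrary to \<open>ns\<close>.\<close>
  have thinW: "\<exists>i\<in>set (shared (flats m) p q (thins m)). \<phi> i = [w]" if w: "w \<in> W" for w
  proof -
    have ws: "w \<in> span m \<phi>" "same w h1" "same w h2" using W(1)[OF w] by auto
    obtain r where r: "r \<in> set (coarse m)" "located \<phi> r w" by (rule ex_coarse[OF ws(1)])
    have s: "share (flats m) r p" "share (flats m) r q" using share_same[OF r pq(2,4)] share_same[OF r pq(3,5)] ws by auto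
    have "\<exists>i\<in>set (thins m). r = Thin i"
    proof (rule ccontr)
      assume "\<not> ?thesis"
      then obtain f where f: "f \<in> set (flats m)" "r = Whole f" using r(1) unfolding coarse_iff by blast
      have fu: "g = f" if "g \<in> set (flats m)" "on r g" for g
      proof -
        have "fst f = fst g" using that(2) f(2) by (cases g) auto
        then show ?thesis using emb_flat_unique[OF emb' that(1) f(1)] by simp
      qed
      then have "on p f" "on q f" using s unfolding share_iff by blast+
      then show False using ns f(1) unfolding share_iff by blast
    qed
    then obtain i where "i \<in> set (thins m)" "r = Thin i" by blast
    then show ?thesis using s r(2) shared_iff by auto
  qed
  \<comment> \<open>Two elements would lie on a common closed path by assumption, but
    \<open>indep\<close> says that the candidates never do.\<close>
  have Wone: "w = w'" if w: "w \<in> W" "w' \<in> W" for w w'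
  proof (rule ccontr)
    assume ne: "w \<noteq> w'"
    obtain i j where ij: "i \<in> set (shared (flats m) p q (thins m))" "\<phi> i = [w]" "j \<in> set (shared (flats m) p q (thins m))" "\<phi> j = [w']"
      using thinW[OF w(1)] thinW[OF w(2)] by blast
    have "i \<noteq> j" using ij ne by auto
    then have "(i, j) \<in> set (pairs (shared (flats m) p q (thins m))) \<or> (j, i) \<in> set (pairs (shared (flats m) p q (thins m)))"
      using pairs_mem[OF ij(1,3)] by blast
    then have "\<not> share (flats m) (Thin i) (Thin j)" using indepD[OF info(1)] share_sym by metis
    moreover have "Thin i \<in> set (coarse m)" "Thin j \<in> set (coarse m)" using ij(1,3) shared_iff coarse_iff by auto
    ultimately have "\<not> same w w'" using share_same[of "Thin i" w "Thin j" w'] ij(2,4) by simp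
    then show False using W(2)[OF w ne] by blast
  qed
  have row: "killed_all (refine q' (refine p' m)) [pid p', pid q'] cs ([] # map (\<lambda>w. [w]) (shared (flats m) p q (thins m))) \<or>
      shared (flats m) p q (thins m) = [] \<and> (p', q') \<in> set G"
    by (rule ears_rowD[OF ears_tableD[OF info(2) p'(1)] q'(1)])
  have kill: False if K: "killed_all m1 [pid p, pid q] cs ([] # map (\<lambda>w. [w]) (shared (flats m) p q (thins m)))"
  proof -
    have "\<exists>Wl. set Wl \<subseteq> set (thins m) \<and> Wl \<in> set ([] # map (\<lambda>w. [w]) (shared (flats m) p q (thins m))) \<and> (\<forall>w. w \<in> W \<longleftrightarrow> (\<exists>i\<in>set Wl. \<phi> i = [w]))"
    proof (cases "W = {}")
      case True
      then show ?thesis by (intro exI[of _ "[]"]) auto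
    next
      case False
      then obtain w where w: "w \<in> W" by blast
      obtain i where i: "i \<in> set (shared (flats m) p q (thins m))" "\<phi> i = [w]" using thinW[OF w] by blast
      have "v \<in> W \<longleftrightarrow> (\<exists>i\<in>set [i]. \<phi> i = [v])" for v using Wone[OF w, of v] w i(2) by auto
      moreover have "set [i] \<subseteq> set (thins m)" using i(1) shared_iff by auto
      ultimately show ?thesis using i(1) by (intro exI[of _ "[i]"]) auto
    qed
    then obtain Wl where Wl: "set Wl \<subseteq> set (thins m)" "Wl \<in> set ([] # map (\<lambda>w. [w]) (shared (flats m) p q (thins m)))"
      "\<forall>w. w \<in> W \<longleftrightarrow> (\<exists>i\<in>set Wl. \<phi> i = [w])" by blast
    have same_phi: "\<psi> i = \<phi> i" if i: "i \<in> set Wl" for i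
    proof -
      have it: "i \<in> set (thins m)" using Wl(1) i by blast
      obtain v where v: "\<phi> i = [v]" using D(3)[OF it] by blast
      then have "v \<in> W" using Wl(3) i by blast
      then have vn: "v \<noteq> h1" "v \<noteq> h2" using W(1) by auto
      have ii: "i \<in> set (ids m)" using it ids_m by blast
      have "i \<noteq> pid p" using located_mem[OF pq(2,4)] v vn by auto
      moreover have "i \<noteq> pid q" using located_mem[OF pq(3,5)] v vn by auto
      ultimately show ?thesis using \<psi>(5) ids_range[OF ii] p'(3) q'(3) by auto
    qed
    have u: "ucheck (links m1 @ map (Pair 99) ([pid p, pid q] @ Wl)) (99 # ids m1) (thins m1) cs"
      by (rule killed_allD[OF K Wl(2)])
    show False
    proof (rule attach_ucheck[OF \<psi>(1) ipath_conn[OF P(2,1)] _ \<psi>(7) _ _ _ u])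
      show "set P \<subseteq> V - span m1 \<psi>" using P(3) \<psi>(2) by simp
      show "set ([pid p, pid q] @ Wl) \<subseteq> set (thins m1)" using pp Wl(1) \<psi>(6) by auto
      show "thins m1 = thins m1 \<or> thins m1 = 99 # thins m1 \<and> (\<exists>x. set P = {x})" by simp
      fix h assume "h \<in> span m1 \<psi>"
      then have "sees E h (set P) \<longleftrightarrow> h = h1 \<or> h = h2 \<or> h \<in> W" using nb \<psi>(2) by simp
      also have "\<dots> \<longleftrightarrow> (\<exists>c\<in>set ([pid p, pid q] @ Wl). \<psi> c = [h])"
        using pp Wl(3) same_phi by auto
      finally show "sees E h (set P) \<longleftrightarrow> (\<exists>c\<in>set ([pid p, pid q] @ Wl). \<psi> c = [h])" .
    qed
  qed
  from row show False
  proof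
    assume "killed_all (refine q' (refine p' m)) [pid p', pid q'] cs ([] # map (\<lambda>w. [w]) (shared (flats m) p q (thins m)))"
    then show False using kill p'(3) q'(3) m1_def by simp
  next
    assume g: "shared (flats m) p q (thins m) = [] \<and> (p', q') \<in> set G"
    then have "W = {}" using thinW by auto
    obtain N R F where m1: "m1 = (N, R, F)" by (cases m1)
    have sp: "is_split p'" "is_split q'" using info(3) g by auto
    \<comment> \<open>Growth occurs only with both ends inside different paths. These are
      anticomplete, so the ends are not adjacent and the ear is an induced path together with
      them.\<close>
    have "\<exists>f\<in>set (flats m). p = Whole f" using pq(2) p'(1) sp(1) unfolding coarse_iff by auto
    moreover have "\<exists>f\<in>set (flats m). q = Whole f" using pq(3) q'(1) sp(2) unfolding coarse_iff by auto
    ultimately obtain f f' where ff: "p = Whole f" "q = Whole f'" and fF: "f \<in> set (flats m)" "f' \<in> set (flats m)" by blast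
    have "anticomplete E (set (\<phi> (fst f))) (set (\<phi> (fst f')))" using D(7)[OF fF] pne ff by simp
    then have nadj: "{h1, h2} \<notin> E" using pq(4,5) ff unfolding anticomplete_def by auto
    have "emb V E (N, R, (99, pid p, pid q) # F) (\<psi>(99 := P))"
    proof (rule emb_ear[OF \<psi>(1)[unfolded m1] _ P(1) _ _ _ _ pp(2,4) ends[OF \<open>W = {}\<close> nadj]])
      show "99 \<notin> set (ids (N, R, F))" using \<psi>(7) m1 by simp
      show "set P \<subseteq> V" "set P \<inter> span (N, R, F) \<psi> = {}" using P(3) \<psi>(2) m1 by auto
      show "pid p \<in> set N" "pid q \<in> set N" using pp(1,3) m1 by auto
      fix x h assume x: "x \<in> set P" and hs: "h \<in> span (N, R, F) \<psi>" "h \<noteq> h1" "h \<noteq> h2"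
      then have "\<not> sees E h (set P)" using nb \<psi>(2) m1 \<open>W = {}\<close> by auto
      then show "{x, h} \<notin> E" using x unfolding sees_def by (auto simp: insert_commute)
    qed
    then have "emb V E (add_ear (pid p') (pid q') (refine q' (refine p' m))) (\<psi>(99 := P))"
      using m1 m1_def p'(3) q'(3) by simp
    moreover have "grows_to m (add_ear (pid p') (pid q') (refine q' (refine p' m)))" using info(3) g by blast
    ultimately show False by (rule grows_to_False[rotated])
  qed
qed

text \<open>The tables contain each pair of pieces in one order only; for the other order the ear is
  reversed.\<close>

lemma no_ear:
  assumes P: "P \<noteq> []" "ipath E P" "set P \<subseteq> V - span m \<phi>"
    and h: "h1 \<in> span m \<phi>" "h2 \<in> span m \<phi>" "h1 \<noteq> h2" "\<not> same h1 h2"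
    and nb: "\<And>h. h \<in> span m \<phi> \<Longrightarrow> sees E h (set P) \<longleftrightarrow> h = h1 \<or> h = h2 \<or> h \<in> W"
    and W: "\<And>w. w \<in> W \<Longrightarrow> w \<in> span m \<phi> \<and> w \<noteq> h1 \<and> w \<noteq> h2 \<and> same w h1 \<and> same w h2"
      "\<And>w w'. w \<in> W \<Longrightarrow> w' \<in> W \<Longrightarrow> w \<noteq> w' \<Longrightarrow> same w w'"
    and ends: "W = {} \<Longrightarrow> {h1, h2} \<notin> E \<Longrightarrow> ipath E ([h1] @ P @ [h2])"
  shows False
proof -
  obtain p where p: "p \<in> set (coarse m)" "located \<phi> p h1" by (rule ex_coarse[OF h(1)])
  obtain q where q: "q \<in> set (coarse m)" "located \<phi> q h2" by (rule ex_coarse[OF h(2)])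
  have ns: "\<not> share (flats m) p q" using share_same[OF p q] h(4) by blast
  have "p \<noteq> q"
  proof
    assume "p = q"
    then show False using ns p q h(3) unfolding coarse_iff share_iff by auto
  qed
  then consider "(p, q) \<in> set (pairs (coarse m))" | "(q, p) \<in> set (pairs (coarse m))" using pairs_mem[OF p(1) q(1)] by blast
  then show False
  proof cases
    case 1
    show False by (rule no_ear_ordered[OF P 1 p(1) q(1) p(2) q(2) h(4) \<open>p \<noteq> q\<close> nb W ends])
  next
    case 2
    show False
    proof (rule no_ear_ordered[of "rev P" q p h2 h1 W])
      show "rev P \<noteq> []" "ipath E (rev P)" "set (rev P) \<subseteq> V - span m \<phi>" using P ipath_rev by auto
      show "\<not> same h2 h1" using h(4) same_sym by blast
      show "\<And>h. h \<in> span m \<phi> \<Longrightarrow> sees E h (set (rev P)) \<longleftrightarrow> h = h2 \<or> h = h1 \<or> h \<in> W" using nb by auto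
      show "\<And>w. w \<in> W \<Longrightarrow> w \<in> span m \<phi> \<and> w \<noteq> h2 \<and> w \<noteq> h1 \<and> same w h2 \<and> same w h1" using W(1) by auto
      show "W = {} \<Longrightarrow> {h2, h1} \<notin> E \<Longrightarrow> ipath E ([h2] @ rev P @ [h1])"
        using ends ipath_rev[of E "[h1] @ P @ [h2]"] by (simp add: insert_commute)
    qed (use 2 p q \<open>p \<noteq> q\<close> W(2) in auto)
  qed
qed

end

section \<open>Outside vertices with three neighbours in the copy\<close>

lemma pairs_distinct: "distinct (map f xs) \<Longrightarrow> (x, y) \<in> set (pairs xs) \<Longrightarrow> f x \<noteq> f y"
  by (induction xs) auto

lemma triples_distinct:
  assumes "distinct (map f xs)" "(x, y, z) \<in> set (triples xs)"
  shows "distinct (map f [x, y, z])"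
  using assms
proof (induction xs)
  case (Cons w ws)
  show ?case
  proof (cases "(x, y, z) \<in> set (triples ws)")
    case True
    then show ?thesis using Cons by simp
  next
    case False
    then have xw: "x = w" "(y, z) \<in> set (pairs ws)" using Cons.prems(2) by auto
    have "f y \<noteq> f z" using pairs_distinct[of f ws y z] Cons.prems(1) xw(2) by simp
    moreover have "f y \<in> f ` set ws" "f z \<in> f ` set ws" using pairs_sub[OF xw(2)] by auto
    ultimately show ?thesis using Cons.prems(1) xw(1) by auto
  qed
qed simp

context stage
begin

lemma map_pid_coarse: "map pid (coarse m) = ids m"
  by (cases m) (simp add: comp_def)

lemma distinct_ids: "distinct (ids m)"
  using D(1) by (cases m) simp

definition exc_list :: "(pt \<times> pt \<times> pt) list \<Rightarrow> bool" where
  "exc_list exc \<longleftrightarrow> (\<forall>p q r. (p, q, r) \<in> set (triples (coarse m)) \<longrightarrow> share_any (flats m) (pairs [p, q, r]) \<or> near_any m (pairs [p, q, r]) \<or>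
       (\<exists>msk cs. length msk = 3 \<and> claw_variants m cs (variants msk [p, q, r])) \<or> (p, q, r) \<in> set exc) \<and>
     (exc = [] \<or> (\<exists>p q r ecs EG. exc = [(p, q, r)] \<and> is_whole p \<and> is_whole q \<and> is_whole r \<and>
        exc_variants m ecs EG (variants [True, True, True] [p, q, r]) \<and>
        (\<forall>ps\<in>set EG. grows_to m (add_vertex (map pid ps) (fold refine ps m)))))"

lemma ex_exc_list: "\<exists>exc. exc_list exc"
proof -
  obtain C exc ecs EG where 1: "claws_ok m C" "claws_cover m (exc @ map (\<lambda>(p, q, r, c). (p, q, r)) C) (triples (coarse m))"
    and 2: "exc = [] \<or> (\<exists>p q r. exc = [(p, q, r)] \<and> is_whole p \<and> is_whole q \<and> is_whole r \<and>
        exc_variants m ecs EG (variants [True, True, True] [p, q, r]) \<and>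
        (\<forall>ps\<in>set EG. grows_to m (add_vertex (map pid ps) (fold refine ps m))))"
    using chk unfolding checked_def by blast
  show ?thesis
    unfolding exc_list_def
  proof (intro exI[of _ exc] conjI allI impI)
    fix p q r assume t: "(p, q, r) \<in> set (triples (coarse m))"
    have "(p, q, r) \<in> set exc \<or> (\<exists>msk cs. length msk = 3 \<and> claw_variants m cs (variants msk [p, q, r]))"
      if "(p, q, r) \<in> set (exc @ map (\<lambda>(p, q, r, c). (p, q, r)) C)"
    proof (cases "(p, q, r) \<in> set exc")
      case False
      then have "(p, q, r) \<in> (\<lambda>(p, q, r, c). (p, q, r)) ` set C" using that by simp
      then obtain msk cs where "(p, q, r, msk, cs) \<in> set C" by auto
      then show ?thesis using claws_okD[OF 1(1)] by blast
    qed simp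
    then show "share_any (flats m) (pairs [p, q, r]) \<or> near_any m (pairs [p, q, r]) \<or>
       (\<exists>msk cs. length msk = 3 \<and> claw_variants m cs (variants msk [p, q, r])) \<or> (p, q, r) \<in> set exc"
      using claws_coverD[OF 1(2) t] by blast
  next
    show "exc = [] \<or> (\<exists>p q r ecs EG. exc = [(p, q, r)] \<and> is_whole p \<and> is_whole q \<and> is_whole r \<and>
        exc_variants m ecs EG (variants [True, True, True] [p, q, r]) \<and>
        (\<forall>ps\<in>set EG. grows_to m (add_vertex (map pid ps) (fold refine ps m))))" using 2 by blast
  qed
qed

lemma near_pts_False:
  assumes e: "emb V E m' \<psi>" and ps: "\<forall>p\<in>set ps. \<not> is_whole p \<longrightarrow> pid p \<in> set (thins m') \<and> \<psi> (pid p) = [hh (pid p)]"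
    and dist: "distinct (map pid ps)" and x: "x \<notin> span m' \<psi>" "\<forall>p\<in>set ps. {x, hh (pid p)} \<in> E" and n: "near_any m' (pairs ps)"
  shows False
proof -
  obtain p q where pq: "(p, q) \<in> set (pairs ps)" "\<not> is_whole p" "\<not> is_whole q" "near m' (pid p) (pid q)"
    using near_anyD[OF n] by blast
  have ps': "p \<in> set ps" "q \<in> set ps" using pairs_sub[OF pq(1)] by auto
  have ne: "pid p \<noteq> pid q" using pairs_distinct[OF dist pq(1)] .
  show False
    using near_False[OF e _ _ ne _ _ x(1) _ _ pq(4), of "hh (pid p)" "hh (pid q)"] ps ps' pq(2,3) x(2) by blast
qed

text \<open>A certificate from the claw table would make an edge at \<open>x\<close> a unichord,
  whatever further neighbours \<open>x\<close> has. Only the exceptional triple comes without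
  certificate.\<close>

lemma claw_exc:
  assumes t: "(p, q, r) \<in> set (triples (coarse m))" and l: "located \<phi> p h1" "located \<phi> q h2" "located \<phi> r h3"
    and x: "x \<in> V" "x \<notin> span m \<phi>" "{x, h1} \<in> E" "{x, h2} \<in> E" "{x, h3} \<in> E"
    and ns: "\<not> share_any (flats m) (pairs [p, q, r])"
    and exc: "exc_list exc"
  shows "(p, q, r) \<in> set exc"
proof -
  have c: "p \<in> set (coarse m)" "q \<in> set (coarse m)" "r \<in> set (coarse m)" using triples_sub[OF t] by auto
  have d0: "distinct (map pid (coarse m))" using map_pid_coarse distinct_ids by simp
  have dist: "distinct (map pid [p, q, r])" by (rule triples_distinct[OF d0 t])
  define hh where "hh i = (if i = pid p then h1 else if i = pid q then h2 else h3)" for i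
  have hh: "hh (pid p) = h1" "hh (pid q) = h2" "hh (pid r) = h3" using dist unfolding hh_def by auto
  have loc: "s \<in> set (coarse m) \<and> located \<phi> s (hh (pid s))" if "s \<in> set [p, q, r]" for s
    using that c l hh by auto
  have xs: "{x, hh (pid s)} \<in> E" if "s \<in> set [p, q, r]" for s using that hh x by auto
  have n1: False if "near_any m (pairs [p, q, r])"
  proof (rule near_pts_False[OF emb _ dist x(2) _ that])
    show "\<forall>s\<in>set [p, q, r]. \<not> is_whole s \<longrightarrow> pid s \<in> set (thins m) \<and> \<phi> (pid s) = [hh (pid s)]"
    proof (intro ballI impI)
      fix s assume s: "s \<in> set [p, q, r]" "\<not> is_whole s"
      then have ls: "s \<in> set (coarse m)" "located \<phi> s (hh (pid s))" using loc by auto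
      then obtain i where "i \<in> set (thins m)" "s = Thin i" using s(2) unfolding coarse_iff by auto
      then show "pid s \<in> set (thins m) \<and> \<phi> (pid s) = [hh (pid s)]" using ls(2) by simp
    qed
    show "\<forall>s\<in>set [p, q, r]. {x, hh (pid s)} \<in> E" using xs by blast
  qed
  have n2: False if len: "length msk = 3" and cv: "claw_variants m cs (variants msk [p, q, r])" for msk cs
  proof -
    have len': "length msk = length [p, q, r]" using len by simp
    obtain qs where qs: "qs \<in> set (variants msk [p, q, r])" "map pid qs = map pid [p, q, r]" "\<forall>s\<in>set qs. okpt hh s"
      using variants_okpt[OF len' loc] by blast
    have dq: "distinct (map pid qs)" using qs(2) dist by simp
    have okq: "okpt hh s" if "s \<in> set qs" for s using qs(3) that by blast
    obtain \<psi> where \<psi>: "emb V E (fold refine qs m) \<psi>" "span (fold refine qs m) \<psi> = span m \<phi>"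
      "\<forall>p\<in>set qs. hh (pid p) \<in> set (\<psi> (pid p))"
      "\<forall>p\<in>set qs. \<not> is_whole p \<longrightarrow> pid p \<in> set (thins (fold refine qs m)) \<and> \<psi> (pid p) = [hh (pid p)]"
      by (rule refined[OF okq dq])
    have xn: "x \<notin> span (fold refine qs m) \<psi>" using x(2) \<psi>(2) by simp
    have xq: "{x, hh (pid s)} \<in> E" if "s \<in> set qs" for s
    proof -
      have "pid s \<in> set (map pid [p, q, r])" using that qs(2) by (metis imageI set_map)
      then show ?thesis using xs hh by auto
    qed
    from claw_variantsD[OF cv qs(1)] show False
    proof
      assume "near_any (fold refine qs m) (pairs qs)"
      then show False using near_pts_False[OF \<psi>(1,4) dq xn] xq by blast
    next
      assume rc: "rcheck (links (fold refine qs m)) (ids (fold refine qs m)) (thins (fold refine qs m)) (map pid qs) cs"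
      show False
      proof (rule rcheck_False[OF emb_sys[OF \<psi>(1)] rc])
        show "\<And>t. t \<in> set (thins (fold refine qs m)) \<Longrightarrow> t \<in> set (ids (fold refine qs m)) \<and> (\<exists>x. set (\<psi> t) = {x})"
          using emb_thin_single[OF \<psi>(1)] thins_ids[of "fold refine qs m"] by force
        show "x \<notin> (\<Union>i\<in>set (ids (fold refine qs m)). set (\<psi> i))" using xn unfolding span_def .
        fix i assume "i \<in> set (map pid qs)"
        then obtain s where s: "s \<in> set qs" "i = pid s" by auto
        then show "sees E x (set (\<psi> i))" using xq[OF s(1)] \<psi>(3) unfolding sees_def by blast
      qed
    qed
  qed
  have "share_any (flats m) (pairs [p, q, r]) \<or> near_any m (pairs [p, q, r]) \<or>
      (\<exists>msk cs. length msk = 3 \<and> claw_variants m cs (variants msk [p, q, r])) \<or> (p, q, r) \<in> set exc"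
    using exc t unfolding exc_list_def by blast
  then show ?thesis using ns n1 n2 by blast
qed

text \<open>In contrast to \<open>claw_exc\<close> the neighbours of \<open>x\<close> must be known
  exactly, since \<open>x\<close> itself may be used inside a side of a certificate or be added to
  the pattern.\<close>

lemma exc_False:
  assumes c: "p \<in> set (coarse m)" "q \<in> set (coarse m)" "r \<in> set (coarse m)" and dist: "distinct (map pid [p, q, r])"
    and l: "located \<phi> p h1" "located \<phi> q h2" "located \<phi> r h3" and x: "x \<in> V" "x \<notin> span m \<phi>"
    and nb: "\<And>h. h \<in> span m \<phi> \<Longrightarrow> {x, h} \<in> E \<longleftrightarrow> h = h1 \<or> h = h2 \<or> h = h3"
    and ev: "exc_variants m ecs EG (variants [True, True, True] [p, q, r])"
    and EG: "\<forall>ps\<in>set EG. grows_to m (add_vertex (map pid ps) (fold refine ps m))"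
  shows False
proof -
  define hh where "hh i = (if i = pid p then h1 else if i = pid q then h2 else h3)" for i
  have hh: "hh (pid p) = h1" "hh (pid q) = h2" "hh (pid r) = h3" using dist unfolding hh_def by auto
  have loc: "s \<in> set (coarse m) \<and> located \<phi> s (hh (pid s))" if "s \<in> set [p, q, r]" for s
    using that c l hh by auto
  have hspan: "h1 \<in> span m \<phi>" "h2 \<in> span m \<phi>" "h3 \<in> span m \<phi>" using located_span c l by blast+
  have len': "length [True, True, True] = length [p, q, r]" by simp
  have "\<forall>b\<in>set [True, True, True]. b" by simp
  with variants_okpt[OF len' loc] obtain qs where qs: "qs \<in> set (variants [True, True, True] [p, q, r])"
    "map pid qs = map pid [p, q, r]" "\<forall>s\<in>set qs. okpt hh s" "\<forall>s\<in>set qs. \<not> is_whole s"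
    by blast
  have dq: "distinct (map pid qs)" using qs(2) dist by simp
  have okq: "okpt hh s" if "s \<in> set qs" for s using qs(3) that by blast
  define m1 where "m1 = fold refine qs m"
  obtain \<psi> where \<psi>: "emb V E m1 \<psi>" "span m1 \<psi> = span m \<phi>"
    "\<forall>p\<in>set qs. \<not> is_whole p \<longrightarrow> pid p \<in> set (thins m1) \<and> \<psi> (pid p) = [hh (pid p)]" "99 \<notin> set (ids m1)"
    by (rule refined[OF okq dq, folded m1_def])
  have xn: "x \<notin> span m1 \<psi>" using x(2) \<psi>(2) by simp
  have pids: "pid ` set qs = {pid p, pid q, pid r}" using arg_cong[OF qs(2), of set] by simp
  have hs: "(\<exists>s\<in>set qs. h = hh (pid s)) \<longleftrightarrow> h = h1 \<or> h = h2 \<or> h = h3" for h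
  proof -
    have "(\<exists>s\<in>set qs. h = hh (pid s)) \<longleftrightarrow> (\<exists>i\<in>pid ` set qs. h = hh i)" by blast
    then show ?thesis unfolding pids using hh by auto
  qed
  have xq: "\<forall>s\<in>set qs. {x, hh (pid s)} \<in> E"
  proof
    fix s assume "s \<in> set qs"
    then have "hh (pid s) = h1 \<or> hh (pid s) = h2 \<or> hh (pid s) = h3" using hs[of "hh (pid s)"] by blast
    then show "{x, hh (pid s)} \<in> E" using nb[OF hspan(1)] nb[OF hspan(2)] nb[OF hspan(3)] by metis
  qed
  have C: "set (map pid qs) \<subseteq> set (thins m1)" using \<psi>(3) qs(4) by auto
  have nbC: "{x, h} \<in> E \<longleftrightarrow> (\<exists>c\<in>set (map pid qs). \<psi> c = [h])" if "h \<in> span m1 \<psi>" for h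
  proof -
    have "{x, h} \<in> E \<longleftrightarrow> (\<exists>s\<in>set qs. h = hh (pid s))" using nb[of h] hs \<psi>(2) that by simp
    also have "\<dots> \<longleftrightarrow> (\<exists>s\<in>set qs. \<psi> (pid s) = [h])" using \<psi>(3) qs(4) by auto
    finally show ?thesis by simp
  qed
  from exc_variantsD[OF ev qs(1)] show False unfolding m1_def[symmetric]
  proof (elim disjE)
    assume "near_any m1 (pairs qs)"
    then show False using near_pts_False[OF \<psi>(1,3) dq xn xq] by blast
  next
    assume u: "ucheck (links m1 @ map (Pair 99) (map pid qs)) (99 # ids m1) (99 # thins m1) ecs"
    show False
    proof (rule attach_ucheck[OF \<psi>(1) _ _ \<psi>(4) C _ _ u])
      show "conn E {x}" by simp
      show "{x} \<subseteq> V - span m1 \<psi>" using x(1) xn by simp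
      show "99 # thins m1 = thins m1 \<or> 99 # thins m1 = 99 # thins m1 \<and> (\<exists>y. {x} = {y})" by blast
      show "\<And>h. h \<in> span m1 \<psi> \<Longrightarrow> sees E h {x} \<longleftrightarrow> (\<exists>c\<in>set (map pid qs). \<psi> c = [h])"
        using nbC by (simp add: sees_singleton insert_commute)
    qed
  next
    assume g: "qs \<in> set EG"
    obtain N R F where m1': "m1 = (N, R, F)" by (cases m1)
    have "emb V E (99 # N, map (Pair 99) (map pid qs) @ R, F) (\<psi>(99 := [x]))"
    proof (rule emb_vertex[OF \<psi>(1)[unfolded m1'] _ x(1)])
      show "99 \<notin> set (ids (N, R, F))" using \<psi>(4) m1' by simp
      show "x \<notin> span (N, R, F) \<psi>" using xn m1' by simp
      show "set (map pid qs) \<subseteq> set N" using C m1' by simp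
      show "\<And>h. h \<in> span (N, R, F) \<psi> \<Longrightarrow> {x, h} \<in> E \<longleftrightarrow> (\<exists>c\<in>set (map pid qs). \<psi> c = [h])" using nbC m1' by simp
    qed
    then have "emb V E (add_vertex (map pid qs) m1) (\<psi>(99 := [x]))" using m1' by simp
    moreover have "grows_to m (add_vertex (map pid qs) m1)" using EG g m1_def by blast
    ultimately show False by (rule grows_to_False[rotated])
  qed
qed

lemma flat_ends:
  assumes f: "(d, a, b) \<in> set (flats m)"
  obtains va vb where "\<phi> a = [va]" "\<phi> b = [vb]" "ipath E ([va] @ \<phi> d @ [vb])" "\<phi> d \<noteq> []"
    "cl (d, a, b) = {va, vb} \<union> set (\<phi> d)" "a \<in> set (thins m)" "b \<in> set (thins m)" "a \<noteq> b" "d \<in> set (ids m)"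
    "va \<notin> set (\<phi> d)" "vb \<notin> set (\<phi> d)" "va \<noteq> vb" "{va, vb} \<notin> E"
proof -
  have ab: "a \<in> set (thins m)" "b \<in> set (thins m)" "a \<noteq> b" "\<phi> d \<noteq> []" using D(4)[OF f] by auto
  obtain va where va: "\<phi> a = [va]" using D(3)[OF ab(1)] by auto
  obtain vb where vb: "\<phi> b = [vb]" using D(3)[OF ab(2)] by auto
  have ip: "ipath E ([va] @ \<phi> d @ [vb])" using D(4)[OF f] va vb by simp
  have "d \<in> set (ids m)" using f unfolding ids_m by force
  then show thesis using that[OF va vb ip ab(4)] ipath_mid[OF ip ab(4)] ab va vb unfolding cl_def by auto
qed

lemma cl_span: "f \<in> set (flats m) \<Longrightarrow> cl f \<subseteq> span m \<phi>"
proof -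
  assume f: "f \<in> set (flats m)"
  obtain d a b where fd: "f = (d, a, b)" by (cases f)
  have "a \<in> set (ids m)" "b \<in> set (ids m)" "d \<in> set (ids m)"
    using D(4)[OF f[unfolded fd]] f fd unfolding ids_m by force+
  then show ?thesis unfolding fd cl_def span_def by auto
qed

text \<open>Outside one closed path the copy stays connected, touches the path only through its two
  ends, and contains a single vertex with three neighbours. The first two serve unichords, the last
  one shows that this side of a 2-cutset is not a path.\<close>

lemma rest_facts:
  assumes f: "(d, a, b) \<in> set (flats m)" and v: "\<phi> a = [va]" "\<phi> b = [vb]"
  shows "conn E (span m \<phi> - cl (d, a, b))" "sees E va (span m \<phi> - cl (d, a, b))" "sees E vb (span m \<phi> - cl (d, a, b))"
    "\<And>z s. z \<in> set (\<phi> d) \<Longrightarrow> s \<in> span m \<phi> - cl (d, a, b) \<Longrightarrow> {z, s} \<notin> E"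
    "\<exists>c\<in>set (thins m). c \<noteq> a \<and> c \<noteq> b \<and> 3 \<le> card {i. linked (links m) c i} \<and> \<not> linked (links m) c c"
proof -
  obtain yss where "flat_shapes m (flats m) yss" using chk unfolding checked_def shape_ok_def by blast
  from flat_shapesD[OF this f] obtain ys where ys: "rotate_conn (links m) (removeAll b (removeAll a (removeAll d (ids m)))) ys"
    "meets (nbs (links m) a) ys" "meets (nbs (links m) b) ys" "length (remdups (nbs (links m) (hd ys))) \<ge> 3" "memb (hd ys) (thins m)"
    "\<not> memb (hd ys) (nbs (links m) (hd ys))" by blast
  let ?xs = "removeAll b (removeAll a (removeAll d (ids m)))"
  have y: "conn_ok (links m) ys" "distinct ys" "length ?xs = length ys" "set ys \<subseteq> set ?xs"
    using ys(1) set_filter_member[of ?xs ys] by (auto simp: dist_ok_iff keep_eq)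
  have "distinct ?xs" using distinct_ids by (simp add: distinct_removeAll)
  then have "set ys = set ?xs" using y card_subset_eq[of "set ?xs" "set ys"] distinct_card[of ?xs] distinct_card[of ys] by simp
  then have sy: "set ys = set (ids m) - {d, a, b}" by auto
  obtain va' vb' where fe: "\<phi> a = [va']" "\<phi> b = [vb']" "a \<in> set (thins m)" "b \<in> set (thins m)" "d \<in> set (ids m)"
    by (rule flat_ends[OF f])
  have abi: "a \<in> set (ids m)" "b \<in> set (ids m)" using fe(3,4) ids_m by auto
  have rest: "(\<Union>i\<in>set ys. set (\<phi> i)) = span m \<phi> - cl (d, a, b)"
  proof
    show "(\<Union>i\<in>set ys. set (\<phi> i)) \<subseteq> span m \<phi> - cl (d, a, b)"
    proof
      fix z assume "z \<in> (\<Union>i\<in>set ys. set (\<phi> i))"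
      then obtain i where i: "i \<in> set (ids m)" "i \<noteq> d" "i \<noteq> a" "i \<noteq> b" "z \<in> set (\<phi> i)" using sy by blast
      have "z \<notin> cl (d, a, b)"
        using unique_id[OF i(1) _ i(5)] i(2-4) abi fe(5) unfolding cl_def by auto
      then show "z \<in> span m \<phi> - cl (d, a, b)" using i unfolding span_def by blast
    qed
    show "span m \<phi> - cl (d, a, b) \<subseteq> (\<Union>i\<in>set ys. set (\<phi> i))"
      unfolding span_def cl_def sy by auto
  qed
  have sys: "sys V E (set (ids m)) (links m) (\<lambda>i. set (\<phi> i))" by (rule emb_sys[OF emb])
  show "conn E (span m \<phi> - cl (d, a, b))" using conn_ok_conn[OF y(1) sys _ y(2)] sy rest by auto
  have see: "sees E v (span m \<phi> - cl (d, a, b))" if v: "\<phi> c = [v]" "c \<in> {a, b}" and mt: "meets (nbs (links m) c) ys" for c v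
  proof -
    obtain j where j: "j \<in> set ys" "linked (links m) c j" using mt meets_nbs by auto
    have "c \<in> set (ids m)" "j \<in> set (ids m)" "c \<noteq> j" using v(2) abi j(1) sy by auto
    then have "\<exists>x\<in>set (\<phi> c). \<exists>y\<in>set (\<phi> j). {x, y} \<in> E" using sys_edge[OF sys] j(2) by blast
    then show ?thesis using v(1) j(1) rest unfolding sees_def by auto
  qed
  show "sees E va (span m \<phi> - cl (d, a, b))" "sees E vb (span m \<phi> - cl (d, a, b))"
    using see[of a va] see[of b vb] v ys(2,3) by auto
  show "{z, s} \<notin> E" if z: "z \<in> set (\<phi> d)" and s: "s \<in> span m \<phi> - cl (d, a, b)" for z s
  proof
    assume e: "{z, s} \<in> E"
    obtain i where i: "i \<in> set ys" "s \<in> set (\<phi> i)" using s rest by blast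
    then have ii: "i \<in> set (ids m)" "i \<noteq> d" "i \<noteq> a" "i \<noteq> b" using sy by auto
    have "(\<exists>x\<in>set (\<phi> d). \<exists>y\<in>set (\<phi> i). {x, y} \<in> E) = linked (links m) d i"
      using sys fe(5) ii(1) ii(2)[symmetric] unfolding sys_def by simp
    then have l: "linked (links (thins m, fst (snd m), flats m)) d i" using z i(2) e by (cases m) auto
    from ii(1) have "i \<in> set (thins m) \<or> i \<in> fst ` set (flats m)" unfolding ids_m by blast
    then show False
    proof
      assume "i \<in> set (thins m)"
      then show False using linked_links_flat[OF emb' f, of i] l ii(3,4) by blast
    next
      assume "i \<in> fst ` set (flats m)"
      then obtain g where "g \<in> set (flats m)" "i = fst g" by blast
      then show False using linked_links_flats[OF emb' f, of g] l by simp
    qed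
  qed
  have "hd ys \<in> set ys" using y(1) by (cases ys) auto
  then have "hd ys \<noteq> a" "hd ys \<noteq> b" using sy by auto
  moreover have "hd ys \<in> set (thins m)" using ys(5) by simp
  moreover have "3 \<le> card {i. linked (links m) (hd ys) i}"
  proof -
    have "{i. linked (links m) (hd ys) i} = set (nbs (links m) (hd ys))" using nbs_iff by blast
    then show ?thesis using ys(4) by (simp add: length_remdups_card_conv)
  qed
  moreover have "\<not> linked (links m) (hd ys) (hd ys)" using ys(6) by (simp add: nbs_iff)
  ultimately show "\<exists>c\<in>set (thins m). c \<noteq> a \<and> c \<noteq> b \<and> 3 \<le> card {i. linked (links m) c i} \<and> \<not> linked (links m) c c" by blast
qed

text \<open>This is \<open>inner_neighbour\<close> for the closed path and the rest of the copy,
  with the path reversed if \<open>g'\<close> precedes \<open>g\<close>.\<close>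

lemma interior:
  assumes f: "(d, a, b) \<in> set (flats m)" and x: "x \<notin> span m \<phi>" "{x, g} \<in> E" "{x, g'} \<in> E" "{x, y} \<in> E"
    and g: "g \<in> set (\<phi> d)" "g' \<in> cl (d, a, b)" "g \<noteq> g'" "y \<in> span m \<phi>" "y \<notin> cl (d, a, b)"
  shows False
proof -
  obtain va vb where fe: "\<phi> a = [va]" "\<phi> b = [vb]" "ipath E ([va] @ \<phi> d @ [vb])" "\<phi> d \<noteq> []"
    "cl (d, a, b) = {va, vb} \<union> set (\<phi> d)" "va \<notin> set (\<phi> d)" "vb \<notin> set (\<phi> d)" "va \<noteq> vb" by (rule flat_ends[OF f])
  define C where "C = [va] @ \<phi> d @ [vb]"
  define S where "S = span m \<phi> - cl (d, a, b)"
  note rf = rest_facts[OF f fe(1,2), folded S_def]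
  have setC: "set C = cl (d, a, b)" unfolding C_def fe(5) by auto
  have hl: "hd C = va" "last C = vb" unfolding C_def by auto
  have CV: "set C \<subseteq> V" using cl_span[OF f] span_subset[OF emb] setC by blast
  have SV: "S \<subseteq> V - set C" using span_subset[OF emb] setC unfolding S_def by blast
  have xC: "x \<notin> set C" "x \<notin> S" using x(1) cl_span[OF f] setC unfolding S_def by auto
  have yS: "y \<in> S" using g(4,5) unfolding S_def by blast
  have gC: "g \<in> set C" "g' \<in> set C" "g \<noteq> va" "g \<noteq> vb" using g fe setC by auto
  have anti: "{z, s} \<notin> E" if "z \<in> set C" "z \<noteq> va" "z \<noteq> vb" "s \<in> S" for z s
    using rf(4) that setC fe(5) by auto
  have ipC: "ipath E C" using fe(3) unfolding C_def .
  from gC(1,2) g(3) show False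
  proof (cases rule: split_two)
    case (1 A0 M B0)
    have "A0 \<noteq> []" using 1 hl(1) gC(3) by (cases A0) auto
    show False
      by (rule inner_neighbour[OF 1 \<open>A0 \<noteq> []\<close> ipC rf(1) SV _ CV _ xC(1,2) x(2,3) yS x(4)]) (use hl rf(3) anti in auto)
  next
    case (2 A0 M B0)
    have r: "rev C = rev B0 @ g # rev M @ g' # rev A0" using 2 by simp
    have "rev B0 \<noteq> []" using 2 hl(2) gC(4) by (cases B0) auto
    have ipr: "ipath E (rev C)" using ipC by (simp only: ipath_rev)
    have Cne: "C \<noteq> []" unfolding C_def by simp
    then have hlr: "hd (rev C) = vb" "last (rev C) = va" using hl by (auto simp: hd_rev last_rev)
    show False
    proof (rule inner_neighbour[OF r \<open>rev B0 \<noteq> []\<close> ipr rf(1) _ _ _ _ _ xC(2) x(2,3) yS x(4)])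
      show "S \<subseteq> V - set (rev C)" "set (rev C) \<subseteq> V" "x \<notin> set (rev C)" using SV CV xC by simp_all
      show "sees E (last (rev C)) S" using hlr rf(2) by simp
      show "\<And>z s. z \<in> set (rev C) \<Longrightarrow> z \<noteq> hd (rev C) \<Longrightarrow> z \<noteq> last (rev C) \<Longrightarrow> s \<in> S \<Longrightarrow> {z, s} \<notin> E"
        using anti unfolding hlr by simp
    qed
  qed
qed

text \<open>Otherwise \<open>reroute\<close> would produce a copy of the same pattern with fewer
  vertices.\<close>

lemma not_all_in_flat:
  assumes f: "(d, a, b) \<in> set (flats m)" and x: "x \<in> V" "x \<notin> span m \<phi>"
    and h: "h1 \<in> cl (d, a, b)" "h2 \<in> cl (d, a, b)" "h1 \<noteq> h2" "{x, h1} \<in> E" "{x, h2} \<in> E"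
  obtains y where "y \<in> span m \<phi>" "{x, y} \<in> E" "y \<notin> cl (d, a, b)"
proof (rule ccontr)
  assume no: "\<not> thesis"
  have mm: "(thins m, fst (snd m), flats m) = m" by (cases m) simp
  have c: "cl (d, a, b) = set (\<phi> a @ \<phi> d @ \<phi> b)" unfolding cl_def by simp
  have nb: "h \<in> set (\<phi> a @ \<phi> d @ \<phi> b)" if "h \<in> span (thins m, fst (snd m), flats m) \<phi>" "{x, h} \<in> E" for h
    using no \<open>\<And>y. \<lbrakk>y \<in> span m \<phi>; {x, y} \<in> E; y \<notin> cl (d, a, b)\<rbrakk> \<Longrightarrow> thesis\<close> that unfolding mm c by blast
  have xn: "x \<notin> span (thins m, fst (snd m), flats m) \<phi>" using x(2) unfolding mm .
  obtain \<psi> where "emb V E (thins m, fst (snd m), flats m) \<psi>"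
    "card (span (thins m, fst (snd m), flats m) \<psi>) < card (span (thins m, fst (snd m), flats m) \<phi>)"
    by (rule reroute[OF emb' f x(1) xn nb h(1,2)[unfolded c] h(3-5)])
  then show False using smaller[of \<psi>] unfolding mm by simp
qed

text \<open>A second neighbour on the path forces a neighbour \<open>y\<close> off it. If one of the
  two is interior, \<open>interior\<close> applies. If they are the two ends, the triple formed by
  them and the piece of \<open>y\<close> is covered by the claw table, and it is not exceptional
  because exceptional triples consist of whole paths.\<close>

lemma one_per_flat:
  assumes f: "f \<in> set (flats m)" and x: "x \<in> V" "x \<notin> span m \<phi>"
    and h: "h1 \<in> cl f" "h2 \<in> cl f" "h1 \<noteq> h2" "{x, h1} \<in> E" "{x, h2} \<in> E"
  shows False
proof -
  have inter: False if g: "(d, a, b) \<in> set (flats m)" "k \<in> set (\<phi> d)" "k' \<in> cl (d, a, b)" "k \<noteq> k'" "{x, k} \<in> E" "{x, k'} \<in> E" for d a b k k'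
  proof -
    have k: "k \<in> cl (d, a, b)" using g(2) unfolding cl_def by simp
    obtain y where y: "y \<in> span m \<phi>" "{x, y} \<in> E" "y \<notin> cl (d, a, b)"
      by (rule not_all_in_flat[OF g(1) x k g(3-6)])
    show False by (rule interior[OF g(1) x(2) g(5,6) y(2) g(2-4) y(1,3)])
  qed
  obtain d a b where fd: "f = (d, a, b)" by (cases f)
  obtain va vb where fe: "\<phi> a = [va]" "\<phi> b = [vb]" "cl (d, a, b) = {va, vb} \<union> set (\<phi> d)" "a \<in> set (thins m)" "b \<in> set (thins m)" "a \<noteq> b"
    by (rule flat_ends[OF f[unfolded fd]])
  have "h1 \<notin> set (\<phi> d)" "h2 \<notin> set (\<phi> d)"
    using inter[OF f[unfolded fd], of h1 h2] inter[OF f[unfolded fd], of h2 h1] h unfolding fd by auto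
  then have hab: "{h1, h2} = {va, vb}" using h(1-3) unfolding fd fe(3) by auto
  have xa: "{x, va} \<in> E" "{x, vb} \<in> E" using h(4,5) hab by (metis doubleton_eq_iff)+
  obtain y where y: "y \<in> span m \<phi>" "{x, y} \<in> E" "y \<notin> cl (d, a, b)"
    by (rule not_all_in_flat[OF f[unfolded fd] x h(1,2)[unfolded fd] h(3-5)])
  obtain r where r: "r \<in> set (coarse m)" "located \<phi> r y" by (rule ex_coarse[OF y(1)])
  have pt: "Thin a \<in> set (coarse m)" "Thin b \<in> set (coarse m)" "located \<phi> (Thin a) va" "located \<phi> (Thin b) vb"
    using fe coarse_iff by auto
  have yab: "y \<noteq> va" "y \<noteq> vb" using y(3) fe(3) by auto
  have rne: "r \<noteq> Thin a" "r \<noteq> Thin b" using r(2) pt(3,4) yab by auto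
  obtain exc where exc: "exc_list exc" using ex_exc_list by blast
  \<comment> \<open>Sharing involving a whole path would put the interior vertex \<open>y\<close>
    and one of the ends \<open>va\<close>, \<open>vb\<close> on one closed path, which
    \<open>inter\<close> excludes. Both ends themselves do share, but neither is a whole
    path.\<close>
  have ns: "\<not> (share (flats m) s t \<and> (is_whole s \<or> is_whole t))" if st: "s \<in> {Thin a, Thin b, r}" "t \<in> {Thin a, Thin b, r}" "s \<noteq> t" for s t
  proof
    assume sh: "share (flats m) s t \<and> (is_whole s \<or> is_whole t)"
    have "is_whole r" "share (flats m) r (Thin a) \<or> share (flats m) r (Thin b)"
      using sh st share_sym[of "flats m"] by auto
    then obtain c v where c: "share (flats m) r (Thin c)" "is_whole r" "c = a \<and> v = va \<or> c = b \<and> v = vb"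
      by blast
    obtain g where g: "g \<in> set (flats m)" "r = Whole g" using c(2) r(1) coarse_iff by auto
    obtain d' a' b' where gd: "g = (d', a', b')" by (cases g)
    have yd: "y \<in> set (\<phi> d')" using r(2) g(2) gd by simp
    have "same y v" using share_same[OF r, of "Thin c" v] c pt by auto
    then obtain k where k: "k \<in> set (flats m)" "y \<in> cl k" "v \<in> cl k" unfolding same_def by blast
    have "on r k" using on_iff[OF r k(1)] k(2) by blast
    then have "fst k = fst g" using g(2) by (cases k) auto
    then have "k = g" using emb_flat_unique[OF emb' k(1) g(1)] by blast
    then show False using inter[OF g(1)[unfolded gd] yd, of v] k(3) gd y(2) xa c(3) yab by auto
  qed
  obtain s1 s2 s3 where s: "(s1, s2, s3) \<in> set (triples (coarse m))" "{s1, s2, s3} = {Thin a, Thin b, r}"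
    using triples_mem[OF pt(1,2) r(1)] fe(6) rne by auto
  define lh where "lh s = (if s = r then y else if s = Thin a then va else vb)" for s
  have lhs: "located \<phi> s (lh s) \<and> {x, lh s} \<in> E" if "s \<in> {Thin a, Thin b, r}" for s
    using that r(2) pt xa y(2) fe(6) rne unfolding lh_def by auto
  have dst: "distinct (map pid [s1, s2, s3])" using triples_distinct[OF _ s(1), of pid] map_pid_coarse distinct_ids by simp
  have nsa: "\<not> share_any (flats m) (pairs [s1, s2, s3])"
  proof
    assume "share_any (flats m) (pairs [s1, s2, s3])"
    then obtain s t where st: "(s, t) \<in> set (pairs [s1, s2, s3])" "share (flats m) s t \<and> (is_whole s \<or> is_whole t)"
      using share_anyD by blast
    have "s \<in> {Thin a, Thin b, r}" "t \<in> {Thin a, Thin b, r}" using pairs_sub[OF st(1)] s(2) by auto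
    moreover have "s \<noteq> t" using pairs_distinct[OF dst st(1)] by auto
    ultimately show False using ns st(2) by blast
  qed
  have m3: "s1 \<in> {Thin a, Thin b, r}" "s2 \<in> {Thin a, Thin b, r}" "s3 \<in> {Thin a, Thin b, r}" using s(2) by auto
  have "(s1, s2, s3) \<in> set exc"
    by (rule claw_exc[OF s(1) conjunct1[OF lhs[OF m3(1)]] conjunct1[OF lhs[OF m3(2)]] conjunct1[OF lhs[OF m3(3)]] x
        conjunct2[OF lhs[OF m3(1)]] conjunct2[OF lhs[OF m3(2)]] conjunct2[OF lhs[OF m3(3)]] nsa exc])
  then have "is_whole s1" "is_whole s2" "is_whole s3" using exc unfolding exc_list_def by auto
  moreover have "Thin a \<in> {s1, s2, s3}" using s(2) by blast
  ultimately show False by auto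
qed

end

section \<open>Attachments of connected outside sets\<close>

context stage
begin

lemma nbs_not_same:
  assumes "x \<in> V" "x \<notin> span m \<phi>" "{x, h} \<in> E" "{x, h'} \<in> E" "h \<noteq> h'"
  shows "\<not> same h h'"
  using one_per_flat[OF _ assms(1,2), of _ h h'] assms(3-5) unfolding same_def by blast

lemma located_neq:
  assumes "p \<in> set (coarse m)" "located \<phi> p h" "q \<in> set (coarse m)" "located \<phi> q h'" "h \<noteq> h'" "\<not> same h h'"
  shows "p \<noteq> q"
proof
  assume e: "p = q"
  have "\<not> share (flats m) p p" using share_same[OF assms(1,2) assms(3,4)] assms(6) e by simp
  then show False using assms(1,2,4,5) e unfolding coarse_iff share_iff by auto
qed

lemma claw_triple:
  assumes x: "x \<in> V" "x \<notin> span m \<phi>" and a: "{x, h1} \<in> E" "{x, h2} \<in> E" "{x, h3} \<in> E" "h1 \<noteq> h2" "h2 \<noteq> h3" "h1 \<noteq> h3"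
    and p: "p1 \<in> set (coarse m)" "located \<phi> p1 h1" "p2 \<in> set (coarse m)" "located \<phi> p2 h2" "p3 \<in> set (coarse m)" "located \<phi> p3 h3"
    and exc: "exc_list exc"
  obtains s1 s2 s3 where "(s1, s2, s3) \<in> set exc" "{s1, s2, s3} = {p1, p2, p3}" "(s1, s2, s3) \<in> set (triples (coarse m))"
proof -
  have n: "\<not> same h1 h2" "\<not> same h2 h3" "\<not> same h1 h3"
    using nbs_not_same[OF x] a by blast+
  have pn: "p1 \<noteq> p2" "p2 \<noteq> p3" "p1 \<noteq> p3"
    using located_neq[OF p(1-4) a(4) n(1)] located_neq[OF p(3-6) a(5) n(2)] located_neq[OF p(1,2) p(5,6) a(6) n(3)] by auto
  obtain s1 s2 s3 where s: "(s1, s2, s3) \<in> set (triples (coarse m))" "{s1, s2, s3} = {p1, p2, p3}"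
    using triples_mem[OF p(1,3,5) pn] by blast
  define lh where "lh s = (if s = p1 then h1 else if s = p2 then h2 else h3)" for s
  have lhs: "located \<phi> s (lh s) \<and> {x, lh s} \<in> E \<and> s \<in> set (coarse m)" if "s \<in> {p1, p2, p3}" for s
    using that p a pn unfolding lh_def by auto
  have lne: "lh s \<noteq> lh t" if "s \<in> {p1, p2, p3}" "t \<in> {p1, p2, p3}" "s \<noteq> t" for s t
    using that a pn unfolding lh_def by auto
  have dst: "distinct (map pid [s1, s2, s3])" using triples_distinct[OF _ s(1), of pid] map_pid_coarse distinct_ids by simp
  have nsa: "\<not> share_any (flats m) (pairs [s1, s2, s3])"
  proof
    assume "share_any (flats m) (pairs [s1, s2, s3])"
    then obtain s t where st: "(s, t) \<in> set (pairs [s1, s2, s3])" "share (flats m) s t"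
      using share_anyD by blast
    have mem: "s \<in> {p1, p2, p3}" "t \<in> {p1, p2, p3}" using pairs_sub[OF st(1)] s(2) by auto
    have "s \<noteq> t" using pairs_distinct[OF dst st(1)] by auto
    then have "\<not> same (lh s) (lh t)" using nbs_not_same[OF x] lhs[OF mem(1)] lhs[OF mem(2)] lne[OF mem] by blast
    then show False using share_same[of s "lh s" t "lh t"] lhs[OF mem(1)] lhs[OF mem(2)] st(2) by blast
  qed
  have m3: "s1 \<in> {p1, p2, p3}" "s2 \<in> {p1, p2, p3}" "s3 \<in> {p1, p2, p3}" using s(2) by auto
  have "(s1, s2, s3) \<in> set exc"
    using claw_exc[OF s(1) _ _ _ x _ _ _ nsa exc, of "lh s1" "lh s2" "lh s3"] lhs[OF m3(1)] lhs[OF m3(2)] lhs[OF m3(3)] by blast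
  then show thesis using that s by blast
qed

text \<open>Three neighbours form the exceptional triple. A fourth one in place of one of them would
  form it again, although its piece is a different one; so there are exactly three, and
  \<open>exc_False\<close> finishes.\<close>

lemma three_nbs_False:
  assumes x: "x \<in> V" "x \<notin> span m \<phi>" and a: "{x, h1} \<in> E" "{x, h2} \<in> E" "{x, h3} \<in> E" "h1 \<noteq> h2" "h2 \<noteq> h3" "h1 \<noteq> h3"
    and h: "h1 \<in> span m \<phi>" "h2 \<in> span m \<phi>" "h3 \<in> span m \<phi>"
  shows False
proof -
  obtain p1 where p1: "p1 \<in> set (coarse m)" "located \<phi> p1 h1" by (rule ex_coarse[OF h(1)])
  obtain p2 where p2: "p2 \<in> set (coarse m)" "located \<phi> p2 h2" by (rule ex_coarse[OF h(2)])
  obtain p3 where p3: "p3 \<in> set (coarse m)" "located \<phi> p3 h3" by (rule ex_coarse[OF h(3)])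
  obtain exc where exc: "exc_list exc" using ex_exc_list by blast
  obtain s1 s2 s3 where s: "(s1, s2, s3) \<in> set exc" "{s1, s2, s3} = {p1, p2, p3}" "(s1, s2, s3) \<in> set (triples (coarse m))"
    by (rule claw_triple[OF x a p1 p2 p3 exc])
  have "exc \<noteq> []" using s(1) by auto
  then obtain q1 q2 q3 ecs EG where q: "exc = [(q1, q2, q3)]" "is_whole q1" "is_whole q2" "is_whole q3"
    "exc_variants m ecs EG (variants [True, True, True] [q1, q2, q3])"
    "\<forall>ps\<in>set EG. grows_to m (add_vertex (map pid ps) (fold refine ps m))"
    using exc unfolding exc_list_def by blast
  have sq: "s1 = q1" "s2 = q2" "s3 = q3" using s(1) q(1) by auto
  have n: "\<not> same h1 h2" "\<not> same h2 h3" "\<not> same h1 h3" using nbs_not_same[OF x] a by blast+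
  have pn: "p1 \<noteq> p2" "p2 \<noteq> p3" "p1 \<noteq> p3"
    using located_neq[OF p1 p2 a(4) n(1)] located_neq[OF p2 p3 a(5) n(2)] located_neq[OF p1 p3 a(6) n(3)] by auto
  define lh where "lh s = (if s = p1 then h1 else if s = p2 then h2 else h3)" for s
  have m3: "s1 \<in> {p1, p2, p3}" "s2 \<in> {p1, p2, p3}" "s3 \<in> {p1, p2, p3}" using s(2) by auto
  have lhs: "located \<phi> s (lh s)" if "s \<in> {p1, p2, p3}" for s
    using that p1 p2 p3 pn unfolding lh_def by auto
  have "{lh s1, lh s2, lh s3} = lh ` {s1, s2, s3}" by simp
  also have "\<dots> = {h1, h2, h3}" unfolding s(2) using pn unfolding lh_def by auto
  finally have lset: "{lh s1, lh s2, lh s3} = {h1, h2, h3}" .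
  have nb: "{x, k} \<in> E \<longleftrightarrow> k = lh s1 \<or> k = lh s2 \<or> k = lh s3" if k: "k \<in> span m \<phi>" for k
  proof -
    have "{x, k} \<in> E \<longleftrightarrow> k \<in> {h1, h2, h3}"
    proof
      assume xk: "{x, k} \<in> E"
      show "k \<in> {h1, h2, h3}"
      proof (rule ccontr)
        assume "k \<notin> {h1, h2, h3}"
        then have kn: "k \<noteq> h1" "k \<noteq> h2" "k \<noteq> h3" by auto
        obtain r where r: "r \<in> set (coarse m)" "located \<phi> r k" by (rule ex_coarse[OF k])
        have "\<not> same k h1" "\<not> same k h2" "\<not> same k h3" using nbs_not_same[OF x xk] a kn by blast+
        then have rn: "r \<noteq> p1" "r \<noteq> p2" "r \<noteq> p3"
          using located_neq[OF r p1 kn(1)] located_neq[OF r p2 kn(2)] located_neq[OF r p3 kn(3)] by auto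
        obtain t1 t2 t3 where t: "(t1, t2, t3) \<in> set exc" "{t1, t2, t3} = {p1, p2, r}"
          by (rule claw_triple[OF x a(1,2) xk a(4) kn(2)[symmetric] kn(1)[symmetric] p1 p2 r exc])
        then have "{p1, p2, r} = {p1, p2, p3}" using q(1) sq s(2) by auto
        then show False using rn by auto
      qed
    qed (use a in auto)
    then show ?thesis using lset by auto
  qed
  have dst: "distinct (map pid [s1, s2, s3])" using triples_distinct[OF _ s(3), of pid] map_pid_coarse distinct_ids by simp
  have sc: "s1 \<in> set (coarse m)" "s2 \<in> set (coarse m)" "s3 \<in> set (coarse m)" using triples_sub[OF s(3)] by auto
  show False
    by (rule exc_False[OF sc dst lhs[OF m3(1)] lhs[OF m3(2)] lhs[OF m3(3)] x nb q(5)[folded sq] q(6)])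
qed

text \<open>Choose a smallest connected outside set with two attachments not on a common closed
  path, and a shortest path in it. By minimality proper subpaths have only attachments that are
  pairwise \<open>same\<close>, which gives exactly the hypotheses on \<open>W\<close> in
  \<open>no_ear\<close>.\<close>

lemma no_pair:
  assumes "conn E S" "S \<subseteq> V - span m \<phi>" "h1 \<in> span m \<phi>" "h2 \<in> span m \<phi>" "h1 \<noteq> h2" "sees E h1 S" "sees E h2 S"
  shows "same h1 h2"
proof (rule ccontr)
  assume "\<not> same h1 h2"
  define bad where "bad S \<longleftrightarrow> conn E S \<and> S \<subseteq> V - span m \<phi> \<and>
    (\<exists>h1\<in>span m \<phi>. \<exists>h2\<in>span m \<phi>. h1 \<noteq> h2 \<and> \<not> same h1 h2 \<and> sees E h1 S \<and> sees E h2 S)" for S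
  have "bad S" unfolding bad_def using assms \<open>\<not> same h1 h2\<close> by blast
  then obtain S where S: "bad S" and min: "\<And>S'. bad S' \<Longrightarrow> card S \<le> card S'"
    using ex_has_least_nat[of bad S card] by blast
  obtain h1 h2 where h: "h1 \<in> span m \<phi>" "h2 \<in> span m \<phi>" "h1 \<noteq> h2" "\<not> same h1 h2" "sees E h1 S" "sees E h2 S"
    using S unfolding bad_def by blast
  have SV: "conn E S" "S \<subseteq> V - span m \<phi>" using S unfolding bad_def by auto
  have S12: "S \<subseteq> V - {h1, h2}" using SV(2) h(1,2) by blast
  obtain xs where xs: "thin_path h1 h2 xs" "set xs \<subseteq> S" by (rule sees_thin_path[OF SV(1) h(5,6) S12])
  have t: "xs \<noteq> []" "ipath E xs" "\<And>z. z \<in> set xs \<Longrightarrow> {h1, z} \<in> E \<longleftrightarrow> z = hd xs" "\<And>z. z \<in> set xs \<Longrightarrow> {h2, z} \<in> E \<longleftrightarrow> z = last xs"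
    using xs(1) unfolding thin_path_def by auto
  have xsV: "set xs \<subseteq> V - span m \<phi>" using xs(2) SV(2) by blast
  have dist: "distinct xs" by (rule ipath_distinct[OF t(2)])
  have finS: "finite S" using SV(2) finite_subset[OF _ fin] by blast
  have small: "same g k" if T: "conn E T" "T \<subset> set xs" and gk: "g \<in> span m \<phi>" "k \<in> span m \<phi>" "g \<noteq> k" "sees E g T" "sees E k T" for T g k
  proof (rule ccontr)
    assume "\<not> same g k"
    then have "bad T" unfolding bad_def using T gk xsV by blast
    moreover have "card T < card S" using T(2) xs(2) psubset_card_mono[OF finS] by (meson psubset_subset_trans)
    ultimately show False using min[of T] by simp
  qed
  have ends: "{h1, hd xs} \<in> E" "{h2, last xs} \<in> E" "hd xs \<in> set xs" "last xs \<in> set xs" using t by auto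
  \<comment> \<open>A further attachment \<open>w\<close> cannot be at an end of the path: there one
    outside vertex would see \<open>w\<close> and \<open>h1\<close>, or \<open>w\<close> and
    \<open>h2\<close>, while minimality puts these on one closed path. At an inner vertex
    \<open>z\<close> the two subpaths ending in \<open>z\<close> are proper, so \<open>w\<close> is
    \<open>same\<close> with both.\<close>
  have inner: "as \<noteq> [] \<and> bs \<noteq> [] \<and> same w h1 \<and> same w h2"
    if w: "w \<in> span m \<phi>" "w \<noteq> h1" "w \<noteq> h2" "{z, w} \<in> E" and s: "xs = as @ z # bs" for w z as bs
  proof -
    have zV: "z \<in> V" "z \<notin> span m \<phi>" using s xsV by auto
    have wz: "sees E w {z}" using w(4) by (simp add: sees_singleton insert_commute)
    have long: "as \<noteq> [] \<or> bs \<noteq> []"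
    proof (rule ccontr)
      assume "\<not> (as \<noteq> [] \<or> bs \<noteq> [])"
      then have "xs = [z]" using s by simp
      then have "{z, h1} \<in> E" "{z, h2} \<in> E" using ends by (auto simp: insert_commute)
      then show False using three_nbs_False[OF zV _ _ w(4) h(3) w(3)[symmetric] w(2)[symmetric] h(1,2) w(1)] by blast
    qed
    have bs: "bs \<noteq> []"
    proof
      assume b: "bs = []"
      then have as: "as \<noteq> []" using long by blast
      then have "{z} \<subset> set xs" using s dist by (cases as) auto
      moreover have zh: "{h2, z} \<in> E" using ends(2) s b by simp
      ultimately have "same w h2" using small[of "{z}" w h2] w h(2) wz by (simp add: sees_singleton)
      moreover have "{z, h2} \<in> E" using zh by (simp add: insert_commute)
      ultimately show False using nbs_not_same[OF zV w(4) _ w(3)] by blast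
    qed
    have as: "as \<noteq> []"
    proof
      assume a: "as = []"
      then have "{z} \<subset> set xs" using s dist bs by (cases bs) auto
      moreover have zh: "{h1, z} \<in> E" using ends(1) s a by simp
      ultimately have "same w h1" using small[of "{z}" w h1] w h(1) wz by (simp add: sees_singleton)
      moreover have "{z, h1} \<in> E" using zh by (simp add: insert_commute)
      ultimately show False using nbs_not_same[OF zV w(4) _ w(2)] by blast
    qed
    have i: "ipath E (as @ z # bs)" using t(2) s by simp
    have "same w h1"
    proof (rule small[of "set (as @ [z])"])
      show "conn E (set (as @ [z]))" using ipath_conn[OF ipath_prefix[OF i]] by simp
      have "set bs \<inter> set (as @ [z]) = {}" "set bs \<subseteq> set xs" using dist s by auto
      then have "last bs \<in> set xs" "last bs \<notin> set (as @ [z])" using last_in_set[OF bs] by blast+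
      moreover have "set (as @ [z]) \<subseteq> set xs" using s by auto
      ultimately show "set (as @ [z]) \<subset> set xs" by blast
      show "sees E w (set (as @ [z]))" using wz unfolding sees_def by auto
      have "hd xs \<in> set (as @ [z])" using s as by (cases as) auto
      then show "sees E h1 (set (as @ [z]))" using ends(1) unfolding sees_def by blast
    qed (use w h in auto)
    moreover have "same w h2"
    proof (rule small[of "set (z # bs)"])
      show "conn E (set (z # bs))" using ipath_conn[OF ipath_suffix[OF i]] by simp
      have "set as \<inter> set (z # bs) = {}" "set as \<subseteq> set xs" using dist s by auto
      then have "hd as \<in> set xs" "hd as \<notin> set (z # bs)" using hd_in_set[OF as] by blast+
      moreover have "set (z # bs) \<subseteq> set xs" using s by auto
      ultimately show "set (z # bs) \<subset> set xs" by blast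
      show "sees E w (set (z # bs))" using wz unfolding sees_def by auto
      have "last xs \<in> set (z # bs)" using s bs by auto
      then show "sees E h2 (set (z # bs))" using ends(2) unfolding sees_def by blast
    qed (use w h in auto)
    ultimately show ?thesis using as bs by blast
  qed
  define W where "W = {w \<in> span m \<phi>. sees E w (set xs) \<and> w \<noteq> h1 \<and> w \<noteq> h2}"
  have Wz: "\<exists>z\<in>set xs. {z, w} \<in> E" if "w \<in> W" for w
    using that unfolding W_def sees_def by (auto simp: insert_commute)
  show False
  proof (rule no_ear[OF t(1,2) xsV h(1-4), of W])
    fix k assume k: "k \<in> span m \<phi>"
    have "sees E h1 (set xs)" "sees E h2 (set xs)" using ends unfolding sees_def by blast+
    then show "sees E k (set xs) \<longleftrightarrow> k = h1 \<or> k = h2 \<or> k \<in> W" using k unfolding W_def by blast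
  next
    fix w assume w: "w \<in> W"
    obtain z where z: "z \<in> set xs" "{z, w} \<in> E" using Wz[OF w] by blast
    obtain as bs where s: "xs = as @ z # bs" using z(1) by (meson split_list)
    have "w \<in> span m \<phi>" "w \<noteq> h1" "w \<noteq> h2" using w unfolding W_def by auto
    then show "w \<in> span m \<phi> \<and> w \<noteq> h1 \<and> w \<noteq> h2 \<and> same w h1 \<and> same w h2" using inner[OF _ _ _ z(2) s] by blast
  next
    fix w w' assume w: "w \<in> W" "w' \<in> W" "w \<noteq> w'"
    have wp: "w \<in> span m \<phi>" "w \<noteq> h1" "w \<noteq> h2" "w' \<in> span m \<phi>" "w' \<noteq> h1" "w' \<noteq> h2" using w unfolding W_def by auto
    obtain z z' where z: "z \<in> set xs" "{z, w} \<in> E" "z' \<in> set xs" "{z', w'} \<in> E" using Wz[OF w(1)] Wz[OF w(2)] by blast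
    \<comment> \<open>The subpath between two further attachments omits the first vertex of the path
      by \<open>inner\<close>, so it is proper.\<close>
    have seg: "same v v'" if v: "v \<in> span m \<phi>" "v \<noteq> h1" "v \<noteq> h2" "v' \<in> span m \<phi>" "v \<noteq> v'" "{y, v} \<in> E" "{y', v'} \<in> E"
      and s: "xs = as @ y # M @ y' # bs" for v v' y y' as M bs
    proof (rule small[of "set (y # M @ [y'])"])
      have as: "as \<noteq> []" using inner[OF v(1-3,6) s] by blast
      have i: "ipath E ((y # M) @ y' # bs)" using ipath_suffix[of E as y "M @ y' # bs"] t(2) s by simp
      show "conn E (set (y # M @ [y']))" using ipath_conn[OF ipath_prefix[OF i]] by simp
      have "set as \<inter> set (y # M @ [y']) = {}" "set as \<subseteq> set xs" using dist s by auto
      then have "hd as \<in> set xs" "hd as \<notin> set (y # M @ [y'])" using hd_in_set[OF as] by blast+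
      moreover have "set (y # M @ [y']) \<subseteq> set xs" using s by auto
      ultimately show "set (y # M @ [y']) \<subset> set xs" by blast
      show "sees E v (set (y # M @ [y']))" "sees E v' (set (y # M @ [y']))"
        using v(6,7) unfolding sees_def by (auto simp: insert_commute)
    qed (use v in auto)
    show "same w w'"
    proof (cases "z = z'")
      case True
      obtain as bs where s: "xs = as @ z # bs" using z(1) by (meson split_list)
      have as: "as \<noteq> []" using inner[OF wp(1-3) z(2) s] by blast
      show ?thesis
      proof (rule small[of "{z}"])
        show "{z} \<subset> set xs" using s as dist by (cases as) auto
        show "sees E w {z}" "sees E w' {z}" using z True by (simp_all add: sees_singleton insert_commute)
      qed (use wp w in auto)
    next
      case False
      from z(1,3) False show ?thesis
      proof (cases rule: split_two)
        case (1 as M bs)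
        show ?thesis by (rule seg[OF wp(1-4) w(3) z(2,4) 1])
      next
        case (2 as M bs)
        have "same w' w" by (rule seg[OF wp(4-6) wp(1) w(3)[symmetric] z(4,2) 2])
        then show ?thesis by (rule same_sym)
      qed
    qed
  next
    assume "{h1, h2} \<notin> E"
    moreover have "h1 \<notin> set xs" "h2 \<notin> set xs" using xsV h(1,2) by auto
    moreover have "ipath E (xs @ [h2])" unfolding ipath_append using t(2,4) \<open>h2 \<notin> set xs\<close> by (auto simp: insert_commute)
    ultimately show "ipath E ([h1] @ xs @ [h2])" using t(1,3) h(3) ends(1) by auto
  qed
qed

end

section \<open>The proper 2-cutset produced by an outside component\<close>

lemma proper_2cutsetI:
  assumes "a \<in> V" "b \<in> V" "a \<noteq> b" "{a, b} \<notin> E" "V = X \<union> Y \<union> {a, b}" "X \<inter> Y = {}" "a \<notin> X" "b \<notin> X" "a \<notin> Y" "b \<notin> Y"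
    "2 \<le> card X" "2 \<le> card Y" "\<And>x y. x \<in> X \<Longrightarrow> y \<in> Y \<Longrightarrow> {x, y} \<notin> E"
    "has_path (X \<union> {a, b}) (induced_edges E (X \<union> {a, b})) a b" "has_path (Y \<union> {a, b}) (induced_edges E (Y \<union> {a, b})) a b"
    "\<not> is_ab_path (X \<union> {a, b}) (induced_edges E (X \<union> {a, b})) a b" "\<not> is_ab_path (Y \<union> {a, b}) (induced_edges E (Y \<union> {a, b})) a b"
  shows "proper_2cutset V E a b"
proof -
  have no: "\<forall>x\<in>X. \<forall>y\<in>Y. {x, y} \<notin> E" using assms(13) by blast
  show ?thesis unfolding proper_2cutset_def
    by (intro conjI; (rule exI[where x = X], rule exI[where x = Y], intro conjI)?) (fact no assms)+
qed

context stage
begin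

lemma linked_ids: "linked (links m) c i \<Longrightarrow> i \<in> set (ids m)"
proof -
  obtain N R F where m: "m = (N, R, F)" by (cases m)
  note D' = embD[OF emb[unfolded m]]
  assume "linked (links m) c i"
  then consider "i \<in> set N" | d a b where "(d, a, b) \<in> set F" "i = d \<or> i = a \<or> i = b"
    using D'(2) unfolding m linked_def by auto
  then show ?thesis
  proof cases
    case 2
    then show ?thesis using D'(4)[OF 2(1)] unfolding m by (auto intro: rev_image_eqI)
  qed (simp add: m)
qed

lemma thins_ge: "4 \<le> length (thins m)"
  using chk unfolding checked_def shape_ok_def by blast

definition Cmp :: "'a \<Rightarrow> 'a set" where
  "Cmp x = component E (V - span m \<phi>) x"

lemma Cmp_facts:
  assumes "x \<in> V - span m \<phi>"
  shows "conn E (Cmp x)" "Cmp x \<subseteq> V - span m \<phi>" "x \<in> Cmp x"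
    "\<And>y z. y \<in> Cmp x \<Longrightarrow> {y, z} \<in> E \<Longrightarrow> z \<in> Cmp x \<or> z \<in> span m \<phi>"
proof -
  show "conn E (Cmp x)" unfolding Cmp_def by (rule component_conn)
  show "Cmp x \<subseteq> V - span m \<phi>" unfolding Cmp_def by (rule component_subset[OF assms])
  show "x \<in> Cmp x" unfolding Cmp_def by (rule component_self)
  fix y z assume y: "y \<in> Cmp x" and e: "{y, z} \<in> E"
  then show "z \<in> Cmp x \<or> z \<in> span m \<phi>"
    using component_closed[of y E "V - span m \<phi>" x z] assms adj_in[OF e] unfolding Cmp_def by blast
qed

lemma Cmp_same:
  assumes "x \<in> V - span m \<phi>" "h \<in> span m \<phi>" "h' \<in> span m \<phi>" "h \<noteq> h'" "sees E h (Cmp x)" "sees E h' (Cmp x)"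
  shows "same h h'"
  using no_pair[OF Cmp_facts(1,2)[OF assms(1)] assms(2-6)] .

lemma interior_unique:
  assumes "(d, a, b) \<in> set (flats m)" "h \<in> set (\<phi> d)" "f \<in> set (flats m)" "h \<in> cl f"
  shows "f = (d, a, b)"
proof -
  have W: "Whole (d, a, b) \<in> set (coarse m)" "located \<phi> (Whole (d, a, b)) h" using assms(1,2) coarse_iff by auto
  have "on (Whole (d, a, b)) f" using on_iff[OF W assms(3)] assms(4) by blast
  then have "fst f = d" by (cases f) auto
  then show ?thesis using emb_flat_unique[OF emb' assms(3,1)] by simp
qed

text \<open>An interior vertex belongs to one closed path only, so being \<open>same\<close> with it
  means lying on that path.\<close>

lemma Cmp_interior:
  assumes x: "x \<in> V - span m \<phi>" and f: "(d, a, b) \<in> set (flats m)" and h: "h \<in> set (\<phi> d)" "sees E h (Cmp x)"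
    and k: "k \<in> span m \<phi>" "sees E k (Cmp x)"
  shows "k \<in> cl (d, a, b)"
proof (cases "k = h")
  case True
  then show ?thesis using h(1) unfolding cl_def by simp
next
  case False
  have hs: "h \<in> span m \<phi>" using cl_span[OF f] h(1) unfolding cl_def by auto
  have "same h k" using Cmp_same[OF x hs k(1)] False h(2) k(2) by blast
  then obtain g where "g \<in> set (flats m)" "h \<in> cl g" "k \<in> cl g" unfolding same_def by blast
  then show ?thesis using interior_unique[OF f h(1)] by blast
qed

text \<open>If some attachment is interior to a path, use \<open>Cmp_interior\<close>. Otherwise all
  attachments are single vertices; two of them exist by 2-connectivity and fix a path, and a third
  one off it would give a triangle of paths, against \<open>no_flat_triangle\<close>.\<close>

lemma Cmp_flat:
  assumes x: "x \<in> V - span m \<phi>"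
  obtains f where "f \<in> set (flats m)" "\<And>k. k \<in> span m \<phi> \<Longrightarrow> sees E k (Cmp x) \<Longrightarrow> k \<in> cl f"
proof -
  note cf = Cmp_facts[OF x]
  have hsub: "span m \<phi> \<subseteq> V - Cmp x" using cf(2) span_subset[OF emb] by blast
  obtain i j where ij: "i \<in> set (thins m)" "j \<in> set (thins m)" "i \<noteq> j"
  proof -
    have "distinct (thins m)" using D(1) by simp
    then have "thins m ! 0 \<noteq> thins m ! 1" using thins_ge by (subst nth_eq_iff_index_eq) auto
    moreover have "thins m ! 0 \<in> set (thins m)" "thins m ! 1 \<in> set (thins m)" using thins_ge by (auto intro: nth_mem)
    ultimately show thesis by (rule that[rotated 2])
  qed
  have thin_span: "hd (\<phi> i) \<in> span m \<phi>" if "i \<in> set (thins m)" for i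
  proof -
    have "i \<in> set (ids m)" using that ids_m by blast
    moreover have "hd (\<phi> i) \<in> set (\<phi> i)" using D(3)[OF that] by auto
    ultimately show ?thesis unfolding span_def by blast
  qed
  have ne: "V - Cmp x \<noteq> {}" "\<And>y. V - Cmp x \<noteq> {y}"
  proof -
    have t: "hd (\<phi> i) \<in> V - Cmp x" "hd (\<phi> j) \<in> V - Cmp x" "hd (\<phi> i) \<noteq> hd (\<phi> j)"
      using thin_span[OF ij(1)] thin_span[OF ij(2)] D(5)[OF ij] hsub by blast+
    then show "V - Cmp x \<noteq> {}" by blast
    show "V - Cmp x \<noteq> {y}" for y
    proof
      assume e: "V - Cmp x = {y}"
      show False using t unfolding e by simp
    qed
  qed
  have CV: "Cmp x \<subseteq> V" using cf(2) by blast
  obtain h1 h2 where h: "h1 \<in> V - Cmp x" "h2 \<in> V - Cmp x" "h1 \<noteq> h2" "sees E h1 (Cmp x)" "sees E h2 (Cmp x)"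
    by (rule two_attachments[OF cf(1) CV ne])
  have hs: "h1 \<in> span m \<phi>" "h2 \<in> span m \<phi>" using h cf(4) unfolding sees_def by (metis DiffD2 insert_commute)+
  show thesis
  proof (cases "\<exists>d a b h. (d, a, b) \<in> set (flats m) \<and> h \<in> set (\<phi> d) \<and> sees E h (Cmp x)")
    case True
    then obtain d a b h where "(d, a, b) \<in> set (flats m)" "h \<in> set (\<phi> d)" "sees E h (Cmp x)" by blast
    then show thesis using that[of "(d, a, b)"] Cmp_interior[OF x] by blast
  next
    case False
    have thin: "\<exists>i\<in>set (thins m). located \<phi> (Thin i) k" if k: "k \<in> span m \<phi>" "sees E k (Cmp x)" for k
    proof -
      obtain r where r: "r \<in> set (coarse m)" "located \<phi> r k" by (rule ex_coarse[OF k(1)])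
      have "\<not> (\<exists>f\<in>set (flats m). r = Whole f)"
      proof
        assume "\<exists>f\<in>set (flats m). r = Whole f"
        then obtain d a b where "(d, a, b) \<in> set (flats m)" "r = Whole (d, a, b)" by auto
        then show False using False r(2) k(2) by auto
      qed
      then show ?thesis using r unfolding coarse_iff by blast
    qed
    obtain i where i: "i \<in> set (thins m)" "located \<phi> (Thin i) h1" using thin[OF hs(1) h(4)] by blast
    obtain j where j: "j \<in> set (thins m)" "located \<phi> (Thin j) h2" using thin[OF hs(2) h(5)] by blast
    have c: "Thin i \<in> set (coarse m)" "Thin j \<in> set (coarse m)" using i(1) j(1) coarse_iff by auto
    have s12: "same h1 h2" using Cmp_same[OF x hs h(3-5)] .
    then obtain f where f: "f \<in> set (flats m)" "h1 \<in> cl f" "h2 \<in> cl f" unfolding same_def by blast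
    show thesis
    proof (rule that[OF f(1)])
      fix k assume k: "k \<in> span m \<phi>" "sees E k (Cmp x)"
      show "k \<in> cl f"
      proof (rule ccontr)
        assume nk: "k \<notin> cl f"
        then have kn: "k \<noteq> h1" "k \<noteq> h2" using f by auto
        obtain l where l: "l \<in> set (thins m)" "located \<phi> (Thin l) k" using thin[OF k] by blast
        have cl: "Thin l \<in> set (coarse m)" using l(1) coarse_iff by auto
        have s: "same h1 k" "same h2 k" using Cmp_same[OF x hs(1) k(1) kn(1)[symmetric] h(4) k(2)]
          Cmp_same[OF x hs(2) k(1) kn(2)[symmetric] h(5) k(2)] by auto
        have sh: "share (flats m) (Thin i) (Thin j)" "share (flats m) (Thin i) (Thin l)" "share (flats m) (Thin j) (Thin l)"
          using share_same[OF c(1) i(2) c(2) j(2)] share_same[OF c(1) i(2) cl l(2)] share_same[OF c(2) j(2) cl l(2)] s12 s by auto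
        have ne3: "i \<noteq> j" "j \<noteq> l" "i \<noteq> l" using i(2) j(2) l(2) h(3) kn by auto
        obtain t1 t2 t3 where t: "(t1, t2, t3) \<in> set (triples (thins m))" "{t1, t2, t3} = {i, j, l}"
          using triples_mem[OF i(1) j(1) l(1) ne3] by blast
        have dt: "distinct (map (\<lambda>x. x) [t1, t2, t3])"
          using triples_distinct[of "\<lambda>x. x" "thins m" t1 t2 t3] t(1) D(1) by simp
        have all: "share (flats m) (Thin u) (Thin v)" if "u \<in> {i, j, l}" "v \<in> {i, j, l}" "u \<noteq> v" for u v
          using that sh share_sym[of "flats m" "Thin u" "Thin v"] by auto
        have m3: "t1 \<in> {i, j, l}" "t2 \<in> {i, j, l}" "t3 \<in> {i, j, l}" using t(2) by auto
        have nft: "no_flat_triangle (flats m) (triples (thins m))" using chk unfolding checked_def shape_ok_def by blast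
        show False
          using no_flat_triangleD[OF nft t(1)] all[OF m3(1,2)] all[OF m3(2,3)] all[OF m3(1,3)] dt by simp
      qed
    qed
  qed
qed

text \<open>A component outside the copy attaches to one closed path only. The ends of that path
  form a proper 2-cutset: on one side the interior of the path with all components attached to this
  closed path only, on the other side everything else.\<close>

lemma span_all: "span m \<phi> = V"
proof (rule ccontr)
  assume "span m \<phi> \<noteq> V"
  then obtain x0 where x0: "x0 \<in> V - span m \<phi>" using span_subset[OF emb] by blast
  obtain f where f: "f \<in> set (flats m)" "\<And>k. k \<in> span m \<phi> \<Longrightarrow> sees E k (Cmp x0) \<Longrightarrow> k \<in> cl f"
    by (rule Cmp_flat[OF x0]) blast
  obtain d a b where fd: "f = (d, a, b)" by (cases f)
  note fF = f(1)[unfolded fd]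
  obtain va vb where fe: "\<phi> a = [va]" "\<phi> b = [vb]" "ipath E ([va] @ \<phi> d @ [vb])" "\<phi> d \<noteq> []"
    "cl (d, a, b) = {va, vb} \<union> set (\<phi> d)" "a \<in> set (thins m)" "b \<in> set (thins m)" "a \<noteq> b" "d \<in> set (ids m)"
    "va \<notin> set (\<phi> d)" "vb \<notin> set (\<phi> d)" "va \<noteq> vb" "{va, vb} \<notin> E" by (rule flat_ends[OF fF])
  note rf = rest_facts[OF fF fe(1,2)]
  define rest where "rest = span m \<phi> - cl (d, a, b)"
  \<comment> \<open>Whether a vertex outside the copy belongs to \<open>X\<close> depends only on
    its component, so no edge joins \<open>X\<close> to another component; those attached just to
    \<open>va\<close> and \<open>vb\<close> are included.\<close>
  define X where "X = set (\<phi> d) \<union> {x \<in> V - span m \<phi>. \<forall>k\<in>span m \<phi>. sees E k (Cmp x) \<longrightarrow> k \<in> cl (d, a, b)}"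
  define Y where "Y = V - X - {va, vb}"
  have clH: "cl (d, a, b) \<subseteq> span m \<phi>" by (rule cl_span[OF fF])
  have HV: "span m \<phi> \<subseteq> V" by (rule span_subset[OF emb])
  have vab: "va \<in> V" "vb \<in> V" "va \<in> span m \<phi>" "vb \<in> span m \<phi>" using clH HV fe(5) by auto
  have restY: "rest \<subseteq> Y" unfolding rest_def Y_def X_def using HV fe(5) by blast
  have x0X: "x0 \<in> X" unfolding X_def using x0 f(2) fd by blast
  have XV: "X \<subseteq> V" unfolding X_def using clH HV fe(5) by blast
  have avX: "va \<notin> X" "vb \<notin> X" unfolding X_def using fe(10,11) vab by blast+
  have noXY: "{x, y} \<notin> E" if x: "x \<in> X" and y: "y \<in> Y" for x y
  proof
    assume e: "{x, y} \<in> E"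
    have yV: "y \<in> V" "y \<notin> X" "y \<noteq> va" "y \<noteq> vb" using y unfolding Y_def by auto
    have yd: "y \<notin> set (\<phi> d)" using yV(2) unfolding X_def by blast
    then have ycl: "y \<notin> cl (d, a, b)" using yV(3,4) fe(5) by auto
    show False
    proof (cases "x \<in> set (\<phi> d)")
      case True
      show False
      proof (cases "y \<in> span m \<phi>")
        case yH: True
        then show False using rf(4)[OF True] ycl e by blast
      next
        case False
        then have yH: "y \<in> V - span m \<phi>" using yV(1) by blast
        have "sees E x (Cmp y)" using e Cmp_facts(3)[OF yH] unfolding sees_def by blast
        then have "\<forall>k\<in>span m \<phi>. sees E k (Cmp y) \<longrightarrow> k \<in> cl (d, a, b)" using Cmp_interior[OF yH fF True] by blast
        then show False using yH yV(2) unfolding X_def by blast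
      qed
    next
      case False
      then have xH: "x \<in> V - span m \<phi>" "\<forall>k\<in>span m \<phi>. sees E k (Cmp x) \<longrightarrow> k \<in> cl (d, a, b)" using x unfolding X_def by auto
      show False
      proof (cases "y \<in> span m \<phi>")
        case True
        have "{y, x} \<in> E" using e by (simp add: insert_commute)
        then have "sees E y (Cmp x)" using Cmp_facts(3)[OF xH(1)] unfolding sees_def by blast
        then show False using xH(2) True ycl by blast
      next
        case False
        then have "y \<in> Cmp x" using Cmp_facts(4)[OF xH(1) Cmp_facts(3)[OF xH(1)] e] by blast
        then have "(x, y) \<in> (edge_rel E (V - span m \<phi>))\<^sup>*" unfolding Cmp_def component_def by simp
        then have "Cmp y = Cmp x" unfolding Cmp_def component_def
          using edge_rel_sym[of x y E "V - span m \<phi>"] by (intro Collect_cong) (metis rtrancl_trans)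
        then show False using xH(2) False yV unfolding X_def by auto
      qed
    qed
  qed
  have conn_cl: "conn E (cl (d, a, b))" using ipath_conn[OF fe(3)] fe(5) by (simp add: insert_commute)
  have connY: "conn E (insert va (insert vb rest))"
    using conn_insert[OF conn_insert[OF rf(1,3)], of va] rf(2) unfolding rest_def sees_def by blast
  obtain c where c: "c \<in> set (thins m)" "c \<noteq> a" "c \<noteq> b" "3 \<le> card {i. linked (links m) c i}" "\<not> linked (links m) c c" using rf(5) by blast
  obtain vc where vc: "\<phi> c = [vc]" using D(3)[OF c(1)] by auto
  have ci: "c \<in> set (ids m)" using c(1) ids_m by blast
  have thin_rest: "hd (\<phi> i) \<in> rest" if i: "i \<in> set (thins m)" "i \<noteq> a" "i \<noteq> b" for i
  proof -
    obtain v where v: "\<phi> i = [v]" using D(3)[OF i(1)] by auto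
    have ii: "i \<in> set (ids m)" "i \<noteq> d" using i(1) ids_m thin_not_flat[OF fF] by auto
    have ab: "a \<in> set (ids m)" "b \<in> set (ids m)" using fe(6,7) ids_m by auto
    have "v \<notin> cl (d, a, b)" using unique_id[OF ii(1) _ , of _ v] v i(2,3) ii(2) ab fe(9) unfolding cl_def by auto
    moreover have "v \<in> span m \<phi>" using in_span[where \<phi>=\<phi>, OF ii(1), of v] v by simp
    ultimately show ?thesis using v unfolding rest_def by simp
  qed
  have finY: "finite Y" "finite X" unfolding Y_def using finite_subset[OF XV] by auto
  have cardX: "2 \<le> card X"
  proof -
    obtain z where z: "z \<in> set (\<phi> d)" using fe(4) by (cases "\<phi> d") auto
    then have "z \<in> span m \<phi>" using clH fe(5) by blast
    then have "z \<noteq> x0" using x0 by blast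
    moreover have "{z, x0} \<subseteq> X" using z x0X unfolding X_def by blast
    ultimately show ?thesis using card_mono[OF finY(2), of "{z, x0}"] by simp
  qed
  \<comment> \<open>At least four single vertices exist and only two of them are ends of the
    path.\<close>
  have cardY: "2 \<le> card Y"
  proof -
    let ?I = "set (thins m) - {a, b}"
    have "distinct (thins m)" using D(1) by simp
    then have "card (set (thins m)) \<ge> 4" using thins_ge by (simp add: distinct_card)
    moreover have "card {a, b} \<le> 2" by (simp add: card_insert_if)
    ultimately have "2 \<le> card ?I" using diff_card_le_card_Diff[of "{a, b}" "set (thins m)"] by simp
    moreover have "inj_on (\<lambda>i. hd (\<phi> i)) ?I" unfolding inj_on_def using D(5) by blast
    ultimately have "2 \<le> card ((\<lambda>i. hd (\<phi> i)) ` ?I)" by (simp add: card_image)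
    moreover have "(\<lambda>i. hd (\<phi> i)) ` ?I \<subseteq> Y" using thin_rest restY by blast
    ultimately show ?thesis using card_mono[OF finY(1)] by (meson le_trans)
  qed
  \<comment> \<open>The closed path joins \<open>va\<close> to \<open>vb\<close> inside this side
    without using \<open>x0\<close>.\<close>
  have nbX: "\<not> is_ab_path (X \<union> {va, vb}) (induced_edges E (X \<union> {va, vb})) va vb"
  proof
    assume p: "is_ab_path (X \<union> {va, vb}) (induced_edges E (X \<union> {va, vb})) va vb"
    have "cl (d, a, b) \<subseteq> X \<union> {va, vb} - {x0}" using fe(5) clH x0 unfolding X_def by blast
    then show False
      using is_ab_path_separates[OF p _ _ _ conn_cl, of x0] x0X x0 vab fe(5) by blast
  qed
  \<comment> \<open>The single vertex \<open>c\<close> off the path has three linked pieces, none of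
    them the path \<open>d\<close>, hence three neighbours in this side.\<close>
  have nbY: "\<not> is_ab_path (Y \<union> {va, vb}) (induced_edges E (Y \<union> {va, vb})) va vb"
  proof
    assume p: "is_ab_path (Y \<union> {va, vb}) (induced_edges E (Y \<union> {va, vb})) va vb"
    have vcr: "vc \<in> rest" using thin_rest[OF c(1-3)] vc by simp
    then have vcY: "vc \<in> Y \<union> {va, vb}" using restY by blast
    obtain y z where yz: "{u. {u, vc} \<in> induced_edges E (Y \<union> {va, vb})} \<subseteq> {y, z}"
      using is_ab_path_nbs(1)[OF p vcY] by blast
    let ?I = "{i. linked (links m) c i}"
    have "\<exists>u. u \<in> set (\<phi> i) \<and> {u, vc} \<in> induced_edges E (Y \<union> {va, vb}) \<and> i \<in> set (ids m)" if i: "i \<in> ?I" for i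
    proof -
      have li: "linked (links m) c i" using i by simp
      have ii: "i \<in> set (ids m)" by (rule linked_ids[OF li])
      have mm: "links m = links (thins m, fst (snd m), flats m)" by (cases m) simp
      have "i \<noteq> d" using linked_links_flat[OF emb' fF c(1)] li c(2,3) linked_sym[of "links m" c i] mm by auto
      have "i \<noteq> c" using li c(5) by blast
      then have "\<exists>x\<in>set (\<phi> c). \<exists>y\<in>set (\<phi> i). {x, y} \<in> E" using sys_edge[OF emb_sys[OF emb] ci ii] li by blast
      then obtain u where u: "u \<in> set (\<phi> i)" "{u, vc} \<in> E" using vc by (auto simp: insert_commute)
      have us: "u \<in> span m \<phi>" using u(1) ii unfolding span_def by blast
      have "u \<notin> set (\<phi> d)" using unique_id[OF ii fe(9) u(1)] \<open>i \<noteq> d\<close> by blast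
      then have "u \<in> Y \<union> {va, vb}" using us restY fe(5) unfolding rest_def by blast
      then show ?thesis using u vcY ii unfolding induced_edges_def by auto
    qed
    then obtain g where g: "\<And>i. i \<in> ?I \<Longrightarrow> g i \<in> set (\<phi> i) \<and> {g i, vc} \<in> induced_edges E (Y \<union> {va, vb}) \<and> i \<in> set (ids m)"
      by metis
    have "inj_on g ?I" unfolding inj_on_def using g unique_id by metis
    then have "card ?I = card (g ` ?I)" by (simp add: card_image)
    also have "\<dots> \<le> card {y, z}" using g yz by (intro card_mono) auto
    also have "\<dots> \<le> 2" by (simp add: card_insert_if)
    finally show False using c(4) by simp
  qed
  have "proper_2cutset V E va vb"
  proof (rule proper_2cutsetI)
    show "V = X \<union> Y \<union> {va, vb}" "X \<inter> Y = {}" using XV vab unfolding Y_def by auto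
    show "has_path (X \<union> {va, vb}) (induced_edges E (X \<union> {va, vb})) va vb"
      by (rule conn_has_path[OF conn_cl]) (use fe(5) in \<open>auto simp: X_def\<close>)
    show "has_path (Y \<union> {va, vb}) (induced_edges E (Y \<union> {va, vb})) va vb"
      by (rule conn_has_path[OF connY]) (use restY in auto)
    show "va \<notin> Y" "vb \<notin> Y" unfolding Y_def by auto
  qed (use vab fe(12,13) avX cardX cardY noXY nbX nbY in blast)+
  then show False using no2 unfolding has_proper_2cutset_def by blast
qed

end

section \<open>Patterns that span the graph\<close>

lemma ipath_cong:
  "(\<And>x y. x \<in> set xs \<Longrightarrow> y \<in> set xs \<Longrightarrow> {x, y} \<in> E' \<longleftrightarrow> {x, y} \<in> E) \<Longrightarrow> ipath E' xs = ipath E xs"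
  by (induction xs) auto

lemma ipath_nbs:
  assumes p: "ipath E (xs @ p # z # q # ys)" and irr: "{z} \<notin> E" and y: "y \<in> set (xs @ p # z # q # ys)"
  shows "{y, z} \<in> E \<longleftrightarrow> y = p \<or> y = q"
proof -
  have P: "ipath E ((xs @ [p]) @ z # q # ys)" using p by simp
  have l: "{x, z} \<in> E \<longleftrightarrow> x = p" if "x \<in> set (xs @ [p])" for x using P that unfolding ipath_append by auto
  have "ipath E (z # q # ys)" using P unfolding ipath_append by blast
  then have r: "{z, x} \<in> E \<longleftrightarrow> x = q" if "x \<in> set (q # ys)" for x using that by auto
  have d: "distinct (xs @ p # z # q # ys)" by (rule ipath_distinct[OF p])
  consider "y \<in> set (xs @ [p])" | "y = z" | "y \<in> set (q # ys)" using y by auto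
  then show ?thesis
  proof cases
    case 1
    then have "y \<noteq> q" using d by auto
    then show ?thesis using l[OF 1] by blast
  next
    case 2
    then show ?thesis using d irr by auto
  next
    case 3
    then have "y \<noteq> p" using d by auto
    then show ?thesis using r[OF 3] by (simp add: insert_commute)
  qed
qed

lemma emb_flat_nbs:
  assumes e: "emb V E m \<phi>" and f: "(d, a, b) \<in> set (flats m)" and z: "z \<in> set (\<phi> d)" and y: "y \<in> span m \<phi>" "{z, y} \<in> E"
  shows "y \<in> set (\<phi> a @ \<phi> d @ \<phi> b)"
proof (rule ccontr)
  assume n: "y \<notin> set (\<phi> a @ \<phi> d @ \<phi> b)"
  obtain N R F where m: "m = (N, R, F)" by (cases m)
  note D = embD[OF e[unfolded m]]
  have fF: "(d, a, b) \<in> set F" using f m by simp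
  obtain i where i: "i \<in> set (ids m)" "y \<in> set (\<phi> i)" using y(1) unfolding span_def by blast
  then consider "i \<in> set N" | g where "g \<in> set F" "i = fst g" unfolding m by auto
  then show False
  proof cases
    case 1
    have "i \<noteq> a" "i \<noteq> b" using n i(2) by auto
    then have "anticomplete E (set (\<phi> d)) (set (\<phi> i))" using D(6)[OF fF 1] by simp
    then show False using z i(2) y(2) unfolding anticomplete_def by blast
  next
    case 2
    have "fst (d, a, b) \<noteq> fst g" using n i(2) 2 by auto
    then have "anticomplete E (set (\<phi> d)) (set (\<phi> i))" using D(7)[OF fF 2(1)] 2 by simp
    then show False using z i(2) y(2) unfolding anticomplete_def by blast
  qed
qed

lemma emb_disjoint:
  "emb V E m \<phi> \<Longrightarrow> i \<in> set (ids m) \<Longrightarrow> j \<in> set (ids m) \<Longrightarrow> x \<in> set (\<phi> i) \<Longrightarrow> x \<in> set (\<phi> j) \<Longrightarrow> i = j"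
  using emb_sys[of V E m \<phi>] unfolding sys_def by (metis disjoint_iff)

text \<open>The inverse of one subdivision: the last vertex \<open>w\<close> of a path with at least
  two vertices is removed and its neighbours \<open>u\<close> and \<open>v\<close> are joined. Then
  \<open>u\<close> has degree 2, so the new edge is one that a 2-extension may subdivide.\<close>

lemma contract_flat:
  assumes g: "graph V E" and e: "emb V E m \<phi>" and s: "span m \<phi> = V" and f: "(d, a, b) \<in> set (flats m)"
    and L: "\<phi> d = L @ [u, w]" and v: "\<phi> b = [v]"
  defines "E' \<equiv> {e \<in> E. w \<notin> e} \<union> {{u, v}}"
  shows "graph (V - {w}) E'" "emb (V - {w}) E' m (\<phi>(d := L @ [u]))" "span m (\<phi>(d := L @ [u])) = V - {w}"
    "\<And>y. y \<in> V \<Longrightarrow> {y, w} \<in> E \<longleftrightarrow> y = u \<or> y = v" "{u, v} \<notin> E" "degree (V - {w}) E' u = 2"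
    "u \<in> V" "v \<in> V" "w \<in> V" "u \<noteq> v" "u \<noteq> w" "v \<noteq> w"
proof -
  interpret ugraph V E by standard (rule g)
  obtain N R F where m: "m = (N, R, F)" by (cases m)
  note D = embD[OF e[unfolded m]]
  have fF: "(d, a, b) \<in> set F" using f m by simp
  have aN: "a \<in> set N" "b \<in> set N" "a \<noteq> b" and ip: "ipath E (\<phi> a @ \<phi> d @ \<phi> b)" using D(4)[OF fF] by auto
  obtain va where va: "\<phi> a = [va]" using D(3)[OF aN(1)] by blast
  have ids: "a \<in> set (ids m)" "b \<in> set (ids m)" "d \<in> set (ids m)" using aN fF unfolding m by force+
  \<comment> \<open>\<open>p\<close> is the predecessor of \<open>u\<close>, possibly the end
    \<open>va\<close>. With it \<open>u\<close> and \<open>w\<close> are inner entries of the closed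
    path, and \<open>ipath_nbs\<close> determines their neighbours.\<close>
  define xs where "xs = butlast (va # L)"
  define p where "p = last (va # L)"
  have xp: "va # L = xs @ [p]" unfolding xs_def p_def by (simp del: butlast.simps last.simps)
  have P: "\<phi> a @ \<phi> d @ \<phi> b = (va # L) @ [u, w, v]" using va L v by simp
  have P1: "\<phi> a @ \<phi> d @ \<phi> b = xs @ p # u # w # [v]" unfolding P xp by simp
  have P2: "\<phi> a @ \<phi> d @ \<phi> b = (xs @ [p]) @ u # w # v # []" unfolding P xp by simp
  have dist: "distinct (\<phi> a @ \<phi> d @ \<phi> b)" by (rule ipath_distinct[OF ip])
  have ud: "u \<in> set (\<phi> d)" "w \<in> set (\<phi> d)" using L by auto
  have sp: "x \<in> V" if "x \<in> set (\<phi> a @ \<phi> d @ \<phi> b)" for x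
    using that in_span[where \<phi>=\<phi>, OF ids(1)] in_span[where \<phi>=\<phi>, OF ids(2)] in_span[where \<phi>=\<phi>, OF ids(3)] s by auto
  show uvw: "u \<in> V" "v \<in> V" "w \<in> V" using sp P by auto
  show ne: "u \<noteq> v" "u \<noteq> w" "v \<noteq> w" using dist unfolding P1 by auto
  have wn: "{y, w} \<in> E \<longleftrightarrow> y = u \<or> y = v" if y: "y \<in> V" for y
  proof (cases "y \<in> set (\<phi> a @ \<phi> d @ \<phi> b)")
    case True
    then show ?thesis using ipath_nbs[OF ip[unfolded P2] adj_irrefl] unfolding P2 by blast
  next
    case False
    have "{w, y} \<notin> E" using emb_flat_nbs[OF e f ud(2)] y s False by blast
    moreover have "y \<noteq> u" "y \<noteq> v" using False unfolding P2 by auto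
    ultimately show ?thesis by (simp add: insert_commute)
  qed
  then show "\<And>y. y \<in> V \<Longrightarrow> {y, w} \<in> E \<longleftrightarrow> y = u \<or> y = v" .
  have un: "{y, u} \<in> E \<longleftrightarrow> y = p \<or> y = w" if y: "y \<in> V" for y
  proof (cases "y \<in> set (\<phi> a @ \<phi> d @ \<phi> b)")
    case True
    then show ?thesis using ipath_nbs[OF ip[unfolded P1] adj_irrefl] unfolding P1 by blast
  next
    case False
    have "{u, y} \<notin> E" using emb_flat_nbs[OF e f ud(1)] y s False by blast
    moreover have "y \<noteq> p" "y \<noteq> w" using False unfolding P1 by auto
    ultimately show ?thesis by (simp add: insert_commute)
  qed
  have pv: "p \<noteq> v" "p \<noteq> w" "p \<in> V" using dist sp unfolding P1 by auto
  show uv: "{u, v} \<notin> E" using un[OF uvw(2)] pv(1) ne by (auto simp: insert_commute)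
  have E': "{x, y} \<in> E' \<longleftrightarrow> {x, y} \<in> E \<and> x \<noteq> w \<and> y \<noteq> w \<or> {x, y} = {u, v}" for x y
    unfolding E'_def by auto
  have "{y \<in> V - {w}. {y, u} \<in> E'} = {p, v}"
    using E' un pv uvw ne by (auto simp: doubleton_eq_iff)
  then show "degree (V - {w}) E' u = 2" unfolding degree_def using pv(1) by simp
  show "graph (V - {w}) E'" unfolding graph_def
  proof (intro conjI ballI)
    show "finite (V - {w})" using g unfolding graph_def by simp
    fix x assume "x \<in> E'"
    then consider "x \<in> E" "w \<notin> x" | "x = {u, v}" unfolding E'_def by blast
    then show "\<exists>u v. x = {u, v} \<and> u \<noteq> v \<and> u \<in> V - {w} \<and> v \<in> V - {w}"
    proof cases
      case 1
      then obtain y z where "x = {y, z}" "y \<noteq> z" "y \<in> V" "z \<in> V" using g unfolding graph_def by blast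
      then show ?thesis using 1(2) by blast
    qed (use ne uvw in blast)
  qed
  let ?\<phi> = "\<phi>(d := L @ [u])"
  have sets: "set (?\<phi> i) = set (\<phi> i) - {w}" if i: "i \<in> set (ids m)" for i
  proof (cases "i = d")
    case True
    then show ?thesis using L dist by auto
  next
    case False
    then show ?thesis using emb_disjoint[OF e i ids(3), of w] ud by auto
  qed
  then show "span m ?\<phi> = V - {w}" unfolding span_def s[symmetric] by auto
  have dN: "d \<notin> set N" using D(1) fF by force
  have thin: "?\<phi> i = \<phi> i" if "i \<in> set N" for i using that dN by auto
  have fi: "fst h \<in> set (ids m)" if "h \<in> set F" for h using that m by auto
  have Ni: "i \<in> set (ids m)" if "i \<in> set N" for i using that m by auto
  have vb: "i = b" if "i \<in> set (ids m)" "v \<in> set (\<phi> i)" for i using emb_disjoint[OF e that(1) ids(2) that(2)] v by simp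
  have ui: "i = d" if "i \<in> set (ids m)" "u \<in> set (\<phi> i)" for i by (rule emb_disjoint[OF e that(1) ids(3) that(2) ud(1)])
  have wi: "i = d" if "i \<in> set (ids m)" "w \<in> set (\<phi> i)" for i by (rule emb_disjoint[OF e that(1) ids(3) that(2) ud(2)])
  have anti: "anticomplete E' A B" if "anticomplete E A B" "v \<notin> A" "v \<notin> B" for A B
    using that unfolding anticomplete_def by (auto simp: E' doubleton_eq_iff)
  have bF: "b \<noteq> fst h" if "h \<in> set F" for h using D(1) aN(2) that by force
  show "emb (V - {w}) E' m ?\<phi>" unfolding m
  proof (rule embI[OF D(1,2)])
    fix i assume i: "i \<in> set N"
    obtain x where x: "x \<in> V" "\<phi> i = [x]" using D(3)[OF i] by blast
    have "x \<noteq> w" using wi[OF Ni[OF i]] x i dN by auto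
    then show "\<exists>v\<in>V - {w}. ?\<phi> i = [v]" using x thin[OF i] by simp
  next
    fix i j assume ij: "i \<in> set N" "j \<in> set N" "i \<noteq> j"
    obtain x y where xy: "\<phi> i = [x]" "\<phi> j = [y]" using D(3) ij by meson
    have "x \<noteq> w" "y \<noteq> w" "x \<noteq> u" "y \<noteq> u" using wi ui Ni ij xy dN by force+
    then have "{x, y} \<in> E' \<longleftrightarrow> {x, y} \<in> E" by (auto simp: E' doubleton_eq_iff)
    then show "hd (?\<phi> i) \<noteq> hd (?\<phi> j) \<and> ({hd (?\<phi> i), hd (?\<phi> j)} \<in> E' \<longleftrightarrow> linked R i j)"
      using D(5)[OF ij] thin ij xy by simp
  next
    fix d' a' b' c assume h: "(d', a', b') \<in> set F" "c \<in> set N" "c \<noteq> a'" "c \<noteq> b'"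
    have d': "d' \<in> set (ids m)" using fi[OF h(1)] by simp
    have A: "anticomplete E (set (?\<phi> d')) (set (?\<phi> c))"
      by (rule anticomplete_mono[OF D(6)[OF h]]) (use sets[OF d'] sets[OF Ni[OF h(2)]] in auto)
    show "anticomplete E' (set (?\<phi> d')) (set (?\<phi> c))"
    proof (cases "c = b")
      case False
      then have "v \<notin> set (?\<phi> c)" "v \<notin> set (?\<phi> d')" using vb Ni[OF h(2)] d' bF[OF h(1)] sets by auto
      then show ?thesis using anti[OF A] by blast
    next
      case True
      then have "d' \<noteq> d" using h(4) emb_flat_unique[OF e[unfolded m] h(1) fF] by auto
      then have "u \<notin> set (?\<phi> d')" "u \<notin> set (?\<phi> c)" using ui Ni[OF h(2)] d' sets dN h(2) by auto
      then show ?thesis using A sets[OF d'] sets[OF Ni[OF h(2)]] unfolding anticomplete_def by (auto simp: E' doubleton_eq_iff)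
    qed
  next
    fix f1 f2 assume h: "f1 \<in> set F" "f2 \<in> set F" "fst f1 \<noteq> fst f2"
    have A: "anticomplete E (set (?\<phi> (fst f1))) (set (?\<phi> (fst f2)))"
      by (rule anticomplete_mono[OF D(7)[OF h]]) (use sets[OF fi[OF h(1)]] sets[OF fi[OF h(2)]] in auto)
    have "v \<notin> set (?\<phi> (fst f1))" "v \<notin> set (?\<phi> (fst f2))" using vb fi bF h sets by blast+
    then show "anticomplete E' (set (?\<phi> (fst f1))) (set (?\<phi> (fst f2)))" by (rule anti[OF A])
  next
    fix d' a' b' assume h: "(d', a', b') \<in> set F"
    note h' = D(4)[OF h]
    have d': "d' \<in> set (ids m)" using fi[OF h] by simp
    show "a' \<in> set N \<and> b' \<in> set N \<and> a' \<noteq> b' \<and> ?\<phi> d' \<noteq> [] \<and> set (?\<phi> d') \<subseteq> V - {w} \<and> ipath E' (?\<phi> a' @ ?\<phi> d' @ ?\<phi> b')"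
    proof (intro conjI)
      show "set (?\<phi> d') \<subseteq> V - {w}" using sets[OF d'] h' by auto
      show "ipath E' (?\<phi> a' @ ?\<phi> d' @ ?\<phi> b')"
      proof (cases "d' = d")
        case True
        then have ab: "a' = a" "b' = b" using emb_flat_unique[OF e[unfolded m] h fF] by auto
        have i0: "ipath E ((va # L @ [u]) @ [w, v])" using ip unfolding P by simp
        then have i1: "ipath E (va # L @ [u])" unfolding ipath_append by blast
        have nx: "{x, v} \<in> E' \<longleftrightarrow> x = u" if x: "x \<in> set (va # L @ [u])" for x
        proof -
          have "{x, v} \<notin> E" using i0 x ne unfolding ipath_append by auto
          then show ?thesis using ne by (auto simp: E' doubleton_eq_iff)
        qed
        have "v \<notin> set (va # L @ [u])" "w \<notin> set (va # L @ [u])" using dist P by auto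
        then have "ipath E' (va # L @ [u]) = ipath E (va # L @ [u])" by (intro ipath_cong) (auto simp: E' doubleton_eq_iff)
        then have "ipath E' ((va # L @ [u]) @ [v])" unfolding ipath_append using i1 nx \<open>v \<notin> set (va # L @ [u])\<close> by auto
        then show ?thesis using True ab thin aN va v by auto
      next
        case False
        have ia: "a' \<in> set (ids m)" "b' \<in> set (ids m)" "a' \<noteq> d" "b' \<noteq> d" using h' Ni dN by auto
        have "u \<notin> set (\<phi> a' @ \<phi> d' @ \<phi> b')" "w \<notin> set (\<phi> a' @ \<phi> d' @ \<phi> b')" using ui wi ia d' False by auto
        then have "ipath E' (\<phi> a' @ \<phi> d' @ \<phi> b') = ipath E (\<phi> a' @ \<phi> d' @ \<phi> b')" by (intro ipath_cong) (auto simp: E' doubleton_eq_iff)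
        then show ?thesis using h' ia False by simp
      qed
    qed (use h' in auto)
  qed
qed

lemma two_ext_nat_edges: "two_ext_nat HV HE V E \<Longrightarrow> e \<in> E \<Longrightarrow> e \<subseteq> V"
proof (induction arbitrary: e rule: two_ext_nat.induct)
  case (subdivide V E u v w)
  have "{u, v} \<subseteq> V" by (rule subdivide.IH[OF subdivide.hyps(2)])
  then show ?case using subdivide.IH subdivide.prems by blast
qed (auto simp: induced_edges_def)

lemma degree_iso:
  assumes "bij_betw f V W" "\<And>x y. x \<in> V \<Longrightarrow> y \<in> V \<Longrightarrow> {x, y} \<in> E \<longleftrightarrow> {f x, f y} \<in> F" "u \<in> V"
  shows "degree W F (f u) = degree V E u"
proof -
  have W: "W = f ` V" using assms(1) unfolding bij_betw_def by simp
  have "{y \<in> W. {y, f u} \<in> F} = f ` {x \<in> V. {x, u} \<in> E}" unfolding W using assms(2,3) by auto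
  moreover have "inj_on f {x \<in> V. {x, u} \<in> E}" using assms(1) unfolding bij_betw_def by (auto intro: inj_on_subset)
  ultimately show ?thesis unfolding degree_def by (simp add: card_image)
qed

text \<open>\<open>l\<close> lists, by piece number, the vertices of the host \<open>H\<close>. The
  test says that the pattern with every path shrunk to one vertex is an induced subgraph of
  \<open>H\<close>.\<close>

definition hosted :: "model \<Rightarrow> model \<Rightarrow> int list \<Rightarrow> bool" where
  "hosted m H l \<longleftrightarrow> dist_ok (map (\<lambda>i. l ! nat i) (ids m)) \<and> list_all (\<lambda>i. memb (l ! nat i) (thins H) \<and> 0 \<le> l ! nat i) (ids m) \<and>
     list_all (\<lambda>(i, j). linked (links m) i j = linked (links H) (l ! nat i) (l ! nat j)) (pairs (ids m))"

text \<open>Induction on the number of vertices: while some path has two vertices, contract one edge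
  and subdivide it again in the 2-extension obtained for the smaller graph. If all paths are single
  vertices, the graph is a host graph with vertices deleted.\<close>

lemma two_extension:
  fixes V :: "'a set"
  assumes l: "hosted m H l" and HV: "HV = nat ` set (thins H)" and HE: "HE = (\<lambda>(i, j). {nat i, nat j}) ` set (links H)"
    and pos: "\<forall>(i, j)\<in>set (links H). 0 \<le> i \<and> 0 \<le> j \<and> i \<noteq> j"
  shows "graph V E \<Longrightarrow> emb V E m \<phi> \<Longrightarrow> span m \<phi> = V \<Longrightarrow> two_extension_of V E HV HE"
proof (induction "card V" arbitrary: V E \<phi> rule: less_induct)
  case less
  interpret ugraph V E by standard (rule less.prems(1))
  obtain N R F where m: "m = (N, R, F)" by (cases m)
  note D = embD[OF less.prems(2)[unfolded m]]
  show ?case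
  proof (cases "\<exists>(d, a, b)\<in>set F. 2 \<le> length (\<phi> d)")
    case True
    then obtain d a b where f: "(d, a, b) \<in> set F" "2 \<le> length (\<phi> d)" by blast
    have fm: "(d, a, b) \<in> set (flats m)" using f m by simp
    obtain v where v: "\<phi> b = [v]" using D(3) D(4)[OF f(1)] by blast
    obtain L u w where L: "\<phi> d = L @ [u, w]"
    proof -
      have "\<phi> d = butlast (butlast (\<phi> d)) @ [last (butlast (\<phi> d)), last (\<phi> d)]"
      proof -
        have n: "\<phi> d \<noteq> []" "butlast (\<phi> d) \<noteq> []" using f(2) by (auto simp: butlast_conv_take)
        have "\<phi> d = butlast (\<phi> d) @ [last (\<phi> d)]" using n by simp
        also have "butlast (\<phi> d) = butlast (butlast (\<phi> d)) @ [last (butlast (\<phi> d))]" using n by simp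
        finally show ?thesis by simp
      qed
      then show thesis by (rule that)
    qed
    define E' where "E' = {e \<in> E. w \<notin> e} \<union> {{u, v}}"
    note c = contract_flat[OF less.prems fm L v, folded E'_def]
    have fin: "finite V" using less.prems(1) unfolding graph_def by simp
    then have "card (V - {w}) < card V" using c(9) by (rule card_Diff1_less)
    from less.hyps[OF this c(1-3)] obtain W G f where WG: "two_ext_nat HV HE W G" "bij_betw f (V - {w}) W"
      "\<And>x y. x \<in> V - {w} \<Longrightarrow> y \<in> V - {w} \<Longrightarrow> {x, y} \<in> E' \<longleftrightarrow> {f x, f y} \<in> G"
      unfolding two_extension_of_def isomorphic_def by metis
    have finW: "finite W" using bij_betw_finite[OF WG(2)] fin by simp
    obtain k where k: "k \<notin> W" using finW ex_new_if_finite infinite_UNIV_nat by blast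
    have uv: "u \<in> V - {w}" "v \<in> V - {w}" using c by auto
    have fW: "f x \<in> W" if "x \<in> V - {w}" for x using WG(2) that unfolding bij_betw_def by blast
    have fk: "f x \<noteq> k" if "x \<in> V - {w}" for x using fW[OF that] k by auto
    have "{f u, f v} \<in> G" using WG(3)[OF uv] unfolding E'_def by blast
    \<comment> \<open>This is the degree condition of \<open>two_ext_nat.subdivide\<close>; it is
      carried over from the contracted graph by the isomorphism.\<close>
    moreover have "degree W G (f u) = 2" using degree_iso[OF WG(2,3) uv(1)] c(6) by simp
    ultimately have t: "two_ext_nat HV HE (insert k W) ((G - {{f u, f v}}) \<union> {{f u, k}, {k, f v}})"
      using two_ext_nat.subdivide[OF WG(1)] k by blast
    let ?f = "f(w := k)" and ?G = "(G - {{f u, f v}}) \<union> {{f u, k}, {k, f v}}"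
    have kG: "{x, k} \<notin> G" for x using two_ext_nat_edges[OF WG(1)] k by blast
    have inj: "f x = f y \<longleftrightarrow> x = y" if "x \<in> V - {w}" "y \<in> V - {w}" for x y
      using WG(2) that unfolding bij_betw_def inj_on_def by blast
    have bij: "bij_betw ?f V (insert k W)"
    proof -
      have "bij_betw ?f (V - {w}) W" using WG(2) by (rule bij_betw_cong[THEN iffD1, rotated]) auto
      moreover have "bij_betw ?f {w} {k}" by (simp add: bij_betw_def)
      ultimately have "bij_betw ?f ((V - {w}) \<union> {w}) (W \<union> {k})" using k by (intro bij_betw_combine) auto
      moreover have "(V - {w}) \<union> {w} = V" using c(9) by blast
      ultimately show ?thesis by simp
    qed
    have new: "{x, w} \<in> E \<longleftrightarrow> {?f x, ?f w} \<in> ?G" if x: "x \<in> V" for x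
    proof (cases "x = w")
      case True
      then show ?thesis using kG[of k] fk uv by (auto simp: doubleton_eq_iff)
    next
      case False
      then have xV: "x \<in> V - {w}" using x by blast
      have "{f x, k} \<in> ?G \<longleftrightarrow> f x = f u \<or> f x = f v" using kG fk[OF xV] fk[OF uv(1)] fk[OF uv(2)] by (auto simp: doubleton_eq_iff)
      then show ?thesis using c(4)[OF x] inj[OF xV uv(1)] inj[OF xV uv(2)] False by simp
    qed
    have "{x, y} \<in> E \<longleftrightarrow> {?f x, ?f y} \<in> ?G" if xy: "x \<in> V" "y \<in> V" for x y
    proof -
      consider "x = w" | "y = w" | "x \<noteq> w" "y \<noteq> w" by blast
      then show ?thesis
      proof cases
        case 1
        then show ?thesis using new[OF xy(2)] by (simp add: insert_commute)
      next
        case 2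
        then show ?thesis using new[OF xy(1)] by simp
      next
        case 3
        then have V: "x \<in> V - {w}" "y \<in> V - {w}" using xy by auto
        have "{x, y} \<in> E \<longleftrightarrow> {x, y} \<in> E' \<and> {x, y} \<noteq> {u, v}" unfolding E'_def using 3 c(5) by auto
        also have "\<dots> \<longleftrightarrow> {f x, f y} \<in> G \<and> {f x, f y} \<noteq> {f u, f v}"
          using WG(3)[OF V] inj V uv by (auto simp: doubleton_eq_iff)
        also have "\<dots> \<longleftrightarrow> {f x, f y} \<in> ?G" using fk[OF V(1)] fk[OF V(2)] by (auto simp: doubleton_eq_iff)
        finally show ?thesis using 3 by simp
      qed
    qed
    then show ?thesis unfolding two_extension_of_def isomorphic_def using t bij by blast
  next
    case False
    have one: "\<exists>x. \<phi> i = [x]" if i: "i \<in> set (ids m)" for i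
    proof (cases "i \<in> set N")
      case True
      then show ?thesis using D(3) by blast
    next
      case no: False
      then obtain a b where "(i, a, b) \<in> set F" using i m by auto
      then have "\<phi> i \<noteq> []" "\<not> 2 \<le> length (\<phi> i)" using D(4) False by blast+
      then show ?thesis by (cases "\<phi> i") (auto simp: Suc_le_eq)
    qed
    define s where "s i = nat (l ! nat i)" for i
    define h where "h i = hd (\<phi> i)" for i
    have h: "\<phi> i = [h i]" if "i \<in> set (ids m)" for i using one[OF that] unfolding h_def by auto
    have bh: "bij_betw h (set (ids m)) V"
      unfolding bij_betw_def
    proof
      show "inj_on h (set (ids m))" unfolding inj_on_def using h emb_disjoint[OF less.prems(2)] by fastforce
      show "h ` set (ids m) = V" unfolding less.prems(3)[symmetric] span_def using h by auto
    qed
    have linj: "inj_on (\<lambda>i. l ! nat i) (set (ids m))" using l unfolding hosted_def by (simp add: dist_ok_iff distinct_map)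
    have lH: "l ! nat i \<in> set (thins H)" "0 \<le> l ! nat i" if "i \<in> set (ids m)" for i
      using l that unfolding hosted_def by (auto simp: list_all_iff)
    have bs: "bij_betw s (set (ids m)) (s ` set (ids m))"
      unfolding bij_betw_def
    proof
      show "inj_on s (set (ids m))" unfolding s_def inj_on_def using linj lH(2) unfolding inj_on_def by (metis eq_nat_nat_iff)
    qed simp
    define S where "S = s ` set (ids m)"
    \<comment> \<open>The piece numbers are integers, the hosts use natural numbers;
      \<open>nat\<close> is injective here because all numbers involved are nonnegative.\<close>
    have HEl: "{nat i, nat j} \<in> HE \<longleftrightarrow> linked (links H) i j" if ij: "0 \<le> i" "0 \<le> j" for i j
    proof
      assume "{nat i, nat j} \<in> HE"
      then obtain i' j' where q: "(i', j') \<in> set (links H)" "{nat i, nat j} = {nat i', nat j'}" unfolding HE by auto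
      then have "0 \<le> i'" "0 \<le> j'" using pos by auto
      moreover have "i = i' \<and> j = j' \<or> i = j' \<and> j = i'"
        using q(2) ij calculation unfolding doubleton_eq_iff eq_nat_nat_iff by (metis eq_nat_nat_iff)
      ultimately show "linked (links H) i j" using q(1) unfolding linked_def by blast
    next
      assume "linked (links H) i j"
      then show "{nat i, nat j} \<in> HE" unfolding linked_def HE by (auto simp: insert_commute rev_image_eqI)
    qed
    have irr: "{k} \<notin> HE" for k
    proof
      assume "{k} \<in> HE"
      then obtain i j where q: "(i, j) \<in> set (links H)" "{k} = {nat i, nat j}" unfolding HE by auto
      then have "0 \<le> i" "0 \<le> j" "i \<noteq> j" "nat i = nat j" using pos by auto
      then show False by simp
    qed
    have edge: "{h i, h j} \<in> E \<longleftrightarrow> {s i, s j} \<in> HE" if ij: "i \<in> set (ids m)" "j \<in> set (ids m)" for i j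
    proof (cases "i = j")
      case True
      then show ?thesis using irr by simp
    next
      case False
      have "(i, j) \<in> set (pairs (ids m)) \<or> (j, i) \<in> set (pairs (ids m))" by (rule pairs_mem[OF ij False])
      moreover have P: "linked (links m) i j = linked (links H) (l ! nat i) (l ! nat j)" if "(i, j) \<in> set (pairs (ids m))" for i j
        using l that unfolding hosted_def by (auto simp: list_all_iff)
      ultimately have "linked (links m) i j = linked (links H) (l ! nat i) (l ! nat j)" using linked_sym by metis
      also have "\<dots> \<longleftrightarrow> {s i, s j} \<in> HE" unfolding s_def using HEl lH(2) ij by blast
      finally have "linked (links m) i j \<longleftrightarrow> {s i, s j} \<in> HE" .
      moreover have "(\<exists>x\<in>set (\<phi> i). \<exists>y\<in>set (\<phi> j). {x, y} \<in> E) = linked (links m) i j"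
        using emb_sys[OF less.prems(2)] ij False unfolding sys_def by simp
      ultimately show ?thesis using h[OF ij(1)] h[OF ij(2)] by simp
    qed
    have SH: "S \<subseteq> HV" unfolding S_def s_def HV using lH(1) by auto
    define f where "f = s \<circ> inv_into (set (ids m)) h"
    have bf: "bij_betw f V S" unfolding f_def S_def by (rule bij_betw_trans[OF bij_betw_inv_into[OF bh] bs])
    have "{x, y} \<in> E \<longleftrightarrow> {f x, f y} \<in> induced_edges HE S" if xy: "x \<in> V" "y \<in> V" for x y
    proof -
      obtain i j where ij: "i \<in> set (ids m)" "j \<in> set (ids m)" "x = h i" "y = h j" using xy bh unfolding bij_betw_def by blast
      then have "f x = s i" "f y = s j" unfolding f_def using bij_betw_inv_into_left[OF bh] by simp_all
      then show ?thesis using edge[OF ij(1,2)] ij unfolding induced_edges_def S_def by auto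
    qed
    then show ?thesis unfolding two_extension_of_def isomorphic_def
      using two_ext_nat.delete[OF SH, of HE] bf by blast
  qed
qed

lemma petersen_model: "petersen_V = nat ` set (thins Pet)" "petersen_E = (\<lambda>(i, j). {nat i, nat j}) ` set (links Pet)"
  "\<forall>(i, j)\<in>set (links Pet). 0 \<le> i \<and> 0 \<le> j \<and> i \<noteq> j"
proof -
  have "{0..9::nat} = set [0..<10]" by auto
  then show "petersen_V = nat ` set (thins Pet)" unfolding petersen_V_def Pet_def by (simp add: upt_rec numeral_eq_Suc)
qed (auto simp: petersen_E_def Pet_def)

lemma heawood_model: "heawood_V = nat ` set (thins Hea)" "heawood_E = (\<lambda>(i, j). {nat i, nat j}) ` set (links Hea)"
  "\<forall>(i, j)\<in>set (links Hea). 0 \<le> i \<and> 0 \<le> j \<and> i \<noteq> j"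
proof -
  have "{0..13::nat} = set [0..<14]" by auto
  then show "heawood_V = nat ` set (thins Hea)" unfolding heawood_V_def Hea_def by (simp add: upt_rec numeral_eq_Suc)
qed (auto simp: heawood_E_def Hea_def)

text \<open>In host numbering the missing vertices are 6, 7 for \<open>K4_model\<close>, 6 for
  \<open>Pet_minus_v\<close>, 7, 11, 12 for \<open>Hea_minus_P3\<close>, 7, 12 for
  \<open>Hea_minus_e\<close> and 7 for \<open>Hea_minus_v\<close>.\<close>

lemma hosted_models:
  "hosted K4_model Pet [0, 1, 3, 9, 4, 5, 2, 8]"
  "hosted Pet_minus_v Pet [0, 1, 3, 9, 4, 8, 5, 2, 7]"
  "hosted Hea_minus_P3 Hea [0, 1, 3, 4, 9, 5, 13, 2, 6, 8, 10]"
  "hosted Hea_minus_e Hea [0, 1, 3, 4, 9, 5, 2, 10, 13, 6, 8, 11]"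
  "hosted Hea_minus_v Hea [0, 1, 3, 4, 9, 5, 2, 10, 13, 11, 6, 8, 12]"
  "hosted Pet Pet [0, 1, 2, 3, 4, 5, 6, 7, 8, 9]"
  "hosted Hea Hea [0, 1, 2, 3, 4, 5, 6, 7, 8, 9, 10, 11, 12, 13]"
  by code_simp+

lemma models_two_extension:
  assumes "T \<in> set models" "graph V E" "emb V E T \<phi>" "span T \<phi> = V"
  shows "two_extension_of V E petersen_V petersen_E \<or> two_extension_of V E heawood_V heawood_E"
  using assms(1) two_extension[OF _ petersen_model assms(2-4)] two_extension[OF _ heawood_model assms(2-4)] hosted_models
  unfolding models_def by auto

section \<open>All seven patterns pass the checks\<close>

lemma grows_toI: "relabel_ok T m' \<sigma> \<Longrightarrow> T \<in> set models \<Longrightarrow> length (thins m) < length (thins T) \<Longrightarrow> grows_to m m'"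
  unfolding grows_to_def by blast

lemma models_mem: "K4_model \<in> set models" "Pet_minus_v \<in> set models" "Hea_minus_P3 \<in> set models"
  "Hea_minus_e \<in> set models" "Hea_minus_v \<in> set models" "Pet \<in> set models" "Hea \<in> set models"
  unfolding models_def by simp_all

lemma models_length: "length (thins K4_model) = 4" "length (thins Pet_minus_v) = 6" "length (thins Hea_minus_P3) = 6"
  "length (thins Hea_minus_e) = 8" "length (thins Hea_minus_v) = 10" "length (thins Pet) = 10" "length (thins Hea) = 14"
  unfolding K4_model_def Pet_minus_v_def Hea_minus_P3_def Hea_minus_e_def Hea_minus_v_def Pet_def Hea_def by simp_all

lemma checkedI:
  assumes "shape_ok m yss" "ears_ok m G D" "ears_cover (flats m) (map (\<lambda>(p, q, c). (p, q)) D) (pairs (coarse m))"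
    "claws_ok m C" "claws_cover m (exc @ map (\<lambda>(p, q, r, c). (p, q, r)) C) (triples (coarse m))"
    "\<forall>(p, q)\<in>set G. is_split p \<and> is_split q \<and> grows_to m (add_ear (pid p) (pid q) (refine q (refine p m)))"
    "exc = [] \<or> (\<exists>p q r. exc = [(p, q, r)] \<and> is_whole p \<and> is_whole q \<and> is_whole r \<and>
        exc_variants m ecs EG (variants [True, True, True] [p, q, r]) \<and>
        (\<forall>ps\<in>set EG. grows_to m (add_vertex (map pid ps) (fold refine ps m))))"
  shows "checked m"
  unfolding checked_def by (intro exI conjI) (fact assms)+

lemma checked_K4_model: "checked K4_model"
proof (rule checkedI[OF K4_model_shape K4_model_ears_ok K4_model_ears_cover K4_model_claws_ok K4_model_claws_cover])
  show "\<forall>(p, q)\<in>set K4_model_grow. is_split p \<and> is_split q \<and> grows_to K4_model (add_ear (pid p) (pid q) (refine q (refine p K4_model)))"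
    unfolding K4_model_grow_def list.set ball_simps prod.case is_split.simps
    using K4_model_grow_ok0[THEN grows_toI] K4_model_grow_ok1[THEN grows_toI] K4_model_grow_ok2[THEN grows_toI]
      K4_model_grow_ok3[THEN grows_toI] K4_model_grow_ok4[THEN grows_toI] K4_model_grow_ok5[THEN grows_toI]
    by (simp only: models_mem models_length)
qed simp

lemma checked_Pet_minus_v: "checked Pet_minus_v"
proof (rule checkedI[OF Pet_minus_v_shape Pet_minus_v_ears_ok Pet_minus_v_ears_cover Pet_minus_v_claws_ok Pet_minus_v_claws_cover])
  show "\<forall>(p, q)\<in>set Pet_minus_v_grow. is_split p \<and> is_split q \<and> grows_to Pet_minus_v (add_ear (pid p) (pid q) (refine q (refine p Pet_minus_v)))"
    unfolding Pet_minus_v_grow_def by simp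
  have "\<forall>ps\<in>set Pet_minus_v_exc_grow. grows_to Pet_minus_v (add_vertex (map pid ps) (fold refine ps Pet_minus_v))"
    unfolding Pet_minus_v_exc_grow_def list.set ball_simps
    using Pet_minus_v_exc_grow_ok0[THEN grows_toI] Pet_minus_v_exc_grow_ok1[THEN grows_toI] Pet_minus_v_exc_grow_ok2[THEN grows_toI]
    by (simp only: models_mem models_length)
  then show "[(Whole (6,0,3), Whole (7,1,2), Whole (8,4,5))] = [] \<or> (\<exists>p q r. [(Whole (6,0,3), Whole (7,1,2), Whole (8,4,5))] = [(p, q, r)] \<and> is_whole p \<and> is_whole q \<and> is_whole r \<and>
        exc_variants Pet_minus_v Pet_minus_v_exc Pet_minus_v_exc_grow (variants [True, True, True] [p, q, r]) \<and>
        (\<forall>ps\<in>set Pet_minus_v_exc_grow. grows_to Pet_minus_v (add_vertex (map pid ps) (fold refine ps Pet_minus_v))))"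
    using Pet_minus_v_exc_ok by (intro disjI2 exI conjI) (rule refl is_whole.simps(1)[THEN eqTrueE] | assumption)+
qed

lemma checked_Hea_minus_P3: "checked Hea_minus_P3"
proof (rule checkedI[OF Hea_minus_P3_shape Hea_minus_P3_ears_ok Hea_minus_P3_ears_cover Hea_minus_P3_claws_ok Hea_minus_P3_claws_cover])
  show "\<forall>(p, q)\<in>set Hea_minus_P3_grow. is_split p \<and> is_split q \<and> grows_to Hea_minus_P3 (add_ear (pid p) (pid q) (refine q (refine p Hea_minus_P3)))"
    unfolding Hea_minus_P3_grow_def list.set ball_simps prod.case is_split.simps
    using Hea_minus_P3_grow_ok0[THEN grows_toI] Hea_minus_P3_grow_ok1[THEN grows_toI]
    by (simp only: models_mem models_length)
qed simp

lemma checked_Hea_minus_e: "checked Hea_minus_e"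
proof (rule checkedI[OF Hea_minus_e_shape Hea_minus_e_ears_ok Hea_minus_e_ears_cover Hea_minus_e_claws_ok Hea_minus_e_claws_cover])
  show "\<forall>(p, q)\<in>set Hea_minus_e_grow. is_split p \<and> is_split q \<and> grows_to Hea_minus_e (add_ear (pid p) (pid q) (refine q (refine p Hea_minus_e)))"
    unfolding Hea_minus_e_grow_def list.set ball_simps prod.case is_split.simps
    using Hea_minus_e_grow_ok0[THEN grows_toI] Hea_minus_e_grow_ok1[THEN grows_toI]
    by (simp only: models_mem models_length)
qed simp

lemma checked_Hea_minus_v: "checked Hea_minus_v"
proof (rule checkedI[OF Hea_minus_v_shape Hea_minus_v_ears_ok Hea_minus_v_ears_cover Hea_minus_v_claws_ok Hea_minus_v_claws_cover])
  show "\<forall>(p, q)\<in>set Hea_minus_v_grow. is_split p \<and> is_split q \<and> grows_to Hea_minus_v (add_ear (pid p) (pid q) (refine q (refine p Hea_minus_v)))"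
    unfolding Hea_minus_v_grow_def by simp
  have "\<forall>ps\<in>set Hea_minus_v_exc_grow. grows_to Hea_minus_v (add_vertex (map pid ps) (fold refine ps Hea_minus_v))"
    unfolding Hea_minus_v_exc_grow_def list.set ball_simps
    using Hea_minus_v_exc_grow_ok0[THEN grows_toI]
    by (simp only: models_mem models_length)
  then show "[(Whole (10,1,5), Whole (11,2,4), Whole (12,8,9))] = [] \<or> (\<exists>p q r. [(Whole (10,1,5), Whole (11,2,4), Whole (12,8,9))] = [(p, q, r)] \<and> is_whole p \<and> is_whole q \<and> is_whole r \<and>
        exc_variants Hea_minus_v Hea_minus_v_exc Hea_minus_v_exc_grow (variants [True, True, True] [p, q, r]) \<and>
        (\<forall>ps\<in>set Hea_minus_v_exc_grow. grows_to Hea_minus_v (add_vertex (map pid ps) (fold refine ps Hea_minus_v))))"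
    using Hea_minus_v_exc_ok by (intro disjI2 exI conjI) (rule refl is_whole.simps(1)[THEN eqTrueE] | assumption)+
qed

lemma checked_Pet: "checked Pet"
  by (rule checkedI[OF Pet_shape Pet_ears_ok Pet_ears_cover Pet_claws_ok Pet_claws_cover]) (simp_all add: Pet_grow_def)

lemma checked_Hea: "checked Hea"
  by (rule checkedI[OF Hea_shape Hea_ears_ok Hea_ears_cover Hea_claws_ok Hea_claws_cover]) (simp_all add: Hea_grow_def)

lemma checked_models: "m \<in> set models \<Longrightarrow> checked m"
  using checked_K4_model checked_Pet_minus_v checked_Hea_minus_P3 checked_Hea_minus_e checked_Hea_minus_v checked_Pet checked_Hea
  unfolding models_def by auto

lemma models_le: "m \<in> set models \<Longrightarrow> length (thins m) \<le> 14"
  using models_length unfolding models_def by auto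

section \<open>The first pattern and the extremal choice\<close>

context girth5
begin

text \<open>The graph without \<open>u\<close> is connected, so an edge leaves \<open>C\<close>
  minus \<open>u\<close> there. It is not \<open>uv\<close>, and \<open>C\<close> is a component
  once \<open>w\<close> is removed; hence it ends in \<open>w\<close>.\<close>

lemma component_attached:
  assumes w: "w \<in> V" "w \<noteq> u" and uv: "u \<in> V" "v \<in> V" "u \<noteq> v" and C: "C = component (E - {{u, v}}) (V - {w}) u"
    and y: "y \<in> C" "y \<noteq> u" and v: "v \<notin> C"
  shows "sees E w C"
proof -
  have sub: "C \<subseteq> V - {w}" unfolding C using w uv by (intro component_subset) blast
  have "conn E (V - {u})" by (rule conn_minus[OF uv(1)])
  then obtain x z where xz: "x \<in> C - {u}" "z \<in> V - {u} - (C - {u})" "{x, z} \<in> E"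
    using conn_cross[of E "V - {u}" "C - {u}"] sub y v uv w by blast
  have "z = w"
  proof (rule ccontr)
    assume "z \<noteq> w"
    moreover have "{x, z} \<noteq> {u, v}" using xz by (auto simp: doubleton_eq_iff)
    ultimately have "z \<in> C"
      using component_closed[of x "E - {{u, v}}" "V - {w}" u z] xz uv w C by auto
    then show False using xz(2) by blast
  qed
  then show ?thesis using xz unfolding sees_def by (auto simp: insert_commute)
qed

lemma conn_del: "conn (E - D) S \<Longrightarrow> conn E S"
proof -
  have "edge_rel (E - D) S \<subseteq> edge_rel E S" unfolding edge_rel_def by auto
  then show "conn (E - D) S \<Longrightarrow> conn E S" unfolding conn_def using rtrancl_mono by blast
qed

lemma two_nbs:
  assumes "degree V E u \<ge> 3"
  obtains x y where "{x, u} \<in> E" "{y, u} \<in> E" "x \<noteq> y" "x \<noteq> v" "y \<noteq> v"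
proof -
  let ?N = "{x \<in> V. {x, u} \<in> E}"
  have "2 \<le> card (?N - {v})" using assms card_Diff_singleton_if[of ?N v] fin unfolding degree_def by (auto split: if_splits)
  then obtain x y where "x \<in> ?N - {v}" "y \<in> ?N - {v}" "x \<noteq> y" by (auto simp: card_le_Suc_iff numeral_2_eq_2)
  then show thesis using that by blast
qed

text \<open>If \<open>w\<close> separated \<open>u\<close> from \<open>v\<close> in the graph
  without the edge \<open>uv\<close>, then \<open>u\<close> and \<open>w\<close> would form a proper
  2-cutset. They are not adjacent by assumption, and the degrees of \<open>u\<close> and
  \<open>v\<close> keep both sides from being paths.\<close>

lemma edge_cut:
  assumes no2: "\<not> has_proper_2cutset V E" and uv: "{u, v} \<in> E" and du: "degree V E u \<ge> 3" and dv: "degree V E v \<ge> 3"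
    and w: "w \<in> V" "w \<noteq> u" "w \<noteq> v" "{u, w} \<notin> E"
  shows "(u, v) \<in> (edge_rel (E - {{u, v}}) (V - {w}))\<^sup>*"
proof (rule ccontr)
  assume sep: "(u, v) \<notin> (edge_rel (E - {{u, v}}) (V - {w}))\<^sup>*"
  have uvV: "u \<in> V" "v \<in> V" "u \<noteq> v" using adj_in[OF uv] adj_neq[OF uv] by auto
  have vu: "{v, u} = {u, v}" by blast
  define C where "C = component (E - {{u, v}}) (V - {w}) u"
  define C' where "C' = component (E - {{v, u}}) (V - {w}) v"
  have sub: "C \<subseteq> V - {w}" "C' \<subseteq> V - {w}"
    unfolding C_def C'_def using w uvV by (auto intro!: component_subset)
  have cn: "conn E C" "conn E C'" "u \<in> C" "v \<in> C'"
    unfolding C_def C'_def by (rule conn_del[OF component_conn] component_self)+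
  have disj: "C \<inter> C' = {}"
  proof (rule ccontr)
    assume "C \<inter> C' \<noteq> {}"
    then obtain z where "(u, z) \<in> (edge_rel (E - {{u, v}}) (V - {w}))\<^sup>*" "(v, z) \<in> (edge_rel (E - {{u, v}}) (V - {w}))\<^sup>*"
      unfolding C_def C'_def component_def vu by blast
    then show False using sep edge_rel_sym by (metis rtrancl_trans)
  qed
  have nv: "v \<notin> C" "u \<notin> C'" using disj cn by auto
  have closed: "z \<in> C" if "x \<in> C" "{x, z} \<in> E" "z \<noteq> w" "{x, z} \<noteq> {u, v}" for x z
    using component_closed[of x "E - {{u, v}}" "V - {w}" u z] that adj_in[OF that(2)] uvV w unfolding C_def by auto
  have closed': "z \<in> C'" if "x \<in> C'" "{x, z} \<in> E" "z \<noteq> w" "{x, z} \<noteq> {u, v}" for x z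
    using component_closed[of x "E - {{v, u}}" "V - {w}" v z] that adj_in[OF that(2)] uvV w unfolding C'_def by auto
  \<comment> \<open>The only edge that leaves \<open>C\<close> other than towards \<open>w\<close>
    is \<open>uv\<close>, and its end \<open>u\<close> belongs to the cutset.\<close>
  define X where "X = C - {u}"
  define Y where "Y = V - C - {w}"
  obtain x1 x2 where x: "{x1, u} \<in> E" "{x2, u} \<in> E" "x1 \<noteq> x2" "x1 \<noteq> v" "x2 \<noteq> v" by (rule two_nbs[OF du])
  obtain y1 y2 where y: "{y1, v} \<in> E" "{y2, v} \<in> E" "y1 \<noteq> y2" "y1 \<noteq> u" "y2 \<noteq> u" by (rule two_nbs[OF dv])
  have xC: "z \<in> X" if "{z, u} \<in> E" "z \<noteq> v" for z
  proof -
    have "{u, z} \<in> E" using that(1) by (simp add: insert_commute)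
    then show ?thesis using closed[OF cn(3), of z] w(4) that(2) adj_neq[of u z] unfolding X_def by (auto simp: doubleton_eq_iff)
  qed
  have yC: "z \<in> C'" if "{z, v} \<in> E" "z \<noteq> u" "z \<noteq> w" for z
  proof -
    have "{v, z} \<in> E" using that(1) by (simp add: insert_commute)
    then show ?thesis using closed'[OF cn(4), of z] that(2,3) uvV by (auto simp: doubleton_eq_iff)
  qed
  have x12: "x1 \<in> X" "x2 \<in> X" using xC x by auto
  \<comment> \<open>One of \<open>y1\<close>, \<open>y2\<close> may be \<open>w\<close>, but not
    both.\<close>
  obtain y0 where y0: "y0 \<in> C'" "y0 \<noteq> v"
  proof -
    have "y1 \<noteq> v" "y2 \<noteq> v" using adj_neq y by auto
    then show thesis using that yC[OF y(1)] yC[OF y(2)] y by metis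
  qed
  have C'Y: "C' \<subseteq> Y" using sub disj unfolding Y_def by blast
  have fins: "finite X" "finite Y" unfolding X_def Y_def using fin finite_subset[OF sub(1)] by auto
  have seeC: "sees E w C" by (rule component_attached[OF w(1,2) uvV C_def _ _ nv(1), of x1]) (use x12 X_def in auto)
  have seeC': "sees E w C'" by (rule component_attached[OF w(1,3) uvV(2,1) uvV(3)[symmetric] C'_def y0 nv(2)])
  have conn1: "conn E (insert w C)" by (rule conn_insert[OF cn(1) seeC])
  have "sees E u C'" using cn(4) uv unfolding sees_def by blast
  then have conn2: "conn E (insert u (insert w C'))"
    by (intro conn_insert conn_insert[OF cn(2) seeC']) (auto simp: sees_def)
  have "proper_2cutset V E u w"
  proof (rule proper_2cutsetI)
    show "V = X \<union> Y \<union> {u, w}" using sub uvV w unfolding X_def Y_def by blast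
    show "X \<inter> Y = {}" "u \<notin> X" "w \<notin> Y" "u \<notin> Y" unfolding X_def Y_def using cn by auto
    show "w \<notin> X" using sub unfolding X_def by blast
    have "card {x1, x2} \<le> card X" using x12 fins by (intro card_mono) auto
    then show "2 \<le> card X" using x(3) by simp
    have "card {y0, v} \<le> card Y" using y0 cn(4) C'Y fins by (intro card_mono) auto
    then show "2 \<le> card Y" using y0(2) by simp
    show "{a, b} \<notin> E" if a: "a \<in> X" and b: "b \<in> Y" for a b
    proof
      assume e: "{a, b} \<in> E"
      have "{a, b} \<noteq> {u, v}" using a b nv cn unfolding X_def Y_def by (auto simp: doubleton_eq_iff)
      then show False using closed[OF _ e] a b unfolding X_def Y_def by blast
    qed
    show "has_path (X \<union> {u, w}) (induced_edges E (X \<union> {u, w})) u w"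
      by (rule conn_has_path[OF conn1]) (use cn in \<open>auto simp: X_def\<close>)
    show "has_path (Y \<union> {u, w}) (induced_edges E (Y \<union> {u, w})) u w"
    proof (rule conn_has_path[OF conn2])
      show "insert u (insert w C') \<subseteq> Y \<union> {u, w}" using C'Y by blast
    qed simp_all
    \<comment> \<open>\<open>u\<close> would be an end of the path and yet has the two neighbours
      \<open>x1\<close> and \<open>x2\<close> in this side.\<close>
    show "\<not> is_ab_path (X \<union> {u, w}) (induced_edges E (X \<union> {u, w})) u w"
    proof
      assume p: "is_ab_path (X \<union> {u, w}) (induced_edges E (X \<union> {u, w})) u w"
      have "u \<in> X \<union> {u, w}" by blast
      from is_ab_path_nbs(2)[OF p this] obtain z where "{z. {z, u} \<in> induced_edges E (X \<union> {u, w})} \<subseteq> {z}" by blast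
      moreover have "{x1, x2} \<subseteq> {z. {z, u} \<in> induced_edges E (X \<union> {u, w})}" using x x12 unfolding induced_edges_def by auto
      ultimately have "x1 = z" "x2 = z" by blast+
      then show False using x(3) by simp
    qed
    \<comment> \<open>\<open>v\<close> has the three neighbours \<open>u\<close>, \<open>y1\<close>
      and \<open>y2\<close> in this side.\<close>
    show "\<not> is_ab_path (Y \<union> {u, w}) (induced_edges E (Y \<union> {u, w})) u w"
    proof
      assume p: "is_ab_path (Y \<union> {u, w}) (induced_edges E (Y \<union> {u, w})) u w"
      have "v \<in> Y \<union> {u, w}" using cn(4) C'Y by blast
      from is_ab_path_nbs(1)[OF p this] obtain z z' where z: "{z. {z, v} \<in> induced_edges E (Y \<union> {u, w})} \<subseteq> {z, z'}" by blast
      have "{u, y1, y2} \<subseteq> {z. {z, v} \<in> induced_edges E (Y \<union> {u, w})}"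
        using yC[OF y(1,4)] yC[OF y(2,5)] y(1,2) uv C'Y cn(4) unfolding induced_edges_def by auto
      then have "{u, y1, y2} \<subseteq> {z, z'}" using z by blast
      then have "card {u, y1, y2} \<le> card {z, z'}" by (intro card_mono) auto
      also have "\<dots> \<le> 2" by (simp add: card_insert_if)
      finally show False using y(3-5) by simp
    qed
  qed (use uvV w in auto)
  then show False using no2 unfolding has_proper_2cutset_def by blast
qed

text \<open>Menger's theorem for the graph without the edge \<open>uv\<close>; a separating vertex
  is ruled out by \<open>edge_cut\<close>.\<close>

lemma ex_double_path:
  assumes no2: "\<not> has_proper_2cutset V E" and uv: "{u, v} \<in> E" and d: "degree V E u \<ge> 3" "degree V E v \<ge> 3"
  obtains A B where "double_path u v A B"
proof -
  let ?E = "E - {{u, v}}"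
  have uvV: "u \<in> V" "v \<in> V" "u \<noteq> v" using adj_in[OF uv] adj_neq[OF uv] by auto
  have c1: "(u, v) \<in> (edge_rel ?E (V - {w}))\<^sup>*" if w: "w \<in> V" "w \<noteq> u" "w \<noteq> v" for w
  proof (cases "{u, w} \<in> E")
    case False
    then show ?thesis by (rule edge_cut[OF no2 uv d w])
  next
    \<comment> \<open>Without triangles a neighbour of \<open>u\<close> is not a neighbour of
      \<open>v\<close>, so \<open>edge_cut\<close> applies with the two exchanged.\<close>
    case True
    have vu: "{v, u} \<in> E" using uv by (simp add: insert_commute)
    have "{v, w} \<notin> E" by (rule tri[OF vu True])
    then have "(v, u) \<in> (edge_rel (E - {{v, u}}) (V - {w}))\<^sup>*" by (rule edge_cut[OF no2 vu d(2,1) w(1,3,2)])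
    then show ?thesis using edge_rel_sym by (simp add: insert_commute)
  qed
  \<comment> \<open>Connection without a deleted vertex follows from connection with any third
    vertex deleted, and a third vertex exists by the degree of \<open>u\<close>.\<close>
  have c0: "(u, v) \<in> (edge_rel ?E V)\<^sup>*"
  proof -
    obtain x y where "{x, u} \<in> E" "x \<noteq> v" by (rule two_nbs[OF d(1)])
    then have "x \<in> V" "x \<noteq> u" "x \<noteq> v" using adj_in[of x u] adj_neq[of x u] by auto
    then show ?thesis using edge_rel_rtrancl_mono[OF c1[of x]] by blast
  qed
  obtain A B where AB: "conn ?E A" "conn ?E B" "A \<inter> B = {}" "A \<subseteq> V - {u, v}" "B \<subseteq> V - {u, v}"
    "sees ?E u A" "sees ?E v A" "sees ?E u B" "sees ?E v B"
    by (rule two_disjoint_paths[of ?E u v V]) (use uvV c0 c1 in auto)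
  have "sees E x S" if "sees ?E x S" for x S using that unfolding sees_def by blast
  then show thesis using that[of A B] AB conn_del uv unfolding double_path_def by blast
qed

lemma thin_split:
  assumes t: "thin_path u v (a1 @ p # a2)" and ne: "a1 \<noteq> []" "a2 \<noteq> []"
  shows "ipath E ([u] @ a1 @ [p])" "ipath E ([v] @ rev a2 @ [p])" "{u, p} \<notin> E" "{v, p} \<notin> E"
    "anticomplete E (set a1) {v}" "anticomplete E (set a2) {u}" "anticomplete E (set a1) (set a2)"
proof -
  have i: "ipath E (a1 @ p # a2)" and s: "set (a1 @ p # a2) \<subseteq> V - {u, v}"
    and hu: "\<And>z. z \<in> set (a1 @ p # a2) \<Longrightarrow> {u, z} \<in> E \<longleftrightarrow> z = hd a1"
    and hv: "\<And>z. z \<in> set (a1 @ p # a2) \<Longrightarrow> {v, z} \<in> E \<longleftrightarrow> z = last a2"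
    using t ne unfolding thin_path_def by (auto simp: hd_append)
  have d: "distinct (a1 @ p # a2)" by (rule ipath_distinct[OF i])
  have h: "hd a1 \<in> set a1" "last a2 \<in> set a2" using ne by auto
  have hn: "hd a1 \<noteq> p" "hd a1 \<notin> set a2" "last a2 \<noteq> p" "last a2 \<notin> set a1" using h d by auto
  show "{u, p} \<notin> E" "{v, p} \<notin> E" using hu[of p] hv[of p] hn by auto
  have i1: "ipath E (a1 @ [p])" "ipath E (p # a2)" using ipath_prefix[OF i] ipath_suffix[OF i] .
  have "u \<notin> set (a1 @ [p])" "\<forall>z\<in>set (a1 @ [p]). {u, z} \<in> E \<longleftrightarrow> z = hd (a1 @ [p])" using s hu ne by (auto simp: hd_append)
  then show "ipath E ([u] @ a1 @ [p])" using i1(1) by simp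
  have "ipath E (rev a2 @ [p])" using i1(2) ipath_rev[of E "p # a2"] by simp
  moreover have "v \<notin> set (rev a2 @ [p])" "\<forall>z\<in>set (rev a2 @ [p]). {v, z} \<in> E \<longleftrightarrow> z = hd (rev a2 @ [p])"
    using s hv ne by (auto simp: hd_append hd_rev)
  ultimately show "ipath E ([v] @ rev a2 @ [p])" by simp
  show "anticomplete E (set a1) {v}" unfolding anticomplete_def using s hv hn by (auto simp: insert_commute)
  show "anticomplete E (set a2) {u}" unfolding anticomplete_def using s hu hn by (auto simp: insert_commute)
  show "anticomplete E (set a1) (set a2)"
    unfolding anticomplete_def using i d unfolding ipath_append by auto
qed

lemma ex_K4:
  assumes "min_pair u v as bs"
  obtains \<phi> where "emb V E K4_model \<phi>"
proof -
  obtain p q a1 a2 b1 b2 where s: "as = a1 @ p # a2" "bs = b1 @ q # b2" "{p, q} \<in> E"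
    and ne: "a1 \<noteq> []" "a2 \<noteq> []" "b1 \<noteq> []" "b2 \<noteq> []"
    and cr: "\<forall>x\<in>set as. \<forall>y\<in>set bs. {x, y} \<in> E \<longleftrightarrow> x = p \<and> y = q"
    by (rule min_pair_K4[OF assms])
  note f = cross_facts[OF assms, unfolded s(1,2)]
  note A = thin_split[OF f(1) ne(1,2)]
  note B = thin_split[OF f(2) ne(3,4)]
  have cross: "anticomplete E (set a1) (set b1)" "anticomplete E (set a1) (set b2)" "anticomplete E (set a2) (set b1)"
    "anticomplete E (set a2) (set b2)" "anticomplete E (set a1) {q}" "anticomplete E (set a2) {q}"
    "anticomplete E (set b1) {p}" "anticomplete E (set b2) {p}"
    unfolding anticomplete_def using cr f(4,16,17) unfolding s(1,2) by (auto simp: insert_commute)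
  note anti = A(5-7) B(5-7) cross
  have edges: "{u, v} \<in> E" "{v, u} \<in> E" "{p, q} \<in> E" "{q, p} \<in> E" "{u, p} \<notin> E" "{p, u} \<notin> E" "{u, q} \<notin> E"
    "{q, u} \<notin> E" "{v, p} \<notin> E" "{p, v} \<notin> E" "{v, q} \<notin> E" "{q, v} \<notin> E"
    using f(3) s(3) A(3,4) B(3,4) by (simp_all add: insert_commute)
  have neqs: "u \<noteq> v" "u \<noteq> p" "u \<noteq> q" "v \<noteq> p" "v \<noteq> q" "p \<noteq> q" using f(4-8,13) by auto
  \<comment> \<open>Pieces 6 and 7 run from \<open>v\<close> to \<open>p\<close> and to
    \<open>q\<close>, so \<open>a2\<close> and \<open>b2\<close> are reversed.\<close>
  define \<phi> :: "int \<Rightarrow> 'a list" where "\<phi> i = [[u], [v], [p], [q], a1, b1, rev a2, rev b2] ! nat i" for i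
  have \<phi>: "\<phi> 0 = [u]" "\<phi> 1 = [v]" "\<phi> 2 = [p]" "\<phi> 3 = [q]" "\<phi> 4 = a1" "\<phi> 5 = b1" "\<phi> 6 = rev a2" "\<phi> 7 = rev b2"
    unfolding \<phi>_def by simp_all
  have "emb V E K4_model \<phi>"
    unfolding K4_model_def
  proof (rule embI)
    fix i :: int assume "i \<in> set [0, 1, 2, 3]"
    then show "\<exists>v\<in>V. \<phi> i = [v]" using \<phi> f(9-12) by auto
  next
    fix d a b :: int assume "(d, a, b) \<in> set [(4, 0, 2), (5, 0, 3), (6, 1, 2), (7, 1, 3)]"
    then show "a \<in> set [0, 1, 2, 3] \<and> b \<in> set [0, 1, 2, 3] \<and> a \<noteq> b \<and> \<phi> d \<noteq> [] \<and> set (\<phi> d) \<subseteq> V \<and> ipath E (\<phi> a @ \<phi> d @ \<phi> b)"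
      using \<phi> ne A(1,2) B(1,2) f(9,10) by auto
  next
    fix i j :: int assume "i \<in> set [0, 1, 2, 3]" "j \<in> set [0, 1, 2, 3]" "i \<noteq> j"
    then have ij: "i = 0 \<or> i = 1 \<or> i = 2 \<or> i = 3" "j = 0 \<or> j = 1 \<or> j = 2 \<or> j = 3" "i \<noteq> j" by simp_all
    show "hd (\<phi> i) \<noteq> hd (\<phi> j) \<and> ({hd (\<phi> i), hd (\<phi> j)} \<in> E \<longleftrightarrow> linked [(0, 1), (2, 3)] i j)"
      using ij by (elim disjE; simp add: \<phi> linked_def edges neqs neqs[symmetric])
  next
    fix d a b c :: int
    assume h: "(d, a, b) \<in> set [(4, 0, 2), (5, 0, 3), (6, 1, 2), (7, 1, 3)]" "c \<in> set [0, 1, 2, 3]" "c \<noteq> a" "c \<noteq> b"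
    then have "(d, a, b) = (4, 0, 2) \<or> (d, a, b) = (5, 0, 3) \<or> (d, a, b) = (6, 1, 2) \<or> (d, a, b) = (7, 1, 3)"
      "c = 0 \<or> c = 1 \<or> c = 2 \<or> c = 3" by simp_all
    then show "anticomplete E (set (\<phi> d)) (set (\<phi> c))" using h(3,4) by (elim disjE; simp add: \<phi> anti)
  next
    fix g h :: flat
    assume "g \<in> set [(4, 0, 2), (5, 0, 3), (6, 1, 2), (7, 1, 3)]" "h \<in> set [(4, 0, 2), (5, 0, 3), (6, 1, 2), (7, 1, 3)]" "fst g \<noteq> fst h"
    then have "fst g = 4 \<or> fst g = 5 \<or> fst g = 6 \<or> fst g = 7" "fst h = 4 \<or> fst h = 5 \<or> fst h = 6 \<or> fst h = 7" "fst g \<noteq> fst h" by auto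
    then show "anticomplete E (set (\<phi> (fst g))) (set (\<phi> (fst h)))"
      by (elim disjE; simp add: \<phi> anti anti[THEN anticomplete_sym])
  qed auto
  then show thesis by (rule that)
qed

text \<open>An edge between branch vertices starts the search. The extremal pattern then fills the
  graph by \<open>span_all\<close>.\<close>

lemma two_extension_or_sparse:
  assumes no2: "\<not> has_proper_2cutset V E" and ns: "\<not> sparse V E"
  shows "two_extension_of V E petersen_V petersen_E \<or> two_extension_of V E heawood_V heawood_E"
proof -
  obtain u v where "{u, v} \<in> E" "degree V E u \<ge> 3" "degree V E v \<ge> 3" using ns unfolding sparse_def by blast
  from ex_double_path[OF no2 this] obtain A B where "double_path u v A B" .
  from ex_min_pair[OF this] obtain u v as bs where "min_pair u v as bs" .
  from ex_K4[OF this] obtain \<phi>0 where K: "emb V E K4_model \<phi>0" .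
  define good where "good = (\<lambda>(m, \<phi>). m \<in> set models \<and> emb V E m \<phi>)"
  \<comment> \<open>Encodes the two-level choice as one number: 14 is the largest number of single
    vertices in a pattern, and the factor exceeds the size of any copy, so one more single vertex
    outweighs every difference in size.\<close>
  define f where "f = (\<lambda>(m, \<phi> :: int \<Rightarrow> 'a list). (14 - length (thins m)) * Suc (card V) + card (span m \<phi>))"
  have "good (K4_model, \<phi>0)" unfolding good_def using K models_mem(1) by simp
  from ex_has_least_nat[of good, OF this, of f] obtain t where t: "good t" "\<And>s. good s \<Longrightarrow> f t \<le> f s" by blast
  obtain m \<phi> where tm: "t = (m, \<phi>)" by (cases t)
  have m: "m \<in> set models" "emb V E m \<phi>" using t(1) unfolding good_def tm by auto
  have min: "f (m, \<phi>) \<le> f (T, \<psi>)" if "T \<in> set models" "emb V E T \<psi>" for T \<psi>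
    using t(2)[of "(T, \<psi>)"] that unfolding good_def tm by simp
  interpret stage V E m \<phi>
  proof
    show "emb V E m \<phi>" "checked m" using m checked_models by auto
    show "\<not> has_proper_2cutset V E" by (rule no2)
    show "card (span m \<phi>) \<le> card (span m \<psi>)" if "emb V E m \<psi>" for \<psi>
      using min[OF m(1) that] unfolding f_def by simp
    show "\<not> emb V E T \<psi>" if T: "T \<in> set models" "length (thins m) < length (thins T)" for T \<psi>
    proof
      assume e: "emb V E T \<psi>"
      have "card (span T \<psi>) < Suc (card V)" using card_mono[OF fin span_subset[OF e]] by simp
      moreover have "Suc (14 - length (thins T)) * Suc (card V) \<le> (14 - length (thins m)) * Suc (card V)"
        using T(2) models_le[OF T(1)] by (intro mult_right_mono) auto
      ultimately have "f (T, \<psi>) < f (m, \<phi>)" unfolding f_def by simp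
      then show False using min[OF T(1) e] by simp
    qed
  qed
  show ?thesis by (rule models_two_extension[OF m(1) graph m(2) span_all])
qed

end

theorem theorem3:
  fixes V :: "'a set" and E :: "'a set set"
  assumes "graph V E"
    and "two_connected V E"
    and "\<not> has_induced_square V E"
    and "unichord_free V E"
  shows "complete V E \<or> sparse V E
    \<or> two_extension_of V E petersen_V petersen_E
    \<or> two_extension_of V E heawood_V heawood_E
    \<or> has_proper_2cutset V E"
proof (cases "complete V E")
  case False
  interpret ufree V E by standard (fact assms)+
  \<comment> \<open>A graph that is not complete has no triangle, by
    \<open>triangle_complete\<close>.\<close>
  interpret girth5 V E
  proof
    show "{x, z} \<notin> E" if "{x, y} \<in> E" "{y, z} \<in> E" for x y z
      using triangle_complete[OF that] False by blast
  qed (fact assms)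
  show ?thesis using two_extension_or_sparse by blast
qed blast

end
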